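(* Let $\theta_0$ be an inner point of $\Theta$ and consider local alternatives $m_n(\cdot)=\mu(\cdot;\theta_0)+r_n\delta_n(\cdot)$, where $\{\delta_n(\cdot)\}_{n\ge1}$ is an equicontinuous sequence from $C_p(L,s)$ for some unknown $s>\underline s$ and $L>0$, with $$\frac1n\sum_{i=1}^n\delta_n^2(X_i)=1+o_{\mathbb P}(1)\quad\text{and}\quad\frac1n\sum_{i=1}^n\delta_n(X_i)\frac{\partial\mu(X_i;\theta_0)}{\partial\theta}=o_{\mathbb P}(1).$$ Assume that for each $x\in[0,1]^p$, $\mu(x;\theta)$ is twice differentiable with respect to $\theta\in\Theta$ with second-order derivatives continuous in $x$ and $\theta$, and that, for some $C_3>0$, $$(C_3+o_{\mathbb P}(1))|\theta-\theta'|^2\le\frac1n\sum_{i=1}^n(\mu(X_i;\theta)-\mu(X_i;\theta'))^2\quad\text{for any }\theta,\theta'\in\Theta,$$ where the $o_{\mathbb P}(1)$ term is a sequence of random variables not depending on $\theta,\theta'$. Let Assumptions D, M, E and W (stated in the context) hold and assume that the variance estimator satisfies $\max_{1\le i\le n}|\hat\sigma_n^2(X_i)/\sigma^2(X_i)-1|=o_{\mathbb P}(1)$ for any equicontinuous sequence of regression functions. If $h_0\to0$, $r_n\to0$ and $\sqrt{nh_0^{p/2}}\,r_n\to\infty$, then the test that rejects $H_0$ when $\widehat T_{\widetilde h}\ge\widehat v_{h_0}z_\alpha$ is consistent given the design, that is, $$\mathbb P(\widehat T_{\widetilde h}\ge\widehat v_{h_0}z_\alpha\mid X_1,\dots,X_n)\xrightarrow{\mathbb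 P}1.$$
   Context: **Model.** Let $p,d\ge1$ be integers. For each $n$ one observes $(Y_i,X_i)\in\mathbb R\times\mathbb R^p$, $i=1,\dots,n$, with $Y_i=m_n(X_i)+\varepsilon_i$, $\mathbb E[\varepsilon_i|X_i]=0$, $\mathrm{Var}[\varepsilon_i|X_i]=\sigma^2(X_i)$; the regression function $m_n$ (possibly depending on $n$) and $\sigma^2(\cdot)$ are unknown. The null hypothesis is $H_0$: $m_n(\cdot)=\mu(\cdot;\theta)$ for some $\theta\in\Theta$, where $\{\mu(\cdot;\theta):\theta\in\Theta\}$ is a given parametric family. For a vector $x$, $|x|=\max_i|x_i|$. For deterministic sequences $a_n\asymp b_n$ means $1/C\le a_n/b_n\le C$ for some $C>1$ and all large $n$. A sequence $\{m_n\}$ is equicontinuous if for any $\epsilon>0$ there is $\eta>0$ with $\sup_n|m_n(x)-m_n(x')|\le\epsilon$ whenever $|x-x'|\le\eta$. **Hölder classes.** For real $s$, $\lfloor s\rfloor$ is the integer with $\lfloor s\rfloor<s\le\lfloor s\rfloor+1$. For $s\in(0,1]$, $C_p(L,s)$ is the set of maps $m:[0,1]^p\to\mathbb R$ with $|m(x)-m(y)|\le L|x-y|^s$ for all $x,y$; for $s>1$, $C_p(L,s)$ is the set of $m$ whose $\lfloor s\rfloor$th partial derivatives are all in $C_p(L,s-\lfloor s\rfloor)$. **Assumption D.** The $X_i\in[0,1]^p$ are i.i.d. with a strictly positive continuous density over $[0,1]^p$. **Assumption M.** $\Theta\subset\mathbb R^d$ is compact, $\mu(x;\theta)$ is continuous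 with respect to $x\in[0,1]^p$ and $\theta\in\Theta$, and there is a constant $\dot\mu$ with $|\mu(x;\theta)-\mu(x;\theta')|\le\dot\mu|\theta-\theta'|$ for all $\theta,\theta'\in\Theta$, $x\in[0,1]^p$. **Assumption E.** The $\varepsilon_i$ are independent given $X_1,\dots,X_n$. For each $i$ the distribution of $\varepsilon_i$ given the design depends only on $X_i$, $\mathbb E[\varepsilon_i|X_i]=0$, $\mathrm{Var}[\varepsilon_i|X_i]=\sigma^2(X_i)$, where $\sigma^2(\cdot)$ is continuous and bounded away from $0$. For some $d'>\max(d,4)$ and some constant $C_1$, $\mathbb E^{1/d'}[|\varepsilon_i|^{d'}|X_i]<C_1$ for all $i$. **Test.** $\widehat\theta_n\in\arg\min_{\theta\in\Theta}\sum_{i=1}^n(Y_i-\mu(X_i;\theta))^2$ (any convention for ties), $\widehat U_i=Y_i-\mu(X_i;\widehat\theta_n)$, $\widehat U=[\widehat U_1,\dots,\widehat U_n]'$. The set of smoothing parameters is $\mathcal H_n=\{h_j=h_0a^{-j},\,j=0,\dots,J_n\}$ with $a>1$, $J_n\to+\infty$ ($h_0$ may depend on $n$). For $h\in\mathcal H_n$, $W_h=[w_{ij}(h)]$ is a symmetric $n\times n$ matrix depending on the design only with $w_{ii}(h)=0$, and $\widehat T_h=\widehat U'W_h\widehat U$. With $\hat\sigma_n^2(\cdot)$ an estimator of $\sigma^2(\cdot)$, set $\widehat v_{h_0}^2=2\sum_{i,j}w_{ij}^2(h_0)\hat\sigma_n^2(X_i)\hat\sigma_n^2(X_j)$ and $\widehat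 v_{h,h_0}^2=2\sum_{i,j}(w_{ij}(h)-w_{ij}(h_0))^2\hat\sigma_n^2(X_i)\hat\sigma_n^2(X_j)$, with $\widehat v_{h_0},\widehat v_{h,h_0}\ge0$. For a sequence $\gamma_n>0$, $\widetilde h=\arg\max_{h\in\mathcal H_n}\{\widehat T_h-\gamma_n\widehat v_{h,h_0}\}$. For $\alpha\in(0,1)$, $z_\alpha$ is the $(1-\alpha)$-quantile of $N(0,1)$. The test rejects $H_0$ when $\widehat T_{\widetilde h}/\widehat v_{h_0}\ge z_\alpha$. **Examples of $W_h$.** - Example 1a: $\psi_k(x)=\prod_{\ell=1}^p x_\ell^{k_\ell}$ for $k\in\mathbb N^p$, $|k|\le1/h$; $P_h$ is the orthogonal projection matrix of $\mathbb R^n$ onto the span of the vectors $(\psi_k(X_1),\dots,\psi_k(X_n))'$, $|k|\le1/h$; $W_h$ is $P_h$ with its diagonal set to zero. - Example 1b: for a fixed integer $\bar q\ge0$ and $1/h$ an integer, with bins $I_k(h)=\prod_{\ell=1}^p[k_\ell h,(k_\ell+1)h)$, $k_\ell=0,\dots,1/h-1$, and functions $\psi_{qkh}(x)=\prod_{\ell}x_\ell^{q_\ell}\mathbb I(x\in I_k(h))$, $0\le|q|\le\bar q$; $P_h$ is the orthogonal projection onto the span of the vectors $(\psi_{qkh}(X_i))_{i}$ and $W_h$ is $P_h$ with its diagonal set to zero. - Example 2: $K$ is a continuous, nonnegative, symmetric, bounded kernel on $\mathbb R^p$ that integrates to $1$ and has a positive integrable Fourier transform, $K_h(x)=K(x_1/h,\dots,x_p/h)$,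 $\widehat f_h(X_i)=\frac1{(n-1)h^p}\sum_{j\ne i}K_h(X_j-X_i)$, and $w_{ij}(h)=\frac{1}{(n-1)h^p}\frac{K_h(X_i-X_j)}{\sqrt{\widehat f_h(X_i)\widehat f_h(X_j)}}$ for $i\ne j$ ($0/0=0$), $w_{ii}(h)=0$. **Assumption W.** (i) The matrices $W_h$ are those of Example 1a, 1b or 2. (ii) $\mathcal H_n$ is the geometric grid above with $h_{J_n}\asymp(\ln n)^{C_2/p}n^{-2/(4\underline s+p)}$ for some $C_2>1$, where $\underline s=5p/4$ in Example 1a and $\underline s=p/4$ in Examples 1b and 2. The number $a$ is an integer for Example 1b. *)

theory Defs
  imports "HOL-Probability.Probability"
begin

abbreviation ucube :: "(real^'p) set" where
  "ucube \<equiv> cbox 0 1"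

(* The norm |x| = max_i |x_i| is the library's infnorm throughout. *)

definition equicontinuous_seq :: "(nat \<Rightarrow> real^'p \<Rightarrow> real) \<Rightarrow> bool" where
  "equicontinuous_seq m \<longleftrightarrow>
     (\<forall>e>0. \<exists>\<eta>>0. \<forall>n\<ge>1. \<forall>x\<in>ucube. \<forall>x'\<in>ucube.
        infnorm (x - x') \<le> \<eta> \<longrightarrow> \<bar>m n x - m n x'\<bar> \<le> e)"

(* g is the partial derivative of f in coordinate l on the closed cube; it is one-sided on the
   boundary, hence g is determined by f on the cube. *)
definition has_partial_deriv :: "'p \<Rightarrow> (real^'p \<Rightarrow> real) \<Rightarrow> (real^'p \<Rightarrow> real) \<Rightarrow> bool" where
  "has_partial_deriv l f g \<longleftrightarrow>
     (\<forall>x\<in>ucube. ((\<lambda>t. f (x + t *\<^sub>R axis l 1)) has_real_derivative g x)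
                  (at 0 within {t. x + t *\<^sub>R axis l 1 \<in> ucube}))"

(* holder_order k L b m: all (iterated) partial derivatives of m of order k exist on the cube and
   are Hoelder continuous with constant L and exponent b. *)
primrec holder_order :: "nat \<Rightarrow> real \<Rightarrow> real \<Rightarrow> (real^'p \<Rightarrow> real) \<Rightarrow> bool" where
  "holder_order 0 L b m \<longleftrightarrow>
     (\<forall>x\<in>ucube. \<forall>y\<in>ucube. \<bar>m x - m y\<bar> \<le> L * infnorm (x - y) powr b)"
| "holder_order (Suc k) L b m \<longleftrightarrow>
     (\<forall>l. \<exists>g. has_partial_deriv l m g \<and> holder_order k L b g)"

(* The integer k with k < s <= k + 1. *)
definition lower_int :: "real \<Rightarrow> nat" where
  "lower_int s = nat (\<lceil>s\<rceil> - 1)"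

definition holder_class :: "real \<Rightarrow> real \<Rightarrow> (real^'p \<Rightarrow> real) set" where
  "holder_class L s = {m. holder_order (lower_int s) L (s - real (lower_int s)) m}"

(* Measurability is part of the notion: measure assigns 0 to non-measurable sets, so without it
   the convergence could hold vacuously. *)
definition conv_in_prob ::
    "'a measure \<Rightarrow> (nat \<Rightarrow> 'a \<Rightarrow> 'b::metric_space) \<Rightarrow> 'b \<Rightarrow> bool" where
  "conv_in_prob M Z c \<longleftrightarrow>
     (\<forall>n. Z n \<in> borel_measurable M) \<and>
     (\<forall>e>0. (\<lambda>n. measure M {\<omega>\<in>space M. dist (Z n \<omega>) c > e}) \<longlonglongrightarrow> 0)"

definition sigma_of :: "'a measure \<Rightarrow> ('a \<Rightarrow> 'b::topological_space) \<Rightarrow> 'a measure" where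
  "sigma_of M Z = vimage_algebra (space M) Z borel"

(* The sigma-algebra generated by X 0, ..., X (n - 1); observations are numbered from 0. *)
definition sigma_design :: "'a measure \<Rightarrow> (nat \<Rightarrow> 'a \<Rightarrow> real^'p) \<Rightarrow> nat \<Rightarrow> 'a measure" where
  "sigma_design M X n =
     vimage_algebra (space M) (\<lambda>\<omega>. \<lambda>i\<in>{..<n}. X i \<omega>) (PiM {..<n} (\<lambda>_. borel))"

definition cond_prob_given :: "'a measure \<Rightarrow> 'a measure \<Rightarrow> ('a \<Rightarrow> bool) \<Rightarrow> 'a \<Rightarrow> real" where
  "cond_prob_given M F A = real_cond_exp M F (indicator {\<omega>\<in>space M. A \<omega>})"

definition real_cond_var :: "'a measure \<Rightarrow> 'a measure \<Rightarrow> ('a \<Rightarrow> real) \<Rightarrow> 'a \<Rightarrow> real" where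
  "real_cond_var M F Z = real_cond_exp M F (\<lambda>\<omega>. (Z \<omega> - real_cond_exp M F Z \<omega>)\<^sup>2)"

definition z_quantile :: "real \<Rightarrow> real" where
  "z_quantile \<alpha> = Inf {z. 1 - \<alpha> \<le> cdf std_normal_distribution z}"

definition assumption_D :: "'a measure \<Rightarrow> (nat \<Rightarrow> 'a \<Rightarrow> real^'p) \<Rightarrow> bool" where
  "assumption_D M X \<longleftrightarrow>
     prob_space.indep_vars M (\<lambda>_. borel) X UNIV \<and>
     (\<forall>i. \<forall>\<omega>\<in>space M. X i \<omega> \<in> ucube) \<and>
     (\<exists>f. continuous_on ucube f \<and> (\<forall>x\<in>ucube. 0 < f x) \<and>
        (\<forall>i. distributed M lborel (X i) (\<lambda>x. ennreal (f x) * indicator ucube x)))"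

definition assumption_M :: "(real^'d) set \<Rightarrow> (real^'p \<Rightarrow> real^'d \<Rightarrow> real) \<Rightarrow> bool" where
  "assumption_M \<Theta> \<mu> \<longleftrightarrow>
     compact \<Theta> \<and> continuous_on (ucube \<times> \<Theta>) (\<lambda>(x, \<theta>). \<mu> x \<theta>) \<and>
     (\<exists>B. \<forall>\<theta>\<in>\<Theta>. \<forall>\<theta>'\<in>\<Theta>. \<forall>x\<in>ucube. \<bar>\<mu> x \<theta> - \<mu> x \<theta>'\<bar> \<le> B * infnorm (\<theta> - \<theta>'))"

(* d is the dimension of the parameter. The integrability clause only makes explicit that the
   bounded conditional moment is finite: real_cond_exp is a junk value otherwise. *)
definition assumption_E ::
    "'a measure \<Rightarrow> (nat \<Rightarrow> 'a \<Rightarrow> real^'p) \<Rightarrow> (nat \<Rightarrow> 'a \<Rightarrow> real) \<Rightarrow> (real^'p \<Rightarrow> real) \<Rightarrow> nat \<Rightarrow> bool" where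
  "assumption_E M X \<epsilon> \<sigma>2 d \<longleftrightarrow>
     (\<forall>i. \<epsilon> i \<in> borel_measurable M) \<and>
     (\<forall>n\<ge>1. \<forall>B. (\<forall>i<n. B i \<in> sets borel) \<longrightarrow>
        (AE \<omega> in M. cond_prob_given M (sigma_design M X n) (\<lambda>\<omega>. \<forall>i<n. \<epsilon> i \<omega> \<in> B i) \<omega>
           = (\<Prod>i<n. cond_prob_given M (sigma_design M X n) (\<lambda>\<omega>. \<epsilon> i \<omega> \<in> B i) \<omega>))) \<and>
     (\<forall>n\<ge>1. \<forall>i<n. \<forall>B\<in>sets borel.
        (AE \<omega> in M. cond_prob_given M (sigma_design M X n) (\<lambda>\<omega>. \<epsilon> i \<omega> \<in> B) \<omega>
           = cond_prob_given M (sigma_of M (X i)) (\<lambda>\<omega>. \<epsilon> i \<omega> \<in> B) \<omega>)) \<and>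
     (\<forall>i. AE \<omega> in M. real_cond_exp M (sigma_of M (X i)) (\<epsilon> i) \<omega> = 0) \<and>
     (\<forall>i. AE \<omega> in M. real_cond_var M (sigma_of M (X i)) (\<epsilon> i) \<omega> = \<sigma>2 (X i \<omega>)) \<and>
     continuous_on ucube \<sigma>2 \<and> (\<exists>c>0. \<forall>x\<in>ucube. c \<le> \<sigma>2 x) \<and>
     (\<exists>d'>max (real d) 4. \<exists>C1. \<forall>i.
        integrable M (\<lambda>\<omega>. \<bar>\<epsilon> i \<omega>\<bar> powr d') \<and>
        (AE \<omega> in M. (real_cond_exp M (sigma_of M (X i)) (\<lambda>\<omega>. \<bar>\<epsilon> i \<omega>\<bar> powr d') \<omega>) powr (1/d') < C1))"

(* mu(x; .) is twice differentiable on Theta (relative to Theta), with gradient G and Hessian H,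
   and H is jointly continuous. *)
definition twice_diff_param ::
    "(real^'d) set \<Rightarrow> (real^'p \<Rightarrow> real^'d \<Rightarrow> real) \<Rightarrow> (real^'p \<Rightarrow> real^'d \<Rightarrow> real^'d) \<Rightarrow>
     (real^'p \<Rightarrow> real^'d \<Rightarrow> real^'d^'d) \<Rightarrow> bool" where
  "twice_diff_param \<Theta> \<mu> G H \<longleftrightarrow>
     (\<forall>x\<in>ucube. \<forall>\<theta>\<in>\<Theta>.
        (\<mu> x has_derivative (\<lambda>v. G x \<theta> \<bullet> v)) (at \<theta> within \<Theta>) \<and>
        (G x has_derivative (\<lambda>v. H x \<theta> *v v)) (at \<theta> within \<Theta>)) \<and>
     continuous_on (ucube \<times> \<Theta>) (\<lambda>(x, \<theta>). H x \<theta>)"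

(* Vectors of R^n and n x n matrices are functions on nat read at indices below n. P is the matrix
   of the orthogonal projection of R^n onto the span of the vectors v k, k in K (K finite):
   P u lies in the span and u - P u is orthogonal to it, for all u. *)
definition is_orth_proj :: "nat \<Rightarrow> 'k set \<Rightarrow> ('k \<Rightarrow> nat \<Rightarrow> real) \<Rightarrow> (nat \<Rightarrow> nat \<Rightarrow> real) \<Rightarrow> bool" where
  "is_orth_proj n K v P \<longleftrightarrow>
     (\<forall>u. (\<exists>c. \<forall>i<n. (\<Sum>j<n. P i j * u j) = (\<Sum>k\<in>K. c k * v k i)) \<and>
          (\<forall>k\<in>K. (\<Sum>i<n. (u i - (\<Sum>j<n. P i j * u j)) * v k i) = 0))"

definition proj_matrix :: "nat \<Rightarrow> 'k set \<Rightarrow> ('k \<Rightarrow> nat \<Rightarrow> real) \<Rightarrow> nat \<Rightarrow> nat \<Rightarrow> real" where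
  "proj_matrix n K v =
     (THE P. is_orth_proj n K v P \<and> (\<forall>i j. n \<le> i \<or> n \<le> j \<longrightarrow> P i j = 0))"

lemma is_orth_proj_exists:
  assumes "finite K"
  shows "\<exists>P. is_orth_proj n K v P"
  using assms
proof (induction K)
  case empty
  show ?case by (rule exI[of _ "\<lambda>_ _. 0"]) (simp add: is_orth_proj_def)
next
  case (insert a K)
  then obtain P where P: "is_orth_proj n K v P" by blast
  define ip where "ip f g = (\<Sum>i<n. f i * g i)" for f g :: "nat \<Rightarrow> real"
  define A where "A u i = (\<Sum>j<n. P i j * u j)" for u i
  define r where "r i = v a i - A (v a) i" for i
  define S where "S = ip r r"
  have ex: "\<exists>c. \<forall>i<n. A u i = (\<Sum>k\<in>K. c k * v k i)" for u
    using P unfolding is_orth_proj_def A_def by blast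
  have orth: "ip (\<lambda>i. u i - A u i) (v k) = 0" if "k \<in> K" for u k
    using P that unfolding is_orth_proj_def A_def ip_def by blast
  have orthA: "ip (\<lambda>i. u i - A u i) (A w) = 0" for u w
  proof -
    obtain c where c: "\<forall>i<n. A w i = (\<Sum>k\<in>K. c k * v k i)" using ex by blast
    have "ip (\<lambda>i. u i - A u i) (A w) = (\<Sum>i<n. \<Sum>k\<in>K. c k * ((u i - A u i) * v k i))"
      unfolding ip_def using c by (intro sum.cong refl) (simp add: sum_distrib_left mult_ac)
    also have "\<dots> = (\<Sum>k\<in>K. c k * ip (\<lambda>i. u i - A u i) (v k))"
      unfolding ip_def by (subst sum.swap) (simp add: sum_distrib_left)
    finally show ?thesis using orth by simp
  qed
  have rk: "ip r (v k) = 0" if "k \<in> K" for k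
    using orth[OF that, of "v a"] by (simp add: r_def[abs_def])
  have rA: "ip r (A w) = 0" for w using orthA[of "v a" w] by (simp add: r_def[abs_def])
  have ipdl: "ip (\<lambda>i. f i - g i) h = ip f h - ip g h" for f g h
    by (simp add: ip_def left_diff_distrib sum_subtractf)
  have ipdr: "ip h (\<lambda>i. f i - g i) = ip h f - ip h g" for f g h
    by (simp add: ip_def right_diff_distrib sum_subtractf)
  have ipml: "ip (\<lambda>i. q * f i) h = q * ip f h" for q f h
    by (simp add: ip_def sum_distrib_left mult_ac)
  have sym: "ip f g = ip g f" for f g by (simp add: ip_def mult.commute)
  have rva: "ip r (v a) = S"
  proof -
    have "S = ip r (v a) - ip r (A (v a))" unfolding S_def
      by (subst (2) r_def[abs_def]) (rule ipdr)
    then show ?thesis using rA by simp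
  qed
  have r0: "r i = 0" if "S = 0" "i < n" for i
  proof -
    have "(\<Sum>i<n. r i * r i) = 0" using that(1) by (simp add: S_def ip_def)
    then have "\<forall>i\<in>{..<n}. r i * r i = 0" by (subst (asm) sum_nonneg_eq_0_iff) auto
    then show ?thesis using that(2) by simp
  qed
  define Q where "Q i j = P i j + r i * r j / S" for i j
  have Q: "(\<Sum>j<n. Q i j * u j) = A u i + ip r u / S * r i" for u i
  proof -
    have "(\<Sum>j<n. Q i j * u j) = (\<Sum>j<n. P i j * u j + (r i / S) * (r j * u j))"
      by (intro sum.cong refl) (simp add: Q_def distrib_right)
    also have "\<dots> = A u i + (r i / S) * ip r u"
      by (simp only: sum.distrib A_def ip_def sum_distrib_left)
    finally show ?thesis by simp
  qed
  have "is_orth_proj n (insert a K) v Q"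
    unfolding is_orth_proj_def Q
  proof (intro allI conjI ballI)
    fix u
    obtain c where c: "\<forall>i<n. A u i = (\<Sum>k\<in>K. c k * v k i)" using ex by blast
    obtain b where b: "\<forall>i<n. A (v a) i = (\<Sum>k\<in>K. b k * v k i)" using ex by blast
    define q where "q = ip r u / S"
    show "\<exists>c. \<forall>i<n. A u i + ip r u / S * r i = (\<Sum>k\<in>insert a K. c k * v k i)"
    proof (intro exI allI impI)
      fix i assume i: "i < n"
      have "(\<Sum>k\<in>K. (if k = a then q else c k - q * b k) * v k i)
          = (\<Sum>k\<in>K. c k * v k i - q * (b k * v k i))"
        using insert.hyps(2) by (intro sum.cong) (auto simp: algebra_simps)
      also have "\<dots> = A u i - q * A (v a) i"
        using c b i by (simp add: sum_subtractf sum_distrib_left)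
      finally show "A u i + ip r u / S * r i
          = (\<Sum>k\<in>insert a K. (if k = a then q else c k - q * b k) * v k i)"
        using insert.hyps by (simp add: q_def[symmetric] r_def algebra_simps)
    qed
    fix k assume k: "k \<in> insert a K"
    have "(\<Sum>i<n. (u i - (A u i + q * r i)) * v k i)
        = (\<Sum>i<n. (u i - A u i) * v k i - q * (r i * v k i))"
      by (intro sum.cong refl) (simp add: left_diff_distrib distrib_right)
    also have "\<dots> = ip (\<lambda>i. u i - A u i) (v k) - q * ip r (v k)"
      by (simp add: sum_subtractf ip_def sum_distrib_left[symmetric])
    finally have eq: "(\<Sum>i<n. (u i - (A u i + ip r u / S * r i)) * v k i)
        = ip (\<lambda>i. u i - A u i) (v k) - q * ip r (v k)"
      by (simp only: q_def)
    show "(\<Sum>i<n. (u i - (A u i + ip r u / S * r i)) * v k i) = 0"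
    proof (cases "k = a")
      case False
      then show ?thesis using k eq orth[of k u] rk[of k] by auto
    next
      case True
      have "ip (\<lambda>i. u i - A u i) (v a) = ip (\<lambda>i. u i - A u i) r"
        using orthA[of u "v a"] by (subst r_def[abs_def]) (simp add: ipdr)
      also have "\<dots> = ip u r" using rA[of u] by (simp add: ipdl sym[of "A u" r])
      finally have 1: "ip (\<lambda>i. u i - A u i) (v a) = ip r u" by (simp add: sym)
      have "ip r u = q * S"
      proof (cases "S = 0")
        case True
        then have "ip r u = 0" unfolding ip_def using r0 by (intro sum.neutral) auto
        then show ?thesis using True by simp
      qed (simp add: q_def)
      then show ?thesis unfolding eq using True 1 rva by simp
    qed
  qed
  then show ?case by blast
qed

lemma is_orth_proj_unique:
  assumes P: "is_orth_proj n K v P" and Q: "is_orth_proj n K v Q" and ij: "i < n" "j < n"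
  shows "P i j = Q i j"
proof -
  define u :: "nat \<Rightarrow> real" where "u l = (if l = j then 1 else 0)" for l
  have ap: "(\<Sum>l<n. R i l * u l) = R i j" for R :: "nat \<Rightarrow> nat \<Rightarrow> real" and i
    using ij by (simp add: u_def if_distrib[of "(*) _"] cong: if_cong)
  note Pu = spec[OF P[unfolded is_orth_proj_def], of u, unfolded ap]
  note Qu = spec[OF Q[unfolded is_orth_proj_def], of u, unfolded ap]
  obtain b where b: "\<forall>i<n. P i j = (\<Sum>k\<in>K. b k * v k i)"
    using Pu by blast
  obtain c where c: "\<forall>i<n. Q i j = (\<Sum>k\<in>K. c k * v k i)"
    using Qu by blast
  have o: "(\<Sum>i<n. (u i - P i j) * v k i) = 0" "(\<Sum>i<n. (u i - Q i j) * v k i) = 0"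
    if "k \<in> K" for k
    using Pu Qu that by blast+
  have d: "(\<Sum>i<n. (P i j - Q i j) * v k i) = 0" if "k \<in> K" for k
    using o[OF that] by (simp add: algebra_simps sum_subtractf)
  have "(\<Sum>i<n. (P i j - Q i j) * (P i j - Q i j))
      = (\<Sum>i<n. \<Sum>k\<in>K. (b k - c k) * ((P i j - Q i j) * v k i))"
  proof (intro sum.cong refl)
    fix i assume "i \<in> {..<n}"
    then have "P i j - Q i j = (\<Sum>k\<in>K. (b k - c k) * v k i)"
      using b c by (simp add: sum_subtractf left_diff_distrib)
    then have "(P i j - Q i j) * (P i j - Q i j) = (P i j - Q i j) * (\<Sum>k\<in>K. (b k - c k) * v k i)"
      by simp
    then show "(P i j - Q i j) * (P i j - Q i j)
        = (\<Sum>k\<in>K. (b k - c k) * ((P i j - Q i j) * v k i))"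
      by (simp add: sum_distrib_left mult_ac)
  qed
  also have "\<dots> = (\<Sum>k\<in>K. (b k - c k) * (\<Sum>i<n. (P i j - Q i j) * v k i))"
    by (subst sum.swap) (simp add: sum_distrib_left)
  also have "\<dots> = 0" using d by simp
  finally have "\<forall>i\<in>{..<n}. (P i j - Q i j) * (P i j - Q i j) = 0"
    by (subst (asm) sum_nonneg_eq_0_iff) auto
  then show ?thesis using ij by simp
qed

lemma is_orth_proj_proj_matrix:
  assumes "finite K"
  shows "is_orth_proj n K v (proj_matrix n K v)"
proof -
  obtain P where P: "is_orth_proj n K v P" using is_orth_proj_exists[OF assms] by blast
  define P' where "P' i j = (if i < n \<and> j < n then P i j else 0)" for i j
  have "(\<Sum>j<n. P' i j * u j) = (\<Sum>j<n. P i j * u j)" if "i < n" for i u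
    using that by (simp add: P'_def)
  with P have P': "is_orth_proj n K v P'" by (simp add: is_orth_proj_def)
  have "\<exists>!P. is_orth_proj n K v P \<and> (\<forall>i j. n \<le> i \<or> n \<le> j \<longrightarrow> P i j = 0)"
  proof (rule ex1I)
    show "is_orth_proj n K v P' \<and> (\<forall>i j. n \<le> i \<or> n \<le> j \<longrightarrow> P' i j = 0)"
      using P' by (auto simp: P'_def)
    fix R assume R: "is_orth_proj n K v R \<and> (\<forall>i j. n \<le> i \<or> n \<le> j \<longrightarrow> R i j = 0)"
    have "R i j = P' i j" for i j
      using R is_orth_proj_unique[of n K v R P' i j] P'
      by (cases "i < n \<and> j < n") (auto simp: P'_def not_less)
    then show "R = P'" by blast
  qed
  from theI'[OF this] show ?thesis unfolding proj_matrix_def by blast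
qed

(* |k| <= 1/h for the maximum norm of the exponent. *)
definition poly_index :: "real \<Rightarrow> ('p \<Rightarrow> nat) set" where
  "poly_index h = {k. \<forall>l. real (k l) \<le> 1 / h}"

definition monomial :: "('p \<Rightarrow> nat) \<Rightarrow> real^'p \<Rightarrow> real" where
  "monomial k x = (\<Prod>l\<in>UNIV. (x $ l) ^ k l)"

(* q is an exponent and k numbers a bin; 1 / h is an integer where this is used. *)
definition piecewise_index :: "nat \<Rightarrow> real \<Rightarrow> (('p \<Rightarrow> nat) \<times> ('p \<Rightarrow> nat)) set" where
  "piecewise_index qbar h = {(q, k). (\<forall>l. q l \<le> qbar) \<and> (\<forall>l. real (k l) \<le> 1 / h - 1)}"

definition bin :: "real \<Rightarrow> ('p \<Rightarrow> nat) \<Rightarrow> (real^'p) set" where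
  "bin h k = {x. \<forall>l. real (k l) * h \<le> x $ l \<and> x $ l < (real (k l) + 1) * h}"

definition piecewise_fun :: "real \<Rightarrow> ('p \<Rightarrow> nat) \<times> ('p \<Rightarrow> nat) \<Rightarrow> real^'p \<Rightarrow> real" where
  "piecewise_fun h = (\<lambda>(q, k) x. monomial q x * indicator (bin h k) x)"

definition fourier :: "(real^'p \<Rightarrow> real) \<Rightarrow> real^'p \<Rightarrow> complex" where
  "fourier K t = (\<integral>x. cis (- (t \<bullet> x)) * complex_of_real (K x) \<partial>lborel)"

definition admissible_kernel :: "(real^'p \<Rightarrow> real) \<Rightarrow> bool" where
  "admissible_kernel K \<longleftrightarrow>
     continuous_on UNIV K \<and> (\<forall>x. 0 \<le> K x) \<and> (\<forall>x. K (- x) = K x) \<and> bounded (range K) \<and>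
     has_bochner_integral lborel K 1 \<and>
     (\<forall>t. \<exists>r>0. fourier K t = complex_of_real r) \<and> integrable lborel (fourier K)"

(* K_h(x) = K(x_1/h, ..., x_p/h), without normalisation by h^p. *)
definition scaled_kernel :: "(real^'p \<Rightarrow> real) \<Rightarrow> real \<Rightarrow> real^'p \<Rightarrow> real" where
  "scaled_kernel K h x = K (x /\<^sub>R h)"

definition loo_density ::
    "(real^'p \<Rightarrow> real) \<Rightarrow> nat \<Rightarrow> real \<Rightarrow> (nat \<Rightarrow> real^'p) \<Rightarrow> nat \<Rightarrow> real" where
  "loo_density K n h x i =
     1 / ((real n - 1) * h ^ CARD('p)) * (\<Sum>j\<in>{..<n} - {i}. scaled_kernel K h (x j - x i))"

datatype ('p::finite) smoother =
    Polynomial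
  | Piecewise nat
  | Kernel "real^'p \<Rightarrow> real"

(* The entries w_ij(h) for sample size n and design x. In the kernel case, a vanishing density
   estimate at x i or x j forces a vanishing numerator, and the quotient is then 0 / 0 = 0. *)
definition weight ::
    "('p::finite) smoother \<Rightarrow> nat \<Rightarrow> real \<Rightarrow> (nat \<Rightarrow> real^'p) \<Rightarrow> nat \<Rightarrow> nat \<Rightarrow> real" where
  "weight S n h x i j =
     (if i = j then 0
      else case S of
        Polynomial \<Rightarrow> proj_matrix n (poly_index h) (\<lambda>k i. monomial k (x i)) i j
      | Piecewise qbar \<Rightarrow>
          proj_matrix n (piecewise_index qbar h) (\<lambda>qk i. piecewise_fun h qk (x i)) i j
      | Kernel K \<Rightarrow>
          1 / ((real n - 1) * h ^ CARD('p)) *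
          (scaled_kernel K h (x i - x j) / sqrt (loo_density K n h x i * loo_density K n h x j)))"

definition s_lower :: "('p::finite) smoother \<Rightarrow> real" where
  "s_lower S = (case S of Polynomial \<Rightarrow> 5 * real CARD('p) / 4 | _ \<Rightarrow> real CARD('p) / 4)"

definition bandwidths :: "real \<Rightarrow> real \<Rightarrow> nat \<Rightarrow> real set" where
  "bandwidths h0 a J = {h0 / a ^ j | j. j \<le> J}"

definition same_order :: "(nat \<Rightarrow> real) \<Rightarrow> (nat \<Rightarrow> real) \<Rightarrow> bool" where
  "same_order f g \<longleftrightarrow> (\<exists>C>1. \<forall>\<^sub>F n in sequentially. 1 / C \<le> f n / g n \<and> f n / g n \<le> C)"

definition assumption_W ::
    "('p::finite) smoother \<Rightarrow> real \<Rightarrow> (nat \<Rightarrow> real) \<Rightarrow> (nat \<Rightarrow> nat) \<Rightarrow> bool" where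
  "assumption_W S a h0 J \<longleftrightarrow>
     (case S of
        Polynomial \<Rightarrow> True
      | Piecewise qbar \<Rightarrow> a \<in> \<int> \<and> (\<forall>n\<ge>1. \<forall>h\<in>bandwidths (h0 n) a (J n). 1 / h \<in> \<int>)
      | Kernel K \<Rightarrow> admissible_kernel K) \<and>
     1 < a \<and> (\<forall>n\<ge>1. 0 < h0 n) \<and> filterlim J at_top sequentially \<and>
     (\<exists>C2>1. same_order (\<lambda>n. h0 n / a ^ J n)
        (\<lambda>n. ln (real n) powr (C2 / real CARD('p)) *
             real n powr (- 2 / (4 * s_lower S + real CARD('p)))))"

definition sum_sq_resid ::
    "(real^'p \<Rightarrow> real^'d \<Rightarrow> real) \<Rightarrow> nat \<Rightarrow> (nat \<Rightarrow> real^'p) \<Rightarrow> (nat \<Rightarrow> real) \<Rightarrow> real^'d \<Rightarrow> real" where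
  "sum_sq_resid \<mu> n x y \<theta> = (\<Sum>i<n. (y i - \<mu> (x i) \<theta>)\<^sup>2)"

(* T_h as a function of the data and of the estimated parameter. *)
definition T_stat ::
    "(real^'p \<Rightarrow> real^'d \<Rightarrow> real) \<Rightarrow> ('p::finite) smoother \<Rightarrow> nat \<Rightarrow> (nat \<Rightarrow> real^'p) \<Rightarrow>
     (nat \<Rightarrow> real) \<Rightarrow> real^'d \<Rightarrow> real \<Rightarrow> real" where
  "T_stat \<mu> S n x y \<theta> h =
     (\<Sum>i<n. \<Sum>j<n. (y i - \<mu> (x i) \<theta>) * weight S n h x i j * (y j - \<mu> (x j) \<theta>))"

(* The argument s is the variance estimate as a function on the cube. *)
definition v_base ::
    "('p::finite) smoother \<Rightarrow> nat \<Rightarrow> (nat \<Rightarrow> real^'p) \<Rightarrow> (real^'p \<Rightarrow> real) \<Rightarrow> real \<Rightarrow> real" where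
  "v_base S n x s h0 =
     sqrt (2 * (\<Sum>i<n. \<Sum>j<n. (weight S n h0 x i j)\<^sup>2 * s (x i) * s (x j)))"

definition v_diff ::
    "('p::finite) smoother \<Rightarrow> nat \<Rightarrow> (nat \<Rightarrow> real^'p) \<Rightarrow> (real^'p \<Rightarrow> real) \<Rightarrow> real \<Rightarrow> real \<Rightarrow> real" where
  "v_diff S n x s h h0 =
     sqrt (2 * (\<Sum>i<n. \<Sum>j<n. (weight S n h x i j - weight S n h0 x i j)\<^sup>2 * s (x i) * s (x j)))"

(* The responses under regression function m, and the first n observations (Y_i, X_i). *)
definition response ::
    "(real^'p \<Rightarrow> real) \<Rightarrow> (nat \<Rightarrow> 'a \<Rightarrow> real^'p) \<Rightarrow> (nat \<Rightarrow> 'a \<Rightarrow> real) \<Rightarrow> 'a \<Rightarrow> nat \<Rightarrow> real" where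
  "response m X \<epsilon> \<omega> i = m (X i \<omega>) + \<epsilon> i \<omega>"

definition sample ::
    "(real^'p \<Rightarrow> real) \<Rightarrow> (nat \<Rightarrow> 'a \<Rightarrow> real^'p) \<Rightarrow> (nat \<Rightarrow> 'a \<Rightarrow> real) \<Rightarrow> nat \<Rightarrow> 'a \<Rightarrow>
     nat \<Rightarrow> real \<times> (real^'p)" where
  "sample m X \<epsilon> n \<omega> = (\<lambda>i\<in>{..<n}. (response m X \<epsilon> \<omega> i, X i \<omega>))"

(* V n z is the variance function estimated from a sample z of size n. It is nonnegative, and its
   values at the design points are measurable functions of the sample. *)
definition variance_estimator ::
    "(nat \<Rightarrow> (nat \<Rightarrow> real \<times> (real^'p)) \<Rightarrow> real^'p \<Rightarrow> real) \<Rightarrow> bool" where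
  "variance_estimator V \<longleftrightarrow>
     (\<forall>n z x. 0 \<le> V n z x) \<and>
     (\<forall>n. \<forall>i<n. (\<lambda>z. V n z (snd (z i))) \<in> borel_measurable (PiM {..<n} (\<lambda>_. borel)))"

(* Uniform relative consistency at the design points, whatever the equicontinuous sequence of
   regression functions generating the responses. *)
definition variance_estimator_consistent ::
    "'a measure \<Rightarrow> (nat \<Rightarrow> 'a \<Rightarrow> real^'p) \<Rightarrow> (nat \<Rightarrow> 'a \<Rightarrow> real) \<Rightarrow> (real^'p \<Rightarrow> real) \<Rightarrow>
     (nat \<Rightarrow> (nat \<Rightarrow> real \<times> (real^'p)) \<Rightarrow> real^'p \<Rightarrow> real) \<Rightarrow> bool" where
  "variance_estimator_consistent M X \<epsilon> \<sigma>2 V \<longleftrightarrow>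
     (\<forall>m. equicontinuous_seq m \<longrightarrow>
        conv_in_prob M
          (\<lambda>n \<omega>. MAX i\<in>{..<n}. \<bar>V n (sample (m n) X \<epsilon> n \<omega>) (X i \<omega>) / \<sigma>2 (X i \<omega>) - 1\<bar>) 0)"

end

theory Submission
  imports Defs "HOL-Real_Asymp.Real_Asymp"
begin

text \<open>The penalty vanishes at the base bandwidth \<open>h\<^sub>0\<close>, so the maximised statistic is at least the one at
  \<open>h\<^sub>0\<close>, and it suffices to show that the latter exceeds the critical value with probability tending to one.
  There the residuals are \<open>\<epsilon>\<^sub>i + r\<^sub>n \<delta>\<^sub>n(X\<^sub>i) - (\<mu>(X\<^sub>i; \<theta>\<^sub>n) - \<mu>(X\<^sub>i; \<theta>\<^sub>0))\<close>, where \<open>\<theta>\<^sub>n\<close> is the least squares estimator.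
  Since \<open>\<delta>\<^sub>n\<close> is asymptotically orthogonal to the gradient and \<open>n r\<^sub>n\<^sup>2 \<rightarrow> \<infinity>\<close>, the estimator satisfies
  \<open>\<theta>\<^sub>n - \<theta>\<^sub>0 = o(r\<^sub>n)\<close>. All the weight matrices have spectral norm at most 2, squared Frobenius norm of order
  \<open>h\<^sub>0\<^sup>-\<^sup>p\<close>, and a quadratic form at \<open>\<delta>\<^sub>n\<close> of order \<open>n\<close>: a projection matrix nearly reproduces an equicontinuous function,
  and a kernel with positive Fourier transform smooths it to itself. Hence the statistic at \<open>h\<^sub>0\<close> is at
  least of order \<open>n r\<^sub>n\<^sup>2\<close>, while the quadratic form in the errors and the critical value are
  of order \<open>h\<^sub>0\<^sup>-\<^sup>p\<^sup>/\<^sup>2\<close>, which is negligible because \<open>\<surd>(n h\<^sub>0\<^sup>p\<^sup>/\<^sup>2) r\<^sub>n \<rightarrow> \<infinity>\<close>.\<close>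

section \<open>Events of probability tending to one\<close>

text \<open>The claim is conditional on the design, but it is enough that the rejection event has
  probability tending to one: a conditional probability is at most 1 and its mean is the
  unconditional probability. Several intermediate events quantify over all of \<Theta> or over all
  vectors and are not known to be measurable, so \<open>whp\<close> asks only for a measurable
  subset of large probability. Assumption E describes each error given \<open>X i\<close> alone,
  together with a product formula for joint events; it has to be turned into a statement on
  \<open>\<epsilon> i\<close> given the design and the earlier errors, which makes linear and
  quadratic forms sums of martingale differences. For kernels the obstacles are the random
  denominators and the boundary of the cube: positivity of the Fourier transform enters through
  \<open>K 0 > 0\<close>, which bounds the smoothed density away from zero. The lower end of the
  bandwidth grid makes n h0^p diverge for every smoother, so that the trace of a projection is o(n)
  and the density estimate is consistent.\<close>

definition whp :: "'a measure \<Rightarrow> (nat \<Rightarrow> 'a \<Rightarrow> bool) \<Rightarrow> bool" where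
  "whp M Q \<longleftrightarrow> (\<forall>e>0. \<forall>\<^sub>F n in sequentially.
     \<exists>A\<in>sets M. 1 - e \<le> measure M A \<and> (\<forall>\<omega>\<in>A. Q n \<omega>))"

lemma whp_mono:
  assumes "whp M P" "\<forall>\<^sub>F n in sequentially. \<forall>\<omega>\<in>space M. P n \<omega> \<longrightarrow> Q n \<omega>"
  shows "whp M Q"
  unfolding whp_def
proof (intro allI impI)
  fix e :: real assume "e > 0"
  with assms(1) have "\<forall>\<^sub>F n in sequentially. \<exists>A\<in>sets M. 1 - e \<le> measure M A \<and> (\<forall>\<omega>\<in>A. P n \<omega>)"
    by (simp add: whp_def)
  with assms(2) show "\<forall>\<^sub>F n in sequentially. \<exists>A\<in>sets M. 1 - e \<le> measure M A \<and> (\<forall>\<omega>\<in>A. Q n \<omega>)"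
    by eventually_elim (meson sets.sets_into_space subsetD)
qed

context prob_space
begin

lemma whp_conj:
  assumes "whp M P" "whp M Q"
  shows "whp M (\<lambda>n \<omega>. P n \<omega> \<and> Q n \<omega>)"
  unfolding whp_def
proof (intro allI impI)
  fix e :: real assume "e > 0"
  then have "e/2 > 0" by simp
  with assms have "\<forall>\<^sub>F n in sequentially. \<exists>A\<in>sets M. 1 - e/2 \<le> prob A \<and> (\<forall>\<omega>\<in>A. P n \<omega>)"
    "\<forall>\<^sub>F n in sequentially. \<exists>A\<in>sets M. 1 - e/2 \<le> prob A \<and> (\<forall>\<omega>\<in>A. Q n \<omega>)"
    unfolding whp_def by blast+
  then show "\<forall>\<^sub>F n in sequentially. \<exists>A\<in>sets M. 1 - e \<le> prob A \<and> (\<forall>\<omega>\<in>A. P n \<omega> \<and> Q n \<omega>)"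
  proof eventually_elim
    case (elim n)
    then obtain A B where A: "A \<in> sets M" "1 - e/2 \<le> prob A" "\<forall>\<omega>\<in>A. P n \<omega>"
      and B: "B \<in> sets M" "1 - e/2 \<le> prob B" "\<forall>\<omega>\<in>B. Q n \<omega>" by blast
    have "prob (A \<union> B) = prob A + prob B - prob (A \<inter> B)"
      using A B by (subst finite_measure_Union') (auto simp: finite_measure_Diff' Int_commute)
    moreover have "prob (A \<union> B) \<le> 1" by simp
    ultimately have "1 - e \<le> prob (A \<inter> B)" using A B by simp
    with A B show ?case by (intro bexI[of _ "A \<inter> B"]) auto
  qed
qed

lemma whp_eventually_AE:
  assumes "\<forall>\<^sub>F n in sequentially. AE \<omega> in M. Q n \<omega>"
  shows "whp M Q"
  unfolding whp_def
proof (intro allI impI)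
  fix e :: real assume e: "e > 0"
  show "\<forall>\<^sub>F n in sequentially. \<exists>A\<in>sets M. 1 - e \<le> prob A \<and> (\<forall>\<omega>\<in>A. Q n \<omega>)"
    using assms
  proof eventually_elim
    case (elim n)
    from AE_E_prob[OF elim] obtain S where "S \<subseteq> {\<omega> \<in> space M. Q n \<omega>}" "S \<in> events" "prob S = 1" .
    with e show ?case by (intro bexI[of _ S]) auto
  qed
qed

lemma whp_eventually:
  assumes "\<forall>\<^sub>F n in sequentially. \<forall>\<omega>\<in>space M. Q n \<omega>"
  shows "whp M Q"
  by (rule whp_eventually_AE, rule eventually_mono[OF assms]) (auto intro: AE_I2)

lemma whp_finite_ball:
  assumes "finite I" "\<And>i. i \<in> I \<Longrightarrow> whp M (Q i)"
  shows "whp M (\<lambda>n \<omega>. \<forall>i\<in>I. Q i n \<omega>)"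
  using assms
proof (induction I)
  case empty
  show ?case by (rule whp_eventually) simp
next
  case (insert i I)
  have "whp M (\<lambda>n \<omega>. Q i n \<omega> \<and> (\<forall>i\<in>I. Q i n \<omega>))"
    using insert by (intro whp_conj) auto
  then show ?case by simp
qed

lemma whp_Markov:
  fixes Z :: "nat \<Rightarrow> 'a \<Rightarrow> real" and a b :: "nat \<Rightarrow> real"
  assumes "\<forall>\<^sub>F n in sequentially. integrable M (Z n) \<and> (AE \<omega> in M. 0 \<le> Z n \<omega>) \<and> expectation (Z n) \<le> b n"
    and "\<forall>\<^sub>F n in sequentially. 0 < a n" and "(\<lambda>n. b n / a n) \<longlonglongrightarrow> 0"
  shows "whp M (\<lambda>n \<omega>. Z n \<omega> \<le> a n)"
  unfolding whp_def
proof (intro allI impI)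
  fix e :: real assume "e > 0"
  with assms(3) have "\<forall>\<^sub>F n in sequentially. b n / a n < e"
    by (intro order_tendstoD(2)) auto
  with assms(1,2) show "\<forall>\<^sub>F n in sequentially. \<exists>A\<in>sets M. 1 - e \<le> prob A \<and> (\<forall>\<omega>\<in>A. Z n \<omega> \<le> a n)"
  proof eventually_elim
    case (elim n)
    then have [measurable]: "Z n \<in> borel_measurable M" by auto
    have "prob {\<omega>\<in>space M. Z n \<omega> \<ge> a n} \<le> expectation (Z n) / a n"
      using elim by (intro integral_Markov_inequality_measure[where A = "space M"]) auto
    also have "\<dots> \<le> b n / a n" using elim by (intro divide_right_mono) auto
    finally have "prob {\<omega>\<in>space M. Z n \<omega> \<ge> a n} \<le> e" using elim by simp
    moreover have "prob (space M - {\<omega>\<in>space M. Z n \<omega> \<ge> a n}) = 1 - prob {\<omega>\<in>space M. Z n \<omega> \<ge> a n}"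
      by (rule prob_compl) measurable
    ultimately show ?case
      by (intro bexI[of _ "space M - {\<omega>\<in>space M. Z n \<omega> \<ge> a n}"]) auto
  qed
qed

lemma whp_Chebyshev:
  fixes Z :: "nat \<Rightarrow> 'a \<Rightarrow> real" and a b :: "nat \<Rightarrow> real"
  assumes "\<forall>\<^sub>F n in sequentially. integrable M (\<lambda>\<omega>. (Z n \<omega>)\<^sup>2) \<and> expectation (\<lambda>\<omega>. (Z n \<omega>)\<^sup>2) \<le> b n"
    and "\<forall>\<^sub>F n in sequentially. 0 < a n" and "(\<lambda>n. b n / (a n)\<^sup>2) \<longlonglongrightarrow> 0"
  shows "whp M (\<lambda>n \<omega>. \<bar>Z n \<omega>\<bar> \<le> a n)"
proof -
  have "whp M (\<lambda>n \<omega>. (Z n \<omega>)\<^sup>2 \<le> (a n)\<^sup>2)"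
  proof (rule whp_Markov[where b = b])
    show "\<forall>\<^sub>F n in sequentially. 0 < (a n)\<^sup>2"
      using assms(2) by eventually_elim simp
  qed (use assms in \<open>auto elim!: eventually_mono\<close>)
  then show ?thesis
    by (rule whp_mono, use assms(2) in eventually_elim) (auto simp: abs_le_square_iff[symmetric])
qed

text \<open>Passing to a bound that holds with probability \<open>1 - e\<close>, so that the constant may depend on \<open>e\<close>.\<close>
lemma whp_tight:
  fixes Z :: "nat \<Rightarrow> 'a \<Rightarrow> real"
  assumes "\<forall>\<^sub>F n in sequentially. integrable M (Z n) \<and> (AE \<omega> in M. 0 \<le> Z n \<omega>) \<and> expectation (Z n) \<le> b"
    and "\<And>K. K > 0 \<Longrightarrow> whp M (\<lambda>n \<omega>. Z n \<omega> \<le> K \<longrightarrow> Q n \<omega>)"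
  shows "whp M Q"
  unfolding whp_def
proof (intro allI impI)
  fix e :: real assume e: "e > 0"
  \<comment> \<open>Markov's inequality at level \<open>K\<close> costs at most e/2, half of the
    allowed probability; adding 1 to \<bar>b\<bar> keeps \<open>K\<close> positive when b =
    0.\<close>
  define K where "K = 2 * (\<bar>b\<bar> + 1) / e"
  have K: "K > 0" using e by (simp add: K_def)
  have "b / K = (b / (\<bar>b\<bar> + 1)) * (e / 2)" using e by (simp add: K_def field_simps)
  also have "\<dots> \<le> 1 * (e / 2)" using e by (intro mult_right_mono) auto
  finally have "b / K \<le> e / 2" by simp
  have ev2: "\<forall>\<^sub>F n in sequentially. \<exists>A\<in>sets M. 1 - e/2 \<le> prob A \<and> (\<forall>\<omega>\<in>A. Z n \<omega> \<le> K \<longrightarrow> Q n \<omega>)"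
    using assms(2)[OF K] e unfolding whp_def by (meson half_gt_zero)
  show "\<forall>\<^sub>F n in sequentially. \<exists>A\<in>sets M. 1 - e \<le> prob A \<and> (\<forall>\<omega>\<in>A. Q n \<omega>)"
    using assms(1) ev2
  proof eventually_elim
    case (elim n)
    then have [measurable]: "Z n \<in> borel_measurable M" by auto
    define B where "B = {\<omega>\<in>space M. Z n \<omega> \<ge> K}"
    have B: "B \<in> sets M" by (simp add: B_def)
    have "prob B \<le> expectation (Z n) / K"
      unfolding B_def using elim K by (intro integral_Markov_inequality_measure[where A = "space M"]) auto
    also have "\<dots> \<le> b / K" using elim K by (intro divide_right_mono) auto
    finally have pB: "prob B \<le> e/2" using \<open>b / K \<le> e / 2\<close> by (rule order.trans)
    obtain A where A: "A \<in> sets M" "1 - e/2 \<le> prob A" "\<forall>\<omega>\<in>A. Z n \<omega> \<le> K \<longrightarrow> Q n \<omega>"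
      using elim by blast
    have "prob A \<le> prob (A - B) + prob B"
      using A B by (subst finite_measure_Diff') (auto intro!: finite_measure_mono)
    then have "1 - e \<le> prob (A - B)" using A pB by linarith
    moreover have "\<forall>\<omega>\<in>A - B. Q n \<omega>"
      using A sets.sets_into_space[OF A(1)] by (auto simp: B_def)
    ultimately show ?case using A B by (intro bexI[of _ "A - B"]) auto
  qed
qed

lemma whp_conv_in_prob:
  assumes "conv_in_prob M Z c" "e > 0"
  shows "whp M (\<lambda>n \<omega>. dist (Z n \<omega>) c \<le> e)"
  unfolding whp_def
proof (intro allI impI)
  fix t :: real assume t: "t > 0"
  have [measurable]: "Z n \<in> borel_measurable M" for n
    using assms(1) by (simp add: conv_in_prob_def)
  have "(\<lambda>n. prob {\<omega>\<in>space M. dist (Z n \<omega>) c > e}) \<longlonglongrightarrow> 0"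
    using assms by (simp add: conv_in_prob_def)
  then have "\<forall>\<^sub>F n in sequentially. prob {\<omega>\<in>space M. dist (Z n \<omega>) c > e} < t"
    using t by (intro order_tendstoD(2)) auto
  then show "\<forall>\<^sub>F n in sequentially. \<exists>A\<in>sets M. 1 - t \<le> prob A \<and> (\<forall>\<omega>\<in>A. dist (Z n \<omega>) c \<le> e)"
  proof eventually_elim
    case (elim n)
    have *: "{\<omega>\<in>space M. dist (Z n \<omega>) c > e} \<in> sets M"
    proof -
      have "(\<lambda>\<omega>. dist (Z n \<omega>) c) \<in> borel_measurable M"
        by (rule measurable_compose[where N=borel and g="\<lambda>x. dist x c"])
           (auto intro!: borel_measurable_continuous_onI continuous_intros)
      then show ?thesis by measurable
    qed
    from prob_compl[OF *] elim * show ?case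
      by (intro bexI[of _ "space M - {\<omega>\<in>space M. dist (Z n \<omega>) c > e}"]) auto
  qed
qed

lemma whp_prob:
  assumes "whp M Q" and "\<And>n. {\<omega>\<in>space M. Q n \<omega>} \<in> sets M"
  shows "(\<lambda>n. prob {\<omega>\<in>space M. Q n \<omega>}) \<longlonglongrightarrow> 1"
proof (rule LIMSEQ_I)
  fix e :: real assume "e > 0"
  then have "\<forall>\<^sub>F n in sequentially. \<exists>A\<in>sets M. 1 - e/2 \<le> prob A \<and> (\<forall>\<omega>\<in>A. Q n \<omega>)"
    using assms(1) unfolding whp_def by (meson half_gt_zero)
  then have "\<forall>\<^sub>F n in sequentially. norm (prob {\<omega>\<in>space M. Q n \<omega>} - 1) < e"
  proof eventually_elim
    case (elim n)
    then obtain A where A: "A \<in> sets M" "1 - e/2 \<le> prob A" "\<forall>\<omega>\<in>A. Q n \<omega>" by blast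
    then have "prob A \<le> prob {\<omega>\<in>space M. Q n \<omega>}"
      using assms(2) sets.sets_into_space[OF A(1)] by (intro finite_measure_mono) auto
    moreover have "prob {\<omega>\<in>space M. Q n \<omega>} \<le> 1" by simp
    ultimately show ?case using A \<open>e > 0\<close> by (simp del: prob_le_1)
  qed
  then show "\<exists>no. \<forall>n\<ge>no. norm (prob {\<omega>\<in>space M. Q n \<omega>} - 1) < e"
    by (simp add: eventually_sequentially)
qed

text \<open>The conditional probability \<open>P n\<close> is at most 1 almost everywhere, so its
  distance to 1 is the nonnegative variable 1 - \<open>P n\<close>, whose mean is the probability of
  the complementary event. Markov's inequality then bounds the deviation, whatever the conditioning
  sigma-algebras are.\<close>

lemma conv_in_prob_cond_prob:
  assumes "\<And>n. subalgebra M (F n)" and ev: "\<And>n. {\<omega>\<in>space M. Q n \<omega>} \<in> sets M" and "whp M Q"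
  shows "conv_in_prob M (\<lambda>n. cond_prob_given M (F n) (Q n)) 1"
  unfolding conv_in_prob_def
proof (intro conjI allI impI)
  fix n show "cond_prob_given M (F n) (Q n) \<in> borel_measurable M"
    by (simp add: cond_prob_given_def)
next
  fix e :: real assume e: "e > 0"
  define P where "P n = cond_prob_given M (F n) (Q n)" for n
  have P: "integrable M (P n)" "expectation (P n) = prob {\<omega>\<in>space M. Q n \<omega>}"
    "AE \<omega> in M. P n \<omega> \<le> 1" for n
  proof -
    interpret F: finite_measure_subalgebra M "F n" by standard (rule assms)
    show "integrable M (P n)" "expectation (P n) = prob {\<omega>\<in>space M. Q n \<omega>}"
      using F.real_cond_exp_int[of "indicator {\<omega>\<in>space M. Q n \<omega>}"] ev
      by (auto simp: P_def cond_prob_given_def less_top[symmetric])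
    have "AE x in M. real_cond_exp M (F n) (\<lambda>_. 1::real) x = 1"
      by (rule F.real_cond_exp_F_meas) auto
    moreover have "AE x in M. P n x \<le> real_cond_exp M (F n) (\<lambda>_. 1) x"
      unfolding P_def cond_prob_given_def
      by (rule F.real_cond_exp_mono) (use ev in \<open>auto simp: less_top[symmetric] split: split_indicator\<close>)
    ultimately show "AE \<omega> in M. P n \<omega> \<le> 1" by eventually_elim simp
  qed
  have [measurable]: "P n \<in> borel_measurable M" for n using P(1) by auto
  have le: "prob {\<omega>\<in>space M. dist (P n \<omega>) 1 > e} \<le> (1 - prob {\<omega>\<in>space M. Q n \<omega>}) / e" for n
  proof -
    have "prob {\<omega>\<in>space M. dist (P n \<omega>) 1 > e} \<le> prob {\<omega>\<in>space M. e \<le> 1 - P n \<omega>}"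
    proof (rule finite_measure_mono_AE)
      show "AE x in M. x \<in> {\<omega> \<in> space M. e < dist (P n \<omega>) 1} \<longrightarrow> x \<in> {\<omega> \<in> space M. e \<le> 1 - P n \<omega>}"
        using P(3)[of n] by eventually_elim (auto simp: dist_real_def)
    qed measurable
    also have "\<dots> \<le> expectation (\<lambda>\<omega>. 1 - P n \<omega>) / e"
      using P(1,3)[of n] e by (intro integral_Markov_inequality_measure[where A = "space M"]) auto
    also have "expectation (\<lambda>\<omega>. 1 - P n \<omega>) = 1 - prob {\<omega>\<in>space M. Q n \<omega>}"
      using P(1,2)[of n] by (simp add: prob_space)
    finally show ?thesis .
  qed
  have "(\<lambda>n. (1 - prob {\<omega>\<in>space M. Q n \<omega>}) / e) \<longlonglongrightarrow> (1 - 1) / e"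
    by (rule tendsto_divide[OF tendsto_diff[OF tendsto_const whp_prob[OF assms(3) ev]] tendsto_const])
       (use e in simp)
  then have lim: "(\<lambda>n. (1 - prob {\<omega>\<in>space M. Q n \<omega>}) / e) \<longlonglongrightarrow> 0" by simp
  show "(\<lambda>n. prob {\<omega>\<in>space M. dist (cond_prob_given M (F n) (Q n) \<omega>) 1 > e}) \<longlonglongrightarrow> 0"
    unfolding P_def[symmetric]
  proof (rule tendsto_sandwich[OF _ _ tendsto_const lim])
    show "\<forall>\<^sub>F n in sequentially. 0 \<le> prob {\<omega>\<in>space M. dist (P n \<omega>) 1 > e}" by simp
    show "\<forall>\<^sub>F n in sequentially. prob {\<omega>\<in>space M. dist (P n \<omega>) 1 > e}
        \<le> (1 - prob {\<omega>\<in>space M. Q n \<omega>}) / e"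
      by (rule always_eventually) (use le in blast)
  qed
qed

end

section \<open>Second moments of forms in the errors\<close>

lemma sq_integrable_mult:
  fixes f g :: "'a \<Rightarrow> real"
  assumes [measurable]: "f \<in> borel_measurable M" "g \<in> borel_measurable M"
    and "integrable M (\<lambda>x. (f x)\<^sup>2)" "integrable M (\<lambda>x. (g x)\<^sup>2)"
  shows "integrable M (\<lambda>x. f x * g x)"
proof (rule Bochner_Integration.integrable_bound)
  show "integrable M (\<lambda>x. (f x)\<^sup>2 + (g x)\<^sup>2)" using assms by simp
  have "\<bar>a * b\<bar> \<le> a\<^sup>2 + b\<^sup>2" for a b :: real
  proof -
    have "2 * \<bar>a\<bar> * \<bar>b\<bar> \<le> \<bar>a\<bar>\<^sup>2 + \<bar>b\<bar>\<^sup>2" by (rule sum_squares_bound)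
    moreover have "0 \<le> \<bar>a\<bar> * \<bar>b\<bar>" by simp
    ultimately show ?thesis unfolding abs_mult power2_abs by linarith
  qed
  then show "AE x in M. norm (f x * g x) \<le> norm ((f x)\<^sup>2 + (g x)\<^sup>2)" by auto
qed measurable

lemma sq_integrable_sum:
  fixes f :: "'i \<Rightarrow> 'a \<Rightarrow> real"
  assumes "finite I" "\<And>i. i \<in> I \<Longrightarrow> f i \<in> borel_measurable M"
    and "\<And>i. i \<in> I \<Longrightarrow> integrable M (\<lambda>x. (f i x)\<^sup>2)"
  shows "integrable M (\<lambda>x. (\<Sum>i\<in>I. f i x)\<^sup>2)"
  unfolding power2_eq_square sum_product
  by (intro Bochner_Integration.integrable_sum sq_integrable_mult assms)

section \<open>Conditional law of one error given the design and the earlier errors\<close>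

locale regression_errors = prob_space M for M :: "'a measure" +
  fixes X :: "nat \<Rightarrow> 'a \<Rightarrow> real^'p" and \<epsilon> :: "nat \<Rightarrow> 'a \<Rightarrow> real"
    and \<sigma>2 :: "real^'p \<Rightarrow> real" and d :: nat
  assumes X_measurable [measurable]: "\<And>i. X i \<in> borel_measurable M"
    and X_cube: "\<And>i \<omega>. \<omega> \<in> space M \<Longrightarrow> X i \<omega> \<in> ucube"
    and errors: "assumption_E M X \<epsilon> \<sigma>2 d"
begin

lemma err_measurable [measurable]: "\<epsilon> i \<in> borel_measurable M"
  using errors by (simp add: assumption_E_def)

lemma subalgebra_design: "subalgebra M (sigma_design M X n)"
proof -
  have "sets (sigma_design M X n) \<subseteq> sets M"
    unfolding sigma_design_def by (rule sets_image_in_sets) measurable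
  then show ?thesis by (simp add: subalgebra_def sigma_design_def)
qed

lemma subalgebra_sigma_of: "subalgebra M (sigma_of M (X i))"
proof -
  have "sets (sigma_of M (X i)) \<subseteq> sets M"
    unfolding sigma_of_def by (rule sets_image_in_sets) measurable
  then show ?thesis by (simp add: subalgebra_def sigma_of_def)
qed

lemma X_design:
  assumes "i < n" shows "X i \<in> borel_measurable (sigma_design M X n)"
proof -
  have "(\<lambda>\<omega>. \<lambda>i\<in>{..<n}. X i \<omega>) \<in> measurable (sigma_design M X n) (PiM {..<n} (\<lambda>_. borel))"
    unfolding sigma_design_def by (rule measurable_vimage_algebra1) (auto simp: space_PiM)
  from measurable_compose[OF this measurable_component_singleton[of i]] assms
  show ?thesis by simp
qed

lemma integrable_indicator_event [simp]:
  "A \<in> events \<Longrightarrow> integrable M (indicator A :: 'a \<Rightarrow> real)"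
  by (rule integrable_const_bound[where B = 1]) auto

text \<open>The sigma-algebra generated by the first n design points and the errors with index below
  i. Intersections of a design event with a rectangle in the errors provide a pi-system for a
  uniqueness argument; \<open>B\<close> is indexed by all naturals, but only indices below i are
  read.\<close>

definition past :: "nat \<Rightarrow> nat \<Rightarrow> 'a measure" where
  "past n i = sigma (space M) {D \<inter> {\<omega>\<in>space M. \<forall>j<i. \<epsilon> j \<omega> \<in> B j} | D B.
     D \<in> sets (sigma_design M X n) \<and> (\<forall>j. B j \<in> sets borel)}"

lemma past_generator:
  "{D \<inter> {\<omega>\<in>space M. \<forall>j<i. \<epsilon> j \<omega> \<in> B j} | D B.
     D \<in> sets (sigma_design M X n) \<and> (\<forall>j. B j \<in> sets borel)} \<subseteq> sets M"
proof safe
  fix D and B :: "nat \<Rightarrow> real set"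
  assume "D \<in> sets (sigma_design M X n)" and [rule_format, measurable]: "\<forall>j. B j \<in> sets borel"
  then have [measurable]: "D \<in> sets M" using subalgebra_design by (auto simp: subalgebra_def)
  have "{\<omega>\<in>space M. \<forall>j<i. \<epsilon> j \<omega> \<in> B j} \<in> sets M" by measurable
  then show "D \<inter> {\<omega>\<in>space M. \<forall>j<i. \<epsilon> j \<omega> \<in> B j} \<in> sets M" by simp
qed

lemma space_past [simp]: "space (past n i) = space M"
  unfolding past_def using past_generator[of i n] sets.space_closed[of M]
  by (intro space_measure_of) blast

lemma sets_past: "sets (past n i) = sigma_sets (space M) {D \<inter> {\<omega>\<in>space M. \<forall>j<i. \<epsilon> j \<omega> \<in> B j} | D B.
     D \<in> sets (sigma_design M X n) \<and> (\<forall>j. B j \<in> sets borel)}"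
  unfolding past_def using past_generator[of i n] sets.space_closed[of M]
  by (intro sets_measure_of) blast

lemma subalgebra_past: "subalgebra M (past n i)"
  unfolding subalgebra_def sets_past using sets.sigma_sets_subset[OF past_generator] by auto

lemma past_basic:
  assumes "D \<in> sets (sigma_design M X n)" "\<And>j. B j \<in> sets borel"
  shows "D \<inter> {\<omega>\<in>space M. \<forall>j<i. \<epsilon> j \<omega> \<in> B j} \<in> sets (past n i)"
  unfolding sets_past using assms by (intro sigma_sets.Basic) blast

lemma subalgebra_past_design: "subalgebra (past n i) (sigma_design M X n)"
proof -
  have "D \<in> sets (past n i)" if "D \<in> sets (sigma_design M X n)" for D
  proof -
    have "D \<subseteq> space M"
      using sets.sets_into_space[OF that] subalgebra_design[of n] by (simp add: subalgebra_def)
    with past_basic[OF that, of "\<lambda>_. UNIV" i] show ?thesis by (simp add: Int_absorb2)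
  qed
  then show ?thesis using subalgebra_design[of n] by (auto simp: subalgebra_def)
qed

lemma measurable_past_design: "f \<in> borel_measurable (sigma_design M X n) \<Longrightarrow> f \<in> borel_measurable (past n i)"
  by (rule measurable_from_subalg[OF subalgebra_past_design])

lemma err_past:
  assumes "j < i" shows "\<epsilon> j \<in> borel_measurable (past n i)"
proof (rule measurableI)
  show "\<epsilon> j \<omega> \<in> space borel" for \<omega> by simp
next
  fix B :: "real set" assume B: "B \<in> sets borel"
  have a: "j < i" by (rule assms)
  define B' where "B' j' = (if j' = j then B else UNIV)" for j'
  have B': "B' j = B" "\<And>j'. j' \<noteq> j \<Longrightarrow> B' j' = UNIV" "\<And>j'. B' j' \<in> sets borel"
    using B by (auto simp: B'_def)
  have "(\<forall>j'<i. \<epsilon> j' \<omega> \<in> B' j') \<longleftrightarrow> \<epsilon> j \<omega> \<in> B" for \<omega>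
    using a B'(1,2) by (metis UNIV_I)
  then have "\<epsilon> j -` B \<inter> space (past n i) = space M \<inter> {\<omega>\<in>space M. \<forall>j'<i. \<epsilon> j' \<omega> \<in> B' j'}" (is "_ = ?R")
    by (simp add: Int_def conj_commute)
  moreover have "space M \<in> sets (sigma_design M X n)"
    using subalgebra_design[of n] sets.top[of "sigma_design M X n"] by (simp add: subalgebra_def)
  then have "?R \<in> sets (past n i)"
    by (rule past_basic) (rule B')
  ultimately show "\<epsilon> j -` B \<inter> space (past n i) \<in> sets (past n i)" by (simp only:)
qed

lemma past_mono:
  assumes "i \<le> k" "f \<in> borel_measurable (past n i)" shows "f \<in> borel_measurable (past n k)"
proof (rule measurable_from_subalg[OF _ assms(2)])
  have "D \<inter> {\<omega>\<in>space M. \<forall>j<i. \<epsilon> j \<omega> \<in> B j} \<in> sets (past n k)"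
    if D: "D \<in> sets (sigma_design M X n)" and B: "\<And>j. B j \<in> sets borel" for D B
  proof -
    define B' where "B' j = (if j < i then B j else UNIV)" for j
    have B': "\<And>j. j < i \<Longrightarrow> B' j = B j" "\<And>j. \<not> j < i \<Longrightarrow> B' j = UNIV" "\<And>j. B' j \<in> sets borel"
      using B by (auto simp: B'_def)
    have "(\<forall>j<k. \<epsilon> j \<omega> \<in> B' j) \<longleftrightarrow> (\<forall>j<i. \<epsilon> j \<omega> \<in> B j)" for \<omega>
      using \<open>i \<le> k\<close> B'(1,2) by (metis UNIV_I less_le_trans)
    then show ?thesis
      using past_basic[OF D, of B' k, OF B'(3)] by (simp only:)
  qed
  then have "sigma_sets (space (past n k)) {D \<inter> {\<omega>\<in>space M. \<forall>j<i. \<epsilon> j \<omega> \<in> B j} | D B.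
     D \<in> sets (sigma_design M X n) \<and> (\<forall>j. B j \<in> sets borel)} \<subseteq> sets (past n k)"
    by (intro sets.sigma_sets_subset) blast
  then show "subalgebra (past n k) (past n i)" by (simp add: subalgebra_def sets_past[of n i])
qed

text \<open>On a generating event of the past, the product formula of Assumption E is read twice:
  with \<open>C\<close> in slot i, and with the whole line there. All other factors agree and the
  factor of the whole line is 1, so the conditional probability of \<open>E \<inter> K\<close> is
  that of \<open>E\<close> times \<open>c i C\<close>, and \<open>c i C\<close> depends on
  \<open>X i\<close> only.\<close>

lemma err_factorises:
  fixes B :: "nat \<Rightarrow> real set" and C :: "real set"
  assumes i: "i < n" and D: "D \<in> sets (sigma_design M X n)"
    and B: "\<And>j. B j \<in> sets borel" and C: "C \<in> sets borel"
  defines "E \<equiv> {\<omega>\<in>space M. \<forall>j<i. \<epsilon> j \<omega> \<in> B j}" and "K \<equiv> {\<omega>\<in>space M. \<epsilon> i \<omega> \<in> C}"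
  shows "(\<integral>\<omega>. indicator (D \<inter> E) \<omega> * indicator K \<omega> \<partial>M)
    = (\<integral>\<omega>. indicator (D \<inter> E) \<omega> * real_cond_exp M (sigma_of M (X i)) (indicator K) \<omega> \<partial>M)"
proof -
  let ?F = "sigma_design M X n"
  interpret F: finite_measure_subalgebra M ?F by standard (rule subalgebra_design)
  interpret XI: finite_measure_subalgebra M "sigma_of M (X i)" by standard (rule subalgebra_sigma_of)
  note [measurable] = B C D
  have [measurable]: "D \<in> sets M" using D subalgebra_design[of n] by (auto simp: subalgebra_def)
  have [measurable]: "E \<in> sets M" "K \<in> sets M" unfolding E_def K_def by measurable
  have indD [measurable]: "indicator D \<in> borel_measurable ?F" using D by simp
  define c where "c j T = cond_prob_given M ?F (\<lambda>\<omega>. \<epsilon> j \<omega> \<in> T)" for j T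
  have prodform: "AE \<omega> in M. cond_prob_given M ?F (\<lambda>\<omega>. \<forall>i<n. \<epsilon> i \<omega> \<in> T i) \<omega> = (\<Prod>j<n. c j (T j) \<omega>)"
    if "\<And>j. T j \<in> sets borel" for T
    using errors i that unfolding assumption_E_def c_def by (auto dest!: spec[of _ n])
  \<comment> \<open>The slots after i carry the whole line, since the product formula is available
    only for all n errors at once.\<close>
  define T1 where "T1 j = (if j < i then B j else if j = i then C else UNIV)" for j
  define T2 where "T2 j = (if j < i then B j else UNIV)" for j
  have T: "T1 j \<in> sets borel" "T2 j \<in> sets borel" for j by (auto simp: T1_def T2_def B C)
  have s1: "{\<omega>\<in>space M. \<forall>j<n. \<epsilon> j \<omega> \<in> T1 j} = E \<inter> K"
    using i by (auto simp: T1_def E_def K_def)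
  have s2: "{\<omega>\<in>space M. \<forall>j<n. \<epsilon> j \<omega> \<in> T2 j} = E"
    using i by (auto simp: T2_def E_def)
  have "AE \<omega> in M. real_cond_exp M ?F (\<lambda>_. 1) \<omega> = (1::real)"
    by (rule F.real_cond_exp_F_meas) auto
  moreover have "AE \<omega> in M. c i UNIV \<omega> = real_cond_exp M ?F (\<lambda>_. 1) \<omega>"
    unfolding c_def cond_prob_given_def by (rule F.real_cond_exp_cong) auto
  ultimately have one: "AE \<omega> in M. c i UNIV \<omega> = 1" by eventually_elim simp
  have split: "(\<Prod>j<n. c j (T j) \<omega>) = c i (T i) \<omega> * (\<Prod>j\<in>{..<n}-{i}. c j (T j) \<omega>)" for T \<omega>
    using i by (intro prod.remove) auto
  have cEK: "AE \<omega> in M. real_cond_exp M ?F (indicator (E \<inter> K)) \<omega>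
      = c i C \<omega> * real_cond_exp M ?F (indicator E) \<omega>"
    using prodform[of T1, OF T(1)] prodform[of T2, OF T(2)] one
  proof eventually_elim
    case (elim \<omega>)
    have "(\<Prod>j\<in>{..<n}-{i}. c j (T1 j) \<omega>) = (\<Prod>j\<in>{..<n}-{i}. c j (T2 j) \<omega>)"
      by (intro prod.cong) (auto simp: T1_def T2_def)
    with elim show ?case
      unfolding cond_prob_given_def s1 s2 split by (simp add: T1_def T2_def)
  qed
  have cC: "AE \<omega> in M. c i C \<omega> = real_cond_exp M (sigma_of M (X i)) (indicator K) \<omega>"
    using errors i C unfolding assumption_E_def c_def K_def cond_prob_given_def[symmetric]
    by (auto dest!: spec[of _ n])
  have cK: "c i C = real_cond_exp M ?F (indicator K)" by (simp add: c_def cond_prob_given_def K_def)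
  have intK: "integrable M (c i C)" unfolding cK by (rule F.real_cond_exp_int) (simp add: integrable_indicator_event)
  have cM [measurable]: "c i C \<in> borel_measurable ?F" unfolding cK by measurable
  have [measurable]: "c i C \<in> borel_measurable M" unfolding cK by measurable
  have "(\<integral>\<omega>. indicator (D \<inter> E) \<omega> * indicator K \<omega> \<partial>M) = (\<integral>\<omega>. indicator D \<omega> * indicator (E \<inter> K) \<omega> \<partial>M :: real)"
    by (intro Bochner_Integration.integral_cong) (auto split: split_indicator)
  also have "\<dots> = (\<integral>\<omega>. indicator D \<omega> * real_cond_exp M ?F (indicator (E \<inter> K)) \<omega> \<partial>M)"
  proof (rule F.real_cond_exp_intg(2)[symmetric])
    have "integrable M (\<lambda>\<omega>. indicator (D \<inter> (E \<inter> K)) \<omega> :: real)"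
      by (simp add: integrable_indicator_event)
    then show "integrable M (\<lambda>\<omega>. indicator D \<omega> * indicator (E \<inter> K) \<omega> :: real)"
      by (simp add: indicator_inter_arith)
  qed measurable
  also have "\<dots> = (\<integral>\<omega>. (indicator D \<omega> * c i C \<omega>) * real_cond_exp M ?F (indicator E) \<omega> \<partial>M)"
  proof (rule integral_cong_AE)
    show "AE \<omega> in M. indicator D \<omega> * real_cond_exp M ?F (indicator (E \<inter> K)) \<omega>
        = (indicator D \<omega> * c i C \<omega>) * real_cond_exp M ?F (indicator E) \<omega>"
      using cEK by eventually_elim simp
  qed measurable
  \<comment> \<open>Since \<open>indicator D\<close> times \<open>c i C\<close> is measurable for
    the design, the conditional expectation of the indicator of \<open>E\<close> may be replaced by
    that indicator under the integral.\<close>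
  also have "\<dots> = (\<integral>\<omega>. (indicator D \<omega> * c i C \<omega>) * indicator E \<omega> \<partial>M)"
  proof (rule F.real_cond_exp_intg(2))
    have "integrable M (\<lambda>\<omega>. indicator (D \<inter> E) \<omega> * c i C \<omega>)"
      using integrable_mult_indicator[of "D \<inter> E" M "c i C"] intK by simp
    then show "integrable M (\<lambda>\<omega>. (indicator D \<omega> * c i C \<omega>) * indicator E \<omega>)"
      by (simp add: indicator_inter_arith mult_ac)
  qed (use cM in measurable)
  also have "\<dots> = (\<integral>\<omega>. indicator (D \<inter> E) \<omega> * real_cond_exp M (sigma_of M (X i)) (indicator K) \<omega> \<partial>M)"
  proof (rule integral_cong_AE)
    show "AE \<omega> in M. (indicator D \<omega> * c i C \<omega>) * indicator E \<omega>
        = indicator (D \<inter> E) \<omega> * real_cond_exp M (sigma_of M (X i)) (indicator K) \<omega>"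
      using cC by eventually_elim (simp add: indicator_inter_arith)
  qed measurable
  finally show ?thesis .
qed

end

lemma emeasure_density_real:
  fixes f :: "'a \<Rightarrow> real"
  assumes f: "integrable M f" "AE x in M. 0 \<le> f x" and A: "A \<in> sets M"
  shows "emeasure (density M (\<lambda>x. ennreal (f x))) A = ennreal (\<integral>x. indicator A x * f x \<partial>M)"
proof -
  have int: "integrable M (\<lambda>x. indicator A x * f x)"
    using integrable_mult_indicator[OF A f(1)] by simp
  have "emeasure (density M (\<lambda>x. ennreal (f x))) A = (\<integral>\<^sup>+x. ennreal (f x) * indicator A x \<partial>M)"
    by (rule emeasure_density) (use f A in auto)
  also have "\<dots> = (\<integral>\<^sup>+x. ennreal (indicator A x * f x) \<partial>M)"
    by (intro nn_integral_cong) (auto split: split_indicator)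
  also have "\<dots> = ennreal (\<integral>x. indicator A x * f x \<partial>M)"
    by (rule nn_integral_eq_integral[OF int]) (use f(2) in eventually_elim, auto split: split_indicator)
  finally show ?thesis .
qed

context regression_errors
begin

text \<open>Both sides are finite measures in \<open>A\<close> on the past, and they agree on the
  intersection-stable generator by the factorisation above. The densities are restricted to the past
  so that uniqueness of measures applies there.\<close>

lemma err_cond_prob:
  fixes C :: "real set"
  assumes i: "i < n" and A: "A \<in> sets (past n i)" and C: "C \<in> sets borel"
  defines "K \<equiv> {\<omega>\<in>space M. \<epsilon> i \<omega> \<in> C}"
  shows "(\<integral>\<omega>. indicator A \<omega> * indicator K \<omega> \<partial>M)
    = (\<integral>\<omega>. indicator A \<omega> * real_cond_exp M (sigma_of M (X i)) (indicator K) \<omega> \<partial>M)"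
proof -
  interpret XI: finite_measure_subalgebra M "sigma_of M (X i)" by standard (rule subalgebra_sigma_of)
  define p where "p = real_cond_exp M (sigma_of M (X i)) (indicator K)"
  have K: "K \<in> events" unfolding K_def using C by measurable
  have p: "integrable M p" "AE \<omega> in M. 0 \<le> p \<omega>"
    unfolding p_def using K by (auto intro!: XI.real_cond_exp_int XI.real_cond_exp_pos)
  have k: "integrable M (indicator K :: 'a \<Rightarrow> real)" "AE \<omega> in M. 0 \<le> indicat_real K \<omega>"
    using K by auto
  define N where "N f = restr_to_subalg (density M (\<lambda>x. ennreal (f x))) (past n i)" for f
  have sub: "subalgebra (density M (\<lambda>x. ennreal (f x))) (past n i)" for f
    using subalgebra_past[of n i] by (simp add: subalgebra_def)
  have evs: "T \<in> events" if "T \<in> sets (past n i)" for T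
    using subalgebra_past[of n i] that by (auto simp: subalgebra_def)
  have N: "emeasure (N f) T = ennreal (\<integral>\<omega>. indicator T \<omega> * f \<omega> \<partial>M)"
    if "T \<in> sets (past n i)" "integrable M f" "AE \<omega> in M. 0 \<le> f \<omega>" for T f
    unfolding N_def by (simp only: emeasure_restr_to_subalg[OF sub that(1)]
        emeasure_density_real[OF that(2,3) evs[OF that(1)]])
  have sN: "sets (N f) = sets (past n i)" for f
    unfolding N_def by (rule sets_restr_to_subalg[OF sub])
  let ?E = "{D \<inter> {\<omega>\<in>space M. \<forall>j<i. \<epsilon> j \<omega> \<in> B j} | D B.
     D \<in> sets (sigma_design M X n) \<and> (\<forall>j. B j \<in> sets borel)}"
  have "N (indicator K) = N p"
  proof (rule measure_eqI_generator_eq[where E = ?E and \<Omega> = "space M" and A = "\<lambda>_. space M"])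
    show "Int_stable ?E"
    proof (rule Int_stableI, clarify)
      fix D D' and B B' :: "nat \<Rightarrow> real set"
      assume *: "D \<in> sets (sigma_design M X n)" "\<forall>j. B j \<in> sets borel"
        "D' \<in> sets (sigma_design M X n)" "\<forall>j. B' j \<in> sets borel"
      show "\<exists>D'' B''. D \<inter> {\<omega> \<in> space M. \<forall>j<i. \<epsilon> j \<omega> \<in> B j} \<inter> (D' \<inter> {\<omega> \<in> space M. \<forall>j<i. \<epsilon> j \<omega> \<in> B' j})
        = D'' \<inter> {\<omega> \<in> space M. \<forall>j<i. \<epsilon> j \<omega> \<in> B'' j} \<and> D'' \<in> sets (sigma_design M X n) \<and> (\<forall>j. B'' j \<in> sets borel)"
        by (rule exI[of _ "D \<inter> D'"], rule exI[of _ "\<lambda>j. B j \<inter> B' j"]) (use * in blast)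
    qed
    show "?E \<subseteq> Pow (space M)" by blast
    show "sets (N (indicator K)) = sigma_sets (space M) ?E" "sets (N p) = sigma_sets (space M) ?E"
      unfolding sN by (rule sets_past)+
    have top: "space M \<in> sets (past n i)" using sets.top[of "past n i"] by (simp only: space_past)
    have "space M \<in> sets (sigma_design M X n)"
      using subalgebra_design[of n] sets.top[of "sigma_design M X n"] by (simp add: subalgebra_def)
    then show "range (\<lambda>_::nat. space M) \<subseteq> ?E" by (auto intro!: exI[of _ "space M"] exI[of _ "\<lambda>_. UNIV"])
    show "emeasure (N (indicator K)) (space M) \<noteq> \<infinity>" unfolding N[OF top k] by simp
    fix T assume "T \<in> ?E"
    then obtain D B where T: "T = D \<inter> {\<omega>\<in>space M. \<forall>j<i. \<epsilon> j \<omega> \<in> B j}"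
      and DB: "D \<in> sets (sigma_design M X n)" "\<And>j. B j \<in> sets borel" by blast
    have Tp: "T \<in> sets (past n i)" unfolding T by (rule past_basic[OF DB])
    show "emeasure (N (indicator K)) T = emeasure (N p) T"
      unfolding N[OF Tp k] N[OF Tp p] unfolding T p_def
      using err_factorises[where B = B, OF i DB C] by (simp only: K_def)
  qed auto
  then have "emeasure (N (indicator K)) A = emeasure (N p) A" by (simp only:)
  then have "ennreal (\<integral>\<omega>. indicator A \<omega> * indicator K \<omega> \<partial>M) = ennreal (\<integral>\<omega>. indicator A \<omega> * p \<omega> \<partial>M)"
    unfolding N[OF A k] N[OF A p] .
  moreover have "0 \<le> (\<integral>\<omega>. indicator A \<omega> * indicator K \<omega> \<partial>M :: real)"
    by (intro integral_nonneg_AE) auto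
  moreover have "0 \<le> (\<integral>\<omega>. indicator A \<omega> * p \<omega> \<partial>M)"
    by (intro integral_nonneg_AE) (use p(2) in eventually_elim, auto)
  ultimately show ?thesis by (simp add: p_def)
qed

text \<open>Conditional independence of \<open>\<epsilon>\<^sub>i\<close> and the past given \<open>X\<^sub>i\<close> is symmetric, so the law of
  \<open>\<epsilon>\<^sub>i\<close> restricted to a past event \<open>A\<close> is the law weighted by \<open>P(A | X\<^sub>i)\<close>; comparing the two
  laws on the line yields the identity for every integrable function of \<open>\<epsilon>\<^sub>i\<close> at once.\<close>
lemma err_cond_exp:
  fixes \<phi> :: "real \<Rightarrow> real"
  assumes i: "i < n" and [measurable]: "\<phi> \<in> borel_measurable borel" and int: "integrable M (\<lambda>\<omega>. \<phi> (\<epsilon> i \<omega>))"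
  shows "AE \<omega> in M. real_cond_exp M (past n i) (\<lambda>\<omega>. \<phi> (\<epsilon> i \<omega>)) \<omega>
    = real_cond_exp M (sigma_of M (X i)) (\<lambda>\<omega>. \<phi> (\<epsilon> i \<omega>)) \<omega>"
proof -
  interpret XI: finite_measure_subalgebra M "sigma_of M (X i)" by standard (rule subalgebra_sigma_of)
  interpret P: finite_measure_subalgebra M "past n i" by standard (rule subalgebra_past)
  let ?S = "sigma_of M (X i)"
  define g where "g = real_cond_exp M ?S (\<lambda>\<omega>. \<phi> (\<epsilon> i \<omega>))"
  have g: "integrable M g" unfolding g_def by (rule XI.real_cond_exp_int[OF int])
  have gS [measurable]: "g \<in> borel_measurable ?S" "g \<in> borel_measurable M" unfolding g_def by measurable
  have "(\<integral>\<omega>. indicator A \<omega> * \<phi> (\<epsilon> i \<omega>) \<partial>M) = (\<integral>\<omega>. indicator A \<omega> * g \<omega> \<partial>M)"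
    if A: "A \<in> sets (past n i)" for A
  proof -
    have [measurable]: "A \<in> events" using subalgebra_past[of n i] A by (auto simp: subalgebra_def)
    \<comment> \<open>The conditional probability of \<open>A\<close> given \<open>X i\<close>; it
      replaces the indicator of \<open>A\<close> as the weight on the law of
      \<open>\<epsilon> i\<close>.\<close>
    define q where "q = real_cond_exp M ?S (indicator A)"
    have qm [measurable]: "q \<in> borel_measurable ?S" "q \<in> borel_measurable M" unfolding q_def by measurable
    have q: "integrable M q" "AE \<omega> in M. 0 \<le> q \<omega>"
      unfolding q_def by (auto intro!: XI.real_cond_exp_int XI.real_cond_exp_pos)
    have "AE \<omega> in M. q \<omega> \<le> real_cond_exp M ?S (\<lambda>_. 1) \<omega>"
      unfolding q_def by (rule XI.real_cond_exp_mono) (auto split: split_indicator)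
    moreover have "AE \<omega> in M. real_cond_exp M ?S (\<lambda>_. 1) \<omega> = (1::real)"
      by (rule XI.real_cond_exp_F_meas) auto
    ultimately have q1: "AE \<omega> in M. q \<omega> \<le> 1" by eventually_elim simp
    have intq: "integrable M (\<lambda>\<omega>. q \<omega> * f \<omega>)" if f: "integrable M f" for f :: "'a \<Rightarrow> real"
    proof (rule Bochner_Integration.integrable_bound[OF f])
      show "AE \<omega> in M. norm (q \<omega> * f \<omega>) \<le> norm (f \<omega>)"
        using q(2) q1 by eventually_elim (simp add: abs_mult mult_left_le_one_le)
    qed (use f in measurable)
    have intA: "integrable M (\<lambda>\<omega>. indicator A \<omega> * f \<omega>)" if "integrable M f" for f :: "'a \<Rightarrow> real"
      using integrable_mult_indicator[OF \<open>A \<in> events\<close> that] by simp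
    let ?D = "\<lambda>f. distr (density M (\<lambda>\<omega>. ennreal (f \<omega>))) borel (\<epsilon> i)"
    have "?D (indicator A) = ?D q"
    proof (rule measure_eqI)
      fix C :: "real set" assume "C \<in> sets (?D (indicator A))"
      then have C [measurable]: "C \<in> sets borel" by simp
      define K where "K = {\<omega>\<in>space M. \<epsilon> i \<omega> \<in> C}"
      have K [measurable]: "K \<in> events" unfolding K_def by measurable
      have vK: "\<epsilon> i -` C \<inter> space M = K" by (auto simp: K_def)
      define p where "p = real_cond_exp M ?S (indicator K)"
      have [measurable]: "p \<in> borel_measurable ?S" "p \<in> borel_measurable M" unfolding p_def by measurable
      have pint: "integrable M p" unfolding p_def by (rule XI.real_cond_exp_int) simp
      have D: "emeasure (?D f) C = ennreal (\<integral>\<omega>. indicator K \<omega> * f \<omega> \<partial>M)"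
        if "integrable M f" "AE \<omega> in M. 0 \<le> f \<omega>" for f
      proof -
        have "emeasure (?D f) C = emeasure (density M (\<lambda>\<omega>. ennreal (f \<omega>))) K"
          by (subst emeasure_distr) (simp_all add: vK)
        then show ?thesis using emeasure_density_real[OF that K] by simp
      qed
      have "(\<integral>\<omega>. indicator K \<omega> * indicator A \<omega> \<partial>M) = (\<integral>\<omega>. indicator A \<omega> * p \<omega> \<partial>M)"
        using err_cond_prob[OF i A C] by (simp add: K_def p_def mult.commute)
      also have "\<dots> = (\<integral>\<omega>. p \<omega> * indicator A \<omega> \<partial>M)" by (simp add: mult.commute)
      \<comment> \<open>Conditioning on \<open>X i\<close> is self-adjoint: it is moved from the
        event \<open>K\<close> to the event \<open>A\<close>, passing through the product of the two
        conditional probabilities.\<close>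
      also have "\<dots> = (\<integral>\<omega>. p \<omega> * q \<omega> \<partial>M)"
        unfolding q_def by (rule XI.real_cond_exp_intg(2)[symmetric])
          (use intA[OF pint] in \<open>simp_all add: mult.commute\<close>)
      also have "\<dots> = (\<integral>\<omega>. q \<omega> * p \<omega> \<partial>M)" by (simp add: mult.commute)
      also have "\<dots> = (\<integral>\<omega>. q \<omega> * indicator K \<omega> \<partial>M)"
        unfolding p_def by (rule XI.real_cond_exp_intg(2)) (use intq[of "indicator K"] in simp_all)
      also have "\<dots> = (\<integral>\<omega>. indicator K \<omega> * q \<omega> \<partial>M)" by (simp add: mult.commute)
      finally show "emeasure (?D (indicator A)) C = emeasure (?D q) C"
        using D[OF q] D[of "indicator A"] by simp
    qed simp
    then have "(\<integral>y. \<phi> y \<partial>?D (indicator A)) = (\<integral>y. \<phi> y \<partial>?D q)" by (simp only:)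
    then have "(\<integral>\<omega>. indicator A \<omega> * \<phi> (\<epsilon> i \<omega>) \<partial>M) = (\<integral>\<omega>. q \<omega> * \<phi> (\<epsilon> i \<omega>) \<partial>M)"
      using q(2) by (simp add: integral_distr integral_density)
    also have "\<dots> = (\<integral>\<omega>. q \<omega> * g \<omega> \<partial>M)"
      unfolding g_def by (rule XI.real_cond_exp_intg(2)[symmetric]) (use intq[OF int] in simp_all)
    also have "\<dots> = (\<integral>\<omega>. g \<omega> * q \<omega> \<partial>M)" by (simp add: mult.commute)
    also have "\<dots> = (\<integral>\<omega>. g \<omega> * indicator A \<omega> \<partial>M)"
      unfolding q_def by (rule XI.real_cond_exp_intg(2)) (use intA[OF g] in \<open>simp_all add: mult.commute\<close>)
    finally show ?thesis by (simp add: mult.commute)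
  qed
  then have eq: "(\<integral>\<omega>\<in>A. \<phi> (\<epsilon> i \<omega>) \<partial>M) = (\<integral>\<omega>\<in>A. g \<omega> \<partial>M)" if "A \<in> sets (past n i)" for A
    using that by (simp only: set_lebesgue_integral_def real_scaleR_def)
  \<comment> \<open>The candidate \<open>g\<close> has to be measurable for the past, which holds
    because \<open>X i\<close> is one of the n design points.\<close>
  have "subalgebra (past n i) ?S"
  proof -
    have "X i \<in> borel_measurable (past n i)"
      by (rule measurable_past_design[OF X_design[OF i]])
    then have "sets ?S \<subseteq> sets (past n i)"
      unfolding sigma_of_def by (intro sets_image_in_sets) simp_all
    then show ?thesis by (simp add: subalgebra_def sigma_of_def)
  qed
  from measurable_from_subalg[OF this gS(1)]
  show ?thesis using P.real_cond_exp_charact[OF eq int g] by (simp only: g_def)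
qed

end

section \<open>Martingale bounds for linear and quadratic forms\<close>

context regression_errors
begin

text \<open>Assumption E provides a moment of order greater than 4, so powers up to the fourth are
  integrable. The fourth power is what makes a product of two errors square integrable.\<close>

lemma err_power_integrable:
  assumes "k \<le> 4" shows "integrable M (\<lambda>\<omega>. \<epsilon> i \<omega> ^ k)"
proof -
  obtain d' where d': "d' > 4" "integrable M (\<lambda>\<omega>. \<bar>\<epsilon> i \<omega>\<bar> powr d')"
    using errors unfolding assumption_E_def by (metis max_less_iff_conj)
  have le: "\<bar>x ^ k\<bar> \<le> 1 + \<bar>x\<bar> powr d'" for x :: real
  proof (cases "\<bar>x\<bar> \<le> 1")
    case True
    then have "\<bar>x\<bar> ^ k \<le> 1" by (simp add: power_le_one)
    then show ?thesis by (simp add: power_abs add_increasing2)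
  next
    case False
    then have "\<bar>x\<bar> ^ k = \<bar>x\<bar> powr real k" by (simp add: powr_realpow)
    also have "\<dots> \<le> \<bar>x\<bar> powr d'" using False assms d'(1) by (intro powr_mono) auto
    finally show ?thesis by (simp add: power_abs)
  qed
  show ?thesis
  proof (rule Bochner_Integration.integrable_bound)
    show "integrable M (\<lambda>\<omega>. 1 + \<bar>\<epsilon> i \<omega>\<bar> powr d')"
      by (intro Bochner_Integration.integrable_add d'(2)) simp
    show "AE \<omega> in M. norm (\<epsilon> i \<omega> ^ k) \<le> norm (1 + \<bar>\<epsilon> i \<omega>\<bar> powr d')"
      by (intro AE_I2) (use le in \<open>simp add: add_nonneg_nonneg\<close>)
  qed simp
qed

lemma err_integrable: "integrable M (\<epsilon> i)" "integrable M (\<lambda>\<omega>. (\<epsilon> i \<omega>)\<^sup>2)"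
  using err_power_integrable[of 1 i] err_power_integrable[of 2 i] by simp_all

lemma err_prod_sq_integrable: "integrable M (\<lambda>\<omega>. (\<epsilon> i \<omega> * \<epsilon> j \<omega>)\<^sup>2)"
  unfolding power_mult_distrib using err_power_integrable[of 4]
  by (intro sq_integrable_mult) (auto simp: power_even_eq[symmetric] power_mult[symmetric])

text \<open>The factor \<open>Z\<close> may contain earlier errors and the whole design, because the
  conditional mean of \<open>\<epsilon> i\<close> given the past is that given \<open>X i\<close>,
  hence zero.\<close>

lemma err_mean:
  assumes i: "i < n" and Z: "Z \<in> borel_measurable (past n i)" and int: "integrable M (\<lambda>\<omega>. Z \<omega> * \<epsilon> i \<omega>)"
  shows "expectation (\<lambda>\<omega>. Z \<omega> * \<epsilon> i \<omega>) = 0"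
proof -
  interpret P: finite_measure_subalgebra M "past n i" by standard (rule subalgebra_past)
  have [measurable]: "Z \<in> borel_measurable M" by (rule measurable_from_subalg[OF subalgebra_past Z])
  have "AE \<omega> in M. real_cond_exp M (sigma_of M (X i)) (\<epsilon> i) \<omega> = 0"
    using errors by (simp add: assumption_E_def)
  moreover have "AE \<omega> in M. real_cond_exp M (past n i) (\<epsilon> i) \<omega> = real_cond_exp M (sigma_of M (X i)) (\<epsilon> i) \<omega>"
    using err_cond_exp[OF i, of "\<lambda>y. y"] err_integrable by simp
  ultimately have *: "AE \<omega> in M. Z \<omega> * real_cond_exp M (past n i) (\<epsilon> i) \<omega> = 0"
    by eventually_elim simp
  have "expectation (\<lambda>\<omega>. Z \<omega> * \<epsilon> i \<omega>) = expectation (\<lambda>\<omega>. Z \<omega> * real_cond_exp M (past n i) (\<epsilon> i) \<omega>)"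
    by (rule P.real_cond_exp_intg(2)[OF int Z, symmetric]) simp
  also have "\<dots> = expectation (\<lambda>\<omega>. 0)" by (rule integral_cong_AE) (use * in auto)
  finally show ?thesis by simp
qed

text \<open>Since the conditional mean vanishes, the conditional variance is the conditional second
  moment, and the latter is the same given the past as given \<open>X i\<close>.\<close>

lemma err_variance:
  assumes i: "i < n" and Z: "Z \<in> borel_measurable (past n i)" and int: "integrable M (\<lambda>\<omega>. Z \<omega> * (\<epsilon> i \<omega>)\<^sup>2)"
  shows "integrable M (\<lambda>\<omega>. Z \<omega> * \<sigma>2 (X i \<omega>))"
    "expectation (\<lambda>\<omega>. Z \<omega> * (\<epsilon> i \<omega>)\<^sup>2) = expectation (\<lambda>\<omega>. Z \<omega> * \<sigma>2 (X i \<omega>))"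
proof -
  interpret P: finite_measure_subalgebra M "past n i" by standard (rule subalgebra_past)
  interpret XI: finite_measure_subalgebra M "sigma_of M (X i)" by standard (rule subalgebra_sigma_of)
  let ?S = "sigma_of M (X i)"
  have [measurable]: "Z \<in> borel_measurable M" by (rule measurable_from_subalg[OF subalgebra_past Z])
  have cont: "continuous_on ucube \<sigma>2" using errors by (simp add: assumption_E_def)
  have [measurable]: "(\<lambda>\<omega>. \<sigma>2 (X i \<omega>)) \<in> borel_measurable M"
  proof -
    \<comment> \<open>\<open>\<sigma>2\<close> is known to be continuous only on the cube; cutting
      it off outside gives a globally measurable function, and the design never leaves the
      cube.\<close>
    have "(\<lambda>\<omega>. indicator ucube (X i \<omega>) *\<^sub>R \<sigma>2 (X i \<omega>)) \<in> borel_measurable M"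
      by (rule measurable_compose[OF X_measurable])
         (intro borel_measurable_continuous_on_indicator cont, simp)
    then show ?thesis by (rule measurable_cong[THEN iffD1, rotated]) (use X_cube in auto)
  qed
  have "AE \<omega> in M. real_cond_exp M ?S (\<epsilon> i) \<omega> = 0"
    using errors by (simp add: assumption_E_def)
  then have "AE \<omega> in M. (\<epsilon> i \<omega> - real_cond_exp M ?S (\<epsilon> i) \<omega>)\<^sup>2 = (\<epsilon> i \<omega>)\<^sup>2"
    by eventually_elim simp
  then have "AE \<omega> in M. real_cond_exp M ?S (\<lambda>\<omega>. (\<epsilon> i \<omega> - real_cond_exp M ?S (\<epsilon> i) \<omega>)\<^sup>2) \<omega>
      = real_cond_exp M ?S (\<lambda>\<omega>. (\<epsilon> i \<omega>)\<^sup>2) \<omega>"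
    by (rule XI.real_cond_exp_cong) measurable
  moreover have "AE \<omega> in M. real_cond_exp M ?S (\<lambda>\<omega>. (\<epsilon> i \<omega> - real_cond_exp M ?S (\<epsilon> i) \<omega>)\<^sup>2) \<omega> = \<sigma>2 (X i \<omega>)"
    using errors by (simp add: assumption_E_def real_cond_var_def)
  moreover have "AE \<omega> in M. real_cond_exp M (past n i) (\<lambda>\<omega>. (\<epsilon> i \<omega>)\<^sup>2) \<omega> = real_cond_exp M ?S (\<lambda>\<omega>. (\<epsilon> i \<omega>)\<^sup>2) \<omega>"
    using err_cond_exp[OF i, of "\<lambda>y. y\<^sup>2"] err_integrable by simp
  ultimately have *: "AE \<omega> in M. Z \<omega> * real_cond_exp M (past n i) (\<lambda>\<omega>. (\<epsilon> i \<omega>)\<^sup>2) \<omega> = Z \<omega> * \<sigma>2 (X i \<omega>)"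
    by eventually_elim simp
  note R = P.real_cond_exp_intg[OF int Z]
  show "integrable M (\<lambda>\<omega>. Z \<omega> * \<sigma>2 (X i \<omega>))"
    using R(1) by (rule Bochner_Integration.integrable_cong_AE[THEN iffD1, rotated -1]) (use * in auto)
  have "expectation (\<lambda>\<omega>. Z \<omega> * (\<epsilon> i \<omega>)\<^sup>2) = expectation (\<lambda>\<omega>. Z \<omega> * real_cond_exp M (past n i) (\<lambda>\<omega>. (\<epsilon> i \<omega>)\<^sup>2) \<omega>)"
    by (rule R(2)[symmetric]) simp
  also have "\<dots> = expectation (\<lambda>\<omega>. Z \<omega> * \<sigma>2 (X i \<omega>))"
    by (rule integral_cong_AE) (use * in auto)
  finally show "expectation (\<lambda>\<omega>. Z \<omega> * (\<epsilon> i \<omega>)\<^sup>2) = expectation (\<lambda>\<omega>. Z \<omega> * \<sigma>2 (X i \<omega>))" .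
qed

definition vmax :: real where
  "vmax = (SUP x\<in>ucube. \<sigma>2 x)"

lemma variance_bounds: "x \<in> ucube \<Longrightarrow> \<sigma>2 x \<le> vmax" "x \<in> ucube \<Longrightarrow> 0 < \<sigma>2 x" "0 < vmax"
proof -
  have E: "continuous_on ucube \<sigma>2" "\<exists>c>0. \<forall>x\<in>ucube. c \<le> \<sigma>2 x"
    using errors by (simp_all add: assumption_E_def)
  have "bdd_above (\<sigma>2 ` ucube)"
    by (intro bounded_imp_bdd_above compact_imp_bounded compact_continuous_image E(1)) simp
  then show le: "\<sigma>2 x \<le> vmax" if "x \<in> ucube" for x
    unfolding vmax_def using that by (rule cSUP_upper2) simp
  show pos: "0 < \<sigma>2 x" if "x \<in> ucube" for x using E(2) that by force
  have "(0::real^'p) \<in> ucube" by (simp add: mem_box_cart)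
  from pos[OF this] le[OF this] show "0 < vmax" by linarith
qed

text \<open>The summands are martingale differences for the filtration \<open>past n\<close>.\<close>
lemma martingale_second_moment:
  assumes Z: "\<And>i. i < n \<Longrightarrow> Z i \<in> borel_measurable (past n i)"
    and Z2: "\<And>i. i < n \<Longrightarrow> integrable M (\<lambda>\<omega>. (Z i \<omega>)\<^sup>2)"
    and Ze2: "\<And>i. i < n \<Longrightarrow> integrable M (\<lambda>\<omega>. (Z i \<omega> * \<epsilon> i \<omega>)\<^sup>2)"
  shows "integrable M (\<lambda>\<omega>. (\<Sum>i<n. Z i \<omega> * \<epsilon> i \<omega>)\<^sup>2)"
    and "expectation (\<lambda>\<omega>. (\<Sum>i<n. Z i \<omega> * \<epsilon> i \<omega>)\<^sup>2) \<le> vmax * (\<Sum>i<n. expectation (\<lambda>\<omega>. (Z i \<omega>)\<^sup>2))"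
proof -
  have ZM [measurable]: "Z i \<in> borel_measurable M" if "i < n" for i
    by (rule measurable_from_subalg[OF subalgebra_past Z[OF that]])
  have int: "integrable M (\<lambda>\<omega>. (\<Sum>i<k. Z i \<omega> * \<epsilon> i \<omega>)\<^sup>2)" if "k \<le> n" for k
    by (rule sq_integrable_sum) (use that Ze2 in auto)
  then show "integrable M (\<lambda>\<omega>. (\<Sum>i<n. Z i \<omega> * \<epsilon> i \<omega>)\<^sup>2)" by simp
  have "expectation (\<lambda>\<omega>. (\<Sum>i<k. Z i \<omega> * \<epsilon> i \<omega>)\<^sup>2) \<le> vmax * (\<Sum>i<k. expectation (\<lambda>\<omega>. (Z i \<omega>)\<^sup>2))"
    if "k \<le> n" for k
    using that
  proof (induction k)
    case (Suc k)
    then have k: "k < n" "k \<le> n" by auto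
    define T where "T \<omega> = (\<Sum>i<k. Z i \<omega> * \<epsilon> i \<omega>)" for \<omega>
    have TM [measurable]: "T \<in> borel_measurable M" unfolding T_def
      by (intro borel_measurable_sum borel_measurable_times ZM err_measurable) (use k in auto)
    have Tp: "T \<in> borel_measurable (past n k)"
      unfolding T_def using k
      by (intro borel_measurable_sum borel_measurable_times past_mono[of _ k, OF _ Z] err_past) auto
    have T2: "integrable M (\<lambda>\<omega>. (T \<omega>)\<^sup>2)" unfolding T_def by (rule int) (use k in simp)
    have c: "integrable M (\<lambda>\<omega>. (T \<omega> * Z k \<omega>) * \<epsilon> k \<omega>)"
      using sq_integrable_mult[OF TM _ T2 Ze2[OF k(1)]] k by (simp add: mult.assoc)
    have s: "integrable M (\<lambda>\<omega>. (Z k \<omega>)\<^sup>2 * (\<epsilon> k \<omega>)\<^sup>2)"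
      using Ze2[OF k(1)] by (simp add: power_mult_distrib)
    have zp: "(\<lambda>\<omega>. (Z k \<omega>)\<^sup>2) \<in> borel_measurable (past n k)" using Z[OF k(1)] by simp
    have "expectation (\<lambda>\<omega>. (\<Sum>i<Suc k. Z i \<omega> * \<epsilon> i \<omega>)\<^sup>2)
        = expectation (\<lambda>\<omega>. (T \<omega>)\<^sup>2 + 2 * ((T \<omega> * Z k \<omega>) * \<epsilon> k \<omega>) + (Z k \<omega>)\<^sup>2 * (\<epsilon> k \<omega>)\<^sup>2)"
      by (simp add: T_def power2_eq_square algebra_simps)
    also have "\<dots> = expectation (\<lambda>\<omega>. (T \<omega>)\<^sup>2) + 2 * expectation (\<lambda>\<omega>. (T \<omega> * Z k \<omega>) * \<epsilon> k \<omega>)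
        + expectation (\<lambda>\<omega>. (Z k \<omega>)\<^sup>2 * (\<epsilon> k \<omega>)\<^sup>2)"
      using T2 c s by simp
    \<comment> \<open>The cross term is \<open>\<epsilon> k\<close> multiplied by a factor that is
      measurable for the past of k, so it vanishes.\<close>
    also have "expectation (\<lambda>\<omega>. (T \<omega> * Z k \<omega>) * \<epsilon> k \<omega>) = 0"
      by (rule err_mean[OF k(1) _ c]) (use Tp Z[OF k(1)] in simp)
    also have "expectation (\<lambda>\<omega>. (Z k \<omega>)\<^sup>2 * (\<epsilon> k \<omega>)\<^sup>2) = expectation (\<lambda>\<omega>. (Z k \<omega>)\<^sup>2 * \<sigma>2 (X k \<omega>))"
      by (rule err_variance(2)[OF k(1) zp s])
    also have "\<dots> \<le> expectation (\<lambda>\<omega>. vmax * (Z k \<omega>)\<^sup>2)"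
    proof (rule integral_mono)
      show "integrable M (\<lambda>\<omega>. (Z k \<omega>)\<^sup>2 * \<sigma>2 (X k \<omega>))" by (rule err_variance(1)[OF k(1) zp s])
      show "integrable M (\<lambda>\<omega>. vmax * (Z k \<omega>)\<^sup>2)" using Z2[OF k(1)] by simp
      show "(Z k \<omega>)\<^sup>2 * \<sigma>2 (X k \<omega>) \<le> vmax * (Z k \<omega>)\<^sup>2" if "\<omega> \<in> space M" for \<omega>
        using variance_bounds(1)[OF X_cube[OF that]] by (simp add: mult.commute mult_right_mono)
    qed
    finally have "expectation (\<lambda>\<omega>. (\<Sum>i<Suc k. Z i \<omega> * \<epsilon> i \<omega>)\<^sup>2)
        \<le> expectation (\<lambda>\<omega>. (T \<omega>)\<^sup>2) + vmax * expectation (\<lambda>\<omega>. (Z k \<omega>)\<^sup>2)" by simp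
    with Suc.IH[OF k(2)] show ?case by (simp add: T_def distrib_left)
  qed simp
  then show "expectation (\<lambda>\<omega>. (\<Sum>i<n. Z i \<omega> * \<epsilon> i \<omega>)\<^sup>2) \<le> vmax * (\<Sum>i<n. expectation (\<lambda>\<omega>. (Z i \<omega>)\<^sup>2))"
    by simp
qed

text \<open>The constant \<open>B\<close> only secures integrability; the estimate itself keeps the
  individual second moments of the coefficients.\<close>

lemma linear_form_second_moment:
  assumes a: "\<And>i. i < n \<Longrightarrow> a i \<in> borel_measurable (sigma_design M X n)"
    and bd: "\<And>i \<omega>. i < n \<Longrightarrow> \<omega> \<in> space M \<Longrightarrow> \<bar>a i \<omega>\<bar> \<le> B"
  shows "integrable M (\<lambda>\<omega>. (\<Sum>i<n. a i \<omega> * \<epsilon> i \<omega>)\<^sup>2)"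
    and "expectation (\<lambda>\<omega>. (\<Sum>i<n. a i \<omega> * \<epsilon> i \<omega>)\<^sup>2) \<le> vmax * (\<Sum>i<n. expectation (\<lambda>\<omega>. (a i \<omega>)\<^sup>2))"
proof -
  have aM [measurable]: "a i \<in> borel_measurable M" if "i < n" for i
    by (rule measurable_from_subalg[OF subalgebra_design a[OF that]])
  have sq: "(a i \<omega>)\<^sup>2 \<le> B\<^sup>2" if "i < n" "\<omega> \<in> space M" for i \<omega>
    using bd[OF that] by (rule abs_le_square_iff[THEN iffD1, OF order.trans[OF _ abs_ge_self]])
  have a2: "integrable M (\<lambda>\<omega>. (a i \<omega>)\<^sup>2)" if "i < n" for i
    by (rule integrable_const_bound[where B = "B\<^sup>2"]) (use that sq in auto)
  have ae2: "integrable M (\<lambda>\<omega>. (a i \<omega> * \<epsilon> i \<omega>)\<^sup>2)" if i: "i < n" for i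
  proof (rule Bochner_Integration.integrable_bound[where f = "\<lambda>\<omega>. B\<^sup>2 * (\<epsilon> i \<omega>)\<^sup>2"])
    show "AE \<omega> in M. norm ((a i \<omega> * \<epsilon> i \<omega>)\<^sup>2) \<le> norm (B\<^sup>2 * (\<epsilon> i \<omega>)\<^sup>2)"
      using sq[OF i] by (intro AE_I2) (simp add: power_mult_distrib mult_right_mono)
  qed (use err_integrable i in auto)
  note * = martingale_second_moment[of n a, OF measurable_past_design[OF a] a2 ae2]
  show "integrable M (\<lambda>\<omega>. (\<Sum>i<n. a i \<omega> * \<epsilon> i \<omega>)\<^sup>2)" by (rule *(1))
  show "expectation (\<lambda>\<omega>. (\<Sum>i<n. a i \<omega> * \<epsilon> i \<omega>)\<^sup>2) \<le> vmax * (\<Sum>i<n. expectation (\<lambda>\<omega>. (a i \<omega>)\<^sup>2))"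
    by (rule *(2))
qed

lemma sum_symmetric_offdiag:
  fixes f :: "nat \<Rightarrow> nat \<Rightarrow> real"
  assumes "\<And>i j. i < n \<Longrightarrow> j < n \<Longrightarrow> f i j = f j i" "\<And>i. i < n \<Longrightarrow> f i i = 0"
  shows "(\<Sum>i<n. \<Sum>j<n. f i j) = 2 * (\<Sum>i<n. \<Sum>j<i. f i j)"
  using assms
proof (induction n)
  case (Suc n)
  have "(\<Sum>i<n. f i n) = (\<Sum>j<n. f n j)" using Suc.prems(1) by (intro sum.cong) auto
  moreover have "f n n = 0" using Suc.prems(2) by simp
  moreover have "(\<Sum>i<n. \<Sum>j<n. f i j) = 2 * (\<Sum>i<n. \<Sum>j<i. f i j)"
    using Suc.prems by (intro Suc.IH) auto
  ultimately show ?case by (simp add: sum.distrib)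
qed simp

text \<open>By symmetry and the zero diagonal the form is twice its lower triangle, a sum of
  \<open>Z i * \<epsilon> i\<close> with \<open>Z i\<close> a linear form in the earlier errors. The
  martingale bound gives one factor \<open>vmax\<close> for \<open>\<epsilon> i\<close> and another
  inside \<open>Z i\<close>; the 4 from squaring turns into 2 when the lower triangle is symmetrised
  again.\<close>

lemma quadratic_form_second_moment:
  assumes w: "\<And>i j. i < n \<Longrightarrow> j < n \<Longrightarrow> w i j \<in> borel_measurable (sigma_design M X n)"
    and bd: "\<And>i j \<omega>. i < n \<Longrightarrow> j < n \<Longrightarrow> \<omega> \<in> space M \<Longrightarrow> \<bar>w i j \<omega>\<bar> \<le> B"
    and sym: "\<And>i j \<omega>. i < n \<Longrightarrow> j < n \<Longrightarrow> w i j \<omega> = w j i \<omega>"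
    and diag: "\<And>i \<omega>. i < n \<Longrightarrow> w i i \<omega> = 0"
  shows "integrable M (\<lambda>\<omega>. (\<Sum>i<n. \<Sum>j<n. w i j \<omega> * \<epsilon> i \<omega> * \<epsilon> j \<omega>)\<^sup>2)"
    and "expectation (\<lambda>\<omega>. (\<Sum>i<n. \<Sum>j<n. w i j \<omega> * \<epsilon> i \<omega> * \<epsilon> j \<omega>)\<^sup>2)
      \<le> 2 * vmax\<^sup>2 * expectation (\<lambda>\<omega>. \<Sum>i<n. \<Sum>j<n. (w i j \<omega>)\<^sup>2)"
proof -
  have wM [measurable]: "w i j \<in> borel_measurable M" if "i < n" "j < n" for i j
    by (rule measurable_from_subalg[OF subalgebra_design w[OF that]])
  have sq: "(w i j \<omega>)\<^sup>2 \<le> B\<^sup>2" if "i < n" "j < n" "\<omega> \<in> space M" for i j \<omega>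
    using bd[OF that] by (rule abs_le_square_iff[THEN iffD1, OF order.trans[OF _ abs_ge_self]])
  have w2: "integrable M (\<lambda>\<omega>. (w i j \<omega>)\<^sup>2)" if "i < n" "j < n" for i j
    by (rule integrable_const_bound[where B = "B\<^sup>2"]) (use that sq in auto)
  have dom: "integrable M (\<lambda>\<omega>. (w i j \<omega> * f \<omega>)\<^sup>2)"
    if ij: "i < n" "j < n" and f: "f \<in> borel_measurable M" "integrable M (\<lambda>\<omega>. (f \<omega>)\<^sup>2)" for i j f
  proof (rule Bochner_Integration.integrable_bound[where f = "\<lambda>\<omega>. B\<^sup>2 * (f \<omega>)\<^sup>2"])
    show "AE \<omega> in M. norm ((w i j \<omega> * f \<omega>)\<^sup>2) \<le> norm (B\<^sup>2 * (f \<omega>)\<^sup>2)"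
      using sq[OF ij] by (intro AE_I2) (simp add: power_mult_distrib mult_right_mono)
  qed (use f ij in auto)
  define Z where "Z i \<omega> = (\<Sum>j<i. w i j \<omega> * \<epsilon> j \<omega>)" for i \<omega>
  have Zp: "Z i \<in> borel_measurable (past n i)" if "i < n" for i
    unfolding Z_def using that
    by (intro borel_measurable_sum borel_measurable_times measurable_past_design[OF w] err_past) auto
  have Z2: "integrable M (\<lambda>\<omega>. (Z i \<omega>)\<^sup>2)" if "i < n" for i
    unfolding Z_def using that by (intro sq_integrable_sum dom err_integrable) auto
  have Ze2: "integrable M (\<lambda>\<omega>. (Z i \<omega> * \<epsilon> i \<omega>)\<^sup>2)" if "i < n" for i
  proof -
    have "integrable M (\<lambda>\<omega>. (\<Sum>j<i. w i j \<omega> * (\<epsilon> j \<omega> * \<epsilon> i \<omega>))\<^sup>2)"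
      using that by (intro sq_integrable_sum dom err_prod_sq_integrable) auto
    then show ?thesis by (simp add: Z_def sum_distrib_right mult.assoc)
  qed
  have eq: "(\<Sum>i<n. \<Sum>j<n. w i j \<omega> * \<epsilon> i \<omega> * \<epsilon> j \<omega>) = 2 * (\<Sum>i<n. Z i \<omega> * \<epsilon> i \<omega>)" for \<omega>
  proof -
    have "(\<Sum>i<n. \<Sum>j<n. w i j \<omega> * \<epsilon> i \<omega> * \<epsilon> j \<omega>) = 2 * (\<Sum>i<n. \<Sum>j<i. w i j \<omega> * \<epsilon> i \<omega> * \<epsilon> j \<omega>)"
      using sym diag by (intro sum_symmetric_offdiag) (simp_all add: mult_ac)
    then show ?thesis unfolding Z_def sum_distrib_right by (simp add: mult_ac)
  qed
  note m = martingale_second_moment[of n Z, OF Zp Z2 Ze2]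
  show "integrable M (\<lambda>\<omega>. (\<Sum>i<n. \<Sum>j<n. w i j \<omega> * \<epsilon> i \<omega> * \<epsilon> j \<omega>)\<^sup>2)"
    unfolding eq power_mult_distrib using m(1) by simp
  have EZ: "expectation (\<lambda>\<omega>. (Z i \<omega>)\<^sup>2) \<le> vmax * (\<Sum>j<i. expectation (\<lambda>\<omega>. (w i j \<omega>)\<^sup>2))" if i: "i < n" for i
  proof -
    \<comment> \<open>The coefficients are measurable for the design of size n, so
      \<open>Z i\<close> is written as a linear form over all n indices, padded by zeros from i
      on.\<close>
    have "expectation (\<lambda>\<omega>. (\<Sum>j<n. (if j < i then w i j \<omega> else 0) * \<epsilon> j \<omega>)\<^sup>2)
        \<le> vmax * (\<Sum>j<n. expectation (\<lambda>\<omega>. (if j < i then w i j \<omega> else 0)\<^sup>2))"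
    proof (rule linear_form_second_moment(2)[where B = "\<bar>B\<bar>"])
      show "(\<lambda>\<omega>. if j < i then w i j \<omega> else 0) \<in> borel_measurable (sigma_design M X n)" if "j < n" for j
        using w[OF i that] by (cases "j < i") auto
      show "\<bar>if j < i then w i j \<omega> else 0\<bar> \<le> \<bar>B\<bar>" if "j < n" "\<omega> \<in> space M" for j \<omega>
        using bd[OF i that] by auto
    qed
    moreover have "(\<Sum>j<n. (if j < i then w i j \<omega> else 0) * \<epsilon> j \<omega>) = Z i \<omega>" for \<omega>
      unfolding Z_def using i by (intro sum.mono_neutral_cong_right) auto
    moreover have "(\<Sum>j<n. expectation (\<lambda>\<omega>. (if j < i then w i j \<omega> else 0)\<^sup>2)) = (\<Sum>j<i. expectation (\<lambda>\<omega>. (w i j \<omega>)\<^sup>2))"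
      using i by (intro sum.mono_neutral_cong_right) auto
    ultimately show ?thesis by simp
  qed
  have "expectation (\<lambda>\<omega>. (\<Sum>i<n. \<Sum>j<n. w i j \<omega> * \<epsilon> i \<omega> * \<epsilon> j \<omega>)\<^sup>2)
      = 4 * expectation (\<lambda>\<omega>. (\<Sum>i<n. Z i \<omega> * \<epsilon> i \<omega>)\<^sup>2)"
    unfolding eq power_mult_distrib by simp
  also have "\<dots> \<le> 4 * (vmax * (\<Sum>i<n. expectation (\<lambda>\<omega>. (Z i \<omega>)\<^sup>2)))"
    using m(2) by simp
  also have "\<dots> \<le> 4 * (vmax * (\<Sum>i<n. vmax * (\<Sum>j<i. expectation (\<lambda>\<omega>. (w i j \<omega>)\<^sup>2))))"
    using EZ variance_bounds(3) by (intro mult_left_mono sum_mono) auto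
  also have "\<dots> = 2 * vmax\<^sup>2 * (2 * (\<Sum>i<n. \<Sum>j<i. expectation (\<lambda>\<omega>. (w i j \<omega>)\<^sup>2)))"
    by (simp add: sum_distrib_left[symmetric] power2_eq_square)
  also have "2 * (\<Sum>i<n. \<Sum>j<i. expectation (\<lambda>\<omega>. (w i j \<omega>)\<^sup>2)) = (\<Sum>i<n. \<Sum>j<n. expectation (\<lambda>\<omega>. (w i j \<omega>)\<^sup>2))"
    using sym diag by (intro sum_symmetric_offdiag[symmetric]) simp_all
  also have "\<dots> = expectation (\<lambda>\<omega>. \<Sum>i<n. \<Sum>j<n. (w i j \<omega>)\<^sup>2)"
  proof -
    have "expectation (\<lambda>\<omega>. \<Sum>i<n. \<Sum>j<n. (w i j \<omega>)\<^sup>2) = (\<Sum>i<n. expectation (\<lambda>\<omega>. \<Sum>j<n. (w i j \<omega>)\<^sup>2))"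
      by (intro Bochner_Integration.integral_sum Bochner_Integration.integrable_sum w2) auto
    also have "\<dots> = (\<Sum>i<n. \<Sum>j<n. expectation (\<lambda>\<omega>. (w i j \<omega>)\<^sup>2))"
      by (intro sum.cong refl Bochner_Integration.integral_sum w2) auto
    finally show ?thesis ..
  qed
  finally show "expectation (\<lambda>\<omega>. (\<Sum>i<n. \<Sum>j<n. w i j \<omega> * \<epsilon> i \<omega> * \<epsilon> j \<omega>)\<^sup>2)
      \<le> 2 * vmax\<^sup>2 * expectation (\<lambda>\<omega>. \<Sum>i<n. \<Sum>j<n. (w i j \<omega>)\<^sup>2)" .
qed

end

section \<open>Projection smoothers\<close>

lemma orth_proj_orthogonal:
  assumes P: "is_orth_proj n K v P" and g: "\<And>i. i < n \<Longrightarrow> g i = (\<Sum>k\<in>K. c k * v k i)"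
  shows "(\<Sum>i<n. (u i - (\<Sum>j<n. P i j * u j)) * g i) = 0"
proof -
  have "(\<Sum>i<n. (u i - (\<Sum>j<n. P i j * u j)) * g i)
      = (\<Sum>i<n. \<Sum>k\<in>K. c k * ((u i - (\<Sum>j<n. P i j * u j)) * v k i))"
    by (intro sum.cong refl, subst g, simp, simp only: sum_distrib_left mult.left_commute)
  also have "\<dots> = (\<Sum>k\<in>K. c k * (\<Sum>i<n. (u i - (\<Sum>j<n. P i j * u j)) * v k i))"
    by (subst sum.swap) (simp add: sum_distrib_left)
  also have "\<dots> = 0"
    using P unfolding is_orth_proj_def by (intro sum.neutral) simp
  finally show ?thesis .
qed

lemma orth_proj_span:
  assumes "is_orth_proj n K v P"
  obtains c where "\<And>i. i < n \<Longrightarrow> (\<Sum>j<n. P i j * u j) = (\<Sum>k\<in>K. c k * v k i)"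
  using assms unfolding is_orth_proj_def by blast

lemma orth_proj_orthogonal_range:
  assumes P: "is_orth_proj n K v P"
  shows "(\<Sum>i<n. (u i - (\<Sum>j<n. P i j * u j)) * (\<Sum>j<n. P i j * w j)) = 0"
proof -
  obtain c where "\<And>i. i < n \<Longrightarrow> (\<Sum>j<n. P i j * w j) = (\<Sum>k\<in>K. c k * v k i)"
    using orth_proj_span[OF P, of w] by blast
  then show ?thesis by (rule orth_proj_orthogonal[OF P])
qed

lemma orth_proj_selfadjoint:
  assumes P: "is_orth_proj n K v P"
  shows "(\<Sum>i<n. u i * (\<Sum>j<n. P i j * w j)) = (\<Sum>i<n. (\<Sum>j<n. P i j * u j) * (\<Sum>j<n. P i j * w j))"
  using orth_proj_orthogonal_range[OF P, of u w] by (simp add: left_diff_distrib sum_subtractf)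

text \<open>Self-adjointness tested on unit vectors says that the entry (a, b) is the inner product
  of columns a and b. Symmetry and the row identity are read off from this.\<close>

lemma orth_proj_entries:
  assumes P: "is_orth_proj n K v P" and ij: "i < n" "j < n"
  shows orth_proj_sym: "P i j = P j i" and orth_proj_row: "(\<Sum>k<n. (P i k)\<^sup>2) = P i i"
proof -
  define e where "e l k = (if k = l then 1 else 0 :: real)" for l k :: nat
  have app: "(\<Sum>k<n. Q k * e l k) = Q l" if "l < n" for Q :: "nat \<Rightarrow> real" and l
    using that by (simp add: e_def if_distrib[of "(*) _"] cong: if_cong)
  have app': "(\<Sum>k<n. e l k * Q k) = Q l" if "l < n" for Q :: "nat \<Rightarrow> real" and l
    using app[OF that, of Q] by (simp add: mult.commute)
  have gen: "P a b = (\<Sum>k<n. P k a * P k b)" if "a < n" "b < n" for a b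
    using orth_proj_selfadjoint[OF P, of "e a" "e b"] that by (simp add: app app')
  show sym: "P i j = P j i" using gen[OF ij] gen[OF ij(2,1)] by (simp add: mult.commute)
  have "P a b = P b a" if "a < n" "b < n" for a b
    using gen[OF that] gen[OF that(2,1)] by (simp add: mult.commute)
  then have "(\<Sum>k<n. P k i * P k i) = (\<Sum>k<n. (P i k)\<^sup>2)"
    using ij by (intro sum.cong) (auto simp: power2_eq_square)
  with gen[OF ij(1,1)] show "(\<Sum>k<n. (P i k)\<^sup>2) = P i i" by simp
qed

text \<open>The diagonal entry is one of the entries of its row, so the row identity gives
  \<open>(P i i)\<^sup>2 \<le> P i i\<close>.\<close>

lemma orth_proj_diag:
  assumes P: "is_orth_proj n K v P" and i: "i < n"
  shows "0 \<le> P i i" "P i i \<le> 1"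
proof -
  have "(P i i)\<^sup>2 \<le> (\<Sum>k<n. (P i k)\<^sup>2)" using i by (intro member_le_sum) auto
  then have le: "(P i i)\<^sup>2 \<le> P i i" using orth_proj_row[OF P i i] by simp
  then show "0 \<le> P i i" by (rule order.trans[OF zero_le_power2])
  show "P i i \<le> 1"
  proof (rule ccontr)
    assume "\<not> P i i \<le> 1"
    then have "P i i * 1 < P i i * P i i" by (intro mult_strict_left_mono) auto
    then show False using le by (simp add: power2_eq_square)
  qed
qed

text \<open>Both parts are Pythagoras. In the second, the projection is the best approximation from
  the span, so the quadratic form falls short of the squared norm of \<open>u\<close> by at most the
  squared distance to any competitor \<open>g\<close> in the span.\<close>

lemma orth_proj_quadratic:
  assumes P: "is_orth_proj n K v P" and g: "\<And>i. i < n \<Longrightarrow> g i = (\<Sum>k\<in>K. c k * v k i)"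
  shows "(\<Sum>i<n. (\<Sum>j<n. P i j * u j)\<^sup>2) \<le> (\<Sum>i<n. (u i)\<^sup>2)"
    "(\<Sum>i<n. (u i)\<^sup>2) - (\<Sum>i<n. (u i - g i)\<^sup>2) \<le> (\<Sum>i<n. u i * (\<Sum>j<n. P i j * u j))"
proof -
  define A where "A i = (\<Sum>j<n. P i j * u j)" for i
  have o1: "(\<Sum>i<n. (u i - A i) * A i) = 0" unfolding A_def by (rule orth_proj_orthogonal_range[OF P])
  have o2: "(\<Sum>i<n. (u i - A i) * g i) = 0" unfolding A_def using g by (rule orth_proj_orthogonal[OF P])
  have q: "(\<Sum>i<n. u i * A i) = (\<Sum>i<n. (A i)\<^sup>2)"
    using o1 by (simp add: left_diff_distrib sum_subtractf power2_eq_square)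
  have "(\<Sum>i<n. (u i)\<^sup>2) = (\<Sum>i<n. (A i)\<^sup>2 + 2 * ((u i - A i) * A i) + (u i - A i)\<^sup>2)"
    by (intro sum.cong) (auto simp: power2_eq_square algebra_simps)
  also have "\<dots> = (\<Sum>i<n. (A i)\<^sup>2) + (\<Sum>i<n. (u i - A i)\<^sup>2)"
    using o1 by (simp add: sum.distrib sum_distrib_left[symmetric])
  finally have pyth: "(\<Sum>i<n. (u i)\<^sup>2) = (\<Sum>i<n. (A i)\<^sup>2) + (\<Sum>i<n. (u i - A i)\<^sup>2)" .
  then show "(\<Sum>i<n. (\<Sum>j<n. P i j * u j)\<^sup>2) \<le> (\<Sum>i<n. (u i)\<^sup>2)"
    by (simp add: A_def sum_nonneg)
  have "(\<Sum>i<n. (u i - g i)\<^sup>2)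
      = (\<Sum>i<n. (u i - A i)\<^sup>2 + 2 * ((u i - A i) * A i) - 2 * ((u i - A i) * g i) + (A i - g i)\<^sup>2)"
    by (intro sum.cong) (auto simp: power2_eq_square algebra_simps)
  also have "\<dots> = (\<Sum>i<n. (u i - A i)\<^sup>2) + (\<Sum>i<n. (A i - g i)\<^sup>2)"
    using o1 o2 by (simp add: sum.distrib sum_subtractf sum_distrib_left[symmetric])
  finally have "(\<Sum>i<n. (u i - A i)\<^sup>2) \<le> (\<Sum>i<n. (u i - g i)\<^sup>2)" by (simp add: sum_nonneg)
  with pyth q show "(\<Sum>i<n. (u i)\<^sup>2) - (\<Sum>i<n. (u i - g i)\<^sup>2) \<le> (\<Sum>i<n. u i * (\<Sum>j<n. P i j * u j))"
    by (simp add: A_def)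
qed

text \<open>One Gram-Schmidt step: \<open>r\<close> is the residual of the new vector, and the
  projection is updated by a rank-one matrix. If \<open>S = 0\<close>, the new vector already lies
  in the span, and division by zero makes the update vanish, as it should. This explicit recursion
  replaces the implicit description of \<open>proj_matrix\<close> where a trace or measurability is
  needed.\<close>

lemma orth_proj_insert:
  fixes v :: "'k \<Rightarrow> nat \<Rightarrow> real"
  assumes P: "is_orth_proj n K v P" and K: "finite K" "a \<notin> K"
  defines "r \<equiv> \<lambda>i. v a i - (\<Sum>j<n. P i j * v a j)"
  defines "S \<equiv> \<Sum>i<n. r i * r i"
  shows "is_orth_proj n (insert a K) v (\<lambda>i j. P i j + r i * r j / S)"
  unfolding is_orth_proj_def
proof (intro allI conjI ballI)
  fix u :: "nat \<Rightarrow> real"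
  define A where "A u i = (\<Sum>j<n. P i j * u j)" for u i
  define t where "t = (\<Sum>i<n. r i * u i) / S"
  have app: "(\<Sum>j<n. (P i j + r i * r j / S) * u j) = A u i + t * r i" for i
  proof -
    have "(\<Sum>j<n. (P i j + r i * r j / S) * u j) = (\<Sum>j<n. P i j * u j + (r i / S) * (r j * u j))"
      by (intro sum.cong) (auto simp: distrib_right)
    also have "\<dots> = A u i + (r i / S) * (\<Sum>j<n. r j * u j)"
      by (simp only: A_def sum.distrib sum_distrib_left)
    finally show ?thesis by (simp add: t_def)
  qed
  obtain b where b: "\<And>i. i < n \<Longrightarrow> A (v a) i = (\<Sum>k\<in>K. b k * v k i)"
    unfolding A_def using orth_proj_span[OF P, of "v a"] by blast
  obtain c where c: "\<And>i. i < n \<Longrightarrow> A u i = (\<Sum>k\<in>K. c k * v k i)"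
    unfolding A_def using orth_proj_span[OF P, of u] by blast
  show "\<exists>c. \<forall>i<n. (\<Sum>j<n. (P i j + r i * r j / S) * u j) = (\<Sum>k\<in>insert a K. c k * v k i)"
  proof (intro exI allI impI)
    fix i assume i: "i < n"
    have "(\<Sum>k\<in>K. (if k = a then t else c k - t * b k) * v k i) = (\<Sum>k\<in>K. c k * v k i - t * (b k * v k i))"
      using K(2) by (intro sum.cong) (auto simp: algebra_simps)
    then show "(\<Sum>j<n. (P i j + r i * r j / S) * u j)
        = (\<Sum>k\<in>insert a K. (if k = a then t else c k - t * b k) * v k i)"
      unfolding app using K b[OF i] c[OF i]
      by (simp add: r_def A_def[symmetric] sum_subtractf sum_distrib_left[symmetric] right_diff_distrib)
  qed
  fix k assume k: "k \<in> insert a K"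
  have rA: "(\<Sum>i<n. r i * g i) = 0" if "\<And>i. i < n \<Longrightarrow> g i = (\<Sum>k\<in>K. d k * v k i)" for g d
    unfolding r_def using that by (rule orth_proj_orthogonal[OF P])
  have uA: "(\<Sum>i<n. (u i - A u i) * g i) = 0" if "\<And>i. i < n \<Longrightarrow> g i = (\<Sum>k\<in>K. d k * v k i)" for g d
    unfolding A_def using that by (rule orth_proj_orthogonal[OF P])
  have split: "(\<Sum>i<n. (u i - (A u i + t * r i)) * g i)
      = (\<Sum>i<n. (u i - A u i) * g i) - t * (\<Sum>i<n. r i * g i)" for g
    by (simp add: algebra_simps sum.distrib sum_subtractf sum_distrib_left)
  show "(\<Sum>i<n. (u i - (\<Sum>j<n. (P i j + r i * r j / S) * u j)) * v k i) = 0"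
  proof (cases "k = a")
    case True
    have va: "v a i = r i + A (v a) i" for i by (simp add: r_def A_def)
    have e1: "(\<Sum>i<n. r i * v a i) = S"
    proof -
      have "(\<Sum>i<n. r i * v a i) = S + (\<Sum>i<n. r i * A (v a) i)"
        by (subst va) (simp only: distrib_left sum.distrib S_def)
      then show ?thesis using rA[OF b] by simp
    qed
    have "(\<Sum>i<n. (u i - A u i) * v a i) = (\<Sum>i<n. (u i - A u i) * r i) + (\<Sum>i<n. (u i - A u i) * A (v a) i)"
      by (subst va) (simp only: distrib_left sum.distrib)
    also have "\<dots> = (\<Sum>i<n. (u i - A u i) * r i)" using uA[OF b] by simp
    also have "\<dots> = (\<Sum>i<n. r i * u i) - (\<Sum>i<n. r i * A u i)"
      by (simp only: sum_subtractf[symmetric] mult.commute[of _ "r _"] right_diff_distrib)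
    also have "\<dots> = t * S"
    proof (cases "S = 0")
      case True
      then have "\<forall>i\<in>{..<n}. r i * r i = 0" unfolding S_def by (subst (asm) sum_nonneg_eq_0_iff) auto
      then have "(\<Sum>i<n. r i * u i) = 0" by (intro sum.neutral) auto
      then show ?thesis using True rA[OF c] by simp
    next
      case False
      then show ?thesis using rA[OF c] by (simp add: t_def)
    qed
    finally have e2: "(\<Sum>i<n. (u i - A u i) * v a i) = t * S" .
    show ?thesis unfolding app True split e1 e2 by simp
  next
    case False
    then have kK: "k \<in> K" using k by simp
    have "v k i = (\<Sum>l\<in>K. (if l = k then 1 else 0) * v l i)" for i
      using K(1) kK by (simp add: if_distrib[of "\<lambda>x. x * _"] cong: if_cong)
    then show ?thesis unfolding app split using rA[of "v k"] uA[of "v k"] by simp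
  qed
qed

lemma proj_matrix_insert:
  fixes v :: "'k \<Rightarrow> nat \<Rightarrow> real"
  assumes K: "finite K" "a \<notin> K" and ij: "i < n" "j < n"
  defines "P \<equiv> proj_matrix n K v"
  defines "r \<equiv> \<lambda>i. v a i - (\<Sum>j<n. P i j * v a j)"
  shows "proj_matrix n (insert a K) v i j = P i j + r i * r j / (\<Sum>i<n. r i * r i)"
  unfolding r_def P_def
  by (rule is_orth_proj_unique[OF is_orth_proj_proj_matrix orth_proj_insert[OF is_orth_proj_proj_matrix]])
     (use K ij in auto)

lemma proj_matrix_empty: "i < n \<Longrightarrow> j < n \<Longrightarrow> proj_matrix n {} v i j = 0"
  by (rule is_orth_proj_unique[OF is_orth_proj_proj_matrix, of "{}" n v "\<lambda>_ _. 0"])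
     (auto simp: is_orth_proj_def)

text \<open>Each Gram-Schmidt step adds the squared norm of \<open>r\<close> divided by itself to
  the trace: 1, or 0 if the new vector is redundant.\<close>

lemma trace_proj_matrix:
  assumes "finite K" shows "(\<Sum>i<n. proj_matrix n K v i i) \<le> real (card K)"
  using assms
proof (induction K)
  case empty
  then show ?case by (simp add: proj_matrix_empty)
next
  case (insert a K)
  define r where "r i = v a i - (\<Sum>j<n. proj_matrix n K v i j * v a j)" for i
  have "(\<Sum>i<n. proj_matrix n (insert a K) v i i)
      = (\<Sum>i<n. proj_matrix n K v i i + r i * r i / (\<Sum>i<n. r i * r i))"
    using insert.hyps by (intro sum.cong) (auto simp: proj_matrix_insert r_def)
  also have "\<dots> = (\<Sum>i<n. proj_matrix n K v i i) + (\<Sum>i<n. r i * r i) / (\<Sum>i<n. r i * r i)"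
    by (simp only: sum.distrib sum_divide_distrib)
  also have "\<dots> \<le> real (card K) + 1"
  proof (rule add_mono)
    have "x / x \<le> (1::real)" for x by (cases "x = 0") auto
    then show "(\<Sum>i<n. r i * r i) / (\<Sum>i<n. r i * r i) \<le> 1" .
  qed (rule insert.IH)
  finally show ?case using insert.hyps by simp
qed

text \<open>By the Gram-Schmidt recursion the entries arise from those of the spanning vectors
  through sums, products and quotients; real division stays measurable where the denominator
  vanishes.\<close>

lemma proj_matrix_measurable:
  assumes "finite K" "\<And>k i. k \<in> K \<Longrightarrow> i < n \<Longrightarrow> (\<lambda>\<omega>. v \<omega> k i) \<in> borel_measurable N"
  shows "i < n \<Longrightarrow> j < n \<Longrightarrow> (\<lambda>\<omega>. proj_matrix n K (v \<omega>) i j) \<in> borel_measurable N"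
  using assms
proof (induction K arbitrary: i j)
  case empty
  then show ?case by (simp add: proj_matrix_empty)
next
  case (insert a K)
  have P: "(\<lambda>\<omega>. proj_matrix n K (v \<omega>) i j) \<in> borel_measurable N" if "i < n" "j < n" for i j
    using insert.IH[OF that] insert.prems by blast
  have va: "(\<lambda>\<omega>. v \<omega> a i) \<in> borel_measurable N" if "i < n" for i using insert.prems that by blast
  have r: "(\<lambda>\<omega>. v \<omega> a i - (\<Sum>j<n. proj_matrix n K (v \<omega>) i j * v \<omega> a j)) \<in> borel_measurable N" if "i < n" for i
    using that by (intro borel_measurable_diff borel_measurable_sum borel_measurable_times P va) auto
  show ?case
    unfolding proj_matrix_insert[OF insert.hyps insert.prems(1,2)]
    using insert.prems(1,2)
    by (intro borel_measurable_add borel_measurable_divide borel_measurable_sum borel_measurable_times P r) auto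
qed

text \<open>\<open>P\<close> is a contraction and its diagonal lies in [0, 1], so the difference of
  the two has norm at most 2, hence the 4. Dropping the diagonal can only lower the Frobenius norm,
  whose square is the trace for a projection.\<close>

lemma offdiag_projection_bounds:
  assumes P: "is_orth_proj n K v P" and w: "\<And>i j. w i j = (if i = j then 0 else P i j)"
  shows "(\<Sum>i<n. (\<Sum>j<n. w i j * u j)\<^sup>2) \<le> 4 * (\<Sum>i<n. (u i)\<^sup>2)"
    and "(\<Sum>i<n. \<Sum>j<n. (w i j)\<^sup>2) \<le> (\<Sum>i<n. P i i)"
    and "(\<Sum>i<n. \<Sum>j<n. u i * w i j * u j) = (\<Sum>i<n. u i * (\<Sum>j<n. P i j * u j)) - (\<Sum>i<n. P i i * (u i)\<^sup>2)"
proof -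
  have row: "(\<Sum>j<n. w i j * u j) = (\<Sum>j<n. P i j * u j) - P i i * u i" if "i < n" for i
  proof -
    have "(\<Sum>j<n. w i j * u j) = (\<Sum>j\<in>{..<n}-{i}. P i j * u j)"
      using that by (subst sum.remove[of _ i]) (auto simp: w intro!: sum.cong)
    moreover have "(\<Sum>j<n. P i j * u j) = P i i * u i + (\<Sum>j\<in>{..<n}-{i}. P i j * u j)"
      using that by (intro sum.remove) auto
    ultimately show ?thesis by simp
  qed
  have "(\<Sum>i<n. (\<Sum>j<n. w i j * u j)\<^sup>2) \<le> (\<Sum>i<n. 2 * (\<Sum>j<n. P i j * u j)\<^sup>2 + 2 * (u i)\<^sup>2)"
  proof (rule sum_mono)
    fix i assume "i \<in> {..<n}"
    then have i: "i < n" by simp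
    have "(P i i * u i)\<^sup>2 \<le> 1 * (u i)\<^sup>2"
      unfolding power_mult_distrib using orth_proj_diag[OF P i]
      by (intro mult_right_mono) (auto intro: power_le_one)
    moreover have "(x - y)\<^sup>2 \<le> 2 * x\<^sup>2 + 2 * y\<^sup>2" for x y :: real
      using sum_squares_bound[of x "-y"] by (simp add: power2_eq_square algebra_simps)
    from this[of "\<Sum>j<n. P i j * u j" "P i i * u i"]
    have "(\<Sum>j<n. w i j * u j)\<^sup>2 \<le> 2 * (\<Sum>j<n. P i j * u j)\<^sup>2 + 2 * (P i i * u i)\<^sup>2"
      unfolding row[OF i] .
    ultimately show "(\<Sum>j<n. w i j * u j)\<^sup>2 \<le> 2 * (\<Sum>j<n. P i j * u j)\<^sup>2 + 2 * (u i)\<^sup>2" by simp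
  qed
  also have "\<dots> = 2 * (\<Sum>i<n. (\<Sum>j<n. P i j * u j)\<^sup>2) + 2 * (\<Sum>i<n. (u i)\<^sup>2)"
    by (simp add: sum.distrib sum_distrib_left)
  also have "(\<Sum>i<n. (\<Sum>j<n. P i j * u j)\<^sup>2) \<le> (\<Sum>i<n. (u i)\<^sup>2)"
    by (rule orth_proj_quadratic(1)[OF P, of "\<lambda>_. 0" "\<lambda>_. 0"]) simp
  finally show "(\<Sum>i<n. (\<Sum>j<n. w i j * u j)\<^sup>2) \<le> 4 * (\<Sum>i<n. (u i)\<^sup>2)" by simp
  have "(\<Sum>i<n. \<Sum>j<n. (w i j)\<^sup>2) \<le> (\<Sum>i<n. \<Sum>j<n. (P i j)\<^sup>2)"
    by (intro sum_mono) (simp add: w)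
  then show "(\<Sum>i<n. \<Sum>j<n. (w i j)\<^sup>2) \<le> (\<Sum>i<n. P i i)" using orth_proj_row[OF P] by simp
  have "(\<Sum>i<n. \<Sum>j<n. u i * w i j * u j) = (\<Sum>i<n. u i * (\<Sum>j<n. w i j * u j))"
    by (simp add: sum_distrib_left mult.assoc)
  also have "\<dots> = (\<Sum>i<n. u i * (\<Sum>j<n. P i j * u j) - P i i * (u i)\<^sup>2)"
    by (intro sum.cong) (auto simp: row power2_eq_square right_diff_distrib)
  finally show "(\<Sum>i<n. \<Sum>j<n. u i * w i j * u j) = (\<Sum>i<n. u i * (\<Sum>j<n. P i j * u j)) - (\<Sum>i<n. P i i * (u i)\<^sup>2)"
    by (simp add: sum_subtractf)
qed

section \<open>Equicontinuous sequences on the cube\<close>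

lemma equicontinuous_seqD:
  assumes "equicontinuous_seq m" "e > 0"
  obtains \<eta> where "\<eta> > 0" "\<And>n x x'. n \<ge> 1 \<Longrightarrow> x \<in> ucube \<Longrightarrow> x' \<in> ucube \<Longrightarrow> norm (x - x') \<le> \<eta> \<Longrightarrow> \<bar>m n x - m n x'\<bar> \<le> e"
  using assms infnorm_le_norm unfolding equicontinuous_seq_def by (meson order.trans)

lemma equicontinuous_seq_continuous_on:
  fixes m :: "nat \<Rightarrow> real^'p \<Rightarrow> real"
  assumes "equicontinuous_seq m" "n \<ge> 1" shows "continuous_on ucube (m n)"
  unfolding continuous_on_iff
proof (intro ballI allI impI)
  fix x :: "real^'p" and e :: real assume x: "x \<in> ucube" and e: "0 < e"
  from e have "e/2 > 0" by simp
  then obtain \<eta> where \<eta>: "\<eta> > 0" "\<And>n x x'. n \<ge> 1 \<Longrightarrow> x \<in> ucube \<Longrightarrow> x' \<in> ucube \<Longrightarrow> norm (x - x') \<le> \<eta> \<Longrightarrow> \<bar>m n x - m n x'\<bar> \<le> e/2"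
    using equicontinuous_seqD[OF assms(1)] by blast
  show "\<exists>d>0. \<forall>x'\<in>ucube. dist x' x < d \<longrightarrow> dist (m n x') (m n x) < e"
  proof (intro exI[of _ \<eta>] conjI ballI impI \<eta>(1))
    fix x' :: "real^'p" assume "x' \<in> ucube" "dist x' x < \<eta>"
    then have "\<bar>m n x' - m n x\<bar> \<le> e/2" using assms(2) x by (intro \<eta>(2)) (auto simp: dist_norm)
    then show "dist (m n x') (m n x) < e" using e by (simp add: dist_real_def)
  qed
qed

lemma ucube_norm_diff:
  fixes x y :: "real^'p"
  assumes "x \<in> ucube" "y \<in> ucube" shows "norm (x - y) \<le> real CARD('p)"
proof -
  have "norm (x - y) \<le> (\<Sum>i\<in>UNIV. \<bar>(x - y) $ i\<bar>)" by (rule norm_le_l1_cart)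
  also have "\<dots> \<le> (\<Sum>i\<in>(UNIV::'p set). 1)"
  proof (rule sum_mono)
    fix i show "\<bar>(x - y) $ i\<bar> \<le> 1"
      using assms by (simp add: mem_box_cart) (smt (verit) one_index zero_index)
  qed
  finally show ?thesis by simp
qed

text \<open>Two points of the cube are joined by a segment, cut into \<open>N\<close> pieces of
  length at most \<eta>, and each piece changes \<open>m n\<close> by at most 1. The number of
  pieces depends neither on n nor on the points.\<close>

lemma equicontinuous_oscillation:
  fixes m :: "nat \<Rightarrow> real^'p \<Rightarrow> real"
  assumes "equicontinuous_seq m"
  obtains B where "B \<ge> 0" "\<And>n x y. n \<ge> 1 \<Longrightarrow> x \<in> ucube \<Longrightarrow> y \<in> ucube \<Longrightarrow> \<bar>m n x - m n y\<bar> \<le> B"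
proof -
  obtain \<eta> where \<eta>: "\<eta> > 0" "\<And>n x x'. n \<ge> 1 \<Longrightarrow> x \<in> ucube \<Longrightarrow> x' \<in> ucube \<Longrightarrow> norm (x - x') \<le> \<eta> \<Longrightarrow> \<bar>m n x - m n x'\<bar> \<le> 1"
    using equicontinuous_seqD[OF assms zero_less_one] by blast
  \<comment> \<open>The diameter of the cube is at most \<open>CARD('p)\<close>; the summand 1 keeps
    \<open>N\<close> positive.\<close>
  define N where "N = nat \<lceil>real CARD('p) / \<eta>\<rceil> + 1"
  have N: "N > 0" "real CARD('p) / real N \<le> \<eta>"
  proof -
    show "N > 0" by (simp add: N_def)
    have "real CARD('p) / \<eta> \<le> real N" unfolding N_def by linarith
    then show "real CARD('p) / real N \<le> \<eta>" using \<eta>(1) \<open>N > 0\<close> by (simp add: field_simps)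
  qed
  have "\<bar>m n x - m n y\<bar> \<le> real N" if n: "n \<ge> 1" and xy: "x \<in> ucube" "y \<in> ucube" for n x y
  proof -
    define p where "p k = x + (real k / real N) *\<^sub>R (y - x)" for k
    have p: "p k \<in> ucube" if "k \<le> N" for k
    proof -
      have "(1 - real k / real N) *\<^sub>R x + (real k / real N) *\<^sub>R y \<in> ucube"
        using that N xy by (intro convexD_alt[OF convex_box(1)]) auto
      then show ?thesis by (simp add: p_def algebra_simps)
    qed
    have "\<bar>m n (p k) - m n x\<bar> \<le> real k" if "k \<le> N" for k
      using that
    proof (induction k)
      case (Suc k)
      have "p (Suc k) - p k = (1 / real N) *\<^sub>R (y - x)"
        by (simp add: p_def add_divide_distrib scaleR_add_left)
      then have "norm (p (Suc k) - p k) = norm (y - x) / real N" by simp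
      also have "\<dots> \<le> real CARD('p) / real N" using ucube_norm_diff[OF xy(2,1)] by (intro divide_right_mono) auto
      finally have "norm (p (Suc k) - p k) \<le> \<eta>" using N by simp
      then have "\<bar>m n (p (Suc k)) - m n (p k)\<bar> \<le> 1" using p Suc.prems n by (intro \<eta>(2)) auto
      with Suc show ?case by simp
    qed (simp add: p_def)
    from this[of N] show ?thesis using N by (simp add: p_def)
  qed
  then show thesis by (intro that[of "real N"]) auto
qed

text \<open>The oscillation is bounded, so one value of moderate size is enough. An event of
  probability at least 1/2 is nonempty, and at any of its points the average of squares is at most
  2, which forces a design point where \<delta> is at most 2 in absolute value. The resulting bound
  is deterministic although it is read off from a random sample.\<close>

lemma (in prob_space) equicontinuous_bounded:
  fixes \<delta> :: "nat \<Rightarrow> real^'p \<Rightarrow> real" and X :: "nat \<Rightarrow> 'a \<Rightarrow> real^'p"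
  assumes eq: "equicontinuous_seq \<delta>" and X: "\<And>i \<omega>. \<omega> \<in> space M \<Longrightarrow> X i \<omega> \<in> ucube"
    and conv: "conv_in_prob M (\<lambda>n \<omega>. (1 / real n) * (\<Sum>i<n. (\<delta> n (X i \<omega>))\<^sup>2)) 1"
  obtains B where "B > 0" "\<forall>\<^sub>F n in sequentially. \<forall>x\<in>ucube. \<bar>\<delta> n x\<bar> \<le> B"
proof -
  obtain B where B: "B \<ge> 0" "\<And>n x y. n \<ge> 1 \<Longrightarrow> x \<in> ucube \<Longrightarrow> y \<in> ucube \<Longrightarrow> \<bar>\<delta> n x - \<delta> n y\<bar> \<le> B"
    using equicontinuous_oscillation[OF eq] by blast
  have "whp M (\<lambda>n \<omega>. dist ((1 / real n) * (\<Sum>i<n. (\<delta> n (X i \<omega>))\<^sup>2)) 1 \<le> 1)"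
    by (rule whp_conv_in_prob[OF conv]) simp
  then have "\<forall>\<^sub>F n in sequentially. \<exists>A\<in>sets M. 1 - 1/2 \<le> prob A \<and>
      (\<forall>\<omega>\<in>A. dist ((1 / real n) * (\<Sum>i<n. (\<delta> n (X i \<omega>))\<^sup>2)) 1 \<le> 1)"
    unfolding whp_def by (elim allE[of _ "1/2"]) simp
  then have "\<forall>\<^sub>F n in sequentially. \<forall>x\<in>ucube. \<bar>\<delta> n x\<bar> \<le> 2 + B"
    using eventually_ge_at_top[of 1]
  proof eventually_elim
    case (elim n)
    then obtain A where A: "A \<in> sets M" "1 - 1/2 \<le> prob A"
      "\<forall>\<omega>\<in>A. dist ((1 / real n) * (\<Sum>i<n. (\<delta> n (X i \<omega>))\<^sup>2)) 1 \<le> 1" by blast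
    have "A \<noteq> {}" using A(2) by auto
    then obtain \<omega> where \<omega>: "\<omega> \<in> A" by blast
    have sp: "\<omega> \<in> space M" using \<omega> A(1) sets.sets_into_space by blast
    have "(1 / real n) * (\<Sum>i<n. (\<delta> n (X i \<omega>))\<^sup>2) \<le> 2"
      using A(3) \<omega> by (auto simp: dist_real_def)
    then have le: "(\<Sum>i<n. (\<delta> n (X i \<omega>))\<^sup>2) \<le> 2 * real n" using elim by (simp add: field_simps)
    have "\<exists>i<n. \<bar>\<delta> n (X i \<omega>)\<bar> \<le> 2"
    proof (rule ccontr)
      assume "\<not> ?thesis"
      then have "4 \<le> (\<delta> n (X i \<omega>))\<^sup>2" if "i < n" for i
        using that power_mono[of 2 "\<bar>\<delta> n (X i \<omega>)\<bar>" 2] by force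
      then have "(\<Sum>i<n. 4) \<le> (\<Sum>i<n. (\<delta> n (X i \<omega>))\<^sup>2)" by (intro sum_mono) auto
      with le elim show False by simp
    qed
    then obtain i where i: "\<bar>\<delta> n (X i \<omega>)\<bar> \<le> 2" by blast
    show ?case
    proof
      fix x :: "real^'p" assume "x \<in> ucube"
      then have "\<bar>\<delta> n x - \<delta> n (X i \<omega>)\<bar> \<le> B" using elim X[OF sp] by (intro B(2)) auto
      with i show "\<bar>\<delta> n x\<bar> \<le> 2 + B" by linarith
    qed
  qed
  then show thesis using B(1) by (intro that[of "2 + B"]) auto
qed

section \<open>Index sets of the projection smoothers and approximation from their spans\<close>

lemma function_box_card:
  "finite {k :: 'p::finite \<Rightarrow> nat. \<forall>l. k l \<in> A} \<or> infinite A"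
  "card {k :: 'p::finite \<Rightarrow> nat. \<forall>l. k l \<in> A} = card A ^ CARD('p)"
proof -
  have eq: "{k :: 'p \<Rightarrow> nat. \<forall>l. k l \<in> A} = (\<Pi>\<^sub>E l\<in>UNIV. A)" by (auto simp: PiE_def)
  show "finite {k :: 'p::finite \<Rightarrow> nat. \<forall>l. k l \<in> A} \<or> infinite A"
    unfolding eq using finite_PiE[of "UNIV :: 'p set" "\<lambda>_. A"] by auto
  show "card {k :: 'p::finite \<Rightarrow> nat. \<forall>l. k l \<in> A} = card A ^ CARD('p)"
    unfolding eq by (subst card_PiE) auto
qed

lemma poly_index_alt: "h > 0 \<Longrightarrow> poly_index h = {k. \<forall>l. k l \<in> {..nat \<lfloor>1/h\<rfloor>}}"
  unfolding poly_index_def by (auto simp: le_nat_floor le_nat_iff le_floor_iff)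

text \<open>With h at most 1, the number of exponents per coordinate, the integer part of 1/h plus
  1, is at most 2/h.\<close>

lemma poly_index_card:
  assumes "h > 0" "h \<le> 1"
  shows "finite (poly_index h :: ('p::finite \<Rightarrow> nat) set)"
    "real (card (poly_index h :: ('p::finite \<Rightarrow> nat) set)) \<le> 2 ^ CARD('p) / h ^ CARD('p)"
proof -
  show "finite (poly_index h :: ('p::finite \<Rightarrow> nat) set)"
    unfolding poly_index_alt[OF assms(1)] using function_box_card(1)[of "{..nat \<lfloor>1/h\<rfloor>}"] by simp
  have "real (nat \<lfloor>1/h\<rfloor>) \<le> 1/h" using assms by (simp add: of_nat_floor)
  moreover have "1 \<le> 1/h" using assms by simp
  ultimately have "real (nat \<lfloor>1/h\<rfloor> + 1) \<le> 2/h" by simp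
  then have "real (nat \<lfloor>1/h\<rfloor> + 1) ^ CARD('p) \<le> (2/h) ^ CARD('p)" by (intro power_mono) auto
  then show "real (card (poly_index h :: ('p::finite \<Rightarrow> nat) set)) \<le> 2 ^ CARD('p) / h ^ CARD('p)"
    unfolding poly_index_alt[OF assms(1)] function_box_card(2) by (simp add: power_divide)
qed

lemma piecewise_index_alt:
  "piecewise_index qbar h = {q. \<forall>l. q l \<in> {..qbar}} \<times> {k. \<forall>l. k l \<in> {k. real k \<le> 1 / h - 1}}"
  unfolding piecewise_index_def by auto

lemma piecewise_index_card:
  assumes "h > 0" "h \<le> 1"
  shows "finite (piecewise_index qbar h :: (('p::finite \<Rightarrow> nat) \<times> ('p \<Rightarrow> nat)) set)"
    "real (card (piecewise_index qbar h :: (('p::finite \<Rightarrow> nat) \<times> ('p \<Rightarrow> nat)) set))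
      \<le> (real qbar + 1) ^ CARD('p) / h ^ CARD('p)"
proof -
  have sub: "{k. real k \<le> 1 / h - 1} \<subseteq> {..<nat \<lfloor>1/h\<rfloor>}"
  proof
    fix k assume "k \<in> {k. real k \<le> 1 / h - 1}"
    then have "real (k + 1) \<le> 1/h" by simp
    then have "k + 1 \<le> nat \<lfloor>1/h\<rfloor>" by (rule le_nat_floor)
    then show "k \<in> {..<nat \<lfloor>1/h\<rfloor>}" by simp
  qed
  then have fin: "finite {k. real k \<le> 1 / h - 1}" by (rule finite_subset) simp
  show "finite (piecewise_index qbar h :: (('p::finite \<Rightarrow> nat) \<times> ('p \<Rightarrow> nat)) set)"
    unfolding piecewise_index_alt
    using function_box_card(1)[of "{k. real k \<le> 1 / h - 1}"] function_box_card(1)[of "{..qbar}"] fin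
    by (intro finite_cartesian_product) auto
  have "card {k. real k \<le> 1 / h - 1} \<le> nat \<lfloor>1/h\<rfloor>"
    using card_mono[OF _ sub] by simp
  also have "real (nat \<lfloor>1/h\<rfloor>) \<le> 1/h" using assms by (simp add: of_nat_floor)
  finally have "real (card {k. real k \<le> 1 / h - 1}) \<le> 1/h" by simp
  then have "real (card {k. real k \<le> 1 / h - 1}) ^ CARD('p) \<le> (1/h) ^ CARD('p)"
    by (intro power_mono) auto
  then have "(real qbar + 1) ^ CARD('p) * real (card {k. real k \<le> 1 / h - 1}) ^ CARD('p)
      \<le> (real qbar + 1) ^ CARD('p) * (1/h) ^ CARD('p)"
    by (intro mult_left_mono) auto
  then show "real (card (piecewise_index qbar h :: (('p::finite \<Rightarrow> nat) \<times> ('p \<Rightarrow> nat)) set))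
      \<le> (real qbar + 1) ^ CARD('p) / h ^ CARD('p)"
    unfolding piecewise_index_alt card_cartesian_product function_box_card(2)
    by (simp add: power_divide add.commute)
qed

text \<open>Degrees are bounded in each coordinate separately, as in \<open>poly_index\<close>;
  hence a function with \<open>N\<close> at most 1/h lies in the span of the monomials used at
  bandwidth h.\<close>

definition poly_upto :: "nat \<Rightarrow> (real^'p \<Rightarrow> real) \<Rightarrow> bool" where
  "poly_upto N f \<longleftrightarrow> (\<exists>c. \<forall>x. f x = (\<Sum>k\<in>{k. \<forall>l. k l \<le> N}. c k * monomial k x))"

lemma finite_exponents: "finite {k :: 'p::finite \<Rightarrow> nat. \<forall>l. k l \<le> N}"
  using function_box_card(1)[of "{..N}"] by simp

lemma poly_upto_monomial:
  fixes k :: "'p::finite \<Rightarrow> nat"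
  assumes "\<And>l. k l \<le> N" shows "poly_upto N (\<lambda>x. c * monomial k x)"
  unfolding poly_upto_def
proof (intro exI allI)
  fix x :: "real^'p"
  have "(\<Sum>k'\<in>{k. \<forall>l. k l \<le> N}. (if k' = k then c else 0) * monomial k' x)
      = (\<Sum>k'\<in>{k. \<forall>l. k l \<le> N}. if k' = k then c * monomial k' x else 0)"
    by (intro sum.cong) auto
  also have "\<dots> = c * monomial k x"
    using assms by (subst sum.delta[OF finite_exponents]) simp
  finally show "c * monomial k x = (\<Sum>k'\<in>{k. \<forall>l. k l \<le> N}. (if k' = k then c else 0) * monomial k' x)" ..
qed

lemma poly_upto_cong: "poly_upto N g \<Longrightarrow> (\<And>x. f x = g x) \<Longrightarrow> poly_upto N f"
  by (simp add: poly_upto_def)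

lemma poly_upto_add:
  assumes "poly_upto N f" "poly_upto N g" shows "poly_upto N (\<lambda>x. f x + g x)"
proof -
  obtain c d where "\<And>x. f x = (\<Sum>k\<in>{k. \<forall>l. k l \<le> N}. c k * monomial k x)"
    "\<And>x. g x = (\<Sum>k\<in>{k. \<forall>l. k l \<le> N}. d k * monomial k x)"
    using assms unfolding poly_upto_def by blast
  then show ?thesis unfolding poly_upto_def
    by (intro exI[of _ "\<lambda>k. c k + d k"]) (simp add: distrib_right sum.distrib)
qed

lemma poly_upto_zero: "poly_upto N (\<lambda>_. 0)"
  unfolding poly_upto_def by (rule exI[of _ "\<lambda>_. 0"]) simp

lemma poly_upto_sum:
  "(\<And>i. i \<in> I \<Longrightarrow> poly_upto N (f i)) \<Longrightarrow> poly_upto N (\<lambda>x. \<Sum>i\<in>I. f i x)"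
  by (induction I rule: infinite_finite_induct) (simp_all add: poly_upto_zero poly_upto_add)

lemma poly_upto_mono:
  assumes "poly_upto N f" "N \<le> N'" shows "poly_upto N' f"
proof -
  obtain c where c: "\<And>x. f x = (\<Sum>k\<in>{k. \<forall>l. k l \<le> N}. c k * monomial k x)"
    using assms unfolding poly_upto_def by blast
  have "poly_upto N' (\<lambda>x. \<Sum>k\<in>{k. \<forall>l. k l \<le> N}. c k * monomial k x)"
    using assms(2) by (intro poly_upto_sum poly_upto_monomial) (auto intro: order.trans)
  then show ?thesis by (rule poly_upto_cong) (rule c)
qed

lemma monomial_mult: "monomial k x * monomial k' x = monomial (\<lambda>l. k l + k' l) x"
  by (simp add: monomial_def power_add prod.distrib)

lemma poly_upto_mult:
  assumes "poly_upto N f" "poly_upto N' g" shows "poly_upto (N + N') (\<lambda>x. f x * g x)"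
proof -
  obtain c d where f: "\<And>x. f x = (\<Sum>k\<in>{k. \<forall>l. k l \<le> N}. c k * monomial k x)"
    and g: "\<And>x. g x = (\<Sum>k\<in>{k. \<forall>l. k l \<le> N'}. d k * monomial k x)"
    using assms unfolding poly_upto_def by blast
  have eq: "f x * g x = (\<Sum>k\<in>{k. \<forall>l. k l \<le> N}. \<Sum>k'\<in>{k. \<forall>l. k l \<le> N'}. (c k * d k') * monomial (\<lambda>l. k l + k' l) x)" for x
    unfolding f g sum_product monomial_mult[symmetric] by (simp add: mult_ac)
  have "poly_upto (N + N') (\<lambda>x. \<Sum>k\<in>{k. \<forall>l. k l \<le> N}. \<Sum>k'\<in>{k. \<forall>l. k l \<le> N'}. (c k * d k') * monomial (\<lambda>l. k l + k' l) x)"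
    by (intro poly_upto_sum poly_upto_monomial) (auto intro: add_mono)
  then show ?thesis by (rule poly_upto_cong) (rule eq)
qed

text \<open>Translates the inductively defined polynomials of the Stone-Weierstrass theorem into
  monomial expansions with some bound on the exponents.\<close>

lemma real_polynomial_function_poly_upto:
  fixes f :: "real^'p \<Rightarrow> real"
  assumes "real_polynomial_function f" shows "\<exists>N. poly_upto N f"
  using assms
proof (induction rule: real_polynomial_function.induct)
  case (linear f)
  have m: "monomial (\<lambda>l'. if l' = l then 1 else 0) x = x $ l" for l and x :: "real^'p"
    unfolding monomial_def by (subst prod.remove[of _ l]) auto
  have eq: "f x = (\<Sum>l\<in>UNIV. f (axis l 1) * monomial (\<lambda>l'. if l' = l then 1 else 0) x)" for x
  proof -
    interpret bounded_linear f by (rule linear)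
    have "(\<Sum>l\<in>UNIV. x $ l *\<^sub>R axis l 1) = x"
      using basis_expansion[of x] unfolding scalar_mult_eq_scaleR .
    then have "f x = f (\<Sum>l\<in>UNIV. x $ l *\<^sub>R axis l 1)" by (simp only:)
    also have "\<dots> = (\<Sum>l\<in>UNIV. x $ l * f (axis l 1))" by (simp only: sum scaleR real_scaleR_def)
    finally show ?thesis by (simp only: m mult.commute)
  qed
  have "poly_upto 1 (\<lambda>x. \<Sum>l\<in>UNIV. f (axis l 1) * monomial (\<lambda>l'. if l' = l then 1 else 0) x)"
    by (intro poly_upto_sum poly_upto_monomial) auto
  then have "poly_upto 1 f" by (rule poly_upto_cong) (rule eq)
  then show ?case ..
next
  case (const c)
  have "poly_upto 0 (\<lambda>x. c * monomial (\<lambda>_. 0) x)" by (rule poly_upto_monomial) simp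
  then show ?case by (auto simp: monomial_def)
next
  case (add f g)
  then obtain N N' where "poly_upto N f" "poly_upto N' g" by blast
  then have "poly_upto (max N N') (\<lambda>x. f x + g x)"
    by (intro poly_upto_add) (auto intro: poly_upto_mono)
  then show ?case by blast
next
  case (mult f g)
  then show ?case using poly_upto_mult by blast
qed

text \<open>One degree serves a whole equicontinuous, uniformly bounded family: interpolate on a fixed finite
  net with a continuous partition of unity, and approximate only the finitely many weights.\<close>
lemma equicontinuous_polynomial_approximation:
  fixes \<delta> :: "nat \<Rightarrow> real^'p \<Rightarrow> real"
  assumes eq: "equicontinuous_seq \<delta>" and e: "e > 0" and B: "B > 0"
  obtains N where "\<And>n. n \<ge> 1 \<Longrightarrow> (\<And>x. x \<in> ucube \<Longrightarrow> \<bar>\<delta> n x\<bar> \<le> B) \<Longrightarrow>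
    \<exists>g. poly_upto N g \<and> (\<forall>x\<in>ucube. \<bar>\<delta> n x - g x\<bar> \<le> e)"
proof -
  have "e/2 > 0" using e by simp
  then obtain \<eta> where \<eta>: "\<eta> > 0" "\<And>n x x'. n \<ge> 1 \<Longrightarrow> x \<in> ucube \<Longrightarrow> x' \<in> ucube \<Longrightarrow> norm (x - x') \<le> \<eta> \<Longrightarrow> \<bar>\<delta> n x - \<delta> n x'\<bar> \<le> e/2"
    using equicontinuous_seqD[OF eq] by blast
  have "seq_compact (ucube :: (real^'p) set)" by (rule compact_imp_seq_compact[OF compact_cbox])
  from seq_compact_imp_totally_bounded[OF this, rule_format, OF \<eta>(1)]
  obtain K :: "(real^'p) set" where K: "finite K" "K \<subseteq> ucube" "ucube \<subseteq> (\<Union>x\<in>K. ball x \<eta>)" by blast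
  \<comment> \<open>Tent functions of radius \<eta> around the net points. Their sum is positive on
    the cube because the balls cover it, so normalisation yields a continuous partition of
    unity.\<close>
  define \<psi> where "\<psi> y x = max 0 (\<eta> - norm (x - y))" for x y :: "real^'p"
  define s where "s x = (\<Sum>y\<in>K. \<psi> y x)" for x
  define \<phi> where "\<phi> y x = \<psi> y x / s x" for x y
  have \<psi>0: "\<psi> y x \<ge> 0" for x y by (simp add: \<psi>_def)
  have s: "s x > 0" if x: "x \<in> ucube" for x
  proof -
    obtain y where "y \<in> K" "x \<in> ball y \<eta>" using K(3) x by blast
    then have "0 < \<psi> y x" by (simp add: \<psi>_def dist_norm norm_minus_commute)
    then show ?thesis unfolding s_def using K(1) \<open>y \<in> K\<close> \<psi>0 by (intro sum_pos2[of _ y]) auto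
  qed
  have sum1: "(\<Sum>y\<in>K. \<phi> y x) = 1" if "x \<in> ucube" for x
    using s[OF that] by (simp add: \<phi>_def s_def sum_divide_distrib[symmetric])
  have \<phi>0: "\<phi> y x \<ge> 0" if "x \<in> ucube" for x y using s[OF that] \<psi>0 by (simp add: \<phi>_def)
  have cont: "continuous_on ucube (\<phi> y)" for y
  proof -
    have "continuous_on ucube (\<psi> y)" "continuous_on ucube s"
      unfolding s_def[abs_def] \<psi>_def[abs_def] by (intro continuous_intros)+
    moreover have "\<forall>x\<in>ucube. s x \<noteq> 0" using s by force
    ultimately show ?thesis unfolding \<phi>_def[abs_def] by (rule continuous_on_divide)
  qed
  \<comment> \<open>The \<open>card K\<close> weights, each multiplied by a value of size at most
    \<open>B\<close>, then contribute at most e/2 in total; the summand 1 excludes division by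
    zero.\<close>
  define t where "t = e / (2 * (real (card K) + 1) * B)"
  have t: "t > 0" using e B by (simp add: t_def)
  have "\<exists>g N. poly_upto N g \<and> (\<forall>x\<in>ucube. \<bar>\<phi> y x - g x\<bar> \<le> t)" for y
  proof -
    obtain g where "real_polynomial_function g" "\<And>x. x \<in> ucube \<Longrightarrow> \<bar>\<phi> y x - g x\<bar> < t"
      using Stone_Weierstrass_real_polynomial_function[OF compact_cbox cont t] by blast
    then show ?thesis using real_polynomial_function_poly_upto by (meson less_imp_le)
  qed
  then obtain g N where g: "\<And>y. poly_upto (N y) (g y)" "\<And>y x. x \<in> ucube \<Longrightarrow> \<bar>\<phi> y x - g y x\<bar> \<le> t" by metis
  define N' where "N' = (\<Sum>y\<in>K. N y)"
  have g': "poly_upto N' (\<lambda>x. c * g y x)" if y: "y \<in> K" for y c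
  proof -
    have "N y \<le> N'" unfolding N'_def using K(1) y by (intro member_le_sum) auto
    with g(1) have "poly_upto N' (g y)" by (rule poly_upto_mono)
    moreover have "poly_upto 0 (\<lambda>x::real^'p. c * monomial (\<lambda>_. 0) x)" by (rule poly_upto_monomial) simp
    ultimately have "poly_upto (0 + N') (\<lambda>x. (c * monomial (\<lambda>_. 0) x) * g y x)" by (intro poly_upto_mult)
    then show ?thesis by (simp add: monomial_def)
  qed
  have "\<exists>g. poly_upto N' g \<and> (\<forall>x\<in>ucube. \<bar>\<delta> n x - g x\<bar> \<le> e)"
    if n: "n \<ge> 1" and bd: "\<And>x. x \<in> ucube \<Longrightarrow> \<bar>\<delta> n x\<bar> \<le> B" for n
  proof (intro exI conjI ballI)
    show "poly_upto N' (\<lambda>x. \<Sum>y\<in>K. \<delta> n y * g y x)" by (intro poly_upto_sum g')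
    fix x :: "real^'p" assume x: "x \<in> ucube"
    have "(\<Sum>y\<in>K. \<phi> y x * (\<delta> n x - \<delta> n y)) = (\<Sum>y\<in>K. \<phi> y x) * \<delta> n x - (\<Sum>y\<in>K. \<phi> y x * \<delta> n y)"
      by (simp add: right_diff_distrib sum_subtractf sum_distrib_right)
    then have "\<bar>\<delta> n x - (\<Sum>y\<in>K. \<delta> n y * \<phi> y x)\<bar> = \<bar>\<Sum>y\<in>K. \<phi> y x * (\<delta> n x - \<delta> n y)\<bar>"
      by (simp add: sum1[OF x] mult.commute)
    also have "\<dots> \<le> (\<Sum>y\<in>K. \<bar>\<phi> y x * (\<delta> n x - \<delta> n y)\<bar>)" by (rule sum_abs)
    also have "\<dots> \<le> (\<Sum>y\<in>K. \<phi> y x * (e/2))"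
    proof (rule sum_mono)
      fix y assume y: "y \<in> K"
      show "\<bar>\<phi> y x * (\<delta> n x - \<delta> n y)\<bar> \<le> \<phi> y x * (e/2)"
      proof (cases "\<phi> y x = 0")
        case False
        then have "norm (x - y) \<le> \<eta>" by (auto simp: \<phi>_def \<psi>_def max_def split: if_splits)
        then have "\<bar>\<delta> n x - \<delta> n y\<bar> \<le> e/2" using n x y K(2) by (intro \<eta>(2)) auto
        then show ?thesis
          unfolding abs_mult abs_of_nonneg[OF \<phi>0[OF x]] by (rule mult_left_mono[OF _ \<phi>0[OF x]])
      qed simp
    qed
    also have "\<dots> = e/2" by (simp only: sum_distrib_right[symmetric] sum1[OF x] mult_1)
    finally have 1: "\<bar>\<delta> n x - (\<Sum>y\<in>K. \<delta> n y * \<phi> y x)\<bar> \<le> e/2" .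
    have "\<bar>(\<Sum>y\<in>K. \<delta> n y * \<phi> y x) - (\<Sum>y\<in>K. \<delta> n y * g y x)\<bar> \<le> (\<Sum>y\<in>K. \<bar>\<delta> n y * (\<phi> y x - g y x)\<bar>)"
      unfolding sum_subtractf[symmetric] right_diff_distrib[symmetric] by (rule sum_abs)
    also have "\<dots> \<le> (\<Sum>y\<in>K. B * t)"
      using bd K(2) g(2)[OF x] B unfolding abs_mult by (intro sum_mono mult_mono) auto
    also have "\<dots> = (real (card K) / (real (card K) + 1)) * (e/2)"
    proof -
      have "B * t = (e/2) / (real (card K) + 1)" using B by (simp add: t_def)
      then show ?thesis by simp
    qed
    also have "\<dots> \<le> 1 * (e/2)" using e by (intro mult_right_mono) auto
    finally show "\<bar>\<delta> n x - (\<Sum>y\<in>K. \<delta> n y * g y x)\<bar> \<le> e" using 1 by linarith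
  qed
  then show thesis by (rule that)
qed

lemma infnorm_le_cart:
  fixes x :: "real^'p" assumes "\<And>l. \<bar>x $ l\<bar> \<le> b" shows "infnorm x \<le> b"
  unfolding infnorm_cart by (rule cSup_least) (use assms in auto)

text \<open>Only the exponent zero is used: on each bin the approximant is constant, equal to the
  value of f at the lower corner. Bins are half-open, so a point with a coordinate equal to 1 lies
  in no bin and has to be excluded.\<close>

lemma piecewise_constant_approximation:
  fixes f :: "real^'p \<Rightarrow> real"
  assumes h: "h > 0" "1 / h \<in> \<int>"
    and f: "\<And>x x'. x \<in> ucube \<Longrightarrow> x' \<in> ucube \<Longrightarrow> infnorm (x - x') \<le> h \<Longrightarrow> \<bar>f x - f x'\<bar> \<le> e"
  shows "\<exists>c. \<forall>x\<in>ucube. (\<forall>l. x $ l < 1) \<longrightarrow>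
    \<bar>f x - (\<Sum>k\<in>piecewise_index qbar h. c k * piecewise_fun h k x)\<bar> \<le> e"
proof (intro exI ballI impI)
  define c where "c = (\<lambda>(q, k :: 'p \<Rightarrow> nat). if q = (\<lambda>_::'p. 0::nat) then f (\<chi> l. real (k l) * h) else 0)"
  fix x :: "real^'p" assume x: "x \<in> ucube" and x1: "\<forall>l. x $ l < 1"
  have x0: "0 \<le> x $ l" for l using x by (simp add: mem_box_cart)
  obtain N :: int where N: "1 / h = of_int N" using h(2) by (auto elim: Ints_cases)
  define k where "k l = nat \<lfloor>x $ l / h\<rfloor>" for l
  have k: "real (k l) = of_int \<lfloor>x $ l / h\<rfloor>" for l using x0[of l] h(1) by (simp add: k_def)
  have kb: "real (k l) * h \<le> x $ l" "x $ l < (real (k l) + 1) * h" for l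
  proof -
    have "of_int \<lfloor>x $ l / h\<rfloor> \<le> x $ l / h" "x $ l / h < of_int \<lfloor>x $ l / h\<rfloor> + 1" by linarith+
    then show "real (k l) * h \<le> x $ l" "x $ l < (real (k l) + 1) * h"
      unfolding k using h(1) by (simp_all only: pos_le_divide_eq pos_divide_less_eq)
  qed
  \<comment> \<open>Integrality of 1/h is what puts every point with coordinates below 1 into a bin
    with an admissible number.\<close>
  have kN: "real (k l) \<le> 1 / h - 1" for l
  proof -
    have "x $ l / h < 1 / h" using x1 h(1) by (simp add: divide_strict_right_mono)
    then have "\<lfloor>x $ l / h\<rfloor> < N" unfolding N by (simp add: floor_less_iff)
    then show ?thesis unfolding N k by linarith
  qed
  have uniq: "k' = k" if "x \<in> bin h k'" for k'
  proof
    fix l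
    have *: "real (k' l) * h \<le> x $ l" "x $ l < (real (k' l) + 1) * h" using that by (auto simp: bin_def)
    have "real (k' l) * h < (real (k l) + 1) * h" "real (k l) * h < (real (k' l) + 1) * h"
      using * kb[of l] by linarith+
    then have "real (k' l) < real (k l) + 1" "real (k l) < real (k' l) + 1" using h(1) by auto
    then show "k' l = k l" by linarith
  qed
  have inbin: "x \<in> bin h k" using kb by (simp add: bin_def)
  have zero: "c qk * piecewise_fun h qk x = 0"
    if "qk \<noteq> ((\<lambda>_. 0), k)" for qk
    using that uniq by (cases qk) (auto simp: c_def piecewise_fun_def split: split_indicator)
  have mem: "((\<lambda>_. 0), k) \<in> piecewise_index qbar h" using kN by (simp add: piecewise_index_def)
  \<comment> \<open>An arbitrary coordinate is inspected only to learn that at least one bin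
    exists.\<close>
  have "1 / h \<ge> 1"
  proof -
    have "0 \<le> real (k undefined)" by simp
    then show ?thesis using kN[of undefined] by linarith
  qed
  then have "h \<le> 1" using h(1) by (simp add: field_simps)
  note fin = piecewise_index_card(1)[OF h(1) this, of qbar]
  have "(\<Sum>k\<in>piecewise_index qbar h. c k * piecewise_fun h k x)
      = (\<Sum>qk\<in>{((\<lambda>_. 0), k)}. c qk * piecewise_fun h qk x)"
    by (rule sum.mono_neutral_right[OF fin]) (use mem zero in auto)
  also have "\<dots> = f (\<chi> l. real (k l) * h)"
    using inbin by (simp add: c_def piecewise_fun_def monomial_def)
  finally have eq: "(\<Sum>k\<in>piecewise_index qbar h. c k * piecewise_fun h k x) = f (\<chi> l. real (k l) * h)" .
  have "\<bar>f x - f (\<chi> l. real (k l) * h)\<bar> \<le> e"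
  proof (rule f[OF x])
    have "real (k l) * h \<le> 1" for l using kb(1)[of l] x1 by (meson less_imp_le order.trans)
    then show "(\<chi> l. real (k l) * h) \<in> (ucube :: (real^'p) set)" using h(1) by (simp add: mem_box_cart)
    show "infnorm (x - (\<chi> l. real (k l) * h)) \<le> h"
    proof (rule infnorm_le_cart)
      fix l show "\<bar>(x - (\<chi> l. real (k l) * h)) $ l\<bar> \<le> h"
        using kb[of l] by (simp add: distrib_right)
    qed
  qed
  then show "\<bar>f x - (\<Sum>k\<in>piecewise_index qbar h. c k * piecewise_fun h k x)\<bar> \<le> e"
    unfolding eq .
qed

section \<open>Kernel smoothers\<close>

lemma
  fixes f :: "'a::euclidean_space \<Rightarrow> 'b::{banach, second_countable_topology}"
  assumes f [measurable]: "f \<in> borel_measurable borel" and c: "c \<noteq> 0"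
  shows integrable_lborel_scaleR: "integrable lborel f \<Longrightarrow> integrable lborel (\<lambda>x. f (t + c *\<^sub>R x))"
    and integral_lborel_scaleR: "(\<integral>x. f x \<partial>lborel) = \<bar>c\<bar> ^ DIM('a) *\<^sub>R (\<integral>x. f (t + c *\<^sub>R x) \<partial>lborel)"
proof -
  have m [measurable]: "(\<lambda>x::'a. t + c *\<^sub>R x) \<in> borel_measurable borel" by measurable
  have eq: "lborel = density (distr lborel borel (\<lambda>x::'a. t + c *\<^sub>R x)) (\<lambda>_. ennreal (\<bar>c\<bar> ^ DIM('a)))"
    using lborel_affine[OF c, of t] by (simp add: ennreal_power)
  show "integrable lborel (\<lambda>x. f (t + c *\<^sub>R x))" if int: "integrable lborel f"
  proof -
    have "integrable (distr lborel borel (\<lambda>x::'a. t + c *\<^sub>R x)) (\<lambda>x. \<bar>c\<bar> ^ DIM('a) *\<^sub>R f x)"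
      using int by (subst (asm) eq, subst (asm) integrable_density) auto
    then have "integrable (distr lborel borel (\<lambda>x::'a. t + c *\<^sub>R x)) f"
      using c integrable_scaleR_right[of "1 / \<bar>c\<bar> ^ DIM('a)" _ "\<lambda>x. \<bar>c\<bar> ^ DIM('a) *\<^sub>R f x"] by simp
    then show ?thesis by (subst (asm) integrable_distr_eq) auto
  qed
  have "(\<integral>x. f x \<partial>lborel) = (\<integral>x. \<bar>c\<bar> ^ DIM('a) *\<^sub>R f x \<partial>distr lborel borel (\<lambda>x::'a. t + c *\<^sub>R x))"
    by (subst eq, subst integral_density) auto
  also have "\<dots> = (\<integral>x. \<bar>c\<bar> ^ DIM('a) *\<^sub>R f (t + c *\<^sub>R x) \<partial>lborel)"
    by (subst integral_distr) auto
  finally show "(\<integral>x. f x \<partial>lborel) = \<bar>c\<bar> ^ DIM('a) *\<^sub>R (\<integral>x. f (t + c *\<^sub>R x) \<partial>lborel)" by simp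
qed

section \<open>Gaussian weights and positivity of the kernel at the origin\<close>

lemma cis_measurable [measurable]: "cis \<in> borel_measurable borel"
  by (intro borel_measurable_continuous_onI continuous_on_cis continuous_on_id)

definition gauss :: "'a::euclidean_space \<Rightarrow> real" where
  "gauss x = (\<Prod>b\<in>Basis. std_normal_density (x \<bullet> b))"

lemma gauss_measurable [measurable]: "gauss \<in> borel_measurable borel"
  unfolding gauss_def[abs_def] by measurable

lemma gauss_nonneg: "0 \<le> gauss x" and gauss_pos: "0 < gauss x"
proof -
  show "0 < gauss x" unfolding gauss_def by (intro prod_pos) (auto intro: normal_density_pos)
  then show "0 \<le> gauss x" by simp
qed

lemma gauss_le: "gauss (x::'a) \<le> gauss (0::'a::euclidean_space)"
  unfolding gauss_def by (intro prod_mono) (simp add: std_normal_density_def divide_right_mono)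

lemma isCont_gauss: "isCont gauss x"
  unfolding gauss_def[abs_def] std_normal_density_def by (intro continuous_intros) auto

text \<open>The transform is the characteristic function of the standard normal law, which is again
  a multiple of the normal density.\<close>

lemma std_normal_fourier:
  "integrable lborel (\<lambda>u. cis (- (u * y)) * complex_of_real (std_normal_density u))"
  "(\<integral>u. cis (- (u * y)) * complex_of_real (std_normal_density u) \<partial>lborel)
    = complex_of_real (sqrt (2 * pi) * std_normal_density y)"
proof -
  have m: "(\<lambda>u::real. cis (- (u * y)) * complex_of_real (std_normal_density u)) \<in> borel_measurable borel"
    by measurable
  show "integrable lborel (\<lambda>u. cis (- (u * y)) * complex_of_real (std_normal_density u))"
    by (rule Bochner_Integration.integrable_bound[of _ std_normal_density])
       (use m integrable_normal_moment[of 1 0 0] in \<open>auto simp: norm_mult\<close>)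
  have "(\<integral>u. cis (- (u * y)) * complex_of_real (std_normal_density u) \<partial>lborel)
      = (\<integral>u. std_normal_density u *\<^sub>R iexp (- y * u) \<partial>lborel)"
    by (intro Bochner_Integration.integral_cong) (auto simp: cis_conv_exp scaleR_conv_of_real mult_ac)
  also have "\<dots> = (\<integral>u. iexp (- y * u) \<partial>std_normal_distribution)"
    by (subst integral_density) auto
  also have "\<dots> = char std_normal_distribution (- y)" by (simp add: char_def)
  also have "\<dots> = complex_of_real (sqrt (2 * pi) * std_normal_density y)"
    unfolding char_std_normal_distribution by (simp add: std_normal_density_def)
  finally show "(\<integral>u. cis (- (u * y)) * complex_of_real (std_normal_density u) \<partial>lborel)
    = complex_of_real (sqrt (2 * pi) * std_normal_density y)" .
qed

text \<open>Lebesgue measure on a Euclidean space is the image of the product of one-dimensional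
  Lebesgue measures over the basis, so Fubini for finite products applies to functions that factor
  over the coordinates.\<close>

lemma lborel_prod_integral:
  fixes f :: "'a::euclidean_space \<Rightarrow> real \<Rightarrow> complex"
  assumes "\<And>b. b \<in> Basis \<Longrightarrow> integrable lborel (f b)"
  shows "integrable lborel (\<lambda>x. \<Prod>b\<in>Basis. f b (x \<bullet> b))"
    "(\<integral>x. (\<Prod>b\<in>Basis. f b (x \<bullet> b)) \<partial>lborel) = (\<Prod>b\<in>Basis. \<integral>y. f b y \<partial>lborel)"
proof -
  interpret product_sigma_finite "\<lambda>_::'a. lborel :: real measure" ..
  have [measurable]: "f b \<in> borel_measurable borel" if "b \<in> Basis" for b
    using borel_measurable_integrable[OF assms[OF that]] by simp
  have T [measurable]: "(\<lambda>g. \<Sum>b\<in>Basis. g b *\<^sub>R b) \<in> (\<Pi>\<^sub>M b\<in>Basis. lborel) \<rightarrow>\<^sub>M (borel :: 'a measure)"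
    by measurable
  have F [measurable]: "(\<lambda>x. \<Prod>b\<in>Basis. f b (x \<bullet> b)) \<in> borel_measurable (borel :: 'a measure)"
    by measurable
  have eq: "(\<Prod>b\<in>Basis. f b ((\<Sum>c\<in>Basis. g c *\<^sub>R c) \<bullet> b)) = (\<Prod>b\<in>Basis. f b (g b))" for g
    by (intro prod.cong) auto
  have P: "integrable (\<Pi>\<^sub>M b\<in>Basis. lborel) (\<lambda>g. \<Prod>b\<in>Basis. f b (g b))"
    by (rule product_integrable_prod) (use assms in auto)
  show "integrable lborel (\<lambda>x. \<Prod>b\<in>Basis. f b (x \<bullet> b))"
    by (subst lborel_eq, subst integrable_distr_eq[OF T F]) (use P in \<open>simp add: eq\<close>)
  have "(\<integral>x. (\<Prod>b\<in>Basis. f b (x \<bullet> b)) \<partial>lborel) = (\<integral>g. (\<Prod>b\<in>Basis. f b (g b)) \<partial>(\<Pi>\<^sub>M b\<in>Basis. lborel))"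
    by (subst lborel_eq, subst integral_distr[OF T F]) (simp add: eq)
  also have "\<dots> = (\<Prod>b\<in>Basis. \<integral>y. f b y \<partial>lborel)"
    by (rule product_integral_prod) (use assms in auto)
  finally show "(\<integral>x. (\<Prod>b\<in>Basis. f b (x \<bullet> b)) \<partial>lborel) = (\<Prod>b\<in>Basis. \<integral>y. f b y \<partial>lborel)" .
qed

lemma gauss_fourier:
  fixes x :: "'a::euclidean_space"
  shows "integrable lborel (\<lambda>t. cis (- (t \<bullet> x)) * complex_of_real (gauss t))"
    "(\<integral>t. cis (- (t \<bullet> x)) * complex_of_real (gauss t) \<partial>lborel)
      = complex_of_real (sqrt (2 * pi) ^ DIM('a) * gauss x)"
proof -
  have cis_sum: "cis (\<Sum>b\<in>B. a b) = (\<Prod>b\<in>B. cis (a b))" if "finite B" for B :: "'a set" and a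
    using that by (induction B) (auto simp: cis_mult[symmetric])
  have eq: "cis (- (t \<bullet> x)) * complex_of_real (gauss t)
      = (\<Prod>b\<in>Basis. cis (- ((t \<bullet> b) * (x \<bullet> b))) * complex_of_real (std_normal_density (t \<bullet> b)))" for t :: 'a
  proof -
    have "- (t \<bullet> x) = (\<Sum>b\<in>Basis. - ((t \<bullet> b) * (x \<bullet> b)))"
      by (subst euclidean_inner) (simp add: sum_negf)
    then show ?thesis by (simp add: cis_sum gauss_def prod.distrib)
  qed
  show "integrable lborel (\<lambda>t. cis (- (t \<bullet> x)) * complex_of_real (gauss t))"
    unfolding eq by (rule lborel_prod_integral(1)) (rule std_normal_fourier(1))
  show "(\<integral>t. cis (- (t \<bullet> x)) * complex_of_real (gauss t) \<partial>lborel)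
      = complex_of_real (sqrt (2 * pi) ^ DIM('a) * gauss x)"
    unfolding eq
    by (subst lborel_prod_integral(2)[where f = "\<lambda>b u. cis (- (u * (x \<bullet> b))) * complex_of_real (std_normal_density u)"])
       (auto simp: std_normal_fourier gauss_def prod.distrib)
qed

lemma integrable_gauss: "integrable lborel (gauss :: 'a::euclidean_space \<Rightarrow> real)"
  using integrable_norm[OF gauss_fourier(1)[of "0::'a"]] by (simp add: norm_mult gauss_nonneg)

lemma gauss_fourier_scaled:
  fixes x :: "'a::euclidean_space"
  assumes s: "s > 0"
  shows "(\<integral>t. cis (- (t \<bullet> x)) * complex_of_real (gauss (s *\<^sub>R t)) \<partial>lborel)
      = complex_of_real (sqrt (2 * pi) ^ DIM('a) * gauss (x /\<^sub>R s) / s ^ DIM('a))"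
proof -
  define F where "F t = cis (- (t \<bullet> (x /\<^sub>R s))) * complex_of_real (gauss t)" for t :: 'a
  have [measurable]: "F \<in> borel_measurable borel" unfolding F_def[abs_def] by measurable
  have "F (0 + s *\<^sub>R t) = cis (- (t \<bullet> x)) * complex_of_real (gauss (s *\<^sub>R t))" for t
  proof -
    have "(s *\<^sub>R t) \<bullet> (x /\<^sub>R s) = t \<bullet> x" using s by (simp add: field_simps)
    then show ?thesis by (simp only: F_def add_0)
  qed
  then have "(\<integral>t. cis (- (t \<bullet> x)) * complex_of_real (gauss (s *\<^sub>R t)) \<partial>lborel) = (\<integral>t. F (0 + s *\<^sub>R t) \<partial>lborel)"
    by simp
  moreover have "(\<integral>t. F t \<partial>lborel) = \<bar>s\<bar> ^ DIM('a) *\<^sub>R (\<integral>t. F (0 + s *\<^sub>R t) \<partial>lborel)"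
    by (rule integral_lborel_scaleR) (use s in auto)
  moreover have "(\<integral>t. F t \<partial>lborel) = complex_of_real (sqrt (2 * pi) ^ DIM('a) * gauss (x /\<^sub>R s))"
    unfolding F_def by (rule gauss_fourier(2))
  ultimately show ?thesis using s by (simp add: scaleR_conv_of_real field_simps)
qed

text \<open>Fourier inversion at the origin, in Gaussian-smoothed form.\<close>
lemma fourier_gauss_pairing:
  fixes K :: "real^'p \<Rightarrow> real"
  assumes K: "integrable lborel K" "\<And>x. 0 \<le> K x" and s: "s > 0"
  shows "(\<integral>t. fourier K t * complex_of_real (gauss (s *\<^sub>R t)) \<partial>lborel)
    = complex_of_real (sqrt (2 * pi) ^ CARD('p) * (\<integral>z. K (s *\<^sub>R z) * gauss z \<partial>lborel))"
proof -
  have [measurable]: "K \<in> borel_measurable borel" using borel_measurable_integrable[OF K(1)] by simp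
  have gs: "integrable lborel (\<lambda>t::real^'p. gauss (s *\<^sub>R t))"
    using integrable_lborel_scaleR[OF gauss_measurable _ integrable_gauss, of s 0] s by simp
  define F where "F = (\<lambda>(t, x). cis (- (t \<bullet> x)) * complex_of_real (K x) * complex_of_real (gauss (s *\<^sub>R t)) :: complex)"
  have Fm [measurable]: "F \<in> borel_measurable (lborel \<Otimes>\<^sub>M lborel)"
    unfolding F_def by measurable
  have int: "integrable (lborel \<Otimes>\<^sub>M lborel) F"
  proof (rule lborel_pair.Fubini_integrable[OF Fm])
    have "(\<lambda>t. \<integral>x. norm (F (t, x)) \<partial>lborel) = (\<lambda>t. (\<integral>x. K x \<partial>lborel) * gauss (s *\<^sub>R t))"
      using K(2) by (simp add: F_def norm_mult gauss_nonneg)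
    then show "integrable lborel (\<lambda>t. \<integral>x. norm (F (t, x)) \<partial>lborel)" using gs by simp
    show "AE t in lborel. integrable lborel (\<lambda>x. F (t, x))"
    proof (rule AE_I2)
      fix t :: "real^'p"
      have "integrable lborel (\<lambda>x. K x * gauss (s *\<^sub>R t))" using K(1) by simp
      then show "integrable lborel (\<lambda>x. F (t, x))"
        by (rule Bochner_Integration.integrable_bound) (auto simp: F_def norm_mult)
    qed
  qed
  have "(\<integral>t. fourier K t * complex_of_real (gauss (s *\<^sub>R t)) \<partial>lborel) = (\<integral>t. \<integral>x. F (t, x) \<partial>lborel \<partial>lborel)"
    unfolding fourier_def F_def by simp
  \<comment> \<open>After the exchange the inner integral is the transform of a rescaled Gaussian,
    which is a Gaussian again.\<close>
  also have "\<dots> = (\<integral>x. \<integral>t. F (t, x) \<partial>lborel \<partial>lborel)"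
    using lborel_pair.Fubini_integral[of "\<lambda>t x. F (t, x)"] int by (simp add: case_prod_eta)
  also have "\<dots> = (\<integral>x. complex_of_real (K x * (sqrt (2 * pi) ^ CARD('p) * gauss (x /\<^sub>R s) / s ^ CARD('p))) \<partial>lborel)"
  proof (intro Bochner_Integration.integral_cong refl)
    fix x :: "real^'p"
    have "(\<integral>t. F (t, x) \<partial>lborel) = (\<integral>t. complex_of_real (K x) * (cis (- (t \<bullet> x)) * complex_of_real (gauss (s *\<^sub>R t))) \<partial>lborel)"
      unfolding F_def by (intro Bochner_Integration.integral_cong) auto
    also have "\<dots> = complex_of_real (K x) * complex_of_real (sqrt (2 * pi) ^ DIM(real^'p) * gauss (x /\<^sub>R s) / s ^ DIM(real^'p))"
      unfolding gauss_fourier_scaled[OF s, symmetric] by (rule integral_mult_right_zero)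
    finally show "(\<integral>t. F (t, x) \<partial>lborel)
        = complex_of_real (K x * (sqrt (2 * pi) ^ CARD('p) * gauss (x /\<^sub>R s) / s ^ CARD('p)))" by simp
  qed
  also have "\<dots> = complex_of_real (sqrt (2 * pi) ^ CARD('p) * ((\<integral>x. K x * gauss (x /\<^sub>R s) \<partial>lborel) / s ^ CARD('p)))"
  proof -
    have "K x * (sqrt (2 * pi) ^ CARD('p) * gauss (x /\<^sub>R s) / s ^ CARD('p))
        = (sqrt (2 * pi) ^ CARD('p) / s ^ CARD('p)) * (K x * gauss (x /\<^sub>R s))" for x by simp
    then show ?thesis by (simp only: integral_complex_of_real integral_mult_right_zero) simp
  qed
  also have "(\<integral>x. K x * gauss (x /\<^sub>R s) \<partial>lborel) = s ^ CARD('p) * (\<integral>z. K (s *\<^sub>R z) * gauss z \<partial>lborel)"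
    using integral_lborel_scaleR[of "\<lambda>x. K x * gauss (x /\<^sub>R s)" s 0] s by simp
  finally show ?thesis using s by simp
qed

text \<open>Suppose \<open>K 0\<close> were zero and let the Gaussian in the pairing become flat.
  The side with the transform converges to a positive multiple of the integral of a positive
  function, while by continuity the other side converges to a multiple of \<open>K 0\<close>. This
  is the place where positivity of the transform is used.\<close>

lemma admissible_kernel_pos_0:
  fixes K :: "real^'p \<Rightarrow> real"
  assumes "admissible_kernel K"
  shows "0 < K 0"
proof (rule ccontr)
  have cont: "continuous_on UNIV K" and nn: "\<And>x. 0 \<le> K x" and bd: "bounded (range K)"
    and int: "integrable lborel K" and fpos: "\<And>t. \<exists>r>0. fourier K t = complex_of_real r"
    and fint: "integrable lborel (fourier K)"
    using assms by (auto simp: admissible_kernel_def has_bochner_integral_iff)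
  assume "\<not> 0 < K 0"
  then have K0: "K 0 = 0" using nn[of 0] by simp
  obtain B where B: "\<And>x. \<bar>K x\<bar> \<le> B" using bd unfolding bounded_iff by auto
  have Km [measurable]: "K \<in> borel_measurable borel" by (rule borel_measurable_continuous_onI[OF cont])
  obtain r where r: "\<And>t. r t > 0" "\<And>t. fourier K t = complex_of_real (r t)" using fpos by metis
  have rint: "integrable lborel r"
    using fint unfolding r(2)[abs_def] by (simp add: complex_of_real_integrable_eq)
  have rm [measurable]: "r \<in> borel_measurable borel" using borel_measurable_integrable[OF rint] by simp
  define s where "s n = 1 / (real n + 1)" for n :: nat
  have s: "s n > 0" for n by (simp add: s_def)
  have s0: "s \<longlonglongrightarrow> 0" unfolding s_def by real_asymp
  have s0v: "(\<lambda>n. s n *\<^sub>R x) \<longlonglongrightarrow> 0" for x :: "real^'p" using tendsto_scaleR[OF s0 tendsto_const, of x] by simp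
  have pair: "(\<integral>t. r t * gauss (s n *\<^sub>R t) \<partial>lborel)
      = sqrt (2 * pi) ^ CARD('p) * (\<integral>z. K (s n *\<^sub>R z) * gauss z \<partial>lborel)" for n
  proof -
    have "complex_of_real (\<integral>t. r t * gauss (s n *\<^sub>R t) \<partial>lborel)
        = (\<integral>t. fourier K t * complex_of_real (gauss (s n *\<^sub>R t)) \<partial>lborel)"
      by (simp only: integral_complex_of_real[symmetric] r(2) of_real_mult)
    then show ?thesis unfolding fourier_gauss_pairing[OF int nn s] by (simp only: of_real_eq_iff)
  qed
  have "(\<lambda>n. \<integral>t. r t * gauss (s n *\<^sub>R t) \<partial>lborel) \<longlonglongrightarrow> (\<integral>t. r t * gauss (0::real^'p) \<partial>lborel)"
  proof (rule integral_dominated_convergence[where w = "\<lambda>t. r t * gauss (0::real^'p)"])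
    show "AE t in lborel. (\<lambda>n. r t * gauss (s n *\<^sub>R t)) \<longlonglongrightarrow> r t * gauss (0::real^'p)"
      by (intro AE_I2 tendsto_mult tendsto_const isCont_tendsto_compose[OF isCont_gauss s0v])
    show "AE t in lborel. norm (r t * gauss (s n *\<^sub>R t)) \<le> r t * gauss (0::real^'p)" for n
      using r(1) by (intro AE_I2) (simp add: abs_mult gauss_nonneg gauss_le less_imp_le mult_left_mono)
  qed (use rint in auto)
  then have lim: "(\<lambda>n. sqrt (2 * pi) ^ CARD('p) * (\<integral>z. K (s n *\<^sub>R z) * gauss z \<partial>lborel))
      \<longlonglongrightarrow> (\<integral>t. r t * gauss (0::real^'p) \<partial>lborel)"
    unfolding pair .
  have "(\<lambda>n. \<integral>z. K (s n *\<^sub>R z) * gauss z \<partial>lborel) \<longlonglongrightarrow> (\<integral>z. K 0 * gauss (z::real^'p) \<partial>lborel)"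
  proof (rule integral_dominated_convergence[where w = "\<lambda>z. B * gauss (z::real^'p)"])
    have "isCont K 0" using cont by (simp add: continuous_on_eq_continuous_at)
    then show "AE z in lborel. (\<lambda>n. K (s n *\<^sub>R z) * gauss z) \<longlonglongrightarrow> K 0 * gauss (z::real^'p)"
      by (intro AE_I2 tendsto_mult tendsto_const isCont_tendsto_compose[OF _ s0v])
    show "AE z in lborel. norm (K (s n *\<^sub>R z) * gauss z) \<le> B * gauss (z::real^'p)" for n
      using B by (intro AE_I2) (simp add: abs_mult gauss_nonneg mult_right_mono)
  qed (use integrable_gauss in auto)
  then have "(\<lambda>n. sqrt (2 * pi) ^ CARD('p) * (\<integral>z. K (s n *\<^sub>R z) * gauss z \<partial>lborel)) \<longlonglongrightarrow> sqrt (2 * pi) ^ CARD('p) * 0"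
    by (intro tendsto_mult tendsto_const) (simp add: K0)
  from LIMSEQ_unique[OF lim this] have "(\<integral>t. r t * gauss (0::real^'p) \<partial>lborel) = 0" by simp
  then have "(\<integral>t. r t \<partial>lborel) = 0" using gauss_pos[of "0::real^'p"] by simp
  then have "AE t in lborel. r t = 0"
    using integral_nonneg_eq_0_iff_AE[OF rint] r(1) by (simp add: less_imp_le)
  then have "AE t in (lborel :: (real^'p) measure). False"
    by eventually_elim (metis r(1) less_irrefl)
  then show False by (simp add: ae_filter_eq_bot_iff)
qed

section \<open>The design sample and its density\<close>

locale iid_design = prob_space M for M :: "'a measure" +
  fixes X :: "nat \<Rightarrow> 'a \<Rightarrow> real^'p" and f :: "real^'p \<Rightarrow> real"
  assumes indep: "indep_vars (\<lambda>_. borel) X UNIV"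
    and X_cube: "\<And>i \<omega>. \<omega> \<in> space M \<Longrightarrow> X i \<omega> \<in> ucube"
    and f_cont: "continuous_on ucube f" and f_pos: "\<And>x. x \<in> ucube \<Longrightarrow> 0 < f x"
    and X_dist: "\<And>i. distributed M lborel (X i) (\<lambda>x. ennreal (f x) * indicator ucube x)"
begin

lemma X_measurable [measurable]: "X i \<in> borel_measurable M"
  using distributed_measurable[OF X_dist] by simp

text \<open>The design density on the whole space, zero outside the cube; it is bounded and
  measurable, but it jumps at the boundary.\<close>

definition dens :: "real^'p \<Rightarrow> real" where "dens x = indicator ucube x * f x"

definition fmax :: real where "fmax = (SUP x\<in>ucube. f x)"

definition fmin :: real where "fmin = (INF x\<in>ucube. f x)"

lemma dens_measurable [measurable]: "dens \<in> borel_measurable borel"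
proof -
  have "(\<lambda>x. indicator ucube x *\<^sub>R f x) \<in> borel_measurable borel"
    by (rule borel_measurable_continuous_on_indicator[OF _ f_cont]) simp
  then show ?thesis by (simp add: dens_def[abs_def])
qed

lemma zero_in_ucube: "(0::real^'p) \<in> ucube" by (simp add: mem_box_cart)

lemma f_bounds: "x \<in> ucube \<Longrightarrow> f x \<le> fmax" "x \<in> ucube \<Longrightarrow> fmin \<le> f x" "0 < fmin" "0 < fmax"
proof -
  have bdd: "bounded (f ` ucube)"
    by (intro compact_imp_bounded compact_continuous_image f_cont) simp
  show le: "f x \<le> fmax" if "x \<in> ucube" for x
    unfolding fmax_def using bounded_imp_bdd_above[OF bdd] that by (rule cSUP_upper2) simp
  show "fmin \<le> f x" if "x \<in> ucube" for x
    unfolding fmin_def using bounded_imp_bdd_below[OF bdd] that by (rule cINF_lower2) simp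
  obtain x where x: "x \<in> ucube" "\<And>y. y \<in> ucube \<Longrightarrow> f x \<le> f y"
    using continuous_attains_inf[of ucube f] zero_in_ucube f_cont by fastforce
  have "f x \<le> fmin" unfolding fmin_def by (rule cINF_greatest) (use x zero_in_ucube in auto)
  with f_pos[OF x(1)] show "0 < fmin" by simp
  from le[OF zero_in_ucube] f_pos[OF zero_in_ucube] show "0 < fmax" by simp
qed

lemma dens_bounds: "0 \<le> dens x" "dens x \<le> fmax" "\<bar>dens x\<bar> \<le> fmax"
  using f_bounds f_pos[of x] by (auto simp: dens_def less_imp_le split: split_indicator)

lemma dens_ge: "x \<in> ucube \<Longrightarrow> fmin \<le> dens x"
  using f_bounds by (simp add: dens_def)

lemma X_distributed: "distributed M lborel (X i) (\<lambda>x. ennreal (dens x))"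
proof -
  have "(\<lambda>x. ennreal (dens x)) = (\<lambda>x. ennreal (f x) * indicator ucube x)"
    by (auto simp: dens_def fun_eq_iff split: split_indicator)
  with X_dist[of i] show ?thesis by simp
qed

lemma expectation_X:
  "g \<in> borel_measurable borel \<Longrightarrow> expectation (\<lambda>\<omega>. g (X i \<omega>)) = (\<integral>x. dens x * g x \<partial>lborel)"
  using distributed_integral[OF X_distributed, of g i] dens_bounds(1) by simp

lemma nn_integral_X:
  "g \<in> borel_measurable borel \<Longrightarrow> (\<integral>\<^sup>+\<omega>. g (X i \<omega>) \<partial>M) = (\<integral>\<^sup>+x. ennreal (dens x) * g x \<partial>lborel)"
  using distributed_nn_integral[OF X_distributed, of g i] by simp

lemma integrable_dens: "integrable lborel dens"
  using distributed_integrable[OF X_distributed, of "\<lambda>_. 1" 0] dens_bounds(1) by simp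

lemma integral_dens: "(\<integral>x. dens x \<partial>lborel) = 1"
  using expectation_X[of "\<lambda>_. 1" 0] by (simp add: prob_space)

lemma integrable_dens_mult:
  fixes g :: "real^'p \<Rightarrow> real"
  assumes "integrable lborel g" shows "integrable lborel (\<lambda>x. g x * dens x)"
proof (rule Bochner_Integration.integrable_bound[where f = "\<lambda>x. fmax * g x"])
  show "AE x in lborel. norm (g x * dens x) \<le> norm (fmax * g x)"
  proof (intro AE_I2)
    fix x
    have "\<bar>g x\<bar> * dens x \<le> \<bar>g x\<bar> * fmax" using dens_bounds(2) by (rule mult_left_mono) simp
    then show "norm (g x * dens x) \<le> norm (fmax * g x)"
      using dens_bounds(1)[of x] f_bounds(4) by (simp add: abs_mult mult.commute[of fmax])
  qed
qed (use assms in auto)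

lemma AE_X_notin_null:
  assumes "N \<in> null_sets lborel" shows "AE \<omega> in M. X i \<omega> \<notin> N"
proof -
  have N [measurable]: "N \<in> sets borel" using assms by auto
  have "(\<integral>\<^sup>+\<omega>. indicator N (X i \<omega>) \<partial>M) = (\<integral>\<^sup>+x. ennreal (dens x) * indicator N x \<partial>lborel)"
    by (rule nn_integral_X) simp
  also have "\<dots> = (\<integral>\<^sup>+x. 0 \<partial>(lborel :: (real^'p) measure))"
    by (rule nn_integral_cong_AE) (use AE_not_in[OF assms] in eventually_elim, simp)
  finally have "(\<integral>\<^sup>+\<omega>. indicator N (X i \<omega>) \<partial>M) = 0" by simp
  then have "AE \<omega> in M. indicator N (X i \<omega>) = (0::ennreal)"
    by (subst (asm) nn_integral_0_iff_AE) auto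
  then show ?thesis by eventually_elim (auto split: split_indicator_asm)
qed

text \<open>The boundary of the cube is a null set. This discards the points with a coordinate equal
  to 1, which the half-open bins miss.\<close>

lemma AE_X_less_1: "AE \<omega> in M. \<forall>i l. X i \<omega> $ l < 1"
proof -
  have "AE \<omega> in M. X i \<omega> \<notin> ucube - box 0 1" for i
    by (rule AE_X_notin_null[OF null_sets_cbox_Diff_box])
  then have "AE \<omega> in M. \<forall>i. X i \<omega> \<notin> ucube - box 0 1" by (simp add: AE_all_countable)
  moreover have "AE \<omega> in M. \<forall>i. X i \<omega> \<in> ucube" using X_cube by (intro AE_I2) auto
  ultimately show ?thesis by eventually_elim (auto simp: mem_box_cart)
qed

text \<open>Freezing: by independence the joint law of \<open>X i\<close> and the other design
  points is a product, so a bound valid for each fixed value x of \<open>X i\<close> may be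
  integrated over the law of \<open>X i\<close>. Nonnegative integrals spare any check of
  integrability. The lemma is meant for leave-one-out sums centred at \<open>X i\<close>.\<close>

lemma independent_nn_integral:
  fixes \<Phi> :: "(real^'p) \<times> (nat \<Rightarrow> real^'p) \<Rightarrow> ennreal"
  assumes B: "i \<notin> B" and [measurable]: "\<Phi> \<in> borel_measurable (borel \<Otimes>\<^sub>M PiM B (\<lambda>_. borel))"
    and le: "\<And>x. x \<in> ucube \<Longrightarrow> (\<integral>\<^sup>+\<omega>. \<Phi> (x, \<lambda>j\<in>B. X j \<omega>) \<partial>M) \<le> c x"
    and [measurable]: "c \<in> borel_measurable borel"
  shows "(\<integral>\<^sup>+\<omega>. \<Phi> (X i \<omega>, \<lambda>j\<in>B. X j \<omega>) \<partial>M) \<le> (\<integral>\<^sup>+x. ennreal (dens x) * c x \<partial>lborel)"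
proof -
  have Y [measurable]: "(\<lambda>\<omega>. \<lambda>j\<in>B. X j \<omega>) \<in> measurable M (PiM B (\<lambda>_. borel))" by measurable
  have "indep_var (PiM {i} (\<lambda>_. borel)) (\<lambda>\<omega>. \<lambda>j\<in>{i}. X j \<omega>) (PiM B (\<lambda>_. borel)) (\<lambda>\<omega>. \<lambda>j\<in>B. X j \<omega>)"
    by (rule indep_var_restrict[OF indep]) (use B in auto)
  then have eq: "distr M (PiM {i} (\<lambda>_. borel)) (\<lambda>\<omega>. \<lambda>j\<in>{i}. X j \<omega>) \<Otimes>\<^sub>M distr M (PiM B (\<lambda>_. borel)) (\<lambda>\<omega>. \<lambda>j\<in>B. X j \<omega>)
      = distr M (PiM {i} (\<lambda>_. borel) \<Otimes>\<^sub>M PiM B (\<lambda>_. borel)) (\<lambda>\<omega>. (\<lambda>j\<in>{i}. X j \<omega>, \<lambda>j\<in>B. X j \<omega>))"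
    by (simp add: indep_var_distribution_eq)
  interpret Q: prob_space "distr M (PiM B (\<lambda>_. borel)) (\<lambda>\<omega>. \<lambda>j\<in>B. X j \<omega>)" by (rule prob_space_distr) measurable
  define \<Psi> where "\<Psi> = (\<lambda>(g, y). \<Phi> (g i, y))"
  have \<Psi> [measurable]: "\<Psi> \<in> borel_measurable (PiM {i} (\<lambda>_. borel) \<Otimes>\<^sub>M PiM B (\<lambda>_. borel))"
    unfolding \<Psi>_def by measurable
  have "(\<integral>\<^sup>+\<omega>. \<Phi> (X i \<omega>, \<lambda>j\<in>B. X j \<omega>) \<partial>M) = (\<integral>\<^sup>+\<omega>. \<Psi> (\<lambda>j\<in>{i}. X j \<omega>, \<lambda>j\<in>B. X j \<omega>) \<partial>M)"
    by (simp add: \<Psi>_def)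
  also have "\<dots> = (\<integral>\<^sup>+z. \<Psi> z \<partial>distr M (PiM {i} (\<lambda>_. borel) \<Otimes>\<^sub>M PiM B (\<lambda>_. borel)) (\<lambda>\<omega>. (\<lambda>j\<in>{i}. X j \<omega>, \<lambda>j\<in>B. X j \<omega>)))"
    by (subst nn_integral_distr) measurable
  also have "\<dots> = (\<integral>\<^sup>+g. \<integral>\<^sup>+y. \<Psi> (g, y) \<partial>distr M (PiM B (\<lambda>_. borel)) (\<lambda>\<omega>. \<lambda>j\<in>B. X j \<omega>) \<partial>distr M (PiM {i} (\<lambda>_. borel)) (\<lambda>\<omega>. \<lambda>j\<in>{i}. X j \<omega>))"
    unfolding eq[symmetric] by (rule Q.nn_integral_fst[symmetric]) simp
  also have "\<dots> = (\<integral>\<^sup>+g. \<integral>\<^sup>+\<omega>. \<Psi> (g, \<lambda>j\<in>B. X j \<omega>) \<partial>M \<partial>distr M (PiM {i} (\<lambda>_. borel)) (\<lambda>\<omega>. \<lambda>j\<in>{i}. X j \<omega>))"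
    by (intro nn_integral_cong, subst nn_integral_distr) auto
  also have "\<dots> = (\<integral>\<^sup>+\<omega>. \<integral>\<^sup>+\<omega>'. \<Psi> (\<lambda>j\<in>{i}. X j \<omega>, \<lambda>j\<in>B. X j \<omega>') \<partial>M \<partial>M)"
    by (subst nn_integral_distr) measurable
  also have "\<dots> = (\<integral>\<^sup>+\<omega>. \<integral>\<^sup>+\<omega>'. \<Phi> (X i \<omega>, \<lambda>j\<in>B. X j \<omega>') \<partial>M \<partial>M)"
    by (simp add: \<Psi>_def)
  also have "\<dots> \<le> (\<integral>\<^sup>+\<omega>. c (X i \<omega>) \<partial>M)"
    by (intro nn_integral_mono le X_cube)
  also have "\<dots> = (\<integral>\<^sup>+x. ennreal (dens x) * c x \<partial>lborel)" by (rule nn_integral_X) simp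
  finally show ?thesis .
qed

text \<open>The summands are independent with mean \<open>\<mu>\<close>, so only the diagonal
  remains, and there the variance is at most \<open>b * \<mu>\<close>. Keeping one factor \<mu>
  instead of a second b matters for kernels, where b grows like h^-p while \<mu> stays
  bounded.\<close>

lemma average_second_moment:
  fixes g :: "real^'p \<Rightarrow> real"
  assumes g [measurable]: "g \<in> borel_measurable borel" and gb: "\<And>x. 0 \<le> g x" "\<And>x. g x \<le> b"
    and J: "finite J" "J \<noteq> {}"
  defines "\<mu> \<equiv> \<integral>x. dens x * g x \<partial>lborel"
  shows "expectation (\<lambda>\<omega>. ((\<Sum>j\<in>J. g (X j \<omega>)) / real (card J) - \<mu>)\<^sup>2) \<le> b * \<mu> / real (card J)"
proof -
  have m: "real (card J) > 0" using J by (simp add: card_gt_0_iff)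
  have b0: "0 \<le> b" using gb by (meson order.trans)
  have gi: "integrable M (\<lambda>\<omega>. g (X j \<omega>))" for j
    by (rule integrable_const_bound[where B = b]) (use gb in auto)
  have E: "expectation (\<lambda>\<omega>. g (X j \<omega>)) = \<mu>" for j unfolding \<mu>_def by (rule expectation_X) simp
  define Z where "Z j \<omega> = g (X j \<omega>) - \<mu>" for j \<omega>
  have Zm [measurable]: "Z j \<in> borel_measurable M" for j unfolding Z_def[abs_def] by measurable
  have Zb: "\<bar>Z j \<omega>\<bar> \<le> b + \<bar>\<mu>\<bar>" for j \<omega> using gb[of "X j \<omega>"] by (simp add: Z_def)
  have Zi: "integrable M (Z j)" for j unfolding Z_def[abs_def] using gi by simp
  have ZZ: "integrable M (\<lambda>\<omega>. Z j \<omega> * Z k \<omega>)" for j k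
  proof (rule integrable_const_bound[where B = "(b + \<bar>\<mu>\<bar>) * (b + \<bar>\<mu>\<bar>)"])
    show "AE \<omega> in M. norm (Z j \<omega> * Z k \<omega>) \<le> (b + \<bar>\<mu>\<bar>) * (b + \<bar>\<mu>\<bar>)"
      unfolding real_norm_def abs_mult using Zb b0 by (intro AE_I2 mult_mono) auto
  qed simp
  have EZ: "expectation (Z j) = 0" for j unfolding Z_def[abs_def] using gi E by (simp add: prob_space)
  have off: "expectation (\<lambda>\<omega>. Z j \<omega> * Z k \<omega>) = 0" if "j \<noteq> k" for j k
  proof -
    have "indep_vars (\<lambda>_. borel) (\<lambda>j \<omega>. (\<lambda>x. g x - \<mu>) (X j \<omega>)) {j, k}"
      by (rule indep_vars_compose2[OF indep_vars_subset[OF indep]]) auto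
    then have "indep_vars (\<lambda>_. borel) Z {j, k}" by (simp add: Z_def[abs_def])
    from indep_vars_lebesgue_integral[OF _ this] Zi EZ that show ?thesis by simp
  qed
  have diag: "expectation (\<lambda>\<omega>. Z j \<omega> * Z j \<omega>) \<le> b * \<mu>" for j
  proof -
    have g2: "integrable M (\<lambda>\<omega>. (g (X j \<omega>))\<^sup>2)"
      by (rule integrable_const_bound[where B = "b\<^sup>2"]) (use gb in \<open>auto intro: power_mono\<close>)
    have "expectation (\<lambda>\<omega>. Z j \<omega> * Z j \<omega>) = expectation (\<lambda>\<omega>. (g (X j \<omega>))\<^sup>2 - 2 * \<mu> * g (X j \<omega>) + \<mu>\<^sup>2)"
      by (intro Bochner_Integration.integral_cong) (auto simp: Z_def power2_eq_square algebra_simps)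
    also have "\<dots> = expectation (\<lambda>\<omega>. (g (X j \<omega>))\<^sup>2) - \<mu>\<^sup>2"
      using gi g2 E by (simp add: prob_space power2_eq_square)
    also have "\<dots> \<le> expectation (\<lambda>\<omega>. (g (X j \<omega>))\<^sup>2)" by simp
    also have "\<dots> \<le> expectation (\<lambda>\<omega>. b * g (X j \<omega>))"
      by (intro integral_mono g2 integrable_mult_right gi)
         (use gb in \<open>auto simp: power2_eq_square intro: mult_right_mono\<close>)
    also have "\<dots> = b * \<mu>" using E by simp
    finally show ?thesis .
  qed
  have avg: "(\<Sum>j\<in>J. g (X j \<omega>)) / real (card J) - \<mu> = (\<Sum>j\<in>J. Z j \<omega>) / real (card J)" for \<omega>
    using m by (simp add: Z_def sum_subtractf diff_divide_distrib)
  have "expectation (\<lambda>\<omega>. ((\<Sum>j\<in>J. g (X j \<omega>)) / real (card J) - \<mu>)\<^sup>2)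
      = expectation (\<lambda>\<omega>. (\<Sum>j\<in>J. \<Sum>k\<in>J. Z j \<omega> * Z k \<omega>) / (real (card J))\<^sup>2)"
    unfolding avg by (simp add: power2_eq_square sum_product)
  also have "\<dots> = (\<Sum>j\<in>J. \<Sum>k\<in>J. expectation (\<lambda>\<omega>. Z j \<omega> * Z k \<omega>)) / (real (card J))\<^sup>2"
    using ZZ by (simp add: Bochner_Integration.integral_sum Bochner_Integration.integrable_sum)
  also have "(\<Sum>j\<in>J. \<Sum>k\<in>J. expectation (\<lambda>\<omega>. Z j \<omega> * Z k \<omega>)) = (\<Sum>j\<in>J. expectation (\<lambda>\<omega>. Z j \<omega> * Z j \<omega>))"
  proof (intro sum.cong refl)
    fix j assume "j \<in> J"
    then have "(\<Sum>k\<in>J. expectation (\<lambda>\<omega>. Z j \<omega> * Z k \<omega>)) = expectation (\<lambda>\<omega>. Z j \<omega> * Z j \<omega>)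
        + (\<Sum>k\<in>J - {j}. expectation (\<lambda>\<omega>. Z j \<omega> * Z k \<omega>))" using J by (intro sum.remove) auto
    also have "(\<Sum>k\<in>J - {j}. expectation (\<lambda>\<omega>. Z j \<omega> * Z k \<omega>)) = 0"
      by (intro sum.neutral ballI off) auto
    finally show "(\<Sum>k\<in>J. expectation (\<lambda>\<omega>. Z j \<omega> * Z k \<omega>)) = expectation (\<lambda>\<omega>. Z j \<omega> * Z j \<omega>)" by simp
  qed
  also have "\<dots> / (real (card J))\<^sup>2 \<le> (\<Sum>j\<in>J. b * \<mu>) / (real (card J))\<^sup>2"
    by (intro divide_right_mono sum_mono diag) auto
  also have "\<dots> = b * \<mu> / real (card J)" using m by (simp add: power2_eq_square)
  finally show ?thesis .
qed

end

section \<open>Kernel averages of the design density\<close>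

lemma admissible_kernelD:
  assumes "admissible_kernel K"
  shows "continuous_on UNIV K" "0 \<le> K x" "K (- x) = K x" "K \<in> borel_measurable borel"
    "integrable lborel K" "(\<integral>x. K x \<partial>lborel) = 1" "\<exists>b. \<forall>x. K x \<le> b"
proof -
  show "continuous_on UNIV K" "0 \<le> K x" "K (- x) = K x" "integrable lborel K" "(\<integral>x. K x \<partial>lborel) = 1"
    using assms by (auto simp: admissible_kernel_def has_bochner_integral_iff)
  then show "K \<in> borel_measurable borel" by (intro borel_measurable_continuous_onI)
  have "bounded (range K)" using assms by (simp add: admissible_kernel_def)
  then obtain b where "\<And>x. \<bar>K x\<bar> \<le> b" unfolding bounded_iff by auto
  then show "\<exists>b. \<forall>x. K x \<le> b" by (meson abs_le_D1)
qed

locale kernel_design = iid_design M X f for M :: "'a measure" and X :: "nat \<Rightarrow> 'a \<Rightarrow> real^'p" and f +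
  fixes K :: "real^'p \<Rightarrow> real"
  assumes K: "admissible_kernel K"
begin

lemmas K_nonneg = admissible_kernelD(2)[OF K] and K_sym = admissible_kernelD(3)[OF K]
  and K_measurable [measurable] = admissible_kernelD(4)[OF K] and K_integrable = admissible_kernelD(5)[OF K]
  and K_integral = admissible_kernelD(6)[OF K]

definition Kmax :: real where "Kmax = (SUP x. K x)"

lemma K_le: "K x \<le> Kmax" "0 < Kmax"
proof -
  show le: "K x \<le> Kmax" for x
    unfolding Kmax_def by (rule cSUP_upper) (use admissible_kernelD(7)[OF K] in \<open>auto simp: bdd_above_def\<close>)
  show "0 < Kmax" using le[of 0] admissible_kernel_pos_0[OF K] by simp
qed

definition kern :: "real \<Rightarrow> real^'p \<Rightarrow> real" where
  "kern h u = K (u /\<^sub>R h) / h ^ CARD('p)"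

lemma kern_measurable [measurable]: "kern h \<in> borel_measurable borel"
  unfolding kern_def[abs_def] by measurable

lemma kern_basic:
  assumes "h > 0" shows "0 \<le> kern h u" "kern h (- u) = kern h u" "kern h u \<le> Kmax / h ^ CARD('p)"
  using assms K_nonneg K_sym[of "u /\<^sub>R h"] K_le(1) by (auto simp: kern_def divide_right_mono)

lemma kern_shift:
  assumes h: "h > 0" and g [measurable]: "g \<in> borel_measurable borel"
  shows "(\<integral>y. kern h (y - x) * g y \<partial>lborel) = (\<integral>u. K u * g (x + h *\<^sub>R u) \<partial>lborel)"
proof -
  have "(\<integral>y. kern h (y - x) * g y \<partial>lborel)
      = \<bar>h\<bar> ^ DIM(real^'p) *\<^sub>R (\<integral>u. kern h (x + h *\<^sub>R u - x) * g (x + h *\<^sub>R u) \<partial>lborel)"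
    by (rule integral_lborel_scaleR) (use h in auto)
  also have "\<dots> = (\<integral>u. h ^ CARD('p) * (kern h (x + h *\<^sub>R u - x) * g (x + h *\<^sub>R u)) \<partial>lborel)"
    using h by simp
  also have "\<dots> = (\<integral>u. K u * g (x + h *\<^sub>R u) \<partial>lborel)"
    using h by (intro Bochner_Integration.integral_cong) (auto simp: kern_def)
  finally show ?thesis .
qed

lemma kern_integrable:
  assumes h: "h > 0" shows "integrable lborel (\<lambda>y. kern h (y - x))"
proof -
  have "integrable lborel (\<lambda>y. K (- (1/h) *\<^sub>R x + (1/h) *\<^sub>R y))"
    using h K_integrable by (intro integrable_lborel_scaleR) auto
  then have "integrable lborel (\<lambda>y. K (- (1/h) *\<^sub>R x + (1/h) *\<^sub>R y) / h ^ CARD('p))" by simp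
  moreover have "(- (1/h) *\<^sub>R x + (1/h) *\<^sub>R y) = (y - x) /\<^sub>R h" for y
    by (simp add: scaleR_diff_right divide_inverse)
  ultimately show ?thesis by (simp add: kern_def)
qed

text \<open>The mean of the leave-one-out density estimate at a fixed point x; by symmetry of the
  kernel, the design density convolved with the rescaled kernel.\<close>

definition smooth :: "real \<Rightarrow> real^'p \<Rightarrow> real" where
  "smooth h x = (\<integral>y. dens y * kern h (y - x) \<partial>lborel)"

lemma smooth_alt: "h > 0 \<Longrightarrow> smooth h x = (\<integral>u. K u * dens (x + h *\<^sub>R u) \<partial>lborel)"
  using kern_shift[of h dens x] by (simp add: smooth_def mult.commute)

lemma smooth_measurable [measurable]: "smooth h \<in> borel_measurable borel"
  unfolding smooth_def[abs_def] by measurable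

lemma smooth_bounds:
  assumes h: "h > 0" shows "0 \<le> smooth h x" "smooth h x \<le> fmax"
proof -
  show "0 \<le> smooth h x" unfolding smooth_def
    using dens_bounds kern_basic[OF h] by (intro integral_nonneg_AE AE_I2) simp
  have "smooth h x \<le> (\<integral>u. K u * fmax \<partial>lborel)" unfolding smooth_alt[OF h]
  proof (rule integral_mono)
    show "integrable lborel (\<lambda>u. K u * fmax)" using K_integrable by simp
    then show "integrable lborel (\<lambda>u. K u * dens (x + h *\<^sub>R u))"
    proof (rule Bochner_Integration.integrable_bound)
      show "AE u in lborel. norm (K u * dens (x + h *\<^sub>R u)) \<le> norm (K u * fmax)"
        using dens_bounds f_bounds(4) K_nonneg by (intro AE_I2) (simp add: abs_mult mult_left_mono)
    qed measurable
    show "K u * dens (x + h *\<^sub>R u) \<le> K u * fmax" for u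
      using dens_bounds K_nonneg by (intro mult_left_mono) auto
  qed
  also have "\<dots> = fmax" using K_integral by simp
  finally show "smooth h x \<le> fmax" .
qed

text \<open>Every point of the cube is a vertex of a subcube with side proportional to \<open>h\<close>, on which the
  kernel is bounded below since \<open>K 0 > 0\<close>; this controls the boundary.\<close>
lemma smooth_lower_bound:
  obtains c h1 where "c > 0" "h1 > 0" "\<And>h x. 0 < h \<Longrightarrow> h \<le> h1 \<Longrightarrow> x \<in> ucube \<Longrightarrow> c \<le> smooth h x"
proof -
  have K0: "0 < K 0" by (rule admissible_kernel_pos_0[OF K])
  have "isCont K 0" using admissible_kernelD(1)[OF K] by (simp add: continuous_on_eq_continuous_at)
  then obtain d where "d > 0" "\<And>u. dist u 0 < d \<Longrightarrow> dist (K u) (K 0) < K 0 / 2"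
    unfolding continuous_at_eps_delta using half_gt_zero[OF K0] by blast
  then have d: "d > 0" "\<And>u. norm u < d \<Longrightarrow> dist (K u) (K 0) < K 0 / 2" by simp_all
  \<comment> \<open>A vector with all coordinates at most \<rho> in absolute value has norm at most
    \<open>CARD('p)\<close> times \<rho>, that is d/2, so the kernel is at least half of
    \<open>K 0\<close> there.\<close>
  define \<rho> where "\<rho> = d / (2 * real CARD('p))"
  have \<rho>: "\<rho> > 0" using d by (simp add: \<rho>_def)
  have Klow: "K 0 / 2 \<le> K u" if "\<And>l. \<bar>u $ l\<bar> \<le> \<rho>" for u :: "real^'p"
  proof -
    have "norm u \<le> (\<Sum>l\<in>UNIV. \<bar>u $ l\<bar>)" by (rule norm_le_l1_cart)
    also have "\<dots> \<le> (\<Sum>l\<in>(UNIV::'p set). \<rho>)" by (intro sum_mono that)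
    also have "\<dots> < d" using d(1) by (simp add: \<rho>_def)
    finally have "dist (K u) (K 0) < K 0 / 2" by (rule d(2))
    then show ?thesis unfolding dist_real_def by linarith
  qed
  \<comment> \<open>The volume of the subcube is (\<rho> h)^p, and its power of h cancels the
    normalisation of the kernel.\<close>
  define c where "c = fmin * (K 0 / 2) * \<rho> ^ CARD('p)"
  define h1 where "h1 = 1 / (2 * \<rho>)"
  have "c \<le> smooth h x" if h: "0 < h" "h \<le> h1" and x: "x \<in> ucube" for h x
  proof -
    have \<rho>h: "\<rho> * h \<le> 1 / 2" using h(2) \<rho> by (simp add: h1_def field_simps)
    have x01: "0 \<le> x $ l" "x $ l \<le> 1" for l using x by (auto simp: mem_box_cart)
    \<comment> \<open>In each coordinate the box extends from x away from the nearer face of the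
      cube; since its side is at most 1/2, it stays inside.\<close>
    define a :: "real^'p" where "a = (\<chi> l. if x $ l \<le> 1/2 then x $ l else x $ l - \<rho> * h)"
    define v :: "real^'p" where "v = (\<chi> l. \<rho> * h)"
    define B where "B = cbox a (a + v)"
    have v: "v $ l = \<rho> * h" "b \<in> Basis \<Longrightarrow> v \<bullet> b = \<rho> * h" for l b
      by (auto simp: v_def Basis_vec_def inner_axis)
    have mB: "a $ l \<le> y $ l \<and> y $ l \<le> a $ l + \<rho> * h" if "y \<in> B" for y l
      using that by (auto simp: B_def mem_box_cart v)
    have Bsub: "B \<subseteq> ucube"
    proof
      fix y assume y: "y \<in> B"
      have "0 \<le> y $ l \<and> y $ l \<le> 1" for l
        using mB[OF y, of l] x01[of l] \<rho>h h(1) \<rho> by (auto simp: a_def split: if_splits)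
      then show "y \<in> ucube" by (simp add: mem_box_cart)
    qed
    have Bm: "measure lborel B = (\<rho> * h) ^ CARD('p)"
    proof -
      have "emeasure lborel B = ennreal (\<Prod>b\<in>(Basis::(real^'p) set). (a + v - a) \<bullet> b)"
        unfolding B_def using h \<rho> by (intro emeasure_lborel_cbox) (simp add: inner_add_left v)
      also have "(\<Prod>b\<in>(Basis::(real^'p) set). (a + v - a) \<bullet> b) = (\<rho> * h) ^ CARD('p)"
        by (simp add: v)
      finally show ?thesis using h \<rho> by (simp add: measure_def)
    qed
    have Kern: "K 0 / 2 / h ^ CARD('p) \<le> kern h (y - x)" if y: "y \<in> B" for y
    proof -
      have "\<bar>((y - x) /\<^sub>R h) $ l\<bar> \<le> \<rho>" for l
      proof -
        have "\<bar>y $ l - x $ l\<bar> \<le> \<rho> * h"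
          using mB[OF y, of l] h(1) \<rho> by (auto simp: a_def split: if_splits)
        then show ?thesis using h(1) by (simp add: abs_mult divide_inverse[symmetric] field_simps)
      qed
      from Klow[OF this] show ?thesis unfolding kern_def using h(1) by (intro divide_right_mono) auto
    qed
    have "c = (\<integral>y. indicator B y * (fmin * (K 0 / 2 / h ^ CARD('p))) \<partial>lborel)"
      using h(1) Bm by (simp add: c_def power_mult_distrib)
    also have "\<dots> \<le> smooth h x" unfolding smooth_def
    proof (rule integral_mono)
      have "emeasure lborel B < \<infinity>" unfolding B_def by (rule emeasure_lborel_cbox_finite)
      then show "integrable lborel (\<lambda>y. indicator B y * (fmin * (K 0 / 2 / h ^ CARD('p))))"
        by (intro integrable_mult_left) (simp add: B_def)
      show "integrable lborel (\<lambda>y. dens y * kern h (y - x))"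
        using integrable_dens_mult[OF kern_integrable[OF h(1), of x]] by (simp add: mult.commute)
      show "indicator B y * (fmin * (K 0 / 2 / h ^ CARD('p))) \<le> dens y * kern h (y - x)" for y
      proof (cases "y \<in> B")
        case True
        then have "fmin * (K 0 / 2 / h ^ CARD('p)) \<le> dens y * kern h (y - x)"
          using Bsub K0 h(1) by (intro mult_mono dens_ge Kern dens_bounds) auto
        with True show ?thesis by simp
      next
        case False
        then show ?thesis using dens_bounds(1) kern_basic(1)[OF h(1)] by simp
      qed
    qed
    finally show ?thesis .
  qed
  moreover have "c > 0" using f_bounds(3) K0 \<rho> by (simp add: c_def)
  moreover have "h1 > 0" using \<rho> by (simp add: h1_def)
  ultimately show thesis using that[of c h1] by blast
qed

text \<open>At interior points the density is continuous and dominated convergence gives pointwise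
  convergence; the boundary is a null set. Near the boundary part of the kernel mass falls outside
  the cube, so uniform convergence cannot be expected and the error is measured in mean.\<close>

lemma smooth_bias:
  assumes h: "\<And>n. h n > 0" and h0: "h \<longlonglongrightarrow> 0"
  shows "(\<lambda>n. \<integral>x. dens x * \<bar>smooth (h n) x - dens x\<bar> \<partial>lborel) \<longlonglongrightarrow> 0"
proof -
  have lim: "(\<lambda>n. smooth (h n) x) \<longlonglongrightarrow> dens x" if x: "x \<in> box 0 1" for x
  proof -
    have "isCont dens x"
    proof -
      have "continuous_on (box 0 1) f" by (rule continuous_on_subset[OF f_cont box_subset_cbox])
      then have "isCont f x" using x by (simp add: continuous_on_eq_continuous_at[OF open_box])
      moreover have "\<forall>\<^sub>F y in nhds x. f y = dens y"
        using eventually_nhds_in_open[OF open_box x]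
        by eventually_elim (use subsetD[OF box_subset_cbox[of "0::real^'p" 1]] in \<open>simp add: dens_def\<close>)
      ultimately show ?thesis by (simp add: isCont_cong)
    qed
    then have "(\<lambda>n. dens (x + h n *\<^sub>R u)) \<longlonglongrightarrow> dens x" for u
      by (rule isCont_tendsto_compose)
         (use tendsto_add[OF tendsto_const tendsto_scaleR[OF h0 tendsto_const], of x u] in simp)
    note this [tendsto_intros]
    have "(\<lambda>n. \<integral>u. K u * dens (x + h n *\<^sub>R u) \<partial>lborel) \<longlonglongrightarrow> (\<integral>u. K u * dens x \<partial>lborel)"
    proof (rule integral_dominated_convergence[where w = "\<lambda>u. K u * fmax"])
      show "AE u in lborel. (\<lambda>n. K u * dens (x + h n *\<^sub>R u)) \<longlonglongrightarrow> K u * dens x"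
        by (intro AE_I2 tendsto_intros)
      show "AE u in lborel. norm (K u * dens (x + h n *\<^sub>R u)) \<le> K u * fmax" for n
        using dens_bounds K_nonneg by (intro AE_I2) (simp add: abs_mult mult_left_mono)
    qed (use K_integrable in auto)
    then show ?thesis using K_integral by (simp add: smooth_alt[OF h])
  qed
  have "(\<lambda>n. \<integral>x. dens x * \<bar>smooth (h n) x - dens x\<bar> \<partial>lborel) \<longlonglongrightarrow> (\<integral>x. (0::real) \<partial>(lborel :: (real^'p) measure))"
  proof (rule integral_dominated_convergence[where w = "\<lambda>x. dens x * (2 * fmax)"])
    show "AE x in lborel. (\<lambda>n. dens x * \<bar>smooth (h n) x - dens x\<bar>) \<longlonglongrightarrow> 0"
      using AE_not_in[OF null_sets_cbox_Diff_box[of "0::real^'p" 1]]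
    proof eventually_elim
      case (elim x)
      show ?case
      proof (cases "x \<in> box 0 1")
        case True
        from tendsto_mult[OF tendsto_const tendsto_rabs[OF tendsto_diff[OF lim[OF True] tendsto_const]], of "dens x" "dens x"]
        show ?thesis by simp
      next
        case False
        with elim have "dens x = 0" by (simp add: dens_def)
        then show ?thesis by simp
      qed
    qed
    show "AE x in lborel. norm (dens x * \<bar>smooth (h n) x - dens x\<bar>) \<le> dens x * (2 * fmax)" for n
    proof (rule AE_I2)
      fix x show "norm (dens x * \<bar>smooth (h n) x - dens x\<bar>) \<le> dens x * (2 * fmax)"
        using dens_bounds[of x] smooth_bounds[OF h, of n x] f_bounds(4)
        by (auto simp: abs_mult intro!: mult_left_mono)
    qed
    show "integrable lborel (\<lambda>x. dens x * (2 * fmax))" using integrable_dens by simp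
  qed auto
  then show ?thesis by simp
qed

definition tail :: "real \<Rightarrow> real" where
  "tail R = (\<integral>u. K u * indicator {u. R < norm u} u \<partial>lborel)"

lemma tail_tendsto_0:
  assumes "filterlim R at_top sequentially" shows "(\<lambda>n. tail (R n)) \<longlonglongrightarrow> 0"
proof -
  have "(\<lambda>n. \<integral>u. K u * indicator {u. R n < norm u} u \<partial>lborel) \<longlonglongrightarrow> (\<integral>u. (0::real) \<partial>(lborel :: (real^'p) measure))"
  proof (rule integral_dominated_convergence[where w = K])
    show "AE u in lborel. (\<lambda>n. K u * indicator {u. R n < norm u} u) \<longlonglongrightarrow> 0"
    proof (rule AE_I2)
      fix u :: "real^'p"
      have "\<forall>\<^sub>F n in sequentially. norm u \<le> R n"
        using assms by (simp add: filterlim_at_top)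
      then have "\<forall>\<^sub>F n in sequentially. K u * indicator {u. R n < norm u} u = 0"
        by eventually_elim simp
      then show "(\<lambda>n. K u * indicator {u. R n < norm u} u) \<longlonglongrightarrow> 0" by (rule tendsto_eventually)
    qed
    show "AE u in lborel. norm (K u * indicator {u. R n < norm u} u) \<le> K u" for n
      using K_nonneg by (intro AE_I2) (auto split: split_indicator)
  qed (use K_integrable in auto)
  then show ?thesis by (simp add: tail_def)
qed

text \<open>In the variable u = (y - x) / h the far region becomes norm u > \<eta> / h, so the mean
  is at most the kernel mass there times the bound on the density, uniformly in the position of
  \<open>X i\<close>.\<close>

lemma expectation_far:
  assumes h: "h > 0" and ij: "i \<noteq> j"
  shows "expectation (\<lambda>\<omega>. kern h (X j \<omega> - X i \<omega>) * indicator {u. \<eta> < norm u} (X j \<omega> - X i \<omega>)) \<le> fmax * tail (\<eta> / h)"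
proof -
  define \<Phi> where "\<Phi> = (\<lambda>(x, y :: nat \<Rightarrow> real^'p). ennreal (kern h (y j - x) * indicator {u. \<eta> < norm u} (y j - x)))"
  have \<Phi> [measurable]: "\<Phi> \<in> borel_measurable (borel \<Otimes>\<^sub>M PiM {j} (\<lambda>_. borel))" unfolding \<Phi>_def by measurable
  have t0: "0 \<le> tail (\<eta> / h)" unfolding tail_def using K_nonneg by (intro integral_nonneg_AE AE_I2) simp
  have "(\<integral>\<^sup>+\<omega>. \<Phi> (X i \<omega>, \<lambda>j\<in>{j}. X j \<omega>) \<partial>M) \<le> (\<integral>\<^sup>+x. ennreal (dens x) * ennreal (fmax * tail (\<eta> / h)) \<partial>lborel)"
  proof (rule independent_nn_integral[OF _ \<Phi>])
    fix x :: "real^'p" assume "x \<in> ucube"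
    have intK: "integrable lborel (\<lambda>u. K u * indicator {u. \<eta> / h < norm u} u)"
      using K_integrable by (rule Bochner_Integration.integrable_bound) (auto split: split_indicator)
    have "(\<integral>\<^sup>+\<omega>. \<Phi> (x, \<lambda>j\<in>{j}. X j \<omega>) \<partial>M)
        = (\<integral>\<^sup>+\<omega>. ennreal (kern h (X j \<omega> - x) * indicator {u. \<eta> < norm u} (X j \<omega> - x)) \<partial>M)"
      by (simp add: \<Phi>_def)
    also have "\<dots> = ennreal (expectation (\<lambda>\<omega>. kern h (X j \<omega> - x) * indicator {u. \<eta> < norm u} (X j \<omega> - x)))"
      using kern_basic[OF h] order.trans[OF kern_basic(1,3)[OF h]]
      by (intro nn_integral_eq_integral integrable_const_bound[where B = "Kmax / h ^ CARD('p)"])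
         (auto split: split_indicator)
    finally have eq: "(\<integral>\<^sup>+\<omega>. \<Phi> (x, \<lambda>j\<in>{j}. X j \<omega>) \<partial>M)
      = ennreal (expectation (\<lambda>\<omega>. kern h (X j \<omega> - x) * indicator {u. \<eta> < norm u} (X j \<omega> - x)))" .
    have "expectation (\<lambda>\<omega>. kern h (X j \<omega> - x) * indicator {u. \<eta> < norm u} (X j \<omega> - x))
        = (\<integral>y. dens y * (kern h (y - x) * indicator {u. \<eta> < norm u} (y - x)) \<partial>lborel)"
      by (rule expectation_X) measurable
    also have "\<dots> = (\<integral>y. kern h (y - x) * (dens y * indicator {u. \<eta> < norm u} (y - x)) \<partial>lborel)"
      by (simp add: mult_ac)
    also have "\<dots> = (\<integral>u. K u * (dens (x + h *\<^sub>R u) * indicator {u. \<eta> < norm u} (x + h *\<^sub>R u - x)) \<partial>lborel)"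
      by (rule kern_shift[OF h]) measurable
    also have "\<dots> \<le> (\<integral>u. fmax * (K u * indicator {u. \<eta> / h < norm u} u) \<partial>lborel)"
    proof (rule integral_mono')
      show "integrable lborel (\<lambda>u. fmax * (K u * indicator {u. \<eta> / h < norm u} u))" using intK by simp
      have "\<eta> < norm (h *\<^sub>R u) \<longleftrightarrow> \<eta> / h < norm u" for u :: "real^'p"
        using h by (simp add: field_simps)
      then show "K u * (dens (x + h *\<^sub>R u) * indicator {u. \<eta> < norm u} (x + h *\<^sub>R u - x))
          \<le> fmax * (K u * indicator {u. \<eta> / h < norm u} u)" for u
        using mult_left_mono[OF dens_bounds(2)[of "x + h *\<^sub>R u"] K_nonneg[of u]]
        by (auto split: split_indicator simp: mult.commute)
      show "0 \<le> fmax * (K u * indicator {u. \<eta> / h < norm u} u)" for u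
        using f_bounds(4) K_nonneg by simp
    qed
    also have "\<dots> = fmax * tail (\<eta> / h)" by (simp add: tail_def)
    finally show "(\<integral>\<^sup>+\<omega>. \<Phi> (x, \<lambda>j\<in>{j}. X j \<omega>) \<partial>M) \<le> ennreal (fmax * tail (\<eta> / h))"
      unfolding eq by (rule ennreal_leI)
  qed (use ij in auto)
  also have "\<dots> = ennreal (fmax * tail (\<eta> / h))"
    using integral_dens integrable_dens dens_bounds(1)
    by (simp add: nn_integral_multc nn_integral_eq_integral)
  finally have "(\<integral>\<^sup>+\<omega>. ennreal (kern h (X j \<omega> - X i \<omega>) * indicator {u. \<eta> < norm u} (X j \<omega> - X i \<omega>)) \<partial>M)
      \<le> ennreal (fmax * tail (\<eta> / h))" by (simp add: \<Phi>_def)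
  then show ?thesis
    using t0 f_bounds(4) kern_basic(1)[OF h]
    by (intro integral_real_bounded) simp_all
qed

definition fhat :: "nat \<Rightarrow> real \<Rightarrow> nat \<Rightarrow> 'a \<Rightarrow> real" where
  "fhat n h i \<omega> = loo_density K n h (\<lambda>i. X i \<omega>) i"

lemma fhat_alt: "fhat n h i \<omega> = (\<Sum>j\<in>{..<n}-{i}. kern h (X j \<omega> - X i \<omega>)) / (real n - 1)"
  by (simp add: fhat_def loo_density_def scaled_kernel_def kern_def sum_divide_distrib sum_distrib_left mult.commute)

lemma fhat_measurable [measurable]: "fhat n h i \<in> borel_measurable M"
  unfolding fhat_alt[abs_def] by measurable

text \<open>For a frozen value x of \<open>X i\<close> the estimate is an average of n - 1
  independent kernel values between 0 and \<open>Kmax / h ^ CARD('p)\<close> with mean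
  \<open>smooth h x\<close>, so the bound for averages applies.\<close>

lemma fhat_variance:
  assumes h: "h > 0" and i: "i < n" and n: "n \<ge> 2"
  shows "integrable M (\<lambda>\<omega>. (fhat n h i \<omega> - smooth h (X i \<omega>))\<^sup>2)"
    "expectation (\<lambda>\<omega>. (fhat n h i \<omega> - smooth h (X i \<omega>))\<^sup>2) \<le> Kmax * fmax / (h ^ CARD('p) * (real n - 1))"
proof -
  let ?B = "{..<n} - {i}" and ?c = "Kmax * fmax / (h ^ CARD('p) * (real n - 1))"
  have card: "real (card ?B) = real n - 1" using i by simp
  have ne: "?B \<noteq> {}" using card n by (metis card.empty diff_gt_0_iff_gt less_numeral_extra(3) nat_less_real_le of_nat_0 of_nat_1 one_less_numeral_iff order_less_le_trans semiring_norm(76) of_nat_less_iff)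
  have restr: "(\<Sum>j\<in>?B. kern h ((\<lambda>j\<in>?B. X j \<omega>) j - x)) = (\<Sum>j\<in>?B. kern h (X j \<omega> - x))" for \<omega> x
    by (intro sum.cong) auto
  define \<Phi> where "\<Phi> = (\<lambda>(x, y :: nat \<Rightarrow> real^'p). ennreal (((\<Sum>j\<in>?B. kern h (y j - x)) / (real n - 1) - smooth h x)\<^sup>2))"
  have \<Phi> [measurable]: "\<Phi> \<in> borel_measurable (borel \<Otimes>\<^sub>M PiM ?B (\<lambda>_. borel))" unfolding \<Phi>_def by measurable
  define b where "b = Kmax / h ^ CARD('p)"
  have bd: "0 \<le> kern h u" "kern h u \<le> b" for u unfolding b_def by (rule kern_basic[OF h])+
  have b0: "0 \<le> b" using bd[of 0] by simp
  have avgb: "0 \<le> (\<Sum>j\<in>?B. kern h (y j - x)) / (real n - 1) \<and> (\<Sum>j\<in>?B. kern h (y j - x)) / (real n - 1) \<le> b"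
    for x and y :: "nat \<Rightarrow> real^'p"
  proof
    show "0 \<le> (\<Sum>j\<in>?B. kern h (y j - x)) / (real n - 1)"
      using bd n by (intro divide_nonneg_nonneg sum_nonneg) auto
    have "(\<Sum>j\<in>?B. kern h (y j - x)) \<le> real (card ?B) * b" by (rule sum_bounded_above) (rule bd)
    then show "(\<Sum>j\<in>?B. kern h (y j - x)) / (real n - 1) \<le> b"
      using n card by (simp add: pos_divide_le_eq mult.commute)
  qed
  have sqb: "((\<Sum>j\<in>?B. kern h (y j - x)) / (real n - 1) - smooth h x)\<^sup>2 \<le> (b + fmax)\<^sup>2" for x and y :: "nat \<Rightarrow> real^'p"
    using avgb[of y x] smooth_bounds[OF h, of x] f_bounds(4) b0
    by (intro abs_le_square_iff[THEN iffD1]) (auto simp: abs_le_iff)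
  have "(\<integral>\<^sup>+\<omega>. \<Phi> (X i \<omega>, \<lambda>j\<in>?B. X j \<omega>) \<partial>M) \<le> (\<integral>\<^sup>+x. ennreal (dens x) * ennreal ?c \<partial>lborel)"
  proof (rule independent_nn_integral[OF _ \<Phi>])
    fix x :: "real^'p"
    have "(\<integral>\<^sup>+\<omega>. \<Phi> (x, \<lambda>j\<in>?B. X j \<omega>) \<partial>M)
        = (\<integral>\<^sup>+\<omega>. ennreal (((\<Sum>j\<in>?B. kern h (X j \<omega> - x)) / (real n - 1) - smooth h x)\<^sup>2) \<partial>M)"
      by (simp only: \<Phi>_def restr case_prod_conv)
    also have "\<dots> = ennreal (expectation (\<lambda>\<omega>. ((\<Sum>j\<in>?B. kern h (X j \<omega> - x)) / (real n - 1) - smooth h x)\<^sup>2))"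
      using sqb[of _ x]
      by (intro nn_integral_eq_integral integrable_const_bound[where B = "(b + fmax)\<^sup>2"]) auto
    finally have eq: "(\<integral>\<^sup>+\<omega>. \<Phi> (x, \<lambda>j\<in>?B. X j \<omega>) \<partial>M)
      = ennreal (expectation (\<lambda>\<omega>. ((\<Sum>j\<in>?B. kern h (X j \<omega> - x)) / (real n - 1) - smooth h x)\<^sup>2))" .
    have "expectation (\<lambda>\<omega>. ((\<Sum>j\<in>?B. kern h (X j \<omega> - x)) / (real n - 1) - smooth h x)\<^sup>2)
        \<le> b * smooth h x / (real n - 1)"
      using average_second_moment[of "\<lambda>y. kern h (y - x)" b ?B] bd ne unfolding card smooth_def by simp
    also have "\<dots> \<le> b * fmax / (real n - 1)"
      using smooth_bounds[OF h, of x] b0 n by (intro divide_right_mono mult_left_mono) auto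
    also have "\<dots> = ?c" by (simp add: b_def)
    finally show "(\<integral>\<^sup>+\<omega>. \<Phi> (x, \<lambda>j\<in>?B. X j \<omega>) \<partial>M) \<le> ennreal ?c"
      unfolding eq by (rule ennreal_leI)
  qed auto
  also have "\<dots> = ennreal ?c"
    using integral_dens integrable_dens dens_bounds(1)
    by (simp add: nn_integral_multc nn_integral_eq_integral)
  finally have *: "(\<integral>\<^sup>+\<omega>. ennreal ((fhat n h i \<omega> - smooth h (X i \<omega>))\<^sup>2) \<partial>M) \<le> ennreal ?c"
    by (simp only: \<Phi>_def fhat_alt restr case_prod_conv)
  show "integrable M (\<lambda>\<omega>. (fhat n h i \<omega> - smooth h (X i \<omega>))\<^sup>2)"
    using sqb[of "\<lambda>j. X j _" "X i _"]
    by (intro integrable_const_bound[where B = "(b + fmax)\<^sup>2"]) (auto simp: fhat_alt)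
  have "0 \<le> ?c" using h n f_bounds(4) K_le(2) by simp
  with * show "expectation (\<lambda>\<omega>. (fhat n h i \<omega> - smooth h (X i \<omega>))\<^sup>2) \<le> ?c"
    by (intro integral_real_bounded) simp_all
qed

end

section \<open>Symmetrically normalised kernel matrices\<close>

lemma quadratic_form_bound:
  fixes w :: "nat \<Rightarrow> nat \<Rightarrow> real"
  assumes "\<And>u. (\<Sum>i<n. (\<Sum>j<n. w i j * u j)\<^sup>2) \<le> C\<^sup>2 * (\<Sum>i<n. (u i)\<^sup>2)" "C \<ge> 0"
  shows "\<bar>\<Sum>i<n. u i * (\<Sum>j<n. w i j * v j)\<bar> \<le> C * sqrt (\<Sum>i<n. (u i)\<^sup>2) * sqrt (\<Sum>i<n. (v i)\<^sup>2)"
proof -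
  have "\<bar>\<Sum>i<n. u i * (\<Sum>j<n. w i j * v j)\<bar> \<le> sqrt (\<Sum>i<n. (u i)\<^sup>2) * sqrt (\<Sum>i<n. (\<Sum>j<n. w i j * v j)\<^sup>2)"
  proof -
    have "(\<Sum>i<n. u i * (\<Sum>j<n. w i j * v j))\<^sup>2 \<le> (\<Sum>i<n. (u i)\<^sup>2) * (\<Sum>i<n. (\<Sum>j<n. w i j * v j)\<^sup>2)"
      by (rule Cauchy_Schwarz_ineq_sum)
    then have "sqrt ((\<Sum>i<n. u i * (\<Sum>j<n. w i j * v j))\<^sup>2) \<le> sqrt ((\<Sum>i<n. (u i)\<^sup>2) * (\<Sum>i<n. (\<Sum>j<n. w i j * v j)\<^sup>2))"
      by (rule real_sqrt_le_mono)
    then show ?thesis by (simp add: real_sqrt_mult)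
  qed
  also have "\<dots> \<le> sqrt (\<Sum>i<n. (u i)\<^sup>2) * sqrt (C\<^sup>2 * (\<Sum>i<n. (v i)\<^sup>2))"
    by (intro mult_left_mono real_sqrt_le_mono assms(1)) (simp add: sum_nonneg)
  also have "\<dots> = C * sqrt (\<Sum>i<n. (u i)\<^sup>2) * sqrt (\<Sum>i<n. (v i)\<^sup>2)"
    using assms(2) by (simp add: real_sqrt_mult)
  finally show ?thesis .
qed

lemma sum_sq_le_of_bound:
  fixes u :: "nat \<Rightarrow> real"
  assumes "\<And>i. i < n \<Longrightarrow> \<bar>u i\<bar> \<le> B" "B \<ge> 0" shows "sqrt (\<Sum>i<n. (u i)\<^sup>2) \<le> sqrt (real n) * B"
proof -
  have "(\<Sum>i<n. (u i)\<^sup>2) \<le> (\<Sum>i<n. B\<^sup>2)"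
  proof (rule sum_mono)
    fix i assume "i \<in> {..<n}"
    then show "(u i)\<^sup>2 \<le> B\<^sup>2" using assms(1)[of i] by (intro abs_le_square_iff[THEN iffD1]) auto
  qed
  then have "sqrt (\<Sum>i<n. (u i)\<^sup>2) \<le> sqrt (real n * B\<^sup>2)" by (intro real_sqrt_le_mono) simp
  then show ?thesis using assms(2) by (simp add: real_sqrt_mult)
qed

text \<open>The kernel matrix scaled from both sides by the inverse square roots of its row sums,
  with the design held fixed. Row sums may vanish; the quotient is then 0 by convention, in
  agreement with 0 / 0 = 0 in the weights.\<close>

locale normalized_kernel =
  fixes n :: nat and k :: "nat \<Rightarrow> nat \<Rightarrow> real" and f :: "nat \<Rightarrow> real" and w :: "nat \<Rightarrow> nat \<Rightarrow> real"
  assumes k_nonneg: "\<And>i j. 0 \<le> k i j" and k_sym: "\<And>i j. k i j = k j i"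
    and f_def: "\<And>i. i < n \<Longrightarrow> f i = (\<Sum>j<n. k i j)"
    and w_def: "\<And>i j. i < n \<Longrightarrow> j < n \<Longrightarrow> w i j = k i j / sqrt (f i * f j)"
begin

lemma f_nonneg: "i < n \<Longrightarrow> 0 \<le> f i" by (simp add: f_def sum_nonneg k_nonneg)

lemma k_le_f: "i < n \<Longrightarrow> j < n \<Longrightarrow> k i j \<le> f i"
  unfolding f_def by (intro member_le_sum) (auto simp: k_nonneg)

lemma w_sym: "i < n \<Longrightarrow> j < n \<Longrightarrow> w i j = w j i"
  by (simp add: w_def k_sym mult.commute)

text \<open>Schur test: the weights \<open>k i j / f i\<close> of row i sum to 1, so Cauchy-Schwarz
  bounds the square of the i-th entry by the sum of \<open>k i j * (u j)\<^sup>2 / f j\<close> over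
  j; summing over i uses symmetry of \<open>k\<close> and cancels \<open>f j\<close>.\<close>

lemma contraction: "(\<Sum>i<n. (\<Sum>j<n. w i j * u j)\<^sup>2) \<le> (\<Sum>i<n. (u i)\<^sup>2)"
proof -
  have "(\<Sum>j<n. w i j * u j)\<^sup>2 \<le> (\<Sum>j<n. k i j * (u j)\<^sup>2 / f j)" if i: "i < n" for i
  proof (cases "f i = 0")
    case True
    then have "(\<Sum>j<n. w i j * u j) = 0" using i by (intro sum.neutral) (simp add: w_def)
    then show ?thesis using k_nonneg f_nonneg by (auto intro!: sum_nonneg divide_nonneg_nonneg)
  next
    case False
    then have fi: "f i > 0" using f_nonneg[OF i] by simp
    have "(\<Sum>j<n. w i j * u j) = (\<Sum>j<n. (sqrt (k i j) / sqrt (f i)) * (sqrt (k i j) * u j / sqrt (f j)))"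
    proof (intro sum.cong refl)
      fix j assume "j \<in> {..<n}"
      then have "w i j * u j = (sqrt (k i j) * sqrt (k i j)) / (sqrt (f i) * sqrt (f j)) * u j"
        using i k_nonneg by (simp add: w_def real_sqrt_mult)
      then show "w i j * u j = (sqrt (k i j) / sqrt (f i)) * (sqrt (k i j) * u j / sqrt (f j))" by simp
    qed
    then have "(\<Sum>j<n. w i j * u j)\<^sup>2 \<le> (\<Sum>j<n. (sqrt (k i j) / sqrt (f i))\<^sup>2) * (\<Sum>j<n. (sqrt (k i j) * u j / sqrt (f j))\<^sup>2)"
      by (simp only: Cauchy_Schwarz_ineq_sum)
    also have "(\<Sum>j<n. (sqrt (k i j) / sqrt (f i))\<^sup>2) = (\<Sum>j<n. k i j) / f i"
      using fi k_nonneg by (simp add: power_divide sum_divide_distrib)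
    also have "\<dots> = 1" using fi f_def[OF i] by simp
    also have "(\<Sum>j<n. (sqrt (k i j) * u j / sqrt (f j))\<^sup>2) = (\<Sum>j<n. k i j * (u j)\<^sup>2 / f j)"
      using f_nonneg k_nonneg by (intro sum.cong) (auto simp: power_divide power_mult_distrib)
    finally show ?thesis by simp
  qed
  then have "(\<Sum>i<n. (\<Sum>j<n. w i j * u j)\<^sup>2) \<le> (\<Sum>i<n. \<Sum>j<n. k i j * (u j)\<^sup>2 / f j)" by (intro sum_mono) simp
  also have "\<dots> = (\<Sum>j<n. \<Sum>i<n. k i j * (u j)\<^sup>2 / f j)" by (rule sum.swap)
  also have "\<dots> \<le> (\<Sum>j<n. (u j)\<^sup>2)"
  proof (rule sum_mono)
    fix j assume "j \<in> {..<n}"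
    then have "(\<Sum>i<n. k i j) = f j" by (simp add: f_def k_sym)
    then have "(\<Sum>i<n. k i j * (u j)\<^sup>2 / f j) = (f j / f j) * (u j)\<^sup>2"
      by (simp add: sum_divide_distrib[symmetric] sum_distrib_right[symmetric])
    also have "\<dots> \<le> (u j)\<^sup>2" by (cases "f j = 0") auto
    finally show "(\<Sum>i<n. k i j * (u j)\<^sup>2 / f j) \<le> (u j)\<^sup>2" .
  qed
  finally show ?thesis .
qed

text \<open>By symmetry a row is a column, and a column is the image of a unit vector under a
  contraction.\<close>

lemma row_bound: "i < n \<Longrightarrow> (\<Sum>j<n. (w i j)\<^sup>2) \<le> 1"
proof -
  assume i: "i < n"
  define e where "e j = (if j = i then 1 else 0 :: real)" for j
  have "(\<Sum>l<n. w j l * e l) = w i j" if "j < n" for j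
    using i that w_sym[OF that i] by (simp add: e_def if_distrib[of "(*) _"] cong: if_cong)
  then have "(\<Sum>j<n. (w i j)\<^sup>2) = (\<Sum>j<n. (\<Sum>l<n. w j l * e l)\<^sup>2)" by simp
  also have "\<dots> \<le> (\<Sum>j<n. (e j)\<^sup>2)" by (rule contraction)
  also have "\<dots> = (\<Sum>j<n. e j)" by (intro sum.cong) (auto simp: e_def)
  also have "\<dots> = 1" using i by (simp add: e_def)
  finally show ?thesis .
qed

text \<open>A row or column whose sum lies below c contributes at most 1 by the row bound. For the
  remaining entries the square is the product of k / f taken in both indices; one factor is at most
  \<open>kmax / c\<close> and the other sums to at most 1 over each row.\<close>

lemma hilbert_schmidt_bound:
  assumes c: "c > 0" and kmax: "\<And>i j. k i j \<le> kmax"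
  shows "(\<Sum>i<n. \<Sum>j<n. (w i j)\<^sup>2) \<le> 2 * (\<Sum>i<n. if f i < c then 1 else 0) + real n * kmax / c"
proof -
  define low where "low i = (if f i < c then 1 else 0 :: real)" for i
  have k0: "0 \<le> kmax" using kmax k_nonneg by (meson order.trans)
  have entry: "(w i j)\<^sup>2 \<le> low i * (w i j)\<^sup>2 + low j * (w i j)\<^sup>2 + kmax / c * (k i j / f i)"
    if ij: "i < n" "j < n" for i j
  proof (cases "f i < c \<or> f j < c")
    case True
    have "0 \<le> kmax / c * (k i j / f i)" using k0 c k_nonneg f_nonneg[OF ij(1)] by simp
    with True show ?thesis by (auto simp: low_def)
  next
    case False
    then have f: "c \<le> f i" "c \<le> f j" by auto
    have "(w i j)\<^sup>2 = k i j * k i j / (f j * f i)"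
      using c f ij by (simp add: w_def power_divide power2_eq_square mult.commute)
    also have "\<dots> = (k i j / f j) * (k i j / f i)" by simp
    also have "\<dots> \<le> (kmax / c) * (k i j / f i)"
      using c f kmax k_nonneg k0 by (intro mult_right_mono frac_le) auto
    finally show ?thesis using f by (simp add: low_def)
  qed
  have "(\<Sum>i<n. \<Sum>j<n. (w i j)\<^sup>2)
      \<le> (\<Sum>i<n. \<Sum>j<n. low i * (w i j)\<^sup>2 + low j * (w i j)\<^sup>2 + kmax / c * (k i j / f i))"
    by (intro sum_mono entry) auto
  also have "\<dots> = (\<Sum>i<n. low i * (\<Sum>j<n. (w i j)\<^sup>2)) + (\<Sum>j<n. low j * (\<Sum>i<n. (w i j)\<^sup>2))
      + kmax / c * (\<Sum>i<n. (\<Sum>j<n. k i j) / f i)"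
    unfolding sum.distrib
    by (simp only: sum_distrib_left sum_divide_distrib) (subst (2) sum.swap, rule refl)
  also have "\<dots> \<le> (\<Sum>i<n. low i) + (\<Sum>i<n. low i) + kmax / c * real n"
  proof (intro add_mono)
    show "(\<Sum>i<n. low i * (\<Sum>j<n. (w i j)\<^sup>2)) \<le> (\<Sum>i<n. low i)"
      by (rule sum_mono) (simp add: low_def row_bound)
    show "(\<Sum>j<n. low j * (\<Sum>i<n. (w i j)\<^sup>2)) \<le> (\<Sum>i<n. low i)"
    proof (rule sum_mono)
      fix j assume "j \<in> {..<n}"
      then have "(\<Sum>i<n. (w i j)\<^sup>2) = (\<Sum>i<n. (w j i)\<^sup>2)" by (intro sum.cong) (auto simp: w_sym)
      then show "low j * (\<Sum>i<n. (w i j)\<^sup>2) \<le> low j"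
        using row_bound[of j] \<open>j \<in> {..<n}\<close> by (simp add: low_def)
    qed
    have "(\<Sum>i<n. (\<Sum>j<n. k i j) / f i) \<le> (\<Sum>i<n. 1)"
    proof (rule sum_mono)
      fix i assume "i \<in> {..<n}"
      then show "(\<Sum>j<n. k i j) / f i \<le> 1" using f_def[of i] by (cases "f i = 0") auto
    qed
    then show "kmax / c * (\<Sum>i<n. (\<Sum>j<n. k i j) / f i) \<le> kmax / c * real n"
      using k0 c by (intro mult_left_mono) auto
  qed
  finally show ?thesis by (simp add: low_def mult.commute)
qed

text \<open>The contraction property allows replacing \<open>\<delta>\<close> by \<open>\<delta> \<surd>(f / g)\<close>, which removes the random
  denominators from the quadratic form.\<close>
lemma quadratic_form_lower_bound:
  assumes \<delta>: "\<And>i. i < n \<Longrightarrow> \<bar>\<delta> i\<bar> \<le> B" and B: "B \<ge> 0"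
    and g: "\<And>i. i < n \<Longrightarrow> gmin \<le> g i" "gmin > 0"
    and D: "(\<Sum>i<n. \<bar>f i - g i\<bar>) \<le> \<tau> * real n"
  defines "e \<equiv> B\<^sup>2 * \<tau> / gmin"
  shows "(\<Sum>i<n. (\<delta> i)\<^sup>2) - e * real n - (\<Sum>i<n. \<Sum>j<n. k i j * (\<delta> i / sqrt (g i) - \<delta> j / sqrt (g j))\<^sup>2) / 2
      - (2 * B * sqrt e + e) * real n \<le> (\<Sum>i<n. \<Sum>j<n. \<delta> i * w i j * \<delta> j)"
proof -
  \<comment> \<open>The vector \<open>v\<close> below is \<delta> rescaled by the root of f / g; the
    roots of f cancel against the normalisation, so the quadratic form at \<open>v\<close> has the
    weights \<open>k\<close> alone.\<close>
  define q where "q i = \<delta> i / sqrt (g i)" for i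
  define v where "v i = q i * sqrt (f i)" for i
  have g0: "g i > 0" if "i < n" for i using g(1)[OF that] g(2) by simp
  have q2: "(q i)\<^sup>2 * g i = (\<delta> i)\<^sup>2" "(q i)\<^sup>2 \<le> B\<^sup>2 / gmin" if i: "i < n" for i
  proof -
    show 1: "(q i)\<^sup>2 * g i = (\<delta> i)\<^sup>2" using g0[OF i] by (simp add: q_def power_divide)
    have "(\<delta> i)\<^sup>2 \<le> B\<^sup>2" using \<delta>[OF i] by (intro abs_le_square_iff[THEN iffD1]) auto
    then show "(q i)\<^sup>2 \<le> B\<^sup>2 / gmin"
      using g(1)[OF i] g(2) g0[OF i] unfolding q_def power_divide by (simp add: frac_le)
  qed
  have vd: "(\<Sum>i<n. (v i - \<delta> i)\<^sup>2) \<le> e * real n"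
  proof -
    have "(v i - \<delta> i)\<^sup>2 \<le> B\<^sup>2 / gmin * \<bar>f i - g i\<bar>" if i: "i < n" for i
    proof -
      have "v i - \<delta> i = q i * (sqrt (f i) - sqrt (g i))" using g0[OF i] by (simp add: v_def q_def algebra_simps)
      then have "(v i - \<delta> i)\<^sup>2 = (q i)\<^sup>2 * (sqrt (f i) - sqrt (g i))\<^sup>2" by (simp add: power_mult_distrib)
      \<comment> \<open>The difference of two roots is at most their sum in absolute value, and the
        product of difference and sum is f - g.\<close>
      also have "(sqrt (f i) - sqrt (g i))\<^sup>2 \<le> \<bar>f i - g i\<bar>"
      proof -
        have "\<bar>sqrt (f i) - sqrt (g i)\<bar> * \<bar>sqrt (f i) - sqrt (g i)\<bar> \<le> \<bar>sqrt (f i) - sqrt (g i)\<bar> * \<bar>sqrt (f i) + sqrt (g i)\<bar>"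
          using f_nonneg[OF i] g0[OF i] by (intro mult_left_mono) (auto simp: abs_le_iff)
        also have "\<dots> = \<bar>f i - g i\<bar>"
          unfolding abs_mult[symmetric] using f_nonneg[OF i] g0[OF i] by (simp add: algebra_simps)
        finally show ?thesis by (simp add: power2_eq_square abs_mult[symmetric])
      qed
      also have "(q i)\<^sup>2 * \<bar>f i - g i\<bar> \<le> B\<^sup>2 / gmin * \<bar>f i - g i\<bar>" by (intro mult_right_mono q2[OF i]) simp
      finally show ?thesis by (simp add: mult_left_mono)
    qed
    then have "(\<Sum>i<n. (v i - \<delta> i)\<^sup>2) \<le> (\<Sum>i<n. B\<^sup>2 / gmin * \<bar>f i - g i\<bar>)" by (intro sum_mono) simp
    also have "\<dots> = B\<^sup>2 / gmin * (\<Sum>i<n. \<bar>f i - g i\<bar>)" by (simp add: sum_distrib_left)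
    also have "\<dots> \<le> B\<^sup>2 / gmin * (\<tau> * real n)" using g(2) by (intro mult_left_mono D) simp
    finally show ?thesis by (simp add: e_def)
  qed
  have qf: "(\<Sum>i<n. \<Sum>j<n. a i * w i j * b j) = (\<Sum>i<n. a i * (\<Sum>j<n. w i j * b j))" for a b :: "nat \<Rightarrow> real"
    by (simp add: sum_distrib_left mult.assoc)
  have W: "\<bar>\<Sum>i<n. a i * (\<Sum>j<n. w i j * b j)\<bar> \<le> sqrt (\<Sum>i<n. (a i)\<^sup>2) * sqrt (\<Sum>i<n. (b i)\<^sup>2)" for a b :: "nat \<Rightarrow> real"
    using quadratic_form_bound[where n = n and w = w and C = 1 and u = a and v = b] contraction by simp
  have vWv: "(\<Sum>i<n. \<Sum>j<n. v i * w i j * v j) = (\<Sum>i<n. \<Sum>j<n. k i j * (q i * q j))"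
  proof (intro sum.cong refl)
    fix i j assume "i \<in> {..<n}" "j \<in> {..<n}"
    then have ij: "i < n" "j < n" by auto
    show "v i * w i j * v j = k i j * (q i * q j)"
    proof (cases "f i = 0 \<or> f j = 0")
      case True
      then have "k i j = 0" using k_le_f[OF ij] k_le_f[OF ij(2,1)] k_nonneg[of i j] k_sym[of i j] by auto
      then show ?thesis using ij by (simp add: w_def)
    next
      case False
      then have "sqrt (f i) > 0" "sqrt (f j) > 0" using f_nonneg ij by (auto simp: order_less_le)
      then show ?thesis using ij by (simp add: w_def v_def real_sqrt_mult)
    qed
  qed
  \<comment> \<open>The form in q is its diagonal part, with the row sums as weights, minus half the
    Dirichlet energy of q.\<close>
  have "(\<Sum>i<n. \<Sum>j<n. k i j * (q i - q j)\<^sup>2)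
      = (\<Sum>i<n. \<Sum>j<n. k i j * (q i)\<^sup>2) + (\<Sum>i<n. \<Sum>j<n. k i j * (q j)\<^sup>2) - 2 * (\<Sum>i<n. \<Sum>j<n. k i j * (q i * q j))"
    by (simp add: sum.distrib[symmetric] sum_subtractf[symmetric] sum_distrib_left power2_eq_square algebra_simps)
  moreover have "(\<Sum>i<n. \<Sum>j<n. k i j * (q i)\<^sup>2) = (\<Sum>i<n. f i * (q i)\<^sup>2)"
    by (intro sum.cong) (auto simp: f_def sum_distrib_right)
  moreover have "(\<Sum>i<n. \<Sum>j<n. k i j * (q j)\<^sup>2) = (\<Sum>i<n. f i * (q i)\<^sup>2)"
    by (subst sum.swap, intro sum.cong) (auto simp: f_def sum_distrib_right k_sym)
  ultimately have vWv': "(\<Sum>i<n. \<Sum>j<n. v i * w i j * v j)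
      = (\<Sum>i<n. f i * (q i)\<^sup>2) - (\<Sum>i<n. \<Sum>j<n. k i j * (q i - q j)\<^sup>2) / 2"
    unfolding vWv by linarith
  have "(\<Sum>i<n. (\<delta> i)\<^sup>2) - (\<Sum>i<n. f i * (q i)\<^sup>2) = (\<Sum>i<n. (q i)\<^sup>2 * (g i - f i))"
    unfolding sum_subtractf[symmetric]
    by (intro sum.cong refl) (simp add: q2(1)[symmetric] left_diff_distrib right_diff_distrib mult.commute)
  also have "\<dots> \<le> (\<Sum>i<n. B\<^sup>2 / gmin * \<bar>f i - g i\<bar>)"
  proof (rule sum_mono)
    fix i assume "i \<in> {..<n}"
    then have "(q i)\<^sup>2 * \<bar>f i - g i\<bar> \<le> B\<^sup>2 / gmin * \<bar>f i - g i\<bar>" by (intro mult_right_mono q2) auto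
    moreover have "(q i)\<^sup>2 * (g i - f i) \<le> (q i)\<^sup>2 * \<bar>f i - g i\<bar>" by (intro mult_left_mono) auto
    ultimately show "(q i)\<^sup>2 * (g i - f i) \<le> B\<^sup>2 / gmin * \<bar>f i - g i\<bar>" by simp
  qed
  also have "\<dots> = B\<^sup>2 / gmin * (\<Sum>i<n. \<bar>f i - g i\<bar>)" by (simp add: sum_distrib_left)
  also have "\<dots> \<le> B\<^sup>2 / gmin * (\<tau> * real n)" using g(2) by (intro mult_left_mono D) simp
  finally have main: "(\<Sum>i<n. (\<delta> i)\<^sup>2) - (\<Sum>i<n. f i * (q i)\<^sup>2) \<le> e * real n" by (simp add: e_def)
  have "0 \<le> (\<Sum>i<n. \<bar>f i - g i\<bar>)" by (simp add: sum_nonneg)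
  with D have "0 \<le> \<tau> * real n" by linarith
  then have "0 \<le> B\<^sup>2 / gmin * (\<tau> * real n)" 
    by (rule mult_nonneg_nonneg[rotated]) (use g(2) in simp)
  then have en: "0 \<le> e * real n" by (simp add: e_def)
  have rvd: "sqrt (\<Sum>i<n. (v i - \<delta> i)\<^sup>2) \<le> sqrt (e * real n)" by (rule real_sqrt_le_mono[OF vd])
  have lin: "(\<Sum>j<n. w i j * (v j - \<delta> j)) = (\<Sum>j<n. w i j * v j) - (\<Sum>j<n. w i j * \<delta> j)" for i
    unfolding right_diff_distrib by (rule sum_subtractf)
  \<comment> \<open>The forms at \<open>v\<close> and at \<delta> differ by terms with at least one
    factor \<open>v - \<delta>\<close>, each controlled by the contraction property.\<close>
  have "(\<Sum>i<n. v i * (\<Sum>j<n. w i j * v j)) - (\<Sum>i<n. \<delta> i * (\<Sum>j<n. w i j * \<delta> j))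
      = (\<Sum>i<n. v i * (\<Sum>j<n. w i j * v j) - \<delta> i * (\<Sum>j<n. w i j * \<delta> j))"
    by (rule sum_subtractf[symmetric])
  also have "\<dots> = (\<Sum>i<n. \<delta> i * (\<Sum>j<n. w i j * (v j - \<delta> j)) + (v i - \<delta> i) * (\<Sum>j<n. w i j * \<delta> j)
        + (v i - \<delta> i) * (\<Sum>j<n. w i j * (v j - \<delta> j)))"
    unfolding lin by (rule sum.cong[OF refl]) algebra
  also have "\<dots> = (\<Sum>i<n. \<delta> i * (\<Sum>j<n. w i j * (v j - \<delta> j))) + (\<Sum>i<n. (v i - \<delta> i) * (\<Sum>j<n. w i j * \<delta> j))
        + (\<Sum>i<n. (v i - \<delta> i) * (\<Sum>j<n. w i j * (v j - \<delta> j)))"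
    by (simp only: sum.distrib)
  also have "\<dots> \<le> (sqrt (real n) * B) * sqrt (e * real n) + sqrt (e * real n) * (sqrt (real n) * B)
      + sqrt (e * real n) * sqrt (e * real n)"
  proof (intro add_mono)
    have d: "sqrt (\<Sum>i<n. (\<delta> i)\<^sup>2) \<le> sqrt (real n) * B" by (rule sum_sq_le_of_bound[OF \<delta> B])
    have nn: "0 \<le> sqrt (\<Sum>i<n. (a i)\<^sup>2)" for a :: "nat \<Rightarrow> real" by (simp add: sum_nonneg)
    show "(\<Sum>i<n. \<delta> i * (\<Sum>j<n. w i j * (v j - \<delta> j))) \<le> (sqrt (real n) * B) * sqrt (e * real n)"
      by (rule order.trans[OF order.trans[OF abs_ge_self W] mult_mono[OF d rvd]]) (use nn B in auto)
    show "(\<Sum>i<n. (v i - \<delta> i) * (\<Sum>j<n. w i j * \<delta> j)) \<le> sqrt (e * real n) * (sqrt (real n) * B)"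
      by (rule order.trans[OF order.trans[OF abs_ge_self W] mult_mono[OF rvd d]]) (use nn en in auto)
    show "(\<Sum>i<n. (v i - \<delta> i) * (\<Sum>j<n. w i j * (v j - \<delta> j))) \<le> sqrt (e * real n) * sqrt (e * real n)"
      by (rule order.trans[OF order.trans[OF abs_ge_self W] mult_mono[OF rvd rvd]]) (use nn en in auto)
  qed
  also have "\<dots> = (2 * B * sqrt e + e) * real n"
  proof -
    have "(s * B) * (r * s) + (r * s) * (s * B) + (r * s) * (r * s) = (2 * B * r + r * r) * (s * s)" for s r :: real
      by (simp add: algebra_simps)
    from this[of "sqrt (real n)" "sqrt e"]
    have "(sqrt (real n) * B) * sqrt (e * real n) + sqrt (e * real n) * (sqrt (real n) * B)
        + sqrt (e * real n) * sqrt (e * real n) = (2 * B * sqrt e + sqrt e * sqrt e) * real n"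
      by (simp add: real_sqrt_mult)
    \<comment> \<open>For n = 0 the sign of e is unknown and \<open>sqrt e * sqrt e\<close> need not
      be e, but both sides carry the factor n.\<close>
    moreover have "sqrt e * sqrt e * real n = e * real n" using en by (cases "n = 0") (auto simp: zero_le_mult_iff)
    ultimately show ?thesis by (simp add: distrib_right)
  qed
  finally show ?thesis using main vWv' unfolding qf[of v v] qf[of \<delta> \<delta>] q_def by linarith
qed

end

section \<open>Weights at the base bandwidth\<close>

text \<open>The interface between the smoothers and the statistic. The 4 is the square of the
  operator norm bound 2, which leaves room for the diagonal subtracted from a projection. The
  squared Frobenius norm is controlled in mean only, since for kernels it depends on random
  denominators.\<close>

definition regular_weights ::
    "'a measure \<Rightarrow> (nat \<Rightarrow> 'a \<Rightarrow> real^'p) \<Rightarrow> (nat \<Rightarrow> real) \<Rightarrow> (nat \<Rightarrow> 'a \<Rightarrow> nat \<Rightarrow> nat \<Rightarrow> real) \<Rightarrow> real \<Rightarrow> bool" where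
  "regular_weights M X h w C \<longleftrightarrow> (\<forall>\<^sub>F n in sequentially.
     (\<forall>i<n. \<forall>j<n. (\<lambda>\<omega>. w n \<omega> i j) \<in> borel_measurable (sigma_design M X n)) \<and>
     (\<forall>\<omega>. \<forall>i<n. \<forall>j<n. w n \<omega> i j = w n \<omega> j i) \<and> (\<forall>\<omega>. \<forall>i<n. w n \<omega> i i = 0) \<and>
     (\<forall>\<omega>\<in>space M. \<forall>u. (\<Sum>i<n. (\<Sum>j<n. w n \<omega> i j * u j)\<^sup>2) \<le> 4 * (\<Sum>i<n. (u i)\<^sup>2)) \<and>
     (\<integral>\<omega>. (\<Sum>i<n. \<Sum>j<n. (w n \<omega> i j)\<^sup>2) \<partial>M) \<le> C / h n ^ CARD('p))"

text \<open>The part of Assumption W on which measurability of the weights rests.\<close>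

definition admissible_smoother :: "('p::finite) smoother \<Rightarrow> bool" where
  "admissible_smoother S \<longleftrightarrow> (case S of Kernel K \<Rightarrow> admissible_kernel K | _ \<Rightarrow> True)"

lemma finite_nat_le_real: "finite {k::nat. real k \<le> c}"
proof (rule finite_subset)
  show "{k. real k \<le> c} \<subseteq> {..nat \<lfloor>c\<rfloor>}" using le_nat_floor by auto
qed simp

lemma finite_poly_index: "finite (poly_index h :: ('p::finite \<Rightarrow> nat) set)"
  using function_box_card(1)[of "{k::nat. real k \<le> 1 / h}", where 'p = 'p] finite_nat_le_real[of "1 / h"]
  by (simp add: poly_index_def)

lemma finite_piecewise_index: "finite (piecewise_index q h :: (('p::finite \<Rightarrow> nat) \<times> ('p \<Rightarrow> nat)) set)"
  unfolding piecewise_index_alt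
  using function_box_card(1)[of "{k::nat. real k \<le> 1 / h - 1}", where 'p = 'p]
    function_box_card(1)[of "{..q}", where 'p = 'p] finite_nat_le_real[of "1 / h - 1"]
  by (intro finite_cartesian_product) auto

lemma monomial_measurable [measurable]: "monomial k \<in> borel_measurable borel"
  unfolding monomial_def[abs_def] by measurable

lemma piecewise_fun_measurable [measurable]: "piecewise_fun h qk \<in> borel_measurable borel"
proof -
  obtain q k where qk: "qk = (q, k)" by (cases qk)
  have [measurable]: "bin h k \<in> sets borel" unfolding bin_def by measurable
  show ?thesis unfolding piecewise_fun_def qk case_prod_conv by measurable
qed

text \<open>The sigma-algebra \<open>N\<close> is arbitrary, because measurability is needed both on
  the whole space and with respect to the design alone.\<close>

lemma weight_measurable:
  fixes X :: "nat \<Rightarrow> 'a \<Rightarrow> real^'p"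
  assumes S: "admissible_smoother S" and X: "\<And>j. j < n \<Longrightarrow> X j \<in> borel_measurable N" and ij: "i < n" "j < n"
  shows "(\<lambda>\<omega>. weight S n h (\<lambda>i. X i \<omega>) i j) \<in> borel_measurable N"
proof (cases "i = j")
  case False
  show ?thesis
  proof (cases S)
    case Polynomial
    have "(\<lambda>\<omega>. proj_matrix n (poly_index h) (\<lambda>k i. monomial k (X i \<omega>)) i j) \<in> borel_measurable N"
      by (rule proj_matrix_measurable[OF finite_poly_index _ ij]) (use X in measurable)
    then show ?thesis using False Polynomial by (simp add: weight_def)
  next
    case (Piecewise q)
    have "(\<lambda>\<omega>. proj_matrix n (piecewise_index q h) (\<lambda>k i. piecewise_fun h k (X i \<omega>)) i j) \<in> borel_measurable N"
      by (rule proj_matrix_measurable[OF finite_piecewise_index _ ij]) (use X in measurable)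
    then show ?thesis using False Piecewise by (simp add: weight_def)
  next
    case (Kernel K)
    then have K [measurable]: "K \<in> borel_measurable borel"
      using S by (intro admissible_kernelD) (simp add: admissible_smoother_def)
    have sk: "(\<lambda>\<omega>. scaled_kernel K h (X a \<omega> - X b \<omega>)) \<in> borel_measurable N" if "a < n" "b < n" for a b
      unfolding scaled_kernel_def using X[OF that(1)] X[OF that(2)] by measurable
    have loo: "(\<lambda>\<omega>. loo_density K n h (\<lambda>i. X i \<omega>) a) \<in> borel_measurable N" if "a < n" for a
      unfolding loo_density_def using that
      by (intro borel_measurable_times borel_measurable_const borel_measurable_sum sk) auto
    have "(\<lambda>\<omega>. 1 / ((real n - 1) * h ^ CARD('p)) * (scaled_kernel K h (X i \<omega> - X j \<omega>)
        / sqrt (loo_density K n h (\<lambda>i. X i \<omega>) i * loo_density K n h (\<lambda>i. X i \<omega>) j))) \<in> borel_measurable N"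
      using sk[OF ij] loo[OF ij(1)] loo[OF ij(2)] by measurable
    then show ?thesis using False Kernel by (simp add: weight_def)
  qed
qed (simp add: weight_def)

section \<open>Projection weights on a random design\<close>

context iid_design
begin

lemma X_design_measurable:
  assumes "i < n" shows "X i \<in> borel_measurable (sigma_design M X n)"
proof -
  have "(\<lambda>\<omega>. \<lambda>i\<in>{..<n}. X i \<omega>) \<in> measurable (sigma_design M X n) (PiM {..<n} (\<lambda>_. borel))"
    unfolding sigma_design_def by (rule measurable_vimage_algebra1) (auto simp: space_PiM)
  from measurable_compose[OF this measurable_component_singleton[of i]] assms
  show ?thesis by simp
qed

text \<open>The squared Frobenius norm is at most the trace, hence at most the number of spanning
  vectors for every outcome; the mean inherits this.\<close>

lemma projection_regular:
  assumes K: "\<forall>\<^sub>F n in sequentially. finite (K n) \<and> real (card (K n)) \<le> C / h n ^ CARD('p)"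
    and w: "\<And>n \<omega> i j. w n \<omega> i j = (if i = j then 0 else proj_matrix n (K n) (\<lambda>k i. v n k (X i \<omega>)) i j)"
    and v: "\<And>n k. v n k \<in> borel_measurable borel"
  shows "regular_weights M X h w C"
  unfolding regular_weights_def
  using K
proof eventually_elim
  case (elim n)
  define P where "P \<omega> = proj_matrix n (K n) (\<lambda>k i. v n k (X i \<omega>))" for \<omega>
  have P: "is_orth_proj n (K n) (\<lambda>k i. v n k (X i \<omega>)) (P \<omega>)" for \<omega>
    unfolding P_def using elim by (intro is_orth_proj_proj_matrix) auto
  have wP: "w n \<omega> i j = (if i = j then 0 else P \<omega> i j)" for \<omega> i j by (simp add: w P_def)
  have tr: "(\<Sum>i<n. P \<omega> i i) \<le> C / h n ^ CARD('p)" for \<omega>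
    using trace_proj_matrix[of "K n" n "\<lambda>k i. v n k (X i \<omega>)"] elim by (simp add: P_def)
  have "(\<lambda>\<omega>. P \<omega> i j) \<in> borel_measurable (sigma_design M X n)" if "i < n" "j < n" for i j
    unfolding P_def using elim that
    by (intro proj_matrix_measurable measurable_compose[OF X_design_measurable v]) auto
  then have m: "\<forall>i<n. \<forall>j<n. (\<lambda>\<omega>. w n \<omega> i j) \<in> borel_measurable (sigma_design M X n)"
    unfolding wP by auto
  have nn: "0 \<le> C / h n ^ CARD('p)" using elim order.trans[OF of_nat_0_le_iff] by blast
  have "expectation (\<lambda>\<omega>. \<Sum>i<n. \<Sum>j<n. (w n \<omega> i j)\<^sup>2) \<le> expectation (\<lambda>\<omega>. C / h n ^ CARD('p))"
    by (rule integral_mono')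
       (use nn offdiag_projection_bounds(2)[OF P wP] tr in \<open>auto intro: order.trans sum_nonneg\<close>)
  then have e: "expectation (\<lambda>\<omega>. \<Sum>i<n. \<Sum>j<n. (w n \<omega> i j)\<^sup>2) \<le> C / h n ^ CARD('p)"
    by (simp add: prob_space)
  show ?case
    using m e offdiag_projection_bounds(1)[OF P wP] orth_proj_sym[OF P] by (auto simp: wP)
qed

text \<open>The lower constant 9/10 leaves room for the losses subtracted in the signal bounds,
  which must end above 1/2.\<close>

lemma sum_sq_whp:
  assumes "conv_in_prob M (\<lambda>n \<omega>. (1 / real n) * (\<Sum>i<n. (\<delta> n (X i \<omega>))\<^sup>2)) 1"
  shows "whp M (\<lambda>n \<omega>. 9/10 * real n \<le> (\<Sum>i<n. (\<delta> n (X i \<omega>))\<^sup>2) \<and> (\<Sum>i<n. (\<delta> n (X i \<omega>))\<^sup>2) \<le> 2 * real n)"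
proof -
  have "whp M (\<lambda>n \<omega>. dist ((1 / real n) * (\<Sum>i<n. (\<delta> n (X i \<omega>))\<^sup>2)) 1 \<le> 1/10)"
    by (rule whp_conv_in_prob[OF assms]) simp
  then show ?thesis
  proof (rule whp_mono)
    show "\<forall>\<^sub>F n in sequentially. \<forall>\<omega>\<in>space M. dist ((1 / real n) * (\<Sum>i<n. (\<delta> n (X i \<omega>))\<^sup>2)) 1 \<le> 1/10 \<longrightarrow>
        9/10 * real n \<le> (\<Sum>i<n. (\<delta> n (X i \<omega>))\<^sup>2) \<and> (\<Sum>i<n. (\<delta> n (X i \<omega>))\<^sup>2) \<le> 2 * real n"
      using eventually_gt_at_top[of 0]
    proof (eventually_elim, intro ballI impI)
      fix n :: nat and \<omega> assume n: "0 < n" and d: "dist ((1 / real n) * (\<Sum>i<n. (\<delta> n (X i \<omega>))\<^sup>2)) 1 \<le> 1/10"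
      define s where "s = (\<Sum>i<n. (\<delta> n (X i \<omega>))\<^sup>2)"
      have "\<bar>s / real n - 1\<bar> \<le> 1/10" using d by (simp add: dist_real_def s_def)
      then have "9/10 \<le> s / real n" "s / real n \<le> 2" by linarith+
      then show "9/10 * real n \<le> (\<Sum>i<n. (\<delta> n (X i \<omega>))\<^sup>2) \<and> (\<Sum>i<n. (\<delta> n (X i \<omega>))\<^sup>2) \<le> 2 * real n"
        using n by (simp add: s_def[symmetric] field_simps)
    qed
  qed
qed

text \<open>The off-diagonal form is the form of the projection minus its diagonal part. The former
  loses at most the squared approximation error, n/16 at tolerance 1/4; the latter is at most B^2
  times the trace, which is of order h^-p and hence below n/16 once n h^p is large.\<close>

lemma projection_signal:
  assumes K: "\<forall>\<^sub>F n in sequentially. finite (K n) \<and> real (card (K n)) \<le> C / h n ^ CARD('p)"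
    and w: "\<And>n \<omega> i j. w n \<omega> i j = (if i = j then 0 else proj_matrix n (K n) (\<lambda>k i. v n k (X i \<omega>)) i j)"
    and h: "\<forall>\<^sub>F n in sequentially. 0 < h n" and nh: "filterlim (\<lambda>n. real n * h n ^ CARD('p)) at_top sequentially"
    and B: "\<forall>\<^sub>F n in sequentially. \<forall>x\<in>ucube. \<bar>\<delta> n x\<bar> \<le> B" and C: "C > 0"
    and conv: "conv_in_prob M (\<lambda>n \<omega>. (1 / real n) * (\<Sum>i<n. (\<delta> n (X i \<omega>))\<^sup>2)) 1"
    and approx: "\<forall>\<^sub>F n in sequentially. AE \<omega> in M. \<exists>c. \<forall>i<n. \<bar>\<delta> n (X i \<omega>) - (\<Sum>k\<in>K n. c k * v n k (X i \<omega>))\<bar> \<le> 1/4"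
  shows "whp M (\<lambda>n \<omega>. real n / 2 \<le> (\<Sum>i<n. \<Sum>j<n. \<delta> n (X i \<omega>) * w n \<omega> i j * \<delta> n (X j \<omega>)))"
proof -
  have "\<forall>\<^sub>F n in sequentially. 16 * (B\<^sup>2 + 1) * C \<le> real n * h n ^ CARD('p)"
    using nh by (simp add: filterlim_at_top)
  with K h B have ev: "\<forall>\<^sub>F n in sequentially. 16 * (B\<^sup>2 + 1) * C \<le> real n * h n ^ CARD('p) \<and> finite (K n) \<and>
      real (card (K n)) \<le> C / h n ^ CARD('p) \<and> 0 < h n \<and> (\<forall>x\<in>ucube. \<bar>\<delta> n x\<bar> \<le> B)"
    by eventually_elim blast
  from whp_conj[OF sum_sq_whp[OF conv] whp_eventually_AE[OF approx]] show ?thesis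
  proof (rule whp_mono, use ev in eventually_elim, intro ballI impI, elim conjE exE)
    fix n \<omega> c
    assume n: "16 * (B\<^sup>2 + 1) * C \<le> real n * h n ^ CARD('p)" "finite (K n)" "real (card (K n)) \<le> C / h n ^ CARD('p)"
      "0 < h n" "\<forall>x\<in>ucube. \<bar>\<delta> n x\<bar> \<le> B" and \<omega>: "\<omega> \<in> space M"
      and s: "9/10 * real n \<le> (\<Sum>i<n. (\<delta> n (X i \<omega>))\<^sup>2)"
      and c: "\<forall>i<n. \<bar>\<delta> n (X i \<omega>) - (\<Sum>k\<in>K n. c k * v n k (X i \<omega>))\<bar> \<le> 1/4"
    define P where "P = proj_matrix n (K n) (\<lambda>k i. v n k (X i \<omega>))"
    have P: "is_orth_proj n (K n) (\<lambda>k i. v n k (X i \<omega>)) P"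
      unfolding P_def using n by (intro is_orth_proj_proj_matrix) auto
    have wP: "w n \<omega> i j = (if i = j then 0 else P i j)" for i j by (simp add: w P_def)
    have "(\<Sum>i<n. (\<delta> n (X i \<omega>) - (\<Sum>k\<in>K n. c k * v n k (X i \<omega>)))\<^sup>2) \<le> (\<Sum>i<n. (1/4)\<^sup>2)"
    proof (rule sum_mono)
      fix i assume "i \<in> {..<n}"
      with c show "(\<delta> n (X i \<omega>) - (\<Sum>k\<in>K n. c k * v n k (X i \<omega>)))\<^sup>2 \<le> (1/4)\<^sup>2"
        by (intro abs_le_square_iff[THEN iffD1]) auto
    qed
    then have 1: "(\<Sum>i<n. (\<delta> n (X i \<omega>) - (\<Sum>k\<in>K n. c k * v n k (X i \<omega>)))\<^sup>2) \<le> real n / 16"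
      by (simp add: power2_eq_square)
    have "(\<Sum>i<n. P i i * (\<delta> n (X i \<omega>))\<^sup>2) \<le> (\<Sum>i<n. P i i * B\<^sup>2)"
    proof (rule sum_mono)
      fix i assume "i \<in> {..<n}"
      then show "P i i * (\<delta> n (X i \<omega>))\<^sup>2 \<le> P i i * B\<^sup>2"
        using n(5) X_cube[OF \<omega>, of i] orth_proj_diag[OF P, of i]
        by (intro mult_left_mono abs_le_square_iff[THEN iffD1]) (auto intro: order.trans[OF _ abs_ge_self])
    qed
    also have "\<dots> = B\<^sup>2 * (\<Sum>i<n. P i i)" by (simp add: sum_distrib_left mult.commute)
    also have "\<dots> \<le> (B\<^sup>2 + 1) * (C / h n ^ CARD('p))"
      using trace_proj_matrix[OF n(2), of n "\<lambda>k i. v n k (X i \<omega>)"] n(3) C n(4) orth_proj_diag(1)[OF P]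
      by (intro mult_mono) (auto simp: P_def intro!: sum_nonneg)
    also have "\<dots> \<le> real n / 16" using n(1,4) by (simp add: field_simps)
    finally have 2: "(\<Sum>i<n. P i i * (\<delta> n (X i \<omega>))\<^sup>2) \<le> real n / 16" .
    have "(\<Sum>i<n. (\<delta> n (X i \<omega>))\<^sup>2) - (\<Sum>i<n. (\<delta> n (X i \<omega>) - (\<Sum>k\<in>K n. c k * v n k (X i \<omega>)))\<^sup>2)
        \<le> (\<Sum>i<n. \<delta> n (X i \<omega>) * (\<Sum>j<n. P i j * \<delta> n (X j \<omega>)))"
      by (rule orth_proj_quadratic(2)[OF P refl])
    then show "real n / 2 \<le> (\<Sum>i<n. \<Sum>j<n. \<delta> n (X i \<omega>) * w n \<omega> i j * \<delta> n (X j \<omega>))"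
      unfolding offdiag_projection_bounds(3)[OF P wP, of "\<lambda>i. \<delta> n (X i \<omega>)"] using 1 2 s by linarith
  qed
qed

text \<open>The degree needed for tolerance 1/4 does not depend on n, so it is eventually at most
  1/h.\<close>

lemma polynomial_approximation_whp:
  assumes h: "\<forall>\<^sub>F n in sequentially. 0 < h n" "h \<longlonglongrightarrow> 0"
    and eq: "equicontinuous_seq \<delta>" and B: "B > 0" "\<forall>\<^sub>F n in sequentially. \<forall>x\<in>ucube. \<bar>\<delta> n x\<bar> \<le> B"
  shows "\<forall>\<^sub>F n in sequentially. AE \<omega> in M. \<exists>c. \<forall>i<n. \<bar>\<delta> n (X i \<omega>) - (\<Sum>k\<in>poly_index (h n). c k * monomial k (X i \<omega>))\<bar> \<le> 1/4"
proof -
  have "(1/4::real) > 0" by simp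
  from equicontinuous_polynomial_approximation[OF eq this B(1)] obtain N where
    N: "\<And>n. n \<ge> 1 \<Longrightarrow> (\<And>x. x \<in> ucube \<Longrightarrow> \<bar>\<delta> n x\<bar> \<le> B) \<Longrightarrow> \<exists>g. poly_upto N g \<and> (\<forall>x\<in>ucube. \<bar>\<delta> n x - g x\<bar> \<le> 1/4)"
    by blast
  have "\<forall>\<^sub>F n in sequentially. h n < 1 / (real N + 1)" using h(2) by (intro order_tendstoD(2)) auto
  with h(1) B(2) eventually_ge_at_top[of 1] show ?thesis
  proof (eventually_elim, intro AE_I2)
    fix n \<omega> assume n: "0 < h n" "\<forall>x\<in>ucube. \<bar>\<delta> n x\<bar> \<le> B" "1 \<le> n" "h n < 1 / (real N + 1)" and \<omega>: "\<omega> \<in> space M"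
    obtain g where g: "poly_upto N g" "\<forall>x\<in>ucube. \<bar>\<delta> n x - g x\<bar> \<le> 1/4" using N[OF n(3)] n(2) by blast
    have "real N \<le> 1 / h n" using n(1,4) by (simp add: field_simps)
    then have "N \<le> nat \<lfloor>1 / h n\<rfloor>" by (rule le_nat_floor)
    with g(1) have "poly_upto (nat \<lfloor>1 / h n\<rfloor>) g" by (rule poly_upto_mono)
    then obtain c where "\<And>x. g x = (\<Sum>k\<in>poly_index (h n). c k * monomial k x)"
      unfolding poly_upto_def poly_index_alt[OF n(1)] by auto
    then show "\<exists>c. \<forall>i<n. \<bar>\<delta> n (X i \<omega>) - (\<Sum>k\<in>poly_index (h n). c k * monomial k (X i \<omega>))\<bar> \<le> 1/4"
      using g(2) X_cube[OF \<omega>] by (intro exI[of _ c]) simp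
  qed
qed

text \<open>Once the bin side h is below the modulus of equicontinuity for 1/4, one constant per bin
  suffices, outside the null event that some coordinate equals 1.\<close>

lemma piecewise_approximation_whp:
  assumes h: "\<forall>\<^sub>F n in sequentially. 0 < h n" "h \<longlonglongrightarrow> 0" "\<forall>\<^sub>F n in sequentially. 1 / h n \<in> \<int>"
    and eq: "equicontinuous_seq \<delta>"
  shows "\<forall>\<^sub>F n in sequentially. AE \<omega> in M. \<exists>c. \<forall>i<n. \<bar>\<delta> n (X i \<omega>) - (\<Sum>k\<in>piecewise_index q (h n). c k * piecewise_fun (h n) k (X i \<omega>))\<bar> \<le> 1/4"
proof -
  obtain \<eta> where \<eta>: "\<eta> > 0" "\<And>n x x'. n \<ge> 1 \<Longrightarrow> x \<in> ucube \<Longrightarrow> x' \<in> ucube \<Longrightarrow> infnorm (x - x') \<le> \<eta> \<Longrightarrow> \<bar>\<delta> n x - \<delta> n x'\<bar> \<le> 1/4"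
    using eq unfolding equicontinuous_seq_def by (metis zero_less_divide_1_iff zero_less_numeral)
  have "\<forall>\<^sub>F n in sequentially. h n < \<eta>" using h(2) \<eta>(1) by (intro order_tendstoD(2)) auto
  with h(1,3) eventually_ge_at_top[of 1] show ?thesis
  proof eventually_elim
    case (elim n)
    have "\<exists>c. \<forall>x\<in>ucube. (\<forall>l. x $ l < 1) \<longrightarrow>
        \<bar>\<delta> n x - (\<Sum>k\<in>piecewise_index q (h n). c k * piecewise_fun (h n) k x)\<bar> \<le> 1/4"
      by (rule piecewise_constant_approximation) (use elim \<eta>(2) in auto)
    then obtain c where c: "\<And>x. x \<in> ucube \<Longrightarrow> (\<forall>l. x $ l < 1) \<Longrightarrow>
        \<bar>\<delta> n x - (\<Sum>k\<in>piecewise_index q (h n). c k * piecewise_fun (h n) k x)\<bar> \<le> 1/4" by blast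
    have "AE \<omega> in M. \<forall>i. X i \<omega> \<in> ucube" using X_cube by (intro AE_I2) auto
    with AE_X_less_1 show ?case
      by eventually_elim (use c in blast)
  qed
qed

end

section \<open>Kernel weights on a random design\<close>

context kernel_design
begin

text \<open>Scaled so that its row sums are the leave-one-out density estimates; this makes the
  kernel weights an instance of \<open>normalized_kernel\<close>.\<close>

definition kmat :: "nat \<Rightarrow> real \<Rightarrow> 'a \<Rightarrow> nat \<Rightarrow> nat \<Rightarrow> real" where
  "kmat n h \<omega> i j = (if i = j then 0 else kern h (X j \<omega> - X i \<omega>) / (real n - 1))"

lemma kmat_measurable [measurable]: "(\<lambda>\<omega>. kmat n h \<omega> i j) \<in> borel_measurable M"
  unfolding kmat_def by measurable

lemma fhat_kmat: "i < n \<Longrightarrow> fhat n h i \<omega> = (\<Sum>j<n. kmat n h \<omega> i j)"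
proof -
  assume i: "i < n"
  have "(\<Sum>j<n. kmat n h \<omega> i j) = kmat n h \<omega> i i + (\<Sum>j\<in>{..<n}-{i}. kmat n h \<omega> i j)"
    using i by (intro sum.remove) auto
  also have "\<dots> = (\<Sum>j\<in>{..<n}-{i}. kern h (X j \<omega> - X i \<omega>) / (real n - 1))"
    by (auto simp: kmat_def intro!: sum.cong)
  finally show ?thesis by (simp add: fhat_alt sum_divide_distrib)
qed

lemma kmat_normalized:
  assumes h: "h > 0" and n: "n \<ge> 2"
  shows "normalized_kernel n (kmat n h \<omega>) (\<lambda>i. fhat n h i \<omega>) (weight (Kernel K) n h (\<lambda>i. X i \<omega>))"
proof
  fix i j
  show "0 \<le> kmat n h \<omega> i j" using kern_basic(1)[OF h] n by (simp add: kmat_def)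
  show "kmat n h \<omega> i j = kmat n h \<omega> j i"
    using kern_basic(2)[OF h, of "X j \<omega> - X i \<omega>"] by (simp add: kmat_def)
  show "i < n \<Longrightarrow> fhat n h i \<omega> = (\<Sum>j<n. kmat n h \<omega> i j)" by (rule fhat_kmat)
  have sym: "kern h (X j \<omega> - X i \<omega>) = scaled_kernel K h (X i \<omega> - X j \<omega>) / h ^ CARD('p)"
    using kern_basic(2)[OF h, of "X i \<omega> - X j \<omega>"] by (simp add: kern_def scaled_kernel_def)
  show "weight (Kernel K) n h (\<lambda>i. X i \<omega>) i j = kmat n h \<omega> i j / sqrt (fhat n h i \<omega> * fhat n h j \<omega>)"
    by (simp add: weight_def kmat_def sym fhat_def mult_ac)
qed

lemma kmat_le: "h > 0 \<Longrightarrow> n \<ge> 2 \<Longrightarrow> kmat n h \<omega> i j \<le> Kmax / (h ^ CARD('p) * (real n - 1))"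
  using kern_basic(3)[of h "X j \<omega> - X i \<omega>"] K_le(2)
  by (auto simp: kmat_def divide_right_mono divide_divide_eq_left[symmetric] simp del: divide_divide_eq_left)

text \<open>Rows with a small density estimate are rare: there the estimate deviates from the
  smoothed density by at least c, so each occurs with probability of order 1 / (n h^p), and together
  they contribute order h^-p. The other entries contribute n times the largest kernel entry over c,
  again of order h^-p.\<close>

lemma kernel_regular:
  assumes h: "\<forall>\<^sub>F n in sequentially. 0 < h n" "h \<longlonglongrightarrow> 0"
  obtains C where "C > 0" "regular_weights M X h (\<lambda>n \<omega>. weight (Kernel K) n (h n) (\<lambda>i. X i \<omega>)) C"
proof -
  obtain c' h1 where c': "c' > 0" "h1 > 0" "\<And>h x. 0 < h \<Longrightarrow> h \<le> h1 \<Longrightarrow> x \<in> ucube \<Longrightarrow> c' \<le> smooth h x"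
    using smooth_lower_bound by blast
  \<comment> \<open>Half of the lower bound for the smoothed density, so that an estimate below c is
    off by at least c.\<close>
  define c where "c = c' / 2"
  have c: "c > 0" "\<And>h x. 0 < h \<Longrightarrow> h \<le> h1 \<Longrightarrow> x \<in> ucube \<Longrightarrow> 2 * c \<le> smooth h x"
    using c' by (auto simp: c_def)
  define C where "C = 4 * (Kmax * fmax) / c\<^sup>2 + 2 * Kmax / c"
  have "\<forall>\<^sub>F n in sequentially. h n < h1" using h(2) c'(2) by (intro order_tendstoD(2)) auto
  with h(1) eventually_ge_at_top[of 2]
  have "regular_weights M X h (\<lambda>n \<omega>. weight (Kernel K) n (h n) (\<lambda>i. X i \<omega>)) C"
    unfolding regular_weights_def
  proof eventually_elim
    case (elim n)
    define W where "W \<omega> = weight (Kernel K) n (h n) (\<lambda>i. X i \<omega>)" for \<omega>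
    have nk: "normalized_kernel n (kmat n (h n) \<omega>) (\<lambda>i. fhat n (h n) i \<omega>) (W \<omega>)" for \<omega>
      unfolding W_def using elim by (intro kmat_normalized) auto
    have m: "\<forall>i<n. \<forall>j<n. (\<lambda>\<omega>. W \<omega> i j) \<in> borel_measurable (sigma_design M X n)"
      unfolding W_def using K by (auto intro!: weight_measurable X_design_measurable simp: admissible_smoother_def)
    have Wm [measurable]: "(\<lambda>\<omega>. W \<omega> i j) \<in> borel_measurable M" if "i < n" "j < n" for i j
      unfolding W_def using K that by (auto intro!: weight_measurable simp: admissible_smoother_def)
    have contr: "(\<Sum>i<n. (\<Sum>j<n. W \<omega> i j * u j)\<^sup>2) \<le> 4 * (\<Sum>i<n. (u i)\<^sup>2)" for \<omega> u
    proof -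
      have "(\<Sum>i<n. (\<Sum>j<n. W \<omega> i j * u j)\<^sup>2) \<le> (\<Sum>i<n. (u i)\<^sup>2)" by (rule normalized_kernel.contraction[OF nk])
      moreover have "0 \<le> (\<Sum>i<n. (u i)\<^sup>2)" by (simp add: sum_nonneg)
      ultimately show ?thesis by linarith
    qed
    define v where "v = Kmax * fmax / (h n ^ CARD('p) * (real n - 1))"
    have low: "expectation (\<lambda>\<omega>. if fhat n (h n) i \<omega> < c then 1 else 0) \<le> v / c\<^sup>2" if i: "i < n" for i
    proof -
      have "expectation (\<lambda>\<omega>. if fhat n (h n) i \<omega> < c then 1 else 0)
          \<le> expectation (\<lambda>\<omega>. (fhat n (h n) i \<omega> - smooth (h n) (X i \<omega>))\<^sup>2 / c\<^sup>2)"
      proof (rule integral_mono')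
        show "integrable M (\<lambda>\<omega>. (fhat n (h n) i \<omega> - smooth (h n) (X i \<omega>))\<^sup>2 / c\<^sup>2)"
          using fhat_variance(1)[of "h n" i n] elim i by simp
        fix \<omega> assume \<omega>: "\<omega> \<in> space M"
        show "(if fhat n (h n) i \<omega> < c then 1 else 0) \<le> (fhat n (h n) i \<omega> - smooth (h n) (X i \<omega>))\<^sup>2 / c\<^sup>2"
        proof (cases "fhat n (h n) i \<omega> < c")
          case True
          have "2 * c \<le> smooth (h n) (X i \<omega>)" using elim X_cube[OF \<omega>] by (intro c(2)) auto
          with True have "\<bar>c\<bar> \<le> \<bar>fhat n (h n) i \<omega> - smooth (h n) (X i \<omega>)\<bar>" using c(1) by linarith
          then have "c\<^sup>2 \<le> (fhat n (h n) i \<omega> - smooth (h n) (X i \<omega>))\<^sup>2" by (simp add: abs_le_square_iff)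
          with True c(1) show ?thesis by simp
        qed simp
      qed auto
      also have "\<dots> = expectation (\<lambda>\<omega>. (fhat n (h n) i \<omega> - smooth (h n) (X i \<omega>))\<^sup>2) / c\<^sup>2" by simp
      also have "\<dots> \<le> v / c\<^sup>2"
        unfolding v_def by (rule divide_right_mono[OF fhat_variance(2)]) (use elim i in auto)
      finally show ?thesis .
    qed
    have hp: "0 < h n ^ CARD('p)" using elim by simp
    have kmax: "kmat n (h n) \<omega> i j \<le> Kmax / (h n ^ CARD('p) * (real n - 1))" for \<omega> i j
      using elim by (intro kmat_le) auto
    have lowint: "integrable M (\<lambda>\<omega>. if fhat n (h n) i \<omega> < c then 1 else 0 :: real)" for i
      by (rule integrable_const_bound[where B = 1]) auto
    have "expectation (\<lambda>\<omega>. \<Sum>i<n. \<Sum>j<n. (W \<omega> i j)\<^sup>2)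
        \<le> expectation (\<lambda>\<omega>. 2 * (\<Sum>i<n. if fhat n (h n) i \<omega> < c then 1 else 0) + real n * (Kmax / (h n ^ CARD('p) * (real n - 1))) / c)"
    proof (rule integral_mono')
      show "integrable M (\<lambda>\<omega>. 2 * (\<Sum>i<n. if fhat n (h n) i \<omega> < c then 1 else 0) + real n * (Kmax / (h n ^ CARD('p) * (real n - 1))) / c)"
        using lowint by (intro Bochner_Integration.integrable_add integrable_mult_right Bochner_Integration.integrable_sum) auto
      show "(\<Sum>i<n. \<Sum>j<n. (W \<omega> i j)\<^sup>2) \<le> 2 * (\<Sum>i<n. if fhat n (h n) i \<omega> < c then 1 else 0) + real n * (Kmax / (h n ^ CARD('p) * (real n - 1))) / c" for \<omega>
        by (rule normalized_kernel.hilbert_schmidt_bound[OF nk c(1) kmax])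
      show "0 \<le> 2 * (\<Sum>i<n. if fhat n (h n) i \<omega> < c then 1 else 0) + real n * (Kmax / (h n ^ CARD('p) * (real n - 1))) / c" for \<omega>
        using K_le(2) c(1) hp elim by (intro add_nonneg_nonneg mult_nonneg_nonneg divide_nonneg_nonneg sum_nonneg) auto
    qed
    also have "\<dots> = 2 * (\<Sum>i<n. expectation (\<lambda>\<omega>. if fhat n (h n) i \<omega> < c then 1 else 0)) + real n * (Kmax / (h n ^ CARD('p) * (real n - 1))) / c"
      using lowint by (simp add: prob_space)
    also have "\<dots> \<le> 2 * (\<Sum>i<n. v / c\<^sup>2) + real n * (Kmax / (h n ^ CARD('p) * (real n - 1))) / c"
      by (intro add_right_mono mult_left_mono sum_mono low) auto
    also have "\<dots> = (real n / (real n - 1)) * ((2 * (Kmax * fmax) / c\<^sup>2 + Kmax / c) / h n ^ CARD('p))"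
    proof -
      have "2 * (m * (A / (H * N) / c')) + m * (k / (H * N)) / c = (m / N) * ((2 * A / c' + k / c) / H)"
        for m A H N c' k c :: real
        by (simp add: add_divide_distrib distrib_left mult_ac)
      from this[of "real n" "Kmax * fmax"] show ?thesis by (simp only: v_def sum_constant card_lessThan)
    qed
    \<comment> \<open>The factor n / (n - 1) is at most 2 because n is at least 2.\<close>
    also have "\<dots> \<le> 2 * ((2 * (Kmax * fmax) / c\<^sup>2 + Kmax / c) / h n ^ CARD('p))"
      using elim K_le(2) f_bounds(4) c(1) hp
      by (intro mult_right_mono) (auto simp: field_simps intro!: divide_nonneg_nonneg add_nonneg_nonneg)
    also have "\<dots> = C / h n ^ CARD('p)" by (simp add: C_def add_divide_distrib)
    finally have e: "expectation (\<lambda>\<omega>. \<Sum>i<n. \<Sum>j<n. (W \<omega> i j)\<^sup>2) \<le> C / h n ^ CARD('p)" .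
    show ?case
      unfolding W_def[symmetric] using m contr e normalized_kernel.w_sym[OF nk]
      by (auto simp: W_def weight_def)
  qed
  moreover have "C > 0" using K_le(2) f_bounds(4) c(1) by (auto simp: C_def intro!: add_pos_pos)
  ultimately show thesis by (intro that)
qed

text \<open>The error splits into a stochastic part, with mean at most \<open>2 * sqrt (v n)\<close>
  for \<open>v n\<close> of order 1 / (n h^p), and the bias of the smoothed density. Both vanish in
  mean, and Markov's inequality applies to the average.\<close>

lemma density_error_whp:
  assumes h: "\<forall>\<^sub>F n in sequentially. 0 < h n" "h \<longlonglongrightarrow> 0"
    and nh: "filterlim (\<lambda>n. real n * h n ^ CARD('p)) at_top sequentially" and \<tau>: "\<tau> > 0"
  shows "whp M (\<lambda>n \<omega>. (\<Sum>i<n. \<bar>fhat n (h n) i \<omega> - dens (X i \<omega>)\<bar>) \<le> \<tau> * real n)"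
proof -
  define bias where "bias n = (\<integral>x. dens x * \<bar>smooth (h n) x - dens x\<bar> \<partial>lborel)" for n
  \<comment> \<open>The bias lemma asks for positive bandwidths at every index, hence the shift by
    \<open>N\<close>.\<close>
  obtain N where N: "\<And>n. n \<ge> N \<Longrightarrow> 0 < h n" using h(1) by (auto simp: eventually_sequentially)
  have "(\<lambda>n. bias (n + N)) \<longlonglongrightarrow> 0"
    unfolding bias_def by (rule smooth_bias) (use N LIMSEQ_ignore_initial_segment[OF h(2)] in auto)
  then have bias: "bias \<longlonglongrightarrow> 0" by (rule LIMSEQ_offset)
  define v where "v n = 2 * (Kmax * fmax) / (real n * h n ^ CARD('p))" for n
  have v0: "v \<longlonglongrightarrow> 0" unfolding v_def
    by (rule tendsto_divide_0[OF tendsto_const filterlim_at_top_imp_at_infinity[OF nh]])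
  define b where "b n = real n * (2 * sqrt (v n) + bias n)" for n
  show ?thesis
  proof (rule whp_Markov[where b = b])
    show "\<forall>\<^sub>F n in sequentially. integrable M (\<lambda>\<omega>. \<Sum>i<n. \<bar>fhat n (h n) i \<omega> - dens (X i \<omega>)\<bar>) \<and>
        (AE \<omega> in M. 0 \<le> (\<Sum>i<n. \<bar>fhat n (h n) i \<omega> - dens (X i \<omega>)\<bar>)) \<and>
        expectation (\<lambda>\<omega>. \<Sum>i<n. \<bar>fhat n (h n) i \<omega> - dens (X i \<omega>)\<bar>) \<le> b n"
      using h(1) eventually_ge_at_top[of 2]
    proof eventually_elim
      case (elim n)
      have vn: "v n > 0" using elim K_le(2) f_bounds(4) by (simp add: v_def)
      then have sv: "sqrt (v n) > 0" by simp
      define Z where "Z i \<omega> = fhat n (h n) i \<omega> - smooth (h n) (X i \<omega>)" for i \<omega>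
      have Zm [measurable]: "Z i \<in> borel_measurable M" for i unfolding Z_def[abs_def] by measurable
      have Z2: "integrable M (\<lambda>\<omega>. (Z i \<omega>)\<^sup>2)" "expectation (\<lambda>\<omega>. (Z i \<omega>)\<^sup>2) \<le> v n" if i: "i < n" for i
      proof -
        show "integrable M (\<lambda>\<omega>. (Z i \<omega>)\<^sup>2)" unfolding Z_def by (rule fhat_variance(1)) (use elim i in auto)
        have "expectation (\<lambda>\<omega>. (Z i \<omega>)\<^sup>2) \<le> Kmax * fmax / (h n ^ CARD('p) * (real n - 1))"
          unfolding Z_def by (rule fhat_variance(2)) (use elim i in auto)
        also have "\<dots> \<le> v n"
        proof -
          have "real n * h n ^ CARD('p) / 2 \<le> h n ^ CARD('p) * (real n - 1)"
            using elim mult_left_mono[of "real n / 2" "real n - 1" "h n ^ CARD('p)"] by (simp add: mult.commute)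
          then have "Kmax * fmax / (h n ^ CARD('p) * (real n - 1)) \<le> Kmax * fmax / (real n * h n ^ CARD('p) / 2)"
            using elim K_le(2) f_bounds(4) by (intro divide_left_mono mult_pos_pos) auto
          then show ?thesis by (simp add: v_def mult_ac)
        qed
        finally show "expectation (\<lambda>\<omega>. (Z i \<omega>)\<^sup>2) \<le> v n" .
      qed
      \<comment> \<open>Comparison with the threshold \<open>sqrt (v n)\<close> turns the bound on
        the second moment into one of the right order on the first.\<close>
      have Zabs: "\<bar>Z i \<omega>\<bar> \<le> (Z i \<omega>)\<^sup>2 / sqrt (v n) + sqrt (v n)" for i \<omega>
      proof (cases "\<bar>Z i \<omega>\<bar> \<le> sqrt (v n)")
        case True
        then show ?thesis using sv by (simp add: add_increasing)
      next
        case False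
        then have "\<bar>Z i \<omega>\<bar> * sqrt (v n) \<le> \<bar>Z i \<omega>\<bar> * \<bar>Z i \<omega>\<bar>" by (intro mult_left_mono) auto
        then have "\<bar>Z i \<omega>\<bar> \<le> (Z i \<omega>)\<^sup>2 / sqrt (v n)" using sv by (simp add: pos_le_divide_eq power2_eq_square)
        then show ?thesis using sv by linarith
      qed
      have Zi: "integrable M (\<lambda>\<omega>. \<bar>Z i \<omega>\<bar>)" "expectation (\<lambda>\<omega>. \<bar>Z i \<omega>\<bar>) \<le> 2 * sqrt (v n)" if i: "i < n" for i
      proof -
        have di: "integrable M (\<lambda>\<omega>. (Z i \<omega>)\<^sup>2 / sqrt (v n) + sqrt (v n))" using Z2[OF i] by simp
        show zi: "integrable M (\<lambda>\<omega>. \<bar>Z i \<omega>\<bar>)"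
          by (rule Bochner_Integration.integrable_bound[OF di]) (use Zabs in \<open>auto intro: order.trans[OF _ abs_ge_self]\<close>)
        have "expectation (\<lambda>\<omega>. \<bar>Z i \<omega>\<bar>) \<le> expectation (\<lambda>\<omega>. (Z i \<omega>)\<^sup>2 / sqrt (v n) + sqrt (v n))"
          by (rule integral_mono[OF zi di Zabs])
        also have "\<dots> = expectation (\<lambda>\<omega>. (Z i \<omega>)\<^sup>2) / sqrt (v n) + sqrt (v n)"
          using Z2[OF i] by (simp add: prob_space)
        also have "\<dots> \<le> v n / sqrt (v n) + sqrt (v n)" using Z2[OF i] sv by (intro add_right_mono divide_right_mono) auto
        also have "\<dots> = 2 * sqrt (v n)" using vn by (simp add: real_div_sqrt)
        finally show "expectation (\<lambda>\<omega>. \<bar>Z i \<omega>\<bar>) \<le> 2 * sqrt (v n)" .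
      qed
      have bi: "integrable M (\<lambda>\<omega>. \<bar>smooth (h n) (X i \<omega>) - dens (X i \<omega>)\<bar>)" for i
      proof (rule integrable_const_bound[where B = fmax])
        have "\<bar>smooth (h n) x - dens x\<bar> \<le> fmax" for x
          using smooth_bounds[OF elim(1), of x] dens_bounds(1,2)[of x] by linarith
        then show "AE \<omega> in M. norm \<bar>smooth (h n) (X i \<omega>) - dens (X i \<omega>)\<bar> \<le> fmax" by simp
      qed measurable
      have bE: "expectation (\<lambda>\<omega>. \<bar>smooth (h n) (X i \<omega>) - dens (X i \<omega>)\<bar>) = bias n" for i
        unfolding bias_def by (rule expectation_X) measurable
      have tri: "\<bar>fhat n (h n) i \<omega> - dens (X i \<omega>)\<bar> \<le> \<bar>Z i \<omega>\<bar> + \<bar>smooth (h n) (X i \<omega>) - dens (X i \<omega>)\<bar>" for i \<omega>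
        unfolding Z_def by linarith
      have si: "integrable M (\<lambda>\<omega>. \<bar>Z i \<omega>\<bar> + \<bar>smooth (h n) (X i \<omega>) - dens (X i \<omega>)\<bar>)" if i: "i < n" for i
        using Zi(1)[OF i] bi[of i] by simp
      have fi: "integrable M (\<lambda>\<omega>. \<bar>fhat n (h n) i \<omega> - dens (X i \<omega>)\<bar>)" if i: "i < n" for i
        by (rule Bochner_Integration.integrable_bound[OF si[OF i]]) (use tri in \<open>auto intro: order.trans[OF _ abs_ge_self]\<close>)
      have "expectation (\<lambda>\<omega>. \<Sum>i<n. \<bar>fhat n (h n) i \<omega> - dens (X i \<omega>)\<bar>) = (\<Sum>i<n. expectation (\<lambda>\<omega>. \<bar>fhat n (h n) i \<omega> - dens (X i \<omega>)\<bar>))"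
        using fi by (intro Bochner_Integration.integral_sum) auto
      also have "\<dots> \<le> (\<Sum>i<n. 2 * sqrt (v n) + bias n)"
      proof (rule sum_mono)
        fix i assume "i \<in> {..<n}"
        then have i: "i < n" by simp
        have "expectation (\<lambda>\<omega>. \<bar>fhat n (h n) i \<omega> - dens (X i \<omega>)\<bar>)
            \<le> expectation (\<lambda>\<omega>. \<bar>Z i \<omega>\<bar> + \<bar>smooth (h n) (X i \<omega>) - dens (X i \<omega>)\<bar>)"
          by (rule integral_mono[OF fi[OF i] si[OF i] tri])
        also have "\<dots> = expectation (\<lambda>\<omega>. \<bar>Z i \<omega>\<bar>) + bias n" using Zi[OF i] bi[of i] bE[of i] by simp
        also have "\<dots> \<le> 2 * sqrt (v n) + bias n" using Zi(2)[OF i] by simp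
        finally show "expectation (\<lambda>\<omega>. \<bar>fhat n (h n) i \<omega> - dens (X i \<omega>)\<bar>) \<le> 2 * sqrt (v n) + bias n" .
      qed
      also have "\<dots> = b n" by (simp add: b_def)
      finally have "expectation (\<lambda>\<omega>. \<Sum>i<n. \<bar>fhat n (h n) i \<omega> - dens (X i \<omega>)\<bar>) \<le> b n" .
      moreover have "integrable M (\<lambda>\<omega>. \<Sum>i<n. \<bar>fhat n (h n) i \<omega> - dens (X i \<omega>)\<bar>)"
        using fi by (intro Bochner_Integration.integrable_sum) auto
      ultimately show ?case by (simp add: sum_nonneg)
    qed
    show "\<forall>\<^sub>F n in sequentially. 0 < \<tau> * real n" using eventually_gt_at_top[of 0] by eventually_elim (use \<tau> in simp)
    have "(\<lambda>n. (2 * sqrt (v n) + bias n) / \<tau>) \<longlonglongrightarrow> (2 * sqrt 0 + 0) / \<tau>"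
      by (rule tendsto_divide[OF tendsto_add[OF tendsto_mult[OF tendsto_const tendsto_real_sqrt[OF v0]] bias] tendsto_const]) (use \<tau> in simp)
    then have "(\<lambda>n. (2 * sqrt (v n) + bias n) / \<tau>) \<longlonglongrightarrow> 0" by simp
    then show "(\<lambda>n. b n / (\<tau> * real n)) \<longlonglongrightarrow> 0"
      by (rule Lim_transform_eventually)
         (use eventually_gt_at_top[of 0] in eventually_elim, simp add: b_def)
  qed
qed

text \<open>There are n (n - 1) off-diagonal entries, each with mean at most \<open>fmax\<close>
  times the kernel tail mass over n - 1; with \<eta> fixed and h tending to 0 the tail mass beyond
  \<eta> / h vanishes.\<close>

lemma far_pairs_whp:
  assumes h: "\<forall>\<^sub>F n in sequentially. 0 < h n" "h \<longlonglongrightarrow> 0" and \<eta>: "\<eta> > 0" and \<tau>: "\<tau> > 0"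
  shows "whp M (\<lambda>n \<omega>. (\<Sum>i<n. \<Sum>j<n. kmat n (h n) \<omega> i j * indicator {u. \<eta> < norm u} (X j \<omega> - X i \<omega>)) \<le> \<tau> * real n)"
proof -
  define b where "b n = real n * (fmax * tail (\<eta> / h n))" for n
  show ?thesis
  proof (rule whp_Markov[where b = b])
    show "\<forall>\<^sub>F n in sequentially. integrable M (\<lambda>\<omega>. \<Sum>i<n. \<Sum>j<n. kmat n (h n) \<omega> i j * indicator {u. \<eta> < norm u} (X j \<omega> - X i \<omega>)) \<and>
        (AE \<omega> in M. 0 \<le> (\<Sum>i<n. \<Sum>j<n. kmat n (h n) \<omega> i j * indicator {u. \<eta> < norm u} (X j \<omega> - X i \<omega>))) \<and>
        expectation (\<lambda>\<omega>. \<Sum>i<n. \<Sum>j<n. kmat n (h n) \<omega> i j * indicator {u. \<eta> < norm u} (X j \<omega> - X i \<omega>)) \<le> b n"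
      using h(1) eventually_ge_at_top[of 2]
    proof eventually_elim
      case (elim n)
      let ?Z = "\<lambda>i j \<omega>. kmat n (h n) \<omega> i j * indicator {u. \<eta> < norm u} (X j \<omega> - X i \<omega>)"
      have nn: "0 \<le> ?Z i j \<omega>" for i j \<omega>
        using kern_basic(1)[OF elim(1)] elim(2) by (simp add: kmat_def)
      have zi: "integrable M (?Z i j)" for i j
      proof (rule integrable_const_bound[where B = "Kmax / (h n ^ CARD('p) * (real n - 1))"])
        have "0 \<le> Kmax / (h n ^ CARD('p) * (real n - 1))" using elim K_le(2) by simp
        then show "AE \<omega> in M. norm (?Z i j \<omega>) \<le> Kmax / (h n ^ CARD('p) * (real n - 1))"
          using nn kmat_le[OF elim] by (intro AE_I2) (auto split: split_indicator)
      qed measurable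
      have t0: "0 \<le> fmax * tail (\<eta> / h n)"
        unfolding tail_def using K_nonneg f_bounds(4) by (intro mult_nonneg_nonneg integral_nonneg_AE AE_I2) auto
      have zE: "expectation (?Z i j) \<le> fmax * tail (\<eta> / h n) / (real n - 1)" if "i \<noteq> j" for i j
      proof -
        have "expectation (?Z i j) = expectation (\<lambda>\<omega>. kern (h n) (X j \<omega> - X i \<omega>) * indicator {u. \<eta> < norm u} (X j \<omega> - X i \<omega>)) / (real n - 1)"
          using that by (simp add: kmat_def)
        also have "\<dots> \<le> fmax * tail (\<eta> / h n) / (real n - 1)"
          using elim by (intro divide_right_mono expectation_far that) auto
        finally show ?thesis .
      qed
      have "expectation (\<lambda>\<omega>. \<Sum>i<n. \<Sum>j<n. ?Z i j \<omega>) = (\<Sum>i<n. \<Sum>j<n. expectation (?Z i j))"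
      proof -
        have "expectation (\<lambda>\<omega>. \<Sum>i<n. \<Sum>j<n. ?Z i j \<omega>) = (\<Sum>i<n. expectation (\<lambda>\<omega>. \<Sum>j<n. ?Z i j \<omega>))"
          by (intro Bochner_Integration.integral_sum Bochner_Integration.integrable_sum zi)
        also have "\<dots> = (\<Sum>i<n. \<Sum>j<n. expectation (?Z i j))"
          by (intro sum.cong refl Bochner_Integration.integral_sum zi)
        finally show ?thesis .
      qed
      also have "\<dots> \<le> (\<Sum>i<n. fmax * tail (\<eta> / h n))"
      proof (rule sum_mono)
        fix i assume i: "i \<in> {..<n}"
        then have "(\<Sum>j<n. expectation (?Z i j)) = expectation (?Z i i) + (\<Sum>j\<in>{..<n}-{i}. expectation (?Z i j))"
          by (intro sum.remove) auto
        also have "expectation (?Z i i) = 0" by (simp add: kmat_def)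
        also have "(\<Sum>j\<in>{..<n}-{i}. expectation (?Z i j)) \<le> (\<Sum>j\<in>{..<n}-{i}. fmax * tail (\<eta> / h n) / (real n - 1))"
          by (intro sum_mono zE) auto
        also have "\<dots> = fmax * tail (\<eta> / h n)" using i elim by simp
        finally show "(\<Sum>j<n. expectation (?Z i j)) \<le> fmax * tail (\<eta> / h n)" by simp
      qed
      also have "\<dots> = b n" by (simp add: b_def)
      finally have "expectation (\<lambda>\<omega>. \<Sum>i<n. \<Sum>j<n. ?Z i j \<omega>) \<le> b n" .
      moreover have "integrable M (\<lambda>\<omega>. \<Sum>i<n. \<Sum>j<n. ?Z i j \<omega>)"
        using zi by (intro Bochner_Integration.integrable_sum) auto
      moreover have "AE \<omega> in M. 0 \<le> (\<Sum>i<n. \<Sum>j<n. ?Z i j \<omega>)" by (intro AE_I2 sum_nonneg nn)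
      ultimately show ?case by blast
    qed
    show "\<forall>\<^sub>F n in sequentially. 0 < \<tau> * real n" using eventually_gt_at_top[of 0] by eventually_elim (use \<tau> in simp)
    have "filterlim h (at_right 0) sequentially" using h by (auto simp: filterlim_at elim: eventually_mono)
    then have "filterlim (\<lambda>n. inverse (h n)) at_top sequentially"
      by (rule filterlim_compose[OF filterlim_inverse_at_top_right])
    then have "filterlim (\<lambda>n. \<eta> * inverse (h n)) at_top sequentially"
      by (rule filterlim_tendsto_pos_mult_at_top[OF tendsto_const \<eta>])
    then have "filterlim (\<lambda>n. \<eta> / h n) at_top sequentially" by (simp add: divide_inverse)
    from tendsto_divide[OF tendsto_mult[OF tendsto_const tail_tendsto_0[OF this]] tendsto_const, of \<tau> fmax]
    have "(\<lambda>n. fmax * tail (\<eta> / h n) / \<tau>) \<longlonglongrightarrow> 0" using \<tau> by simp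
    then show "(\<lambda>n. b n / (\<tau> * real n)) \<longlonglongrightarrow> 0"
      by (rule Lim_transform_eventually)
         (use eventually_gt_at_top[of 0] in eventually_elim, simp add: b_def)
  qed
qed

end

text \<open>The lower bound for normalised kernels, with g the true density, loses the density error
  and the Dirichlet energy of q, which is \<delta> over the root of the density. Pairs closer than
  \<eta> have small increments of q, uniformly in n, and distant pairs carry little kernel
  mass.\<close>

lemma (in kernel_design) kernel_signal:
  assumes h: "\<forall>\<^sub>F n in sequentially. 0 < h n" "h \<longlonglongrightarrow> 0"
    and nh: "filterlim (\<lambda>n. real n * h n ^ CARD('p)) at_top sequentially"
    and eq: "equicontinuous_seq \<delta>" and B: "B > 0" "\<forall>\<^sub>F n in sequentially. \<forall>x\<in>ucube. \<bar>\<delta> n x\<bar> \<le> B"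
    and conv: "conv_in_prob M (\<lambda>n \<omega>. (1 / real n) * (\<Sum>i<n. (\<delta> n (X i \<omega>))\<^sup>2)) 1"
  shows "whp M (\<lambda>n \<omega>. real n / 2 \<le> (\<Sum>i<n. \<Sum>j<n. \<delta> n (X i \<omega>) * weight (Kernel K) n (h n) (\<lambda>i. X i \<omega>) i j * \<delta> n (X j \<omega>)))"
proof -
  have fmin: "0 < fmin" "0 < sqrt fmin" using f_bounds(3) by auto
  \<comment> \<open>The losses caused by the density error, \<open>2 * B * sqrt e + 2 * e\<close>
    times n, are then at most n/10.\<close>
  define e where "e = min (1/40) ((1/(40*B))\<^sup>2)"
  have e: "e > 0" "e \<le> 1/40" "2 * B * sqrt e \<le> 1/20"
  proof -
    show "e > 0" "e \<le> 1/40" using B(1) by (auto simp: e_def)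
    have "sqrt e \<le> sqrt ((1/(40*B))\<^sup>2)" by (intro real_sqrt_le_mono) (simp add: e_def)
    also have "\<dots> = 1/(40*B)" using B(1) by simp
    finally have "2 * B * sqrt e \<le> 2 * B * (1/(40*B))" using B(1) by (intro mult_left_mono) auto
    also have "\<dots> = 1/20" using B(1) by simp
    finally show "2 * B * sqrt e \<le> 1/20" .
  qed
  define \<tau> where "\<tau> = e * fmin / B\<^sup>2"
  have \<tau>: "\<tau> > 0" "B\<^sup>2 * \<tau> / fmin = e" using e(1) fmin B(1) by (auto simp: \<tau>_def)
  \<comment> \<open>Near pairs: the squared increment \<open>\<omega>0\<^sup>2\<close> times the
    total kernel mass, at most \<open>fmax + \<tau>\<close> per observation, gives n/10.\<close>
  define \<omega>0 where "\<omega>0 = sqrt (1 / (10 * (fmax + \<tau>)))"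
  have \<omega>0: "\<omega>0 > 0" "\<omega>0\<^sup>2 * (fmax + \<tau>) = 1/10"
    using \<tau>(1) f_bounds(4) by (auto simp: \<omega>0_def field_simps)
  \<comment> \<open>Far pairs: squared increments of q are at most
    \<open>4 * B\<^sup>2 / fmin\<close>, so a kernel mass of \<phi> n costs another n/10.\<close>
  define \<phi> where "\<phi> = fmin / (40 * B\<^sup>2)"
  have \<phi>: "\<phi> > 0" "4 * B\<^sup>2 / fmin * \<phi> = 1/10" using fmin B(1) by (auto simp: \<phi>_def)
  \<comment> \<open>The increment of the product q is split between its factors: t bounds both the
    increment of \<delta> and that of the inverse root of the density.\<close>
  define t where "t = \<omega>0 / (1 / sqrt fmin + B)"
  have den: "0 < 1 / sqrt fmin + B" using fmin B(1) by (intro add_pos_pos) auto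
  have t: "t > 0" "t * (1 / sqrt fmin) + B * t = \<omega>0"
  proof -
    show "t > 0" using \<omega>0 den by (simp add: t_def)
    have "t * (1 / sqrt fmin + B) = \<omega>0" using den by (simp add: t_def)
    then show "t * (1 / sqrt fmin) + B * t = \<omega>0" by (simp add: algebra_simps)
  qed
  have "continuous_on ucube (\<lambda>x. 1 / sqrt (f x))"
    using f_cont f_pos by (intro continuous_intros) (auto simp: less_imp_neq[symmetric])
  then have "uniformly_continuous_on ucube (\<lambda>x. 1 / sqrt (f x))"
    by (rule compact_uniformly_continuous) simp
  then obtain \<eta>1 where \<eta>1: "\<eta>1 > 0"
    "\<And>x y. x \<in> ucube \<Longrightarrow> y \<in> ucube \<Longrightarrow> dist y x < \<eta>1 \<Longrightarrow> dist (1 / sqrt (f y)) (1 / sqrt (f x)) < t"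
    unfolding uniformly_continuous_on_def using t(1) by blast
  obtain \<eta>2 where \<eta>2: "\<eta>2 > 0" "\<And>n x x'. n \<ge> 1 \<Longrightarrow> x \<in> ucube \<Longrightarrow> x' \<in> ucube \<Longrightarrow> norm (x - x') \<le> \<eta>2 \<Longrightarrow> \<bar>\<delta> n x - \<delta> n x'\<bar> \<le> t"
    using equicontinuous_seqD[OF eq t(1)] by blast
  define \<eta> where "\<eta> = min (\<eta>1 / 2) \<eta>2"
  have \<eta>: "\<eta> > 0" "\<eta> < \<eta>1" "\<eta> \<le> \<eta>2" using \<eta>1(1) \<eta>2(1) by (auto simp: \<eta>_def)
  have whps: "whp M (\<lambda>n \<omega>. ((9/10 * real n \<le> (\<Sum>i<n. (\<delta> n (X i \<omega>))\<^sup>2) \<and> (\<Sum>i<n. (\<delta> n (X i \<omega>))\<^sup>2) \<le> 2 * real n) \<and>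
     (\<Sum>i<n. \<bar>fhat n (h n) i \<omega> - dens (X i \<omega>)\<bar>) \<le> \<tau> * real n) \<and>
     (\<Sum>i<n. \<Sum>j<n. kmat n (h n) \<omega> i j * indicator {u. \<eta> < norm u} (X j \<omega> - X i \<omega>)) \<le> \<phi> * real n)"
    by (intro whp_conj sum_sq_whp[OF conv] density_error_whp[OF h nh \<tau>(1)] far_pairs_whp[OF h \<eta>(1) \<phi>(1)])
  have ev: "\<forall>\<^sub>F n in sequentially. 0 < h n \<and> (\<forall>x\<in>ucube. \<bar>\<delta> n x\<bar> \<le> B) \<and> 2 \<le> n"
    using h(1) B(2) eventually_ge_at_top[of 2] by eventually_elim blast
  from whps show ?thesis
  proof (rule whp_mono, use ev in eventually_elim, intro ballI impI, elim conjE)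
    fix n \<omega>
    assume n: "0 < h n" "\<forall>x\<in>ucube. \<bar>\<delta> n x\<bar> \<le> B" "2 \<le> n" and \<omega>: "\<omega> \<in> space M"
      and s: "9/10 * real n \<le> (\<Sum>i<n. (\<delta> n (X i \<omega>))\<^sup>2)"
      and D: "(\<Sum>i<n. \<bar>fhat n (h n) i \<omega> - dens (X i \<omega>)\<bar>) \<le> \<tau> * real n"
      and F: "(\<Sum>i<n. \<Sum>j<n. kmat n (h n) \<omega> i j * indicator {u. \<eta> < norm u} (X j \<omega> - X i \<omega>)) \<le> \<phi> * real n"
    interpret nk: normalized_kernel n "kmat n (h n) \<omega>" "\<lambda>i. fhat n (h n) i \<omega>" "weight (Kernel K) n (h n) (\<lambda>i. X i \<omega>)"
      by (rule kmat_normalized[OF n(1,3)])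
    define q where "q x = \<delta> n x / sqrt (dens x)" for x
    have xc: "X i \<omega> \<in> ucube" for i by (rule X_cube[OF \<omega>])
    have qb: "\<bar>q x\<bar> \<le> B / sqrt fmin" if x: "x \<in> ucube" for x
    proof -
      have "\<bar>q x\<bar> = \<bar>\<delta> n x\<bar> / sqrt (dens x)" using dens_bounds(1)[of x] by (simp add: q_def)
      also have "\<dots> \<le> B / sqrt fmin"
        using n(2) x dens_ge[OF x] fmin B(1) by (intro frac_le) auto
      finally show ?thesis .
    qed
    have far: "(q x - q y)\<^sup>2 \<le> 4 * B\<^sup>2 / fmin" if xy: "x \<in> ucube" "y \<in> ucube" for x y
    proof -
      have "\<bar>q x - q y\<bar> \<le> \<bar>2 * (B / sqrt fmin)\<bar>" using qb[OF xy(1)] qb[OF xy(2)] by linarith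
      then have "(q x - q y)\<^sup>2 \<le> (2 * (B / sqrt fmin))\<^sup>2" by (rule abs_le_square_iff[THEN iffD1])
      also have "\<dots> = 4 * B\<^sup>2 / fmin" using fmin(1) by (simp add: power_mult_distrib power_divide)
      finally show ?thesis .
    qed
    have near: "(q x - q y)\<^sup>2 \<le> \<omega>0\<^sup>2" if xy: "x \<in> ucube" "y \<in> ucube" and d: "norm (y - x) \<le> \<eta>" for x y
    proof -
      define a b where "a = 1 / sqrt (f x)" and "b = 1 / sqrt (f y)"
      have "dist b a < t"
        unfolding a_def b_def using xy d \<eta>(2) by (intro \<eta>1(2)) (auto simp: dist_norm)
      then have ab: "\<bar>a - b\<bar> \<le> t" by (simp add: dist_real_def abs_minus_commute)
      have "norm (x - y) \<le> \<eta>2" using d \<eta>(3) by (simp add: norm_minus_commute)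
      then have dd: "\<bar>\<delta> n x - \<delta> n y\<bar> \<le> t" using xy n(3) by (intro \<eta>2(2)) auto
      have a1: "0 \<le> a" "a \<le> 1 / sqrt fmin"
        using f_bounds(2)[OF xy(1)] fmin f_pos[OF xy(1)] by (auto simp: a_def intro!: divide_left_mono mult_pos_pos)
      have "q x - q y = (\<delta> n x - \<delta> n y) * a + \<delta> n y * (a - b)"
        using xy by (simp add: q_def dens_def a_def b_def algebra_simps)
      then have "\<bar>q x - q y\<bar> \<le> \<bar>(\<delta> n x - \<delta> n y) * a\<bar> + \<bar>\<delta> n y * (a - b)\<bar>" by linarith
      also have "\<dots> = \<bar>\<delta> n x - \<delta> n y\<bar> * a + \<bar>\<delta> n y\<bar> * \<bar>a - b\<bar>" using a1 by (simp add: abs_mult)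
      also have "\<dots> \<le> t * (1 / sqrt fmin) + B * t"
        using dd ab a1 n(2) xy t(1) B(1) by (intro add_mono mult_mono) auto
      also have "\<dots> = \<omega>0" by (rule t(2))
      finally show ?thesis using \<omega>0(1) by (intro abs_le_square_iff[THEN iffD1]) simp
    qed
    have k0: "0 \<le> kmat n (h n) \<omega> i j" for i j by (rule nk.k_nonneg)
    have "(\<Sum>i<n. \<Sum>j<n. kmat n (h n) \<omega> i j * (q (X i \<omega>) - q (X j \<omega>))\<^sup>2)
        \<le> (\<Sum>i<n. \<Sum>j<n. \<omega>0\<^sup>2 * kmat n (h n) \<omega> i j + (4 * B\<^sup>2 / fmin) * (kmat n (h n) \<omega> i j * indicator {u. \<eta> < norm u} (X j \<omega> - X i \<omega>)))"
    proof (intro sum_mono)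
      fix i j
      show "kmat n (h n) \<omega> i j * (q (X i \<omega>) - q (X j \<omega>))\<^sup>2
          \<le> \<omega>0\<^sup>2 * kmat n (h n) \<omega> i j + (4 * B\<^sup>2 / fmin) * (kmat n (h n) \<omega> i j * indicator {u. \<eta> < norm u} (X j \<omega> - X i \<omega>))"
      proof (cases "\<eta> < norm (X j \<omega> - X i \<omega>)")
        case True
        have "kmat n (h n) \<omega> i j * (q (X i \<omega>) - q (X j \<omega>))\<^sup>2 \<le> kmat n (h n) \<omega> i j * (4 * B\<^sup>2 / fmin)"
          by (intro mult_left_mono far xc k0)
        moreover have "0 \<le> \<omega>0\<^sup>2 * kmat n (h n) \<omega> i j" using k0 by simp
        ultimately show ?thesis using True by (simp add: mult.commute)
      next
        case False
        then have "kmat n (h n) \<omega> i j * (q (X i \<omega>) - q (X j \<omega>))\<^sup>2 \<le> kmat n (h n) \<omega> i j * \<omega>0\<^sup>2"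
          by (intro mult_left_mono near xc k0) auto
        then show ?thesis using False by (simp add: mult.commute)
      qed
    qed
    also have "\<dots> = \<omega>0\<^sup>2 * (\<Sum>i<n. fhat n (h n) i \<omega>)
        + (4 * B\<^sup>2 / fmin) * (\<Sum>i<n. \<Sum>j<n. kmat n (h n) \<omega> i j * indicator {u. \<eta> < norm u} (X j \<omega> - X i \<omega>))"
    proof -
      have "(\<Sum>i<n. fhat n (h n) i \<omega>) = (\<Sum>i<n. \<Sum>j<n. kmat n (h n) \<omega> i j)"
        by (intro sum.cong) (auto simp: fhat_kmat)
      then show ?thesis by (simp only: sum.distrib sum_distrib_left)
    qed
    also have "\<dots> \<le> \<omega>0\<^sup>2 * ((fmax + \<tau>) * real n) + (4 * B\<^sup>2 / fmin) * (\<phi> * real n)"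
    proof (intro add_mono mult_left_mono F)
      have "(\<Sum>i<n. fhat n (h n) i \<omega>) \<le> (\<Sum>i<n. fmax + \<bar>fhat n (h n) i \<omega> - dens (X i \<omega>)\<bar>)"
      proof (rule sum_mono)
        fix i show "fhat n (h n) i \<omega> \<le> fmax + \<bar>fhat n (h n) i \<omega> - dens (X i \<omega>)\<bar>"
          using dens_bounds(2)[of "X i \<omega>"] by linarith
      qed
      also have "\<dots> \<le> real n * fmax + \<tau> * real n" using D by (simp add: sum.distrib)
      finally show "(\<Sum>i<n. fhat n (h n) i \<omega>) \<le> (fmax + \<tau>) * real n" by (simp add: algebra_simps)
    qed (use fmin in auto)
    also have "\<dots> = (1/5) * real n"
    proof -
      have "\<omega>0\<^sup>2 * ((fmax + \<tau>) * real n) + (4 * B\<^sup>2 / fmin) * (\<phi> * real n)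
          = (\<omega>0\<^sup>2 * (fmax + \<tau>)) * real n + (4 * B\<^sup>2 / fmin * \<phi>) * real n" by (simp only: mult.assoc)
      then show ?thesis unfolding \<omega>0(2) \<phi>(2) by simp
    qed
    finally have A: "(\<Sum>i<n. \<Sum>j<n. kmat n (h n) \<omega> i j * (q (X i \<omega>) - q (X j \<omega>))\<^sup>2) \<le> (1/5) * real n" .
    have "(\<Sum>i<n. (\<delta> n (X i \<omega>))\<^sup>2) - B\<^sup>2 * \<tau> / fmin * real n
        - (\<Sum>i<n. \<Sum>j<n. kmat n (h n) \<omega> i j * (\<delta> n (X i \<omega>) / sqrt (dens (X i \<omega>)) - \<delta> n (X j \<omega>) / sqrt (dens (X j \<omega>)))\<^sup>2) / 2
        - (2 * B * sqrt (B\<^sup>2 * \<tau> / fmin) + B\<^sup>2 * \<tau> / fmin) * real n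
        \<le> (\<Sum>i<n. \<Sum>j<n. \<delta> n (X i \<omega>) * weight (Kernel K) n (h n) (\<lambda>i. X i \<omega>) i j * \<delta> n (X j \<omega>))"
      by (rule nk.quadratic_form_lower_bound[where g = "\<lambda>i. dens (X i \<omega>)"])
         (use n(2) xc B(1) fmin D dens_ge in auto)
    moreover have "(2 * B * sqrt e + e) * real n \<le> (3/40) * real n" "e * real n \<le> (1/40) * real n"
      using e by (intro mult_right_mono; simp)+
    ultimately show "real n / 2 \<le> (\<Sum>i<n. \<Sum>j<n. \<delta> n (X i \<omega>) * weight (Kernel K) n (h n) (\<lambda>i. X i \<omega>) i j * \<delta> n (X j \<omega>))"
      unfolding \<tau>(2) q_def[symmetric] using A s by linarith
  qed
qed

text \<open>The base bandwidth is the largest of the grid, so Assumption W on the smallest bandwidth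
  bounds it from below. Hence n h0^p is at least of order (ln n)^C2 n^x. For \<open>s_lower\<close>
  equal to p/4 the exponent x is 0 and the logarithm alone provides the divergence.\<close>

lemma bandwidth_effective_sample_size:
  assumes W: "assumption_W (S :: 'p::finite smoother) a h0 J"
  shows "filterlim (\<lambda>n. real n * h0 n ^ CARD('p)) at_top sequentially"
proof -
  let ?p = "real CARD('p)"
  have a: "1 < a" "\<And>n. n \<ge> 1 \<Longrightarrow> 0 < h0 n" using W unfolding assumption_W_def by blast+
  obtain C2 where C2: "C2 > 1" and so: "same_order (\<lambda>n. h0 n / a ^ J n)
      (\<lambda>n. ln (real n) powr (C2 / ?p) * real n powr (- 2 / (4 * s_lower S + ?p)))"
    using W unfolding assumption_W_def by blast
  then obtain C where C: "C > 1" and ev2: "\<forall>\<^sub>F n in sequentially.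
      1 / C \<le> (h0 n / a ^ J n) / (ln (real n) powr (C2 / ?p) * real n powr (- 2 / (4 * s_lower S + ?p))) \<and>
      (h0 n / a ^ J n) / (ln (real n) powr (C2 / ?p) * real n powr (- 2 / (4 * s_lower S + ?p))) \<le> C"
    unfolding same_order_def by blast
  from ev2 have ev: "\<forall>\<^sub>F n in sequentially.
      1 / C \<le> (h0 n / a ^ J n) / (ln (real n) powr (C2 / ?p) * real n powr (- 2 / (4 * s_lower S + ?p)))"
    by (rule eventually_mono) (rule conjunct1)
  have p: "?p > 0" by simp
  define x where "x = 1 - 2 * ?p / (4 * s_lower S + ?p)"
  have x: "x \<ge> 0" using p by (cases S) (auto simp: x_def s_lower_def field_simps)
  have lim: "filterlim (\<lambda>n. (1 / C) ^ CARD('p) * ln (real n) powr C2) at_top sequentially"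
    using C2 C by (intro filterlim_tendsto_pos_mult_at_top[OF tendsto_const]) (auto, real_asymp)
  show ?thesis
  proof (rule filterlim_at_top_mono[OF lim])
    show "\<forall>\<^sub>F n in sequentially. (1 / C) ^ CARD('p) * ln (real n) powr C2 \<le> real n * h0 n ^ CARD('p)"
      using ev eventually_ge_at_top[of 3]
    proof eventually_elim
      case (elim n)
      have n: "real n > 1" using elim by simp
      then have l: "ln (real n) > 0" by simp
      define g where "g = ln (real n) powr (C2 / ?p) * real n powr (- 2 / (4 * s_lower S + ?p))"
      have g: "g > 0" using n l by (simp add: g_def)
      have "1 / C \<le> (h0 n / a ^ J n) / g" using elim(1) by (simp only: g_def)
      then have "1 / C * g \<le> h0 n / a ^ J n" using g by (simp only: pos_le_divide_eq)
      also have "\<dots> \<le> h0 n / 1" using a(1) a(2)[of n] elim by (intro divide_left_mono) auto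
      finally have "(1 / C * g) ^ CARD('p) \<le> h0 n ^ CARD('p)" using C g by (intro power_mono) auto
      then have le: "real n * ((1 / C) ^ CARD('p) * g ^ CARD('p)) \<le> real n * h0 n ^ CARD('p)"
        unfolding power_mult_distrib by (rule mult_left_mono) simp
      have g_pow: "g ^ CARD('p) = ln (real n) powr C2 * real n powr (- 2 * ?p / (4 * s_lower S + ?p))"
      proof -
        have "g ^ CARD('p) = g powr ?p" using g by (simp add: powr_realpow)
        also have "\<dots> = ln (real n) powr (C2 / ?p * ?p) * real n powr (- 2 / (4 * s_lower S + ?p) * ?p)"
          using n l by (simp add: g_def powr_mult powr_powr)
        finally show ?thesis by simp
      qed
      have n_pow: "real n * real n powr (- 2 * ?p / (4 * s_lower S + ?p)) = real n powr x"
      proof -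
        have "real n powr x = real n powr (1 + - 2 * ?p / (4 * s_lower S + ?p))" by (simp add: x_def)
        then show ?thesis using n by (simp only: powr_add) simp
      qed
      have "(1 / C) ^ CARD('p) * ln (real n) powr C2 * real n powr x = real n * ((1 / C) ^ CARD('p) * g ^ CARD('p))"
        unfolding g_pow n_pow[symmetric] by (simp only: mult_ac)
      also note le
      finally have "(1 / C) ^ CARD('p) * ln (real n) powr C2 * real n powr x \<le> real n * h0 n ^ CARD('p)" .
      moreover have "1 \<le> real n powr x" using n x by (simp add: ge_one_powr_ge_zero)
      then have "(1 / C) ^ CARD('p) * ln (real n) powr C2 * 1 \<le> (1 / C) ^ CARD('p) * ln (real n) powr C2 * real n powr x"
        using C by (intro mult_left_mono) auto
      ultimately show ?case by simp
    qed
  qed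
qed

text \<open>Removes the distinction between the smoothers: the statistic is treated afterwards
  through the regularity of the weights and the lower bound for the signal.\<close>

lemma smoother_weights:
  fixes X :: "nat \<Rightarrow> 'a \<Rightarrow> real^'p" and S :: "'p smoother"
  assumes M: "prob_space M" and D: "assumption_D M X" and W: "assumption_W S a h0 J"
    and h0: "h0 \<longlonglongrightarrow> 0" and eq: "equicontinuous_seq \<delta>"
    and conv: "conv_in_prob M (\<lambda>n \<omega>. (1 / real n) * (\<Sum>i<n. (\<delta> n (X i \<omega>))\<^sup>2)) 1"
  obtains C where "C > 0" "regular_weights M X h0 (\<lambda>n \<omega>. weight S n (h0 n) (\<lambda>i. X i \<omega>)) C"
    "whp M (\<lambda>n \<omega>. real n / 2 \<le> (\<Sum>i<n. \<Sum>j<n. \<delta> n (X i \<omega>) * weight S n (h0 n) (\<lambda>i. X i \<omega>) i j * \<delta> n (X j \<omega>)))"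
proof -
  obtain f where f: "continuous_on ucube f" "\<And>x. x \<in> ucube \<Longrightarrow> 0 < f x"
    "\<And>i. distributed M lborel (X i) (\<lambda>x. ennreal (f x) * indicator ucube x)"
    using D by (auto simp: assumption_D_def)
  interpret iid_design M X f
    using M D f by (intro iid_design.intro iid_design_axioms.intro) (auto simp: assumption_D_def)
  obtain B where B: "B > 0" "\<forall>\<^sub>F n in sequentially. \<forall>x\<in>ucube. \<bar>\<delta> n x\<bar> \<le> B"
    using equicontinuous_bounded[OF eq X_cube conv] by blast
  have hp: "\<forall>\<^sub>F n in sequentially. 0 < h0 n"
  proof -
    have *: "\<forall>n\<ge>1. 0 < h0 n" using W unfolding assumption_W_def by blast
    show ?thesis using eventually_ge_at_top[of 1] by eventually_elim (use * in blast)
  qed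
  have h1: "\<forall>\<^sub>F n in sequentially. h0 n < 1" using h0 by (intro order_tendstoD(2)) auto
  note nh = bandwidth_effective_sample_size[OF W]
  show thesis
  proof (cases S)
    case Polynomial
    define C where "C = (2::real) ^ CARD('p)"
    have K: "\<forall>\<^sub>F n in sequentially. finite (poly_index (h0 n) :: ('p \<Rightarrow> nat) set) \<and> real (card (poly_index (h0 n) :: ('p \<Rightarrow> nat) set)) \<le> C / h0 n ^ CARD('p)"
      using hp h1 by eventually_elim (auto simp: C_def intro!: poly_index_card)
    have w: "weight S n (h0 n) (\<lambda>i. X i \<omega>) i j = (if i = j then 0 else proj_matrix n (poly_index (h0 n)) (\<lambda>k i. monomial k (X i \<omega>)) i j)" for n \<omega> i j
      by (simp add: weight_def Polynomial)
    show thesis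
    proof (rule that[of C])
      show "regular_weights M X h0 (\<lambda>n \<omega>. weight S n (h0 n) (\<lambda>i. X i \<omega>)) C"
        by (rule projection_regular[OF K w]) measurable
      show "whp M (\<lambda>n \<omega>. real n / 2 \<le> (\<Sum>i<n. \<Sum>j<n. \<delta> n (X i \<omega>) * weight S n (h0 n) (\<lambda>i. X i \<omega>) i j * \<delta> n (X j \<omega>)))"
        by (rule projection_signal[OF K w hp nh B(2) _ conv polynomial_approximation_whp[OF hp h0 eq B]]) (simp add: C_def)
    qed (simp add: C_def)
  next
    case (Piecewise q)
    define C where "C = (real q + 1) ^ CARD('p)"
    have K: "\<forall>\<^sub>F n in sequentially. finite (piecewise_index q (h0 n) :: (('p \<Rightarrow> nat) \<times> ('p \<Rightarrow> nat)) set) \<and> real (card (piecewise_index q (h0 n) :: (('p \<Rightarrow> nat) \<times> ('p \<Rightarrow> nat)) set)) \<le> C / h0 n ^ CARD('p)"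
      using hp h1 by eventually_elim (auto simp: C_def intro!: piecewise_index_card)
    have w: "weight S n (h0 n) (\<lambda>i. X i \<omega>) i j = (if i = j then 0 else proj_matrix n (piecewise_index q (h0 n)) (\<lambda>k i. piecewise_fun (h0 n) k (X i \<omega>)) i j)" for n \<omega> i j
      by (simp add: weight_def Piecewise)
    have "\<forall>n\<ge>1. 1 / h0 n \<in> \<int>"
    proof (intro allI impI)
      fix n :: nat assume "1 \<le> n"
      \<comment> \<open>The base bandwidth is the grid point with j = 0, so its inverse is an
        integer.\<close>
      moreover have "h0 n \<in> bandwidths (h0 n) a (J n)" unfolding bandwidths_def by (auto intro!: exI[of _ 0])
      ultimately show "1 / h0 n \<in> \<int>" using W Piecewise by (simp add: assumption_W_def)
    qed
    note h0_int = this
    have int: "\<forall>\<^sub>F n in sequentially. 1 / h0 n \<in> \<int>"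
      using eventually_ge_at_top[of 1] by eventually_elim (use h0_int in blast)
    show thesis
    proof (rule that[of C])
      show "regular_weights M X h0 (\<lambda>n \<omega>. weight S n (h0 n) (\<lambda>i. X i \<omega>)) C"
        by (rule projection_regular[OF K w]) measurable
      show "whp M (\<lambda>n \<omega>. real n / 2 \<le> (\<Sum>i<n. \<Sum>j<n. \<delta> n (X i \<omega>) * weight S n (h0 n) (\<lambda>i. X i \<omega>) i j * \<delta> n (X j \<omega>)))"
        by (rule projection_signal[OF K w hp nh B(2) _ conv piecewise_approximation_whp[OF hp h0 int eq]]) (simp add: C_def)
    qed (simp add: C_def)
  next
    case (Kernel K)
    interpret kernel_design M X f K
      using W Kernel by unfold_locales (simp add: assumption_W_def)
    obtain C where "C > 0" "regular_weights M X h0 (\<lambda>n \<omega>. weight (Kernel K) n (h0 n) (\<lambda>i. X i \<omega>)) C"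
      using kernel_regular[OF hp h0] by blast
    with kernel_signal[OF hp h0 nh eq B conv] show thesis by (intro that[of C]) (simp_all add: Kernel)
  qed
qed

section \<open>The least squares estimator\<close>

context regression_errors
begin

lemma continuous_design_measurable:
  assumes "continuous_on ucube \<phi>" "i < n"
  shows "(\<lambda>\<omega>. \<phi> (X i \<omega>) :: real) \<in> borel_measurable (sigma_design M X n)"
proof -
  have "(\<lambda>\<omega>. indicator ucube (X i \<omega>) *\<^sub>R \<phi> (X i \<omega>)) \<in> borel_measurable (sigma_design M X n)"
    by (rule measurable_compose[OF X_design[OF assms(2)]])
       (intro borel_measurable_continuous_on_indicator assms(1), simp)
  then show ?thesis
    by (rule measurable_cong[THEN iffD1, rotated]) (use X_cube subalgebra_design[of n] in \<open>auto simp: subalgebra_def\<close>)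
qed

text \<open>Chebyshev, with second moment at most \<open>vmax\<close> times the mean sum of squared
  coefficients. A bound on this sum, instead of on single coefficients, is what survives the passage
  through a weight matrix.\<close>

lemma linear_form_whp:
  fixes a :: "nat \<Rightarrow> nat \<Rightarrow> 'a \<Rightarrow> real" and c :: "nat \<Rightarrow> real"
  assumes a: "\<forall>\<^sub>F n in sequentially. (\<forall>i<n. a n i \<in> borel_measurable (sigma_design M X n)) \<and>
      (\<forall>\<omega>\<in>space M. (\<Sum>i<n. (a n i \<omega>)\<^sup>2) \<le> B * real n)"
    and c: "\<forall>\<^sub>F n in sequentially. 0 < c n" "(\<lambda>n. real n / (c n)\<^sup>2) \<longlonglongrightarrow> 0"
  shows "whp M (\<lambda>n \<omega>. \<bar>\<Sum>i<n. a n i \<omega> * \<epsilon> i \<omega>\<bar> \<le> c n)"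
proof (rule whp_Chebyshev[where b = "\<lambda>n. vmax * (B * real n)", OF _ c(1)])
  show "\<forall>\<^sub>F n in sequentially. integrable M (\<lambda>\<omega>. (\<Sum>i<n. a n i \<omega> * \<epsilon> i \<omega>)\<^sup>2) \<and>
      expectation (\<lambda>\<omega>. (\<Sum>i<n. a n i \<omega> * \<epsilon> i \<omega>)\<^sup>2) \<le> vmax * (B * real n)"
    using a
  proof eventually_elim
    case (elim n)
    then have am: "a n i \<in> borel_measurable (sigma_design M X n)" if "i < n" for i using that by blast
    have aM [measurable]: "a n i \<in> borel_measurable M" if "i < n" for i
      by (rule measurable_from_subalg[OF subalgebra_design am[OF that]])
    have sq: "(a n i \<omega>)\<^sup>2 \<le> B * real n" if "i < n" "\<omega> \<in> space M" for i \<omega>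
    proof -
      have "(a n i \<omega>)\<^sup>2 \<le> (\<Sum>i<n. (a n i \<omega>)\<^sup>2)" using that(1) by (intro member_le_sum) auto
      also have "\<dots> \<le> B * real n" using elim that(2) by blast
      finally show ?thesis .
    qed
    have bd: "\<bar>a n i \<omega>\<bar> \<le> sqrt (B * real n)" if "i < n" "\<omega> \<in> space M" for i \<omega>
      using real_sqrt_le_mono[OF sq[OF that]] by simp
    have a2: "integrable M (\<lambda>\<omega>. (a n i \<omega>)\<^sup>2)" if "i < n" for i
      by (rule integrable_const_bound[where B = "B * real n"]) (use that sq in auto)
    note L = linear_form_second_moment[of n "a n", OF am bd]
    have "(\<Sum>i<n. expectation (\<lambda>\<omega>. (a n i \<omega>)\<^sup>2)) = expectation (\<lambda>\<omega>. \<Sum>i<n. (a n i \<omega>)\<^sup>2)"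
      using a2 by (intro Bochner_Integration.integral_sum[symmetric]) auto
    also have "\<dots> \<le> expectation (\<lambda>\<omega>. B * real n)"
      using a2 elim by (intro integral_mono Bochner_Integration.integrable_sum) auto
    finally have "(\<Sum>i<n. expectation (\<lambda>\<omega>. (a n i \<omega>)\<^sup>2)) \<le> B * real n" by (simp add: prob_space)
    then have "vmax * (\<Sum>i<n. expectation (\<lambda>\<omega>. (a n i \<omega>)\<^sup>2)) \<le> vmax * (B * real n)"
      using variance_bounds(3) by (intro mult_left_mono) auto
    with L show ?case by (auto intro: order.trans)
  qed
  from tendsto_mult[OF tendsto_const c(2), of "vmax * B"]
  show "(\<lambda>n. vmax * (B * real n) / (c n)\<^sup>2) \<longlonglongrightarrow> 0" by (simp add: mult.assoc)
qed

text \<open>The average of the squared errors has bounded mean, hence is tight. An event may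
  therefore be proved under the extra condition that this average is at most a fixed
  \<open>K\<close>, with constants depending on \<open>K\<close>.\<close>

lemma whp_of_bounded_squares:
  assumes "\<And>K. K > 0 \<Longrightarrow> whp M (\<lambda>n \<omega>. (\<Sum>i<n. (\<epsilon> i \<omega>)\<^sup>2) \<le> K * real n \<longrightarrow> Q n \<omega>)"
  shows "whp M Q"
proof (rule whp_tight[where Z = "\<lambda>n \<omega>. (\<Sum>i<n. (\<epsilon> i \<omega>)\<^sup>2) / real n" and b = vmax])
  show "\<forall>\<^sub>F n in sequentially. integrable M (\<lambda>\<omega>. (\<Sum>i<n. (\<epsilon> i \<omega>)\<^sup>2) / real n) \<and>
      (AE \<omega> in M. 0 \<le> (\<Sum>i<n. (\<epsilon> i \<omega>)\<^sup>2) / real n) \<and>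
      expectation (\<lambda>\<omega>. (\<Sum>i<n. (\<epsilon> i \<omega>)\<^sup>2) / real n) \<le> vmax"
    using eventually_gt_at_top[of 0]
  proof eventually_elim
    case (elim n)
    have e2: "expectation (\<lambda>\<omega>. (\<epsilon> i \<omega>)\<^sup>2) \<le> vmax" for i
    proof -
      \<comment> \<open>The constant weight 1 brings the second moment into the form of the variance
        lemma, applied with the design of size \<open>Suc i\<close>, which contains
        \<open>X i\<close>.\<close>
      have int: "integrable M (\<lambda>\<omega>. 1 * (\<epsilon> i \<omega>)\<^sup>2)" using err_integrable(2)[of i] by simp
      have "expectation (\<lambda>\<omega>. 1 * (\<epsilon> i \<omega>)\<^sup>2) = expectation (\<lambda>\<omega>. 1 * \<sigma>2 (X i \<omega>))"
        by (rule err_variance(2)[of i "Suc i", OF _ _ int]) auto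
      also have "\<dots> \<le> expectation (\<lambda>\<omega>. vmax)"
        using variance_bounds(1) X_cube
        by (intro integral_mono err_variance(1)[of i "Suc i", OF _ _ int]) auto
      finally show ?thesis by (simp add: prob_space)
    qed
    have "expectation (\<lambda>\<omega>. (\<Sum>i<n. (\<epsilon> i \<omega>)\<^sup>2) / real n) = (\<Sum>i<n. expectation (\<lambda>\<omega>. (\<epsilon> i \<omega>)\<^sup>2)) / real n"
      using err_integrable(2) by simp
    also have "\<dots> \<le> (\<Sum>i<n. vmax) / real n"
      using e2 by (intro divide_right_mono sum_mono) auto
    also have "\<dots> = vmax" using elim by simp
    finally show ?case using err_integrable(2) by (auto intro!: sum_nonneg divide_nonneg_nonneg AE_I2)
  qed
  fix K :: real assume K: "K > 0"
  show "whp M (\<lambda>n \<omega>. (\<Sum>i<n. (\<epsilon> i \<omega>)\<^sup>2) / real n \<le> K \<longrightarrow> Q n \<omega>)"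
    by (rule whp_mono[OF assms[OF K]], use eventually_gt_at_top[of 0] in eventually_elim)
       (simp add: pos_divide_le_eq)
qed

text \<open>Reduces to squares by \<bar>y\<bar> \<le> y^2 + 1.\<close>

lemma whp_of_bounded_errors:
  assumes "\<And>K. K > 0 \<Longrightarrow> whp M (\<lambda>n \<omega>. (\<Sum>i<n. \<bar>\<epsilon> i \<omega>\<bar>) \<le> K * real n \<longrightarrow> Q n \<omega>)"
  shows "whp M Q"
proof (rule whp_of_bounded_squares)
  fix K :: real assume "K > 0"
  then have "K + 1 > 0" by simp
  from assms[OF this] show "whp M (\<lambda>n \<omega>. (\<Sum>i<n. (\<epsilon> i \<omega>)\<^sup>2) \<le> K * real n \<longrightarrow> Q n \<omega>)"
  proof (rule whp_mono, intro always_eventually allI ballI impI)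
    fix n \<omega> assume Q: "(\<Sum>i<n. \<bar>\<epsilon> i \<omega>\<bar>) \<le> (K + 1) * real n \<longrightarrow> Q n \<omega>" and le: "(\<Sum>i<n. (\<epsilon> i \<omega>)\<^sup>2) \<le> K * real n"
    have "\<bar>y\<bar> \<le> y\<^sup>2 + 1" for y :: real
      using sum_squares_bound[of "\<bar>y\<bar>" 1] zero_le_power2[of y] by simp
    then have "(\<Sum>i<n. \<bar>\<epsilon> i \<omega>\<bar>) \<le> (\<Sum>i<n. (\<epsilon> i \<omega>)\<^sup>2 + 1)" by (intro sum_mono)
    also have "\<dots> \<le> (K + 1) * real n" using le by (simp add: sum.distrib distrib_right)
    finally show "Q n \<omega>" using Q by simp
  qed
qed

end

section \<open>Expansion of the model around the true parameter\<close>

lemma quadratic_matrix_form: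
  fixes A :: "real^'d^'d" and v :: "real^'d"
  shows "(A *v v) \<bullet> v = (\<Sum>k\<in>UNIV. \<Sum>l\<in>UNIV. A $ k $ l * v $ l * v $ k)"
  by (simp add: inner_vec_def matrix_vector_mult_def sum_distrib_right)

lemma quadratic_matrix_form_le:
  fixes A :: "real^'d^'d" and v :: "real^'d"
  assumes "\<And>k l. \<bar>A $ k $ l\<bar> \<le> b"
  shows "\<bar>(A *v v) \<bullet> v\<bar> \<le> (real CARD('d))\<^sup>2 * b * (norm v)\<^sup>2"
proof -
  have "\<bar>(A *v v) \<bullet> v\<bar> \<le> (\<Sum>k\<in>UNIV. \<Sum>l\<in>UNIV. \<bar>A $ k $ l * v $ l * v $ k\<bar>)"
    unfolding quadratic_matrix_form by (rule order.trans[OF sum_abs]) (intro sum_mono sum_abs)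
  also have "\<dots> \<le> (\<Sum>k\<in>(UNIV::'d set). \<Sum>l\<in>(UNIV::'d set). b * norm v * norm v)"
    unfolding abs_mult using assms component_le_norm_cart[of v] order.trans[OF abs_ge_zero assms]
    by (intro sum_mono mult_mono) (auto intro!: mult_nonneg_nonneg)
  also have "\<dots> = (real CARD('d))\<^sup>2 * b * (norm v)\<^sup>2" by (simp add: power2_eq_square)
  finally show ?thesis .
qed

locale smooth_model =
  fixes \<Theta> :: "(real^'d) set" and \<mu> :: "real^'p \<Rightarrow> real^'d \<Rightarrow> real"
    and G :: "real^'p \<Rightarrow> real^'d \<Rightarrow> real^'d" and H :: "real^'p \<Rightarrow> real^'d \<Rightarrow> real^'d^'d" and \<theta>0 :: "real^'d"
  assumes model: "assumption_M \<Theta> \<mu>" and twice: "twice_diff_param \<Theta> \<mu> G H" and inner: "\<theta>0 \<in> interior \<Theta>"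
begin

lemma theta0: "\<theta>0 \<in> \<Theta>" using inner interior_subset by blast

lemma mu_continuous: "\<theta> \<in> \<Theta> \<Longrightarrow> continuous_on ucube (\<lambda>x. \<mu> x \<theta>)"
proof -
  assume t: "\<theta> \<in> \<Theta>"
  have c: "continuous_on (ucube \<times> \<Theta>) (\<lambda>(x, \<theta>). \<mu> x \<theta>)" using model by (simp add: assumption_M_def)
  have "continuous_on ucube ((\<lambda>(x, \<theta>). \<mu> x \<theta>) \<circ> (\<lambda>x. (x, \<theta>)))"
    by (rule continuous_on_compose) (use t in \<open>auto intro!: continuous_intros continuous_on_subset[OF c]\<close>)
  then show ?thesis by (simp add: comp_def)
qed

lemma H_continuous: "\<theta> \<in> \<Theta> \<Longrightarrow> continuous_on ucube (\<lambda>x. H x \<theta> $ k $ l)"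
proof -
  assume t: "\<theta> \<in> \<Theta>"
  have c: "continuous_on (ucube \<times> \<Theta>) (\<lambda>(x, \<theta>). H x \<theta>)" using twice by (simp add: twice_diff_param_def)
  have "continuous_on ucube ((\<lambda>(x, \<theta>). H x \<theta>) \<circ> (\<lambda>x. (x, \<theta>)))"
    by (rule continuous_on_compose) (use t in \<open>auto intro!: continuous_intros continuous_on_subset[OF c]\<close>)
  then have "continuous_on ucube (\<lambda>x. H x \<theta>)" by (simp add: comp_def)
  then show ?thesis by (intro continuous_intros)
qed

lemma mu_Lipschitz:
  obtains B where "B > 0" "\<And>x \<theta> \<theta>'. x \<in> ucube \<Longrightarrow> \<theta> \<in> \<Theta> \<Longrightarrow> \<theta>' \<in> \<Theta> \<Longrightarrow> \<bar>\<mu> x \<theta> - \<mu> x \<theta>'\<bar> \<le> B * norm (\<theta> - \<theta>')"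
proof -
  obtain B where B: "\<And>x \<theta> \<theta>'. x \<in> ucube \<Longrightarrow> \<theta> \<in> \<Theta> \<Longrightarrow> \<theta>' \<in> \<Theta> \<Longrightarrow> \<bar>\<mu> x \<theta> - \<mu> x \<theta>'\<bar> \<le> B * infnorm (\<theta> - \<theta>')"
    using model unfolding assumption_M_def by blast
  have "\<bar>\<mu> x \<theta> - \<mu> x \<theta>'\<bar> \<le> (\<bar>B\<bar> + 1) * norm (\<theta> - \<theta>')" if "x \<in> ucube" "\<theta> \<in> \<Theta>" "\<theta>' \<in> \<Theta>" for x \<theta> \<theta>'
  proof -
    have "\<bar>\<mu> x \<theta> - \<mu> x \<theta>'\<bar> \<le> B * infnorm (\<theta> - \<theta>')" by (rule B[OF that])
    also have "\<dots> \<le> (\<bar>B\<bar> + 1) * norm (\<theta> - \<theta>')"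
      using infnorm_le_norm[of "\<theta> - \<theta>'"] infnorm_pos_le[of "\<theta> - \<theta>'"] by (intro mult_mono) auto
    finally show ?thesis .
  qed
  then show thesis by (intro that[of "\<bar>B\<bar> + 1"]) auto
qed

text \<open>Two inclusions are recorded: the closed ball is compact, which serves uniform
  continuity, and the open ball lies where derivatives relative to \<Theta> are full
  derivatives.\<close>

lemma Theta_ball: obtains \<rho> where "\<rho> > 0" "cball \<theta>0 \<rho> \<subseteq> \<Theta>" "ball \<theta>0 \<rho> \<subseteq> interior \<Theta>"
proof -
  obtain \<rho> where r: "\<rho> > 0" "cball \<theta>0 \<rho> \<subseteq> interior \<Theta>"
    using inner open_contains_cball[of "interior \<Theta>"] by auto
  then show thesis using interior_subset[of \<Theta>] ball_subset_cball[of \<theta>0 \<rho>] by (intro that[of \<rho>]) blast+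
qed

lemma derivs:
  assumes "x \<in> ucube" "\<theta> \<in> interior \<Theta>"
  shows "(\<mu> x has_derivative (\<lambda>v. G x \<theta> \<bullet> v)) (at \<theta>)" "(G x has_derivative (\<lambda>v. H x \<theta> *v v)) (at \<theta>)"
proof -
  have "\<theta> \<in> \<Theta>" using assms(2) interior_subset by blast
  then have "(\<mu> x has_derivative (\<lambda>v. G x \<theta> \<bullet> v)) (at \<theta> within \<Theta>)" "(G x has_derivative (\<lambda>v. H x \<theta> *v v)) (at \<theta> within \<Theta>)"
    using twice assms(1) by (auto simp: twice_diff_param_def)
  then show "(\<mu> x has_derivative (\<lambda>v. G x \<theta> \<bullet> v)) (at \<theta>)" "(G x has_derivative (\<lambda>v. H x \<theta> *v v)) (at \<theta>)"
    by (simp_all add: at_within_interior[OF assms(2)])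
qed

lemma line_derivs:
  assumes x: "x \<in> ucube" and s: "\<theta>0 + s *\<^sub>R v \<in> interior \<Theta>"
  shows "((\<lambda>s. \<mu> x (\<theta>0 + s *\<^sub>R v)) has_real_derivative (G x (\<theta>0 + s *\<^sub>R v) \<bullet> v)) (at s)"
    "((\<lambda>s. G x (\<theta>0 + s *\<^sub>R v) \<bullet> v) has_real_derivative ((H x (\<theta>0 + s *\<^sub>R v) *v v) \<bullet> v)) (at s)"
proof -
  have l: "((\<lambda>s. \<theta>0 + s *\<^sub>R v) has_derivative (\<lambda>h. h *\<^sub>R v)) (at s)"
    by (auto intro!: derivative_eq_intros)
  have "((\<lambda>s. \<mu> x (\<theta>0 + s *\<^sub>R v)) has_derivative (\<lambda>h. G x (\<theta>0 + s *\<^sub>R v) \<bullet> (h *\<^sub>R v))) (at s)"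
    by (rule has_derivative_compose[OF l derivs(1)[OF x s]])
  then show "((\<lambda>s. \<mu> x (\<theta>0 + s *\<^sub>R v)) has_real_derivative (G x (\<theta>0 + s *\<^sub>R v) \<bullet> v)) (at s)"
    by (simp add: has_field_derivative_def mult.commute[of _ "G x _ \<bullet> v"] fun_eq_iff mult_commute_abs)
  have "((\<lambda>s. G x (\<theta>0 + s *\<^sub>R v)) has_derivative (\<lambda>h. H x (\<theta>0 + s *\<^sub>R v) *v (h *\<^sub>R v))) (at s)"
    by (rule has_derivative_compose[OF l derivs(2)[OF x s]])
  then have "((\<lambda>s. G x (\<theta>0 + s *\<^sub>R v) \<bullet> v) has_derivative (\<lambda>h. (H x (\<theta>0 + s *\<^sub>R v) *v (h *\<^sub>R v)) \<bullet> v)) (at s)"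
    by (rule has_derivative_inner_left)
  then show "((\<lambda>s. G x (\<theta>0 + s *\<^sub>R v) \<bullet> v) has_real_derivative ((H x (\<theta>0 + s *\<^sub>R v) *v v) \<bullet> v)) (at s)"
    by (simp add: has_field_derivative_def matrix_vector_mult_scaleR mult_commute_abs)
qed

text \<open>\<open>twice_diff_param\<close> states no regularity of \<open>G\<close> in x.
  Directional derivatives as limits of difference quotients transfer boundedness and measurability
  in x from \<mu> to \<open>G\<close> at \<theta>0.\<close>

lemma gradient_limit:
  assumes x: "x \<in> ucube"
  shows "(\<lambda>n. (\<mu> x (\<theta>0 + (1 / real (Suc n)) *\<^sub>R v) - \<mu> x \<theta>0) * real (Suc n)) \<longlonglongrightarrow> G x \<theta>0 \<bullet> v"
proof -
  have "((\<lambda>s. \<mu> x (\<theta>0 + s *\<^sub>R v)) has_real_derivative (G x (\<theta>0 + 0 *\<^sub>R v) \<bullet> v)) (at 0)"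
    by (rule line_derivs(1)[OF x]) (use inner in simp)
  then have "((\<lambda>h. (\<mu> x (\<theta>0 + h *\<^sub>R v) - \<mu> x \<theta>0) / h) \<longlongrightarrow> G x \<theta>0 \<bullet> v) (at 0)"
    by (simp add: DERIV_def)
  then have lim: "((\<lambda>h. (\<mu> x (\<theta>0 + h *\<^sub>R v) - \<mu> x \<theta>0) / h) \<longlongrightarrow> G x \<theta>0 \<bullet> v) (at 0)" .
  have f: "filterlim (\<lambda>n. 1 / real (Suc n)) (at 0) sequentially"
    unfolding filterlim_at using LIMSEQ_Suc[OF lim_1_over_n] by (simp del: of_nat_Suc)
  from filterlim_compose[OF lim f] show ?thesis by (simp only: divide_divide_eq_right div_by_1 mult_1_right mult_1)
qed

text \<open>Maclaurin's formula along a segment from \<theta>0, with the intermediate Hessian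
  compared to that at \<theta>0. Uniform continuity of \<open>H\<close> on the cube times a closed
  ball makes the radius independent of x. The constant of the remainder must be arbitrarily small,
  because it is going to multiply the absolute errors.\<close>

lemma Taylor_second_order:
  assumes e: "e > 0"
  obtains \<rho> where "\<rho> > 0" "\<And>x v. x \<in> ucube \<Longrightarrow> norm v < \<rho> \<Longrightarrow>
    \<theta>0 + v \<in> \<Theta> \<and> \<bar>\<mu> x (\<theta>0 + v) - \<mu> x \<theta>0 - G x \<theta>0 \<bullet> v - (H x \<theta>0 *v v) \<bullet> v / 2\<bar> \<le> e * (norm v)\<^sup>2"
proof -
  obtain \<rho>0 where \<rho>0: "\<rho>0 > 0" "cball \<theta>0 \<rho>0 \<subseteq> \<Theta>" "ball \<theta>0 \<rho>0 \<subseteq> interior \<Theta>" using Theta_ball by blast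
  \<comment> \<open>An entrywise bound \<open>b\<close> on a matrix bounds its quadratic form by d^2
    b times the squared norm, with d the parameter dimension.\<close>
  define b where "b = e / (real CARD('d))\<^sup>2"
  have b: "b > 0" "(real CARD('d))\<^sup>2 * b = e" using e by (auto simp: b_def)
  have "continuous_on (ucube \<times> cball \<theta>0 \<rho>0) (\<lambda>(x, \<theta>). H x \<theta>)"
    using twice \<rho>0(2) by (auto simp: twice_diff_param_def elim!: continuous_on_subset)
  then have "uniformly_continuous_on (ucube \<times> cball \<theta>0 \<rho>0) (\<lambda>(x, \<theta>). H x \<theta>)"
    by (rule compact_uniformly_continuous) (intro compact_Times compact_cbox compact_cball)
  then obtain \<rho>1 where \<rho>1: "\<rho>1 > 0" "\<And>z z'. z \<in> ucube \<times> cball \<theta>0 \<rho>0 \<Longrightarrow> z' \<in> ucube \<times> cball \<theta>0 \<rho>0 \<Longrightarrow> dist z' z < \<rho>1 \<Longrightarrow>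
      dist ((\<lambda>(x, \<theta>). H x \<theta>) z') ((\<lambda>(x, \<theta>). H x \<theta>) z) < b"
    unfolding uniformly_continuous_on_def using b(1) by meson
  define \<rho> where "\<rho> = min \<rho>0 \<rho>1"
  have "\<theta>0 + v \<in> \<Theta> \<and> \<bar>\<mu> x (\<theta>0 + v) - \<mu> x \<theta>0 - G x \<theta>0 \<bullet> v - (H x \<theta>0 *v v) \<bullet> v / 2\<bar> \<le> e * (norm v)\<^sup>2"
    if x: "x \<in> ucube" and v: "norm v < \<rho>" for x v
  proof
    show "\<theta>0 + v \<in> \<Theta>" using v \<rho>0(2) by (auto simp: \<rho>_def dist_norm)
    have sv: "norm (s *\<^sub>R v) < \<rho>" if "0 \<le> s" "s \<le> 1" for s
    proof -
      have "\<bar>s\<bar> * norm v \<le> 1 * norm v" using that by (intro mult_right_mono) auto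
      then show ?thesis using v by simp
    qed
    have int: "\<theta>0 + s *\<^sub>R v \<in> interior \<Theta>" if "0 \<le> s" "s \<le> 1" for s
      using sv[OF that] \<rho>0(3) by (auto simp: \<rho>_def dist_norm)
    define D where "D k s = (if k = 0 then \<mu> x (\<theta>0 + s *\<^sub>R v) else if k = 1 then G x (\<theta>0 + s *\<^sub>R v) \<bullet> v
        else (H x (\<theta>0 + s *\<^sub>R v) *v v) \<bullet> v)" for k :: nat and s
    have D0: "D 0 = (\<lambda>s. \<mu> x (\<theta>0 + s *\<^sub>R v))" "D (Suc 0) = (\<lambda>s. G x (\<theta>0 + s *\<^sub>R v) \<bullet> v)"
      "D (Suc (Suc 0)) = (\<lambda>s. (H x (\<theta>0 + s *\<^sub>R v) *v v) \<bullet> v)" by (auto simp: D_def)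
    have "\<exists>t>0. t \<le> 1 \<and> D 0 1 = (\<Sum>m<2. D m 0 / fact m * 1 ^ m) + D 2 t / fact 2 * 1 ^ 2"
    proof (rule Maclaurin2)
      show "\<forall>m t. m < 2 \<and> 0 \<le> t \<and> t \<le> 1 \<longrightarrow> DERIV (D m) t :> D (Suc m) t"
      proof (intro allI impI, elim conjE)
        fix m :: nat and t :: real assume m: "m < 2" and t: "0 \<le> t" "t \<le> 1"
        from m consider "m = 0" | "m = Suc 0" by linarith
        then show "DERIV (D m) t :> D (Suc m) t"
          using line_derivs[OF x int[OF t]] by cases (simp_all add: D0)
      qed
    qed auto
    then obtain t where t: "0 < t" "t \<le> 1" and eq: "\<mu> x (\<theta>0 + v) = \<mu> x \<theta>0 + G x \<theta>0 \<bullet> v + (H x (\<theta>0 + t *\<^sub>R v) *v v) \<bullet> v / 2"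
      by (auto simp: D_def numeral_2_eq_2)
    have "\<bar>((H x (\<theta>0 + t *\<^sub>R v) - H x \<theta>0) *v v) \<bullet> v\<bar> \<le> (real CARD('d))\<^sup>2 * b * (norm v)\<^sup>2"
    proof (rule quadratic_matrix_form_le)
      fix k l
      have nt: "norm (t *\<^sub>R v) < \<rho>" using sv t by simp
      then have "\<theta>0 + t *\<^sub>R v \<in> cball \<theta>0 \<rho>0" by (auto simp: \<rho>_def dist_norm)
      moreover have "dist (x, \<theta>0 + t *\<^sub>R v) (x, \<theta>0) < \<rho>1"
        using nt by (simp add: dist_Pair_Pair dist_norm \<rho>_def)
      ultimately have "dist (H x (\<theta>0 + t *\<^sub>R v)) (H x \<theta>0) < b"
        using \<rho>1(2)[of "(x, \<theta>0)" "(x, \<theta>0 + t *\<^sub>R v)"] x \<rho>0(1) by auto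
      moreover have "\<bar>(H x (\<theta>0 + t *\<^sub>R v) - H x \<theta>0) $ k $ l\<bar> \<le> norm (H x (\<theta>0 + t *\<^sub>R v) - H x \<theta>0)"
        by (rule order.trans[OF component_le_norm_cart Finite_Cartesian_Product.norm_nth_le])
      ultimately show "\<bar>(H x (\<theta>0 + t *\<^sub>R v) - H x \<theta>0) $ k $ l\<bar> \<le> b" by (simp add: dist_norm)
    qed
    also have "\<dots> = e * (norm v)\<^sup>2" by (simp only: b(2))
    finally have "\<bar>((H x (\<theta>0 + t *\<^sub>R v) - H x \<theta>0) *v v) \<bullet> v\<bar> \<le> e * (norm v)\<^sup>2" .
    moreover have "((H x (\<theta>0 + t *\<^sub>R v) - H x \<theta>0) *v v) \<bullet> v = (H x (\<theta>0 + t *\<^sub>R v) *v v) \<bullet> v - (H x \<theta>0 *v v) \<bullet> v"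
      by (simp add: matrix_vector_mult_diff_rdistrib inner_diff_left)
    moreover have "0 \<le> e * (norm v)\<^sup>2" using e by simp
    ultimately show "\<bar>\<mu> x (\<theta>0 + v) - \<mu> x \<theta>0 - G x \<theta>0 \<bullet> v - (H x \<theta>0 *v v) \<bullet> v / 2\<bar> \<le> e * (norm v)\<^sup>2"
      unfolding eq by linarith
  qed
  moreover have "\<rho> > 0" using \<rho>0 \<rho>1 by (simp add: \<rho>_def)
  ultimately show thesis by (intro that)
qed

lemma H_bounded: obtains b where "b > 0" "\<And>x k l. x \<in> ucube \<Longrightarrow> \<bar>H x \<theta>0 $ k $ l\<bar> \<le> b"
proof -
  have "\<exists>b. \<forall>x\<in>ucube. \<bar>H x \<theta>0 $ k $ l\<bar> \<le> b" for k l
    using compact_imp_bounded[OF compact_continuous_image[OF H_continuous[OF theta0] compact_cbox], of k l]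
    unfolding bounded_iff by auto
  then obtain b where b: "\<And>x k l. x \<in> ucube \<Longrightarrow> \<bar>H x \<theta>0 $ k $ l\<bar> \<le> b k l" by metis
  have "\<bar>H x \<theta>0 $ k $ l\<bar> \<le> 1 + (\<Sum>k\<in>UNIV. \<Sum>l\<in>UNIV. \<bar>b k l\<bar>)" if x: "x \<in> ucube" for x k l
  proof -
    have "\<bar>H x \<theta>0 $ k $ l\<bar> \<le> \<bar>b k l\<bar>" using b[OF x, of k l] by linarith
    also have "\<dots> \<le> (\<Sum>l\<in>UNIV. \<bar>b k l\<bar>)" by (rule member_le_sum) auto
    also have "\<dots> \<le> (\<Sum>k\<in>UNIV. \<Sum>l\<in>UNIV. \<bar>b k l\<bar>)" by (rule member_le_sum) (auto intro: sum_nonneg)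
    finally show ?thesis by simp
  qed
  moreover have "1 + (\<Sum>k\<in>UNIV. \<Sum>l\<in>UNIV. \<bar>b k l\<bar>) > 0" by (intro add_pos_nonneg sum_nonneg) auto
  ultimately show thesis by (intro that)
qed

text \<open>The Lipschitz constant of \<mu> bounds every difference quotient and hence the
  limit.\<close>

lemma G_bounded:
  assumes B: "\<And>x \<theta> \<theta>'. x \<in> ucube \<Longrightarrow> \<theta> \<in> \<Theta> \<Longrightarrow> \<theta>' \<in> \<Theta> \<Longrightarrow> \<bar>\<mu> x \<theta> - \<mu> x \<theta>'\<bar> \<le> B * norm (\<theta> - \<theta>')"
    and x: "x \<in> ucube"
  shows "\<bar>G x \<theta>0 \<bullet> v\<bar> \<le> B * norm v"
proof (rule tendsto_upperbound[OF tendsto_rabs[OF gradient_limit[OF x, of v]]])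
  obtain \<rho> where \<rho>: "\<rho> > 0" "cball \<theta>0 \<rho> \<subseteq> \<Theta>" using Theta_ball by blast
  have "(\<lambda>n. (1 / real (Suc n)) * norm v) \<longlonglongrightarrow> 0"
    using tendsto_mult[OF LIMSEQ_Suc[OF lim_1_over_n] tendsto_const, of "norm v"] by simp
  then have "\<forall>\<^sub>F n in sequentially. (1 / real (Suc n)) * norm v < \<rho>" using \<rho>(1) by (rule order_tendstoD(2))
  then show "\<forall>\<^sub>F n in sequentially. \<bar>(\<mu> x (\<theta>0 + (1 / real (Suc n)) *\<^sub>R v) - \<mu> x \<theta>0) * real (Suc n)\<bar> \<le> B * norm v"
  proof eventually_elim
    case (elim n)
    then have "\<theta>0 + (1 / real (Suc n)) *\<^sub>R v \<in> \<Theta>" using \<rho>(2) by (auto simp: dist_norm)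
    then have "\<bar>\<mu> x (\<theta>0 + (1 / real (Suc n)) *\<^sub>R v) - \<mu> x \<theta>0\<bar> \<le> B * norm (\<theta>0 + (1 / real (Suc n)) *\<^sub>R v - \<theta>0)"
      by (rule B[OF x _ theta0])
    then have "\<bar>\<mu> x (\<theta>0 + (1 / real (Suc n)) *\<^sub>R v) - \<mu> x \<theta>0\<bar> \<le> (B * norm v) / real (Suc n)" by simp
    then have "\<bar>\<mu> x (\<theta>0 + (1 / real (Suc n)) *\<^sub>R v) - \<mu> x \<theta>0\<bar> * real (Suc n) \<le> B * norm v"
      by (simp add: pos_le_divide_eq del: of_nat_Suc)
    then show ?case by (simp add: abs_mult del: of_nat_Suc)
  qed
qed simp

lemma G_measurable:
  "(\<lambda>x. indicator ucube x * (G x \<theta>0 \<bullet> v)) \<in> borel_measurable borel"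
proof -
  obtain \<rho> where \<rho>: "\<rho> > 0" "cball \<theta>0 \<rho> \<subseteq> \<Theta>" using Theta_ball by blast
  have "(\<lambda>n. (1 / real (Suc n)) * norm v) \<longlonglongrightarrow> 0"
    using tendsto_mult[OF LIMSEQ_Suc[OF lim_1_over_n] tendsto_const, of "norm v"] by simp
  then have "\<forall>\<^sub>F n in sequentially. (1 / real (Suc n)) * norm v < \<rho>" using \<rho>(1) by (rule order_tendstoD(2))
  then obtain N where N: "\<And>n. n \<ge> N \<Longrightarrow> (1 / real (Suc n)) * norm v < \<rho>" by (auto simp: eventually_sequentially)
  \<comment> \<open>The shift by \<open>N\<close> keeps the evaluation point inside \<Theta> for
    every index.\<close>
  define q where "q n x = indicator ucube x *\<^sub>R ((\<mu> x (\<theta>0 + (1 / real (Suc (n + N))) *\<^sub>R v) - \<mu> x \<theta>0) * real (Suc (n + N)))" for n x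
  have qm: "q n \<in> borel_measurable borel" for n
  proof -
    have "\<theta>0 + (1 / real (Suc (n + N))) *\<^sub>R v \<in> \<Theta>" using \<rho>(2) N[of "n + N"] by (auto simp: dist_norm)
    then show ?thesis unfolding q_def[abs_def]
      by (intro borel_measurable_continuous_on_indicator continuous_on_mult continuous_on_diff mu_continuous theta0 continuous_on_const) auto
  qed
  have "(\<lambda>n. q n x) \<longlonglongrightarrow> indicator ucube x * (G x \<theta>0 \<bullet> v)" for x
  proof (cases "x \<in> ucube")
    case True
    then show ?thesis using LIMSEQ_ignore_initial_segment[OF gradient_limit[OF True, of v], of N] by (simp add: q_def del: of_nat_Suc)
  qed (simp add: q_def)
  with qm show ?thesis by (rule borel_measurable_LIMSEQ_real[rotated])
qed

text \<open>Near \<theta>0 this is Taylor's formula with a bounded Hessian. Further away the left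
  side is at most 2 B times the norm of v, and a norm of at least \<rho> is at most its square over
  \<rho>; so the bound holds on all of \<Theta>.\<close>

lemma quadratic_remainder:
  obtains C where "C > 0" "\<And>x \<theta>. x \<in> ucube \<Longrightarrow> \<theta> \<in> \<Theta> \<Longrightarrow>
    \<bar>\<mu> x \<theta> - \<mu> x \<theta>0 - G x \<theta>0 \<bullet> (\<theta> - \<theta>0)\<bar> \<le> C * (norm (\<theta> - \<theta>0))\<^sup>2"
proof -
  obtain B where B: "B > 0" "\<And>x \<theta> \<theta>'. x \<in> ucube \<Longrightarrow> \<theta> \<in> \<Theta> \<Longrightarrow> \<theta>' \<in> \<Theta> \<Longrightarrow> \<bar>\<mu> x \<theta> - \<mu> x \<theta>'\<bar> \<le> B * norm (\<theta> - \<theta>')"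
    using mu_Lipschitz by blast
  obtain \<rho> where \<rho>: "\<rho> > 0" "\<And>x v. x \<in> ucube \<Longrightarrow> norm v < \<rho> \<Longrightarrow>
    \<theta>0 + v \<in> \<Theta> \<and> \<bar>\<mu> x (\<theta>0 + v) - \<mu> x \<theta>0 - G x \<theta>0 \<bullet> v - (H x \<theta>0 *v v) \<bullet> v / 2\<bar> \<le> 1 * (norm v)\<^sup>2"
    using Taylor_second_order[OF zero_less_one] by blast
  obtain b where b: "b > 0" "\<And>x k l. x \<in> ucube \<Longrightarrow> \<bar>H x \<theta>0 $ k $ l\<bar> \<le> b" using H_bounded by blast
  define C where "C = 1 + (real CARD('d))\<^sup>2 * b + 2 * B / \<rho>"
  have "\<bar>\<mu> x \<theta> - \<mu> x \<theta>0 - G x \<theta>0 \<bullet> (\<theta> - \<theta>0)\<bar> \<le> C * (norm (\<theta> - \<theta>0))\<^sup>2" if x: "x \<in> ucube" and \<theta>: "\<theta> \<in> \<Theta>" for x \<theta>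
  proof -
    define v where "v = \<theta> - \<theta>0"
    have \<theta>v: "\<theta> = \<theta>0 + v" by (simp add: v_def)
    show ?thesis
    proof (cases "norm v < \<rho>")
      case True
      have "\<bar>\<mu> x \<theta> - \<mu> x \<theta>0 - G x \<theta>0 \<bullet> v - (H x \<theta>0 *v v) \<bullet> v / 2\<bar> \<le> (norm v)\<^sup>2"
        using \<rho>(2)[OF x True] by (simp add: \<theta>v)
      moreover have "\<bar>(H x \<theta>0 *v v) \<bullet> v\<bar> \<le> (real CARD('d))\<^sup>2 * b * (norm v)\<^sup>2"
        by (rule quadratic_matrix_form_le) (rule b(2)[OF x])
      moreover have "0 \<le> (real CARD('d))\<^sup>2 * b * (norm v)\<^sup>2" using b(1) by simp
      moreover have "0 \<le> 2 * B / \<rho> * (norm v)\<^sup>2" using B(1) \<rho>(1) by simp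
      ultimately have "\<bar>\<mu> x \<theta> - \<mu> x \<theta>0 - G x \<theta>0 \<bullet> v\<bar> \<le> (norm v)\<^sup>2 + (real CARD('d))\<^sup>2 * b * (norm v)\<^sup>2 + 2 * B / \<rho> * (norm v)\<^sup>2"
        by linarith
      then show ?thesis by (simp add: C_def v_def[symmetric] distrib_right)
    next
      case False
      have "\<bar>\<mu> x \<theta> - \<mu> x \<theta>0 - G x \<theta>0 \<bullet> v\<bar> \<le> B * norm v + B * norm v"
        using B(2)[OF x \<theta> theta0] G_bounded[OF B(2) x, of v] by (simp add: v_def)
      also have "\<dots> = 2 * B / \<rho> * (\<rho> * norm v)" using \<rho>(1) by simp
      also have "\<dots> \<le> 2 * B / \<rho> * (norm v * norm v)"
        using False B(1) \<rho>(1) by (intro mult_left_mono mult_right_mono) auto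
      also have "\<dots> \<le> C * (norm v)\<^sup>2"
        unfolding C_def power2_eq_square[of "norm v"] using b(1) by (intro mult_right_mono) auto
      finally show ?thesis by (simp add: v_def)
    qed
  qed
  moreover have "C > 0" using b(1) B(1) \<rho>(1) by (simp add: C_def add_pos_nonneg)
  ultimately show thesis by (intro that)
qed

end

section \<open>Consistency and rate of the least squares estimator\<close>

locale local_alternatives =
  regression_errors M X \<epsilon> \<sigma>2 d + smooth_model \<Theta> \<mu> G H \<theta>0
  for M :: "'a measure" and X :: "nat \<Rightarrow> 'a \<Rightarrow> real^'p" and \<epsilon> \<sigma>2 d
    and \<Theta> :: "(real^'d) set" and \<mu> :: "real^'p \<Rightarrow> real^'d \<Rightarrow> real" and G H \<theta>0 +
  fixes \<delta> m :: "nat \<Rightarrow> real^'p \<Rightarrow> real" and r :: "nat \<Rightarrow> real" and R :: "nat \<Rightarrow> 'a \<Rightarrow> real"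
    and \<theta>hat :: "nat \<Rightarrow> 'a \<Rightarrow> real^'d" and C3 :: real
  assumes alternative: "\<And>n x. m n x = \<mu> x \<theta>0 + r n * \<delta> n x"
    and equicontinuous: "equicontinuous_seq \<delta>"
    and normalised: "conv_in_prob M (\<lambda>n \<omega>. (1 / real n) * (\<Sum>i<n. (\<delta> n (X i \<omega>))\<^sup>2)) 1"
    and orthogonal: "conv_in_prob M (\<lambda>n \<omega>. (1 / real n) *\<^sub>R (\<Sum>i<n. \<delta> n (X i \<omega>) *\<^sub>R G (X i \<omega>) \<theta>0)) 0"
    and C3: "C3 > 0" and R: "conv_in_prob M R 0"
    and identifiable: "\<And>n. n \<ge> 1 \<Longrightarrow> AE \<omega> in M. \<forall>\<theta>\<in>\<Theta>. \<forall>\<theta>'\<in>\<Theta>.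
           (C3 + R n \<omega>) * (infnorm (\<theta> - \<theta>'))\<^sup>2
             \<le> (1 / real n) * (\<Sum>i<n. (\<mu> (X i \<omega>) \<theta> - \<mu> (X i \<omega>) \<theta>')\<^sup>2)"
    and least_squares: "\<And>n \<omega>. n \<ge> 1 \<Longrightarrow> \<omega> \<in> space M \<Longrightarrow>
           is_arg_min (sum_sq_resid \<mu> n (\<lambda>i. X i \<omega>) (response (m n) X \<epsilon> \<omega>)) (\<lambda>\<theta>. \<theta> \<in> \<Theta>) (\<theta>hat n \<omega>)"
    and r_tendsto: "r \<longlonglongrightarrow> 0" and r_pos: "\<forall>\<^sub>F n in sequentially. 0 < r n"
    and r_rate: "filterlim (\<lambda>n. real n * (r n)\<^sup>2) at_top sequentially"
begin

definition fit_diff :: "nat \<Rightarrow> 'a \<Rightarrow> nat \<Rightarrow> real" where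
  "fit_diff n \<omega> i = \<mu> (X i \<omega>) (\<theta>hat n \<omega>) - \<mu> (X i \<omega>) \<theta>0"

lemma theta_hat_in: "n \<ge> 1 \<Longrightarrow> \<omega> \<in> space M \<Longrightarrow> \<theta>hat n \<omega> \<in> \<Theta>"
  using least_squares by (simp add: is_arg_min_def)

lemma delta_bounded: obtains B where "B > 0" "\<forall>\<^sub>F n in sequentially. \<forall>x\<in>ucube. \<bar>\<delta> n x\<bar> \<le> B"
  using equicontinuous_bounded[OF equicontinuous X_cube normalised] by blast

text \<open>The least squares criterion at the estimator is at most that at \<theta>0; expanding the
  residuals around \<epsilon> + r \<delta> leaves the squared fitted differences against two linear
  terms.\<close>

lemma basic_inequality:
  assumes "n \<ge> 1" "\<omega> \<in> space M"
  shows "(\<Sum>i<n. (fit_diff n \<omega> i)\<^sup>2)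
    \<le> 2 * (\<Sum>i<n. fit_diff n \<omega> i * \<epsilon> i \<omega>) + 2 * r n * (\<Sum>i<n. fit_diff n \<omega> i * \<delta> n (X i \<omega>))"
proof -
  define e where "e i = \<epsilon> i \<omega> + r n * \<delta> n (X i \<omega>)" for i
  have res: "response (m n) X \<epsilon> \<omega> i - \<mu> (X i \<omega>) (\<theta>hat n \<omega>) = e i - fit_diff n \<omega> i"
    "response (m n) X \<epsilon> \<omega> i - \<mu> (X i \<omega>) \<theta>0 = e i" for i
    by (simp_all add: response_def alternative fit_diff_def e_def)
  have "sum_sq_resid \<mu> n (\<lambda>i. X i \<omega>) (response (m n) X \<epsilon> \<omega>) (\<theta>hat n \<omega>)
      \<le> sum_sq_resid \<mu> n (\<lambda>i. X i \<omega>) (response (m n) X \<epsilon> \<omega>) \<theta>0"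
    using least_squares[OF assms] theta0 by (auto simp: is_arg_min_def not_less)
  then have "(\<Sum>i<n. (e i - fit_diff n \<omega> i)\<^sup>2) \<le> (\<Sum>i<n. (e i)\<^sup>2)" by (simp only: sum_sq_resid_def res)
  moreover have "(\<Sum>i<n. (e i - fit_diff n \<omega> i)\<^sup>2)
      = (\<Sum>i<n. (e i)\<^sup>2 + (fit_diff n \<omega> i)\<^sup>2 - (2 * (fit_diff n \<omega> i * \<epsilon> i \<omega>) + 2 * r n * (fit_diff n \<omega> i * \<delta> n (X i \<omega>))))"
    by (rule sum.cong) (simp_all add: e_def power2_eq_square algebra_simps)
  ultimately show ?thesis by (simp add: sum.distrib sum_subtractf sum_distrib_left[symmetric])
qed

text \<open>The identifiability condition uses the maximum norm, and passing to the Euclidean norm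
  costs the factor \<open>CARD('d)\<close>; the factor 2 absorbs the random perturbation
  \<open>R\<close>.\<close>

lemma identified:
  "whp M (\<lambda>n \<omega>. C3 / (2 * real CARD('d)) * real n * (norm (\<theta>hat n \<omega> - \<theta>0))\<^sup>2 \<le> (\<Sum>i<n. (fit_diff n \<omega> i)\<^sup>2))"
proof -
  have "whp M (\<lambda>n \<omega>. \<forall>\<theta>\<in>\<Theta>. \<forall>\<theta>'\<in>\<Theta>. (C3 + R n \<omega>) * (infnorm (\<theta> - \<theta>'))\<^sup>2
      \<le> (1 / real n) * (\<Sum>i<n. (\<mu> (X i \<omega>) \<theta> - \<mu> (X i \<omega>) \<theta>')\<^sup>2))"
    by (rule whp_eventually_AE[OF eventually_mono[OF eventually_ge_at_top[of 1] identifiable]])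
  moreover have "whp M (\<lambda>n \<omega>. dist (R n \<omega>) 0 \<le> C3 / 2)" by (rule whp_conv_in_prob[OF R]) (use C3 in simp)
  ultimately have whps: "whp M (\<lambda>n \<omega>. (\<forall>\<theta>\<in>\<Theta>. \<forall>\<theta>'\<in>\<Theta>. (C3 + R n \<omega>) * (infnorm (\<theta> - \<theta>'))\<^sup>2
      \<le> (1 / real n) * (\<Sum>i<n. (\<mu> (X i \<omega>) \<theta> - \<mu> (X i \<omega>) \<theta>')\<^sup>2)) \<and> dist (R n \<omega>) 0 \<le> C3 / 2)" by (rule whp_conj)
  from whps show ?thesis
  proof (rule whp_mono, use eventually_ge_at_top[of 1] in eventually_elim, intro ballI impI, elim conjE)
    fix n \<omega> assume n: "1 \<le> n" and \<omega>: "\<omega> \<in> space M" and RR: "dist (R n \<omega>) 0 \<le> C3 / 2"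
      and id: "\<forall>\<theta>\<in>\<Theta>. \<forall>\<theta>'\<in>\<Theta>. (C3 + R n \<omega>) * (infnorm (\<theta> - \<theta>'))\<^sup>2
      \<le> (1 / real n) * (\<Sum>i<n. (\<mu> (X i \<omega>) \<theta> - \<mu> (X i \<omega>) \<theta>')\<^sup>2)"
    let ?v = "\<theta>hat n \<omega> - \<theta>0"
    have R2: "C3 / 2 \<le> C3 + R n \<omega>" using RR by (simp add: dist_real_def)
    have "norm ?v \<le> sqrt (real CARD('d)) * infnorm ?v" using norm_le_infnorm[of ?v] by simp
    then have "(norm ?v)\<^sup>2 \<le> (sqrt (real CARD('d)) * infnorm ?v)\<^sup>2" by (rule power_mono) simp
    then have "(norm ?v)\<^sup>2 \<le> real CARD('d) * (infnorm ?v)\<^sup>2" by (simp add: power_mult_distrib)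
    then have "C3 / (2 * real CARD('d)) * (norm ?v)\<^sup>2 \<le> C3 / (2 * real CARD('d)) * (real CARD('d) * (infnorm ?v)\<^sup>2)"
      using C3 by (intro mult_left_mono) auto
    also have "\<dots> = C3 / 2 * (infnorm ?v)\<^sup>2" by simp
    also have "\<dots> \<le> (C3 + R n \<omega>) * (infnorm ?v)\<^sup>2" by (rule mult_right_mono[OF R2]) simp
    also have "\<dots> \<le> (1 / real n) * (\<Sum>i<n. (fit_diff n \<omega> i)\<^sup>2)"
      unfolding fit_diff_def using id theta_hat_in[OF n \<omega>] theta0 by blast
    finally show "C3 / (2 * real CARD('d)) * real n * (norm ?v)\<^sup>2 \<le> (\<Sum>i<n. (fit_diff n \<omega> i)\<^sup>2)"
      using n by (simp add: field_simps)
  qed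
qed

text \<open>The Chebyshev ratio of a linear form with variance of order n at a threshold of order n
  r; it is a multiple of 1 / (n r^2).\<close>

lemma inverse_rate: "\<kappa> > 0 \<Longrightarrow> (\<lambda>n. real n / (\<kappa> * (real n * r n))\<^sup>2) \<longlonglongrightarrow> 0"
proof -
  assume k: "\<kappa> > 0"
  have "(\<lambda>n. 1 / \<kappa>\<^sup>2 * inverse (real n * (r n)\<^sup>2)) \<longlonglongrightarrow> 1 / \<kappa>\<^sup>2 * 0"
    by (intro tendsto_mult tendsto_const tendsto_inverse_0_at_top r_rate)
  moreover have "1 / \<kappa>\<^sup>2 * inverse (real n * (r n)\<^sup>2) = real n / (\<kappa> * (real n * r n))\<^sup>2" for n
    by (cases "n = 0") (simp_all add: power_mult_distrib power2_eq_square divide_simps)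
  ultimately show ?thesis by simp
qed

lemma gradient_design_measurable:
  assumes "i < n" shows "(\<lambda>\<omega>. G (X i \<omega>) \<theta>0 $ k) \<in> borel_measurable (sigma_design M X n)"
proof -
  have "(\<lambda>\<omega>. indicator ucube (X i \<omega>) * (G (X i \<omega>) \<theta>0 \<bullet> axis k 1)) \<in> borel_measurable (sigma_design M X n)"
    by (rule measurable_compose[OF X_design[OF assms] G_measurable])
  then show ?thesis
    by (rule measurable_cong[THEN iffD1, rotated])
       (use X_cube subalgebra_design[of n] in \<open>auto simp: subalgebra_def inner_axis\<close>)
qed

lemma gradient_bounded:
  obtains B where "B > 0" "\<And>x k. x \<in> ucube \<Longrightarrow> \<bar>G x \<theta>0 $ k\<bar> \<le> B"
proof -
  obtain B where B: "B > 0" "\<And>x \<theta> \<theta>'. x \<in> ucube \<Longrightarrow> \<theta> \<in> \<Theta> \<Longrightarrow> \<theta>' \<in> \<Theta> \<Longrightarrow> \<bar>\<mu> x \<theta> - \<mu> x \<theta>'\<bar> \<le> B * norm (\<theta> - \<theta>')"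
    using mu_Lipschitz by blast
  have "\<bar>G x \<theta>0 $ k\<bar> \<le> B" if "x \<in> ucube" for x k
    using G_bounded[OF B(2) that, of "axis k 1"] by (simp add: inner_axis)
  with B(1) show thesis by (rule that)
qed

lemma sum_sq_le_const:
  fixes u :: "nat \<Rightarrow> real"
  assumes "\<And>i. i < n \<Longrightarrow> \<bar>u i\<bar> \<le> B" shows "(\<Sum>i<n. (u i)\<^sup>2) \<le> B\<^sup>2 * real n"
proof -
  have "(\<Sum>i<n. (u i)\<^sup>2) \<le> (\<Sum>i<n. B\<^sup>2)"
    using assms by (intro sum_mono) (auto simp: abs_le_square_iff[symmetric] intro: order.trans[OF _ abs_ge_self])
  then show ?thesis by (simp add: mult.commute)
qed

lemma bounded_design_form_whp:
  assumes \<phi>: "\<And>n i. i < n \<Longrightarrow> (\<lambda>\<omega>. \<phi> (X i \<omega>)) \<in> borel_measurable (sigma_design M X n)"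
    and B: "\<And>x. x \<in> ucube \<Longrightarrow> \<bar>\<phi> x\<bar> \<le> B"
    and c: "\<forall>\<^sub>F n in sequentially. 0 < c n" "(\<lambda>n. real n / (c n)\<^sup>2) \<longlonglongrightarrow> 0"
  shows "whp M (\<lambda>n \<omega>. \<bar>\<Sum>i<n. \<phi> (X i \<omega>) * \<epsilon> i \<omega>\<bar> \<le> c n)"
proof (rule linear_form_whp[where B = "B\<^sup>2", OF _ c])
  show "\<forall>\<^sub>F n in sequentially. (\<forall>i<n. (\<lambda>\<omega>. \<phi> (X i \<omega>)) \<in> borel_measurable (sigma_design M X n)) \<and>
      (\<forall>\<omega>\<in>space M. (\<Sum>i<n. (\<phi> (X i \<omega>))\<^sup>2) \<le> B\<^sup>2 * real n)"
    using \<phi> B X_cube by (intro always_eventually allI conjI impI ballI sum_sq_le_const) auto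
qed

lemma linear_scale_vanishes: "\<tau> > 0 \<Longrightarrow> (\<lambda>n. real n / (\<tau> * real n)\<^sup>2) \<longlonglongrightarrow> 0"
proof -
  assume t: "\<tau> > 0"
  have "(\<lambda>n. 1 / \<tau>\<^sup>2 * inverse (real n)) \<longlonglongrightarrow> 1 / \<tau>\<^sup>2 * 0"
    by (intro tendsto_mult tendsto_const tendsto_inverse_0_at_top filterlim_real_sequentially)
  moreover have "1 / \<tau>\<^sup>2 * inverse (real n) = real n / (\<tau> * real n)\<^sup>2" for n
    by (cases "n = 0") (simp_all add: power_mult_distrib power2_eq_square divide_simps)
  ultimately show ?thesis by simp
qed

text \<open>The score noise is of order sqrt n, negligible against n r because n r^2 diverges. The
  threshold is shared equally among the coordinates.\<close>

lemma gradient_noise_whp: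
  assumes "\<tau> > 0"
  shows "whp M (\<lambda>n \<omega>. norm (\<Sum>i<n. \<epsilon> i \<omega> *\<^sub>R G (X i \<omega>) \<theta>0) \<le> \<tau> * (real n * r n))"
proof -
  obtain B where B: "B > 0" "\<And>x k. x \<in> ucube \<Longrightarrow> \<bar>G x \<theta>0 $ k\<bar> \<le> B" using gradient_bounded by blast
  let ?\<kappa> = "\<tau> / real CARD('d)"
  have k: "?\<kappa> > 0" using assms by simp
  have ev: "\<forall>\<^sub>F n in sequentially. 0 < ?\<kappa> * (real n * r n)"
    using r_pos eventually_gt_at_top[of 0] by eventually_elim (use assms in simp)
  have "whp M (\<lambda>n \<omega>. \<forall>k\<in>(UNIV::'d set). \<bar>\<Sum>i<n. G (X i \<omega>) \<theta>0 $ k * \<epsilon> i \<omega>\<bar> \<le> ?\<kappa> * (real n * r n))"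
    by (rule whp_finite_ball[OF finite])
       (rule bounded_design_form_whp[OF gradient_design_measurable B(2) ev inverse_rate[OF k]])
  then show ?thesis
  proof (rule whp_mono, intro always_eventually allI ballI impI)
    fix n \<omega> assume *: "\<forall>k\<in>UNIV. \<bar>\<Sum>i<n. G (X i \<omega>) \<theta>0 $ k * \<epsilon> i \<omega>\<bar> \<le> ?\<kappa> * (real n * r n)"
    have "norm (\<Sum>i<n. \<epsilon> i \<omega> *\<^sub>R G (X i \<omega>) \<theta>0) \<le> (\<Sum>k\<in>UNIV. \<bar>(\<Sum>i<n. \<epsilon> i \<omega> *\<^sub>R G (X i \<omega>) \<theta>0) $ k\<bar>)"
      by (rule norm_le_l1_cart)
    also have "\<dots> \<le> (\<Sum>k\<in>(UNIV::'d set). ?\<kappa> * (real n * r n))"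
      using * by (intro sum_mono) (simp add: mult.commute)
    finally show "norm (\<Sum>i<n. \<epsilon> i \<omega> *\<^sub>R G (X i \<omega>) \<theta>0) \<le> \<tau> * (real n * r n)" by simp
  qed
qed

text \<open>Bounds on the finitely many entries serve all directions v at once, so the random
  direction of the estimator can be inserted.\<close>

lemma Hessian_noise_whp:
  assumes "\<tau> > 0"
  shows "whp M (\<lambda>n \<omega>. \<forall>v. \<bar>((\<Sum>i<n. \<epsilon> i \<omega> *\<^sub>R H (X i \<omega>) \<theta>0) *v v) \<bullet> v\<bar> \<le> \<tau> * real n * (norm v)\<^sup>2)"
proof -
  obtain b where b: "b > 0" "\<And>x k l. x \<in> ucube \<Longrightarrow> \<bar>H x \<theta>0 $ k $ l\<bar> \<le> b" using H_bounded by blast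
  let ?\<kappa> = "\<tau> / (real CARD('d))\<^sup>2"
  have k: "?\<kappa> > 0" using assms by simp
  have ev: "\<forall>\<^sub>F n in sequentially. 0 < ?\<kappa> * real n"
    using eventually_gt_at_top[of 0] by eventually_elim (use assms in simp)
  have "whp M (\<lambda>n \<omega>. \<forall>k\<in>(UNIV::'d set). \<forall>l\<in>(UNIV::'d set). \<bar>\<Sum>i<n. H (X i \<omega>) \<theta>0 $ k $ l * \<epsilon> i \<omega>\<bar> \<le> ?\<kappa> * real n)"
    by (intro whp_finite_ball[OF finite])
       (rule bounded_design_form_whp[OF continuous_design_measurable[OF H_continuous[OF theta0]] b(2) ev linear_scale_vanishes[OF k]])
  then show ?thesis
  proof (rule whp_mono, intro always_eventually allI ballI impI)
    fix n \<omega> and v :: "real^'d"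
    assume *: "\<forall>k\<in>UNIV. \<forall>l\<in>UNIV. \<bar>\<Sum>i<n. H (X i \<omega>) \<theta>0 $ k $ l * \<epsilon> i \<omega>\<bar> \<le> ?\<kappa> * real n"
    have "\<bar>((\<Sum>i<n. \<epsilon> i \<omega> *\<^sub>R H (X i \<omega>) \<theta>0) *v v) \<bullet> v\<bar> \<le> (real CARD('d))\<^sup>2 * (?\<kappa> * real n) * (norm v)\<^sup>2"
      by (rule quadratic_matrix_form_le) (use * in \<open>simp add: mult.commute\<close>)
    then show "\<bar>((\<Sum>i<n. \<epsilon> i \<omega> *\<^sub>R H (X i \<omega>) \<theta>0) *v v) \<bullet> v\<bar> \<le> \<tau> * real n * (norm v)\<^sup>2" by simp
  qed
qed

text \<open>On a finite net of \<Theta> each form is of order sqrt n. Moving to a net point within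
  \<rho> changes the form by at most the Lipschitz constant times \<rho> times the sum of absolute
  errors, which is at most K n.\<close>

lemma uniform_law:
  assumes \<tau>: "\<tau> > 0"
  shows "whp M (\<lambda>n \<omega>. \<forall>\<theta>\<in>\<Theta>. \<bar>\<Sum>i<n. (\<mu> (X i \<omega>) \<theta> - \<mu> (X i \<omega>) \<theta>0) * \<epsilon> i \<omega>\<bar> \<le> \<tau> * real n)"
proof (rule whp_of_bounded_errors)
  fix K :: real assume K: "K > 0"
  obtain B where B: "B > 0" "\<And>x \<theta> \<theta>'. x \<in> ucube \<Longrightarrow> \<theta> \<in> \<Theta> \<Longrightarrow> \<theta>' \<in> \<Theta> \<Longrightarrow> \<bar>\<mu> x \<theta> - \<mu> x \<theta>'\<bar> \<le> B * norm (\<theta> - \<theta>')"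
    using mu_Lipschitz by blast
  define \<rho> where "\<rho> = \<tau> / (2 * B * K)"
  have \<rho>: "\<rho> > 0" "B * \<rho> * K = \<tau> / 2" using \<tau> B(1) K by (simp_all add: \<rho>_def)
  have "compact \<Theta>" using model by (simp add: assumption_M_def)
  then obtain N where N: "finite N" "N \<subseteq> \<Theta>" "\<Theta> \<subseteq> (\<Union>\<theta>'\<in>N. ball \<theta>' \<rho>)"
    using \<rho>(1) seq_compact_imp_totally_bounded[of \<Theta>] compact_imp_seq_compact by blast
  have t2: "\<tau> / 2 > 0" using \<tau> by simp
  have ev: "\<forall>\<^sub>F n in sequentially. 0 < \<tau> / 2 * real n"
    using eventually_gt_at_top[of 0] by eventually_elim (use \<tau> in simp)
  have whps: "whp M (\<lambda>n \<omega>. \<forall>\<theta>'\<in>N. \<bar>\<Sum>i<n. (\<mu> (X i \<omega>) \<theta>' - \<mu> (X i \<omega>) \<theta>0) * \<epsilon> i \<omega>\<bar> \<le> \<tau> / 2 * real n)"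
  proof (rule whp_finite_ball[OF N(1)])
    fix \<theta>' assume "\<theta>' \<in> N"
    then have \<theta>': "\<theta>' \<in> \<Theta>" using N(2) by blast
    show "whp M (\<lambda>n \<omega>. \<bar>\<Sum>i<n. (\<mu> (X i \<omega>) \<theta>' - \<mu> (X i \<omega>) \<theta>0) * \<epsilon> i \<omega>\<bar> \<le> \<tau> / 2 * real n)"
      by (rule bounded_design_form_whp[OF _ B(2)[OF _ \<theta>' theta0] ev linear_scale_vanishes[OF t2]])
         (intro continuous_design_measurable continuous_on_diff mu_continuous theta0 \<theta>')
  qed
  from whps show "whp M (\<lambda>n \<omega>. (\<Sum>i<n. \<bar>\<epsilon> i \<omega>\<bar>) \<le> K * real n \<longrightarrow>
      (\<forall>\<theta>\<in>\<Theta>. \<bar>\<Sum>i<n. (\<mu> (X i \<omega>) \<theta> - \<mu> (X i \<omega>) \<theta>0) * \<epsilon> i \<omega>\<bar> \<le> \<tau> * real n))"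
  proof (rule whp_mono, intro always_eventually allI ballI impI)
    fix n \<omega> \<theta> assume \<omega>: "\<omega> \<in> space M" and net: "\<forall>\<theta>'\<in>N. \<bar>\<Sum>i<n. (\<mu> (X i \<omega>) \<theta>' - \<mu> (X i \<omega>) \<theta>0) * \<epsilon> i \<omega>\<bar> \<le> \<tau> / 2 * real n"
      and eK: "(\<Sum>i<n. \<bar>\<epsilon> i \<omega>\<bar>) \<le> K * real n" and \<theta>: "\<theta> \<in> \<Theta>"
    obtain \<theta>' where \<theta>': "\<theta>' \<in> N" "dist \<theta>' \<theta> < \<rho>" using N(3) \<theta> by (auto simp: subset_iff)
    have "\<bar>\<Sum>i<n. (\<mu> (X i \<omega>) \<theta> - \<mu> (X i \<omega>) \<theta>') * \<epsilon> i \<omega>\<bar> \<le> (\<Sum>i<n. \<bar>(\<mu> (X i \<omega>) \<theta> - \<mu> (X i \<omega>) \<theta>') * \<epsilon> i \<omega>\<bar>)"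
      by (rule sum_abs)
    also have "\<dots> \<le> (\<Sum>i<n. B * \<rho> * \<bar>\<epsilon> i \<omega>\<bar>)"
      unfolding abs_mult
    proof (intro sum_mono mult_right_mono)
      fix i
      have "\<bar>\<mu> (X i \<omega>) \<theta> - \<mu> (X i \<omega>) \<theta>'\<bar> \<le> B * norm (\<theta> - \<theta>')"
        using B(2)[OF X_cube[OF \<omega>] \<theta>] \<theta>'(1) N(2) by blast
      also have "\<dots> \<le> B * \<rho>" using \<theta>'(2) B(1) by (intro mult_left_mono) (auto simp: dist_norm norm_minus_commute)
      finally show "\<bar>\<mu> (X i \<omega>) \<theta> - \<mu> (X i \<omega>) \<theta>'\<bar> \<le> B * \<rho>" .
    qed simp
    also have "\<dots> = B * \<rho> * (\<Sum>i<n. \<bar>\<epsilon> i \<omega>\<bar>)" by (simp add: sum_distrib_left)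
    also have "\<dots> \<le> B * \<rho> * (K * real n)" using B(1) \<rho>(1) eK by (intro mult_left_mono) auto
    also have "\<dots> = \<tau> / 2 * real n" using \<rho>(2) by (simp add: mult.assoc[symmetric])
    finally have d: "\<bar>\<Sum>i<n. (\<mu> (X i \<omega>) \<theta> - \<mu> (X i \<omega>) \<theta>') * \<epsilon> i \<omega>\<bar> \<le> \<tau> / 2 * real n" .
    have "(\<Sum>i<n. (\<mu> (X i \<omega>) \<theta> - \<mu> (X i \<omega>) \<theta>0) * \<epsilon> i \<omega>)
        = (\<Sum>i<n. (\<mu> (X i \<omega>) \<theta> - \<mu> (X i \<omega>) \<theta>') * \<epsilon> i \<omega>) + (\<Sum>i<n. (\<mu> (X i \<omega>) \<theta>' - \<mu> (X i \<omega>) \<theta>0) * \<epsilon> i \<omega>)"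
      by (simp add: sum.distrib[symmetric] algebra_simps)
    moreover have "\<bar>\<Sum>i<n. (\<mu> (X i \<omega>) \<theta>' - \<mu> (X i \<omega>) \<theta>0) * \<epsilon> i \<omega>\<bar> \<le> \<tau> / 2 * real n" using net \<theta>'(1) by blast
    ultimately show "\<bar>\<Sum>i<n. (\<mu> (X i \<omega>) \<theta> - \<mu> (X i \<omega>) \<theta>0) * \<epsilon> i \<omega>\<bar> \<le> \<tau> * real n"
      using d by linarith
  qed
qed

lemma sum_prod_bound:
  fixes u v :: "nat \<Rightarrow> real"
  assumes "\<And>i. i < n \<Longrightarrow> \<bar>u i\<bar> \<le> a" "\<And>i. i < n \<Longrightarrow> \<bar>v i\<bar> \<le> b" "a \<ge> 0"
  shows "\<bar>\<Sum>i<n. u i * v i\<bar> \<le> a * b * real n"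
proof -
  have "\<bar>\<Sum>i<n. u i * v i\<bar> \<le> (\<Sum>i<n. \<bar>u i\<bar> * \<bar>v i\<bar>)" using sum_abs[of "\<lambda>i. u i * v i"] by (simp add: abs_mult)
  also have "\<dots> \<le> (\<Sum>i<n. a * b)" using assms by (intro sum_mono mult_mono) auto
  finally show ?thesis by (simp add: mult.commute)
qed

lemma r_small: "B > 0 \<Longrightarrow> \<tau> > 0 \<Longrightarrow> \<forall>\<^sub>F n in sequentially. B * r n \<le> \<tau>"
proof -
  assume b: "B > 0" "\<tau> > 0"
  have "\<forall>\<^sub>F n in sequentially. r n < \<tau> / B" using r_tendsto b by (intro order_tendstoD(2)) auto
  then show ?thesis by eventually_elim (use b in \<open>simp add: pos_less_divide_eq mult.commute\<close>)
qed

text \<open>Identifiability makes the left side of the basic inequality grow like n times the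
  squared distance. The noise term is o(n) uniformly over \<Theta>, and the term with \<delta> is of
  order n r because \<Theta> is bounded.\<close>

lemma consistency:
  assumes \<rho>: "\<rho> > 0"
  shows "whp M (\<lambda>n \<omega>. norm (\<theta>hat n \<omega> - \<theta>0) \<le> \<rho>)"
proof -
  define c where "c = C3 / (2 * real CARD('d))"
  have c: "c > 0" using C3 by (simp add: c_def)
  \<comment> \<open>Both linear terms of the basic inequality carry the factor 2 and are at most
    \<tau> n, so their sum is at most c \<rho>^2 n.\<close>
  define \<tau> where "\<tau> = c * \<rho>\<^sup>2 / 4"
  have \<tau>: "\<tau> > 0" using c \<rho> by (simp add: \<tau>_def)
  obtain B where B: "B > 0" "\<And>x \<theta> \<theta>'. x \<in> ucube \<Longrightarrow> \<theta> \<in> \<Theta> \<Longrightarrow> \<theta>' \<in> \<Theta> \<Longrightarrow> \<bar>\<mu> x \<theta> - \<mu> x \<theta>'\<bar> \<le> B * norm (\<theta> - \<theta>')"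
    using mu_Lipschitz by blast
  obtain B' where B': "B' > 0" "\<forall>\<^sub>F n in sequentially. \<forall>x\<in>ucube. \<bar>\<delta> n x\<bar> \<le> B'" by (rule delta_bounded)
  have "bounded \<Theta>" using model by (simp add: assumption_M_def compact_imp_bounded)
  then obtain D where D: "D > 0" "\<And>\<theta>. \<theta> \<in> \<Theta> \<Longrightarrow> norm \<theta> \<le> D" unfolding bounded_pos by blast
  have ev: "\<forall>\<^sub>F n in sequentially. (\<forall>x\<in>ucube. \<bar>\<delta> n x\<bar> \<le> B') \<and> (B * (2 * D) * B') * r n \<le> \<tau> \<and> 0 < r n \<and> n \<ge> 1"
    using B'(2) r_small[of "B * (2 * D) * B'" \<tau>] r_pos eventually_ge_at_top[of 1] B(1) B'(1) D(1) \<tau>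
    by (simp add: eventually_conj_iff)
  from whp_conj[OF identified uniform_law[OF \<tau>]] show ?thesis
  proof (rule whp_mono, use ev in eventually_elim, intro ballI impI, elim conjE)
    fix n \<omega> assume \<delta>: "\<forall>x\<in>ucube. \<bar>\<delta> n x\<bar> \<le> B'" and rs: "B * (2 * D) * B' * r n \<le> \<tau>" "0 < r n" and n: "1 \<le> n"
      and \<omega>: "\<omega> \<in> space M" and id: "C3 / (2 * real CARD('d)) * real n * (norm (\<theta>hat n \<omega> - \<theta>0))\<^sup>2 \<le> (\<Sum>i<n. (fit_diff n \<omega> i)\<^sup>2)"
      and law: "\<forall>\<theta>\<in>\<Theta>. \<bar>\<Sum>i<n. (\<mu> (X i \<omega>) \<theta> - \<mu> (X i \<omega>) \<theta>0) * \<epsilon> i \<omega>\<bar> \<le> \<tau> * real n"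
    note th = theta_hat_in[OF n \<omega>]
    let ?t = "norm (\<theta>hat n \<omega> - \<theta>0)"
    have "\<bar>fit_diff n \<omega> i\<bar> \<le> B * (2 * D)" for i
    proof -
      have "\<bar>fit_diff n \<omega> i\<bar> \<le> B * ?t" unfolding fit_diff_def by (rule B(2)[OF X_cube[OF \<omega>] th theta0])
      also have "\<dots> \<le> B * (2 * D)"
        using norm_triangle_ineq4[of "\<theta>hat n \<omega>" \<theta>0] D(2)[OF th] D(2)[OF theta0] B(1) by (intro mult_left_mono) auto
      finally show ?thesis .
    qed
    then have "\<bar>\<Sum>i<n. fit_diff n \<omega> i * \<delta> n (X i \<omega>)\<bar> \<le> B * (2 * D) * B' * real n"
      using \<delta> X_cube[OF \<omega>] B(1) D(1) by (intro sum_prod_bound) auto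
    then have "r n * (\<Sum>i<n. fit_diff n \<omega> i * \<delta> n (X i \<omega>)) \<le> r n * (B * (2 * D) * B' * real n)"
      using rs(2) by (intro mult_left_mono) auto
    also have "\<dots> = (B * (2 * D) * B' * r n) * real n" by (simp only: mult_ac)
    also have "\<dots> \<le> \<tau> * real n" using rs(1) by (rule mult_right_mono) simp
    finally have 1: "r n * (\<Sum>i<n. fit_diff n \<omega> i * \<delta> n (X i \<omega>)) \<le> \<tau> * real n" .
    have 2: "(\<Sum>i<n. fit_diff n \<omega> i * \<epsilon> i \<omega>) \<le> \<tau> * real n"
      using law th unfolding fit_diff_def by (meson abs_le_D1)
    have "c * real n * ?t\<^sup>2 \<le> 2 * (\<tau> * real n) + 2 * (\<tau> * real n)"
      using id basic_inequality[OF n \<omega>] 1 2 unfolding c_def by linarith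
    also have "\<dots> = c * real n * \<rho>\<^sup>2" by (simp add: \<tau>_def)
    finally have "?t\<^sup>2 \<le> \<rho>\<^sup>2" using c n by simp
    then show "?t \<le> \<rho>" using \<rho> by (simp add: power2_le_iff_abs_le)
  qed
qed

end

lemma scaled_matrix_sum_mult:
  fixes A :: "nat \<Rightarrow> real^'d^'d"
  shows "((\<Sum>i<n. c i *\<^sub>R A i) *v v) \<bullet> v = (\<Sum>i<n. c i * ((A i *v v) \<bullet> v))"
  by (induction n) (simp_all add: matrix_vector_mult_add_rdistrib inner_add_left scaleR_matrix_vector_assoc[symmetric])

context local_alternatives
begin

text \<open>The first order term of the expansion is negligible because the score noise has order \<open>\<surd>n\<close>,
  which is \<open>o(n r\<^sub>n)\<close>, and because \<open>\<delta>\<close> is asymptotically orthogonal to the gradient.\<close>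
lemma parameter_rate:
  assumes \<eta>: "\<eta> > 0"
  shows "whp M (\<lambda>n \<omega>. norm (\<theta>hat n \<omega> - \<theta>0) \<le> \<eta> * r n)"
proof (rule whp_of_bounded_errors)
  fix K :: real assume K: "K > 0"
  define c where "c = C3 / (2 * real CARD('d))"
  have c: "c > 0" using C3 by (simp add: c_def)
  \<comment> \<open>The first entry lets the term 5 \<tau> t^2 be absorbed into half of c t^2; the
    second gives the rate \<eta> r after division by c t.\<close>
  define \<tau> where "\<tau> = min (c / 10) (\<eta> * c / 8)"
  have \<tau>: "\<tau> > 0" "10 * \<tau> \<le> c" "8 * \<tau> \<le> \<eta> * c" using c \<eta> by (auto simp: \<tau>_def)
  \<comment> \<open>The Taylor remainder is multiplied by the absolute errors, whose sum is at most
    K n; hence the constant \<tau> / K.\<close>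
  define e where "e = \<tau> / K"
  have e: "e > 0" "e * K = \<tau>" using \<tau>(1) K by (simp_all add: e_def)
  obtain \<rho> where \<rho>: "\<rho> > 0" "\<And>x v. x \<in> ucube \<Longrightarrow> norm v < \<rho> \<Longrightarrow>
    \<theta>0 + v \<in> \<Theta> \<and> \<bar>\<mu> x (\<theta>0 + v) - \<mu> x \<theta>0 - G x \<theta>0 \<bullet> v - (H x \<theta>0 *v v) \<bullet> v / 2\<bar> \<le> e * (norm v)\<^sup>2"
    using Taylor_second_order[OF e(1)] by blast
  obtain C where C: "C > 0" "\<And>x \<theta>. x \<in> ucube \<Longrightarrow> \<theta> \<in> \<Theta> \<Longrightarrow>
    \<bar>\<mu> x \<theta> - \<mu> x \<theta>0 - G x \<theta>0 \<bullet> (\<theta> - \<theta>0)\<bar> \<le> C * (norm (\<theta> - \<theta>0))\<^sup>2"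
    using quadratic_remainder by blast
  obtain B where B: "B > 0" "\<forall>\<^sub>F n in sequentially. \<forall>x\<in>ucube. \<bar>\<delta> n x\<bar> \<le> B" by (rule delta_bounded)
  have ev: "\<forall>\<^sub>F n in sequentially. (\<forall>x\<in>ucube. \<bar>\<delta> n x\<bar> \<le> B) \<and> (C * B) * r n \<le> \<tau> \<and> 0 < r n \<and> n \<ge> 1"
    using B(2) r_small[of "C * B" \<tau>] r_pos eventually_ge_at_top[of 1] B(1) C(1) \<tau>
    by (simp add: eventually_conj_iff)
  \<comment> \<open>Consistency gives a weak inequality, and half the radius places the estimator
    strictly inside the Taylor ball.\<close>
  have r2: "\<rho> / 2 > 0" using \<rho>(1) by simp
  note whps = whp_conj[OF identified whp_conj[OF consistency[OF r2] whp_conj[OF gradient_noise_whp[OF \<tau>(1)]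
    whp_conj[OF Hessian_noise_whp[OF \<tau>(1)] whp_conv_in_prob[OF orthogonal \<tau>(1)]]]]]
  from whps show "whp M (\<lambda>n \<omega>. (\<Sum>i<n. \<bar>\<epsilon> i \<omega>\<bar>) \<le> K * real n \<longrightarrow> norm (\<theta>hat n \<omega> - \<theta>0) \<le> \<eta> * r n)"
  proof (rule whp_mono, use ev in eventually_elim, intro ballI impI, elim conjE)
    fix n \<omega> assume \<delta>: "\<forall>x\<in>ucube. \<bar>\<delta> n x\<bar> \<le> B" and rs: "C * B * r n \<le> \<tau>" "0 < r n" and n: "1 \<le> n"
      and \<omega>: "\<omega> \<in> space M" and eK: "(\<Sum>i<n. \<bar>\<epsilon> i \<omega>\<bar>) \<le> K * real n"
      and id: "C3 / (2 * real CARD('d)) * real n * (norm (\<theta>hat n \<omega> - \<theta>0))\<^sup>2 \<le> (\<Sum>i<n. (fit_diff n \<omega> i)\<^sup>2)"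
      and near: "norm (\<theta>hat n \<omega> - \<theta>0) \<le> \<rho> / 2"
      and grad: "norm (\<Sum>i<n. \<epsilon> i \<omega> *\<^sub>R G (X i \<omega>) \<theta>0) \<le> \<tau> * (real n * r n)"
      and hess: "\<forall>v. \<bar>((\<Sum>i<n. \<epsilon> i \<omega> *\<^sub>R H (X i \<omega>) \<theta>0) *v v) \<bullet> v\<bar> \<le> \<tau> * real n * (norm v)\<^sup>2"
      and orth: "dist ((1 / real n) *\<^sub>R (\<Sum>i<n. \<delta> n (X i \<omega>) *\<^sub>R G (X i \<omega>) \<theta>0)) 0 \<le> \<tau>"
    note th = theta_hat_in[OF n \<omega>]
    define v where "v = \<theta>hat n \<omega> - \<theta>0"
    have tv: "\<theta>hat n \<omega> = \<theta>0 + v" by (simp add: v_def)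
    define t where "t = norm v"
    have t: "t \<ge> 0" "t < \<rho>" using near \<rho>(1) by (simp_all add: t_def v_def)
    \<comment> \<open>Two remainders are used: \<open>q\<close>, after the second order term, is
      paired with the errors, while \<open>g\<close>, after the first order term, is paired with the
      bounded \<delta>, where the small factor r helps.\<close>
    define q where "q i = fit_diff n \<omega> i - G (X i \<omega>) \<theta>0 \<bullet> v - (H (X i \<omega>) \<theta>0 *v v) \<bullet> v / 2" for i
    define g where "g i = fit_diff n \<omega> i - G (X i \<omega>) \<theta>0 \<bullet> v" for i
    have q: "\<bar>q i\<bar> \<le> e * t\<^sup>2" for i
      using \<rho>(2)[OF X_cube[OF \<omega>], of v i] t(2) unfolding q_def fit_diff_def t_def tv by blast
    have g: "\<bar>g i\<bar> \<le> C * t\<^sup>2" for i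
      using C(2)[OF X_cube[OF \<omega>, of i] th] unfolding g_def fit_diff_def t_def v_def .
    have "(\<Sum>i<n. fit_diff n \<omega> i * \<epsilon> i \<omega>)
        = (\<Sum>i<n. \<epsilon> i \<omega> *\<^sub>R G (X i \<omega>) \<theta>0) \<bullet> v + ((\<Sum>i<n. \<epsilon> i \<omega> *\<^sub>R H (X i \<omega>) \<theta>0) *v v) \<bullet> v / 2 + (\<Sum>i<n. q i * \<epsilon> i \<omega>)"
    proof -
      have "(\<Sum>i<n. fit_diff n \<omega> i * \<epsilon> i \<omega>)
          = (\<Sum>i<n. \<epsilon> i \<omega> * (G (X i \<omega>) \<theta>0 \<bullet> v) + \<epsilon> i \<omega> * ((H (X i \<omega>) \<theta>0 *v v) \<bullet> v) / 2 + q i * \<epsilon> i \<omega>)"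
        by (rule sum.cong) (simp_all add: q_def field_simps)
      then show ?thesis
        by (simp add: sum.distrib scaled_matrix_sum_mult inner_sum_left sum_divide_distrib)
    qed
    moreover have "\<bar>(\<Sum>i<n. \<epsilon> i \<omega> *\<^sub>R G (X i \<omega>) \<theta>0) \<bullet> v\<bar> \<le> \<tau> * (real n * r n) * t"
      using Cauchy_Schwarz_ineq2 mult_right_mono[OF grad t(1)] unfolding t_def by (rule order.trans)
    moreover have "\<bar>((\<Sum>i<n. \<epsilon> i \<omega> *\<^sub>R H (X i \<omega>) \<theta>0) *v v) \<bullet> v\<bar> \<le> \<tau> * real n * t\<^sup>2"
      using hess unfolding t_def by blast
    moreover have "\<bar>\<Sum>i<n. q i * \<epsilon> i \<omega>\<bar> \<le> \<tau> * real n * t\<^sup>2"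
    proof -
      have "\<bar>\<Sum>i<n. q i * \<epsilon> i \<omega>\<bar> \<le> (\<Sum>i<n. \<bar>q i\<bar> * \<bar>\<epsilon> i \<omega>\<bar>)"
        using sum_abs[of "\<lambda>i. q i * \<epsilon> i \<omega>"] by (simp add: abs_mult)
      also have "\<dots> \<le> (\<Sum>i<n. e * t\<^sup>2 * \<bar>\<epsilon> i \<omega>\<bar>)" using q by (intro sum_mono mult_right_mono) auto
      also have "\<dots> = e * t\<^sup>2 * (\<Sum>i<n. \<bar>\<epsilon> i \<omega>\<bar>)" by (simp add: sum_distrib_left)
      also have "\<dots> \<le> e * t\<^sup>2 * (K * real n)" using eK e(1) by (intro mult_left_mono) auto
      also have "\<dots> = (e * K) * real n * t\<^sup>2" by (simp only: mult_ac)
      finally show ?thesis by (simp only: e(2))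
    qed
    ultimately have 1: "(\<Sum>i<n. fit_diff n \<omega> i * \<epsilon> i \<omega>) \<le> \<tau> * (real n * r n) * t + 3/2 * (\<tau> * real n * t\<^sup>2)"
      by linarith
    have "r n * (\<Sum>i<n. fit_diff n \<omega> i * \<delta> n (X i \<omega>)) \<le> \<tau> * (real n * r n) * t + \<tau> * real n * t\<^sup>2"
    proof -
      have "(\<Sum>i<n. fit_diff n \<omega> i * \<delta> n (X i \<omega>))
          = (\<Sum>i<n. \<delta> n (X i \<omega>) * (G (X i \<omega>) \<theta>0 \<bullet> v) + g i * \<delta> n (X i \<omega>))"
        by (rule sum.cong) (simp_all add: g_def algebra_simps)
      also have "\<dots> = (\<Sum>i<n. \<delta> n (X i \<omega>) *\<^sub>R G (X i \<omega>) \<theta>0) \<bullet> v + (\<Sum>i<n. g i * \<delta> n (X i \<omega>))"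
        by (simp add: sum.distrib inner_sum_left)
      also have "\<dots> \<le> real n * \<tau> * t + C * t\<^sup>2 * B * real n"
      proof (rule add_mono)
        have "norm (\<Sum>i<n. \<delta> n (X i \<omega>) *\<^sub>R G (X i \<omega>) \<theta>0) \<le> real n * \<tau>"
          using orth n by (simp add: dist_norm pos_divide_le_eq mult.commute)
        from mult_right_mono[OF this t(1)] norm_cauchy_schwarz[of "\<Sum>i<n. \<delta> n (X i \<omega>) *\<^sub>R G (X i \<omega>) \<theta>0" v]
        show "(\<Sum>i<n. \<delta> n (X i \<omega>) *\<^sub>R G (X i \<omega>) \<theta>0) \<bullet> v \<le> real n * \<tau> * t" unfolding t_def by linarith
        have "\<bar>\<Sum>i<n. g i * \<delta> n (X i \<omega>)\<bar> \<le> C * t\<^sup>2 * B * real n"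
          using g \<delta> X_cube[OF \<omega>] C(1) by (intro sum_prod_bound) auto
        then show "(\<Sum>i<n. g i * \<delta> n (X i \<omega>)) \<le> C * t\<^sup>2 * B * real n" by linarith
      qed
      finally have "r n * (\<Sum>i<n. fit_diff n \<omega> i * \<delta> n (X i \<omega>)) \<le> r n * (real n * \<tau> * t + C * t\<^sup>2 * B * real n)"
        using rs(2) by (intro mult_left_mono) auto
      also have "\<dots> = \<tau> * (real n * r n) * t + (C * B * r n) * (real n * t\<^sup>2)" by (simp add: algebra_simps)
      also have "\<dots> \<le> \<tau> * (real n * r n) * t + \<tau> * (real n * t\<^sup>2)"
        using rs(1) by (intro add_left_mono mult_right_mono) auto
      finally show ?thesis by (simp only: mult.assoc)
    qed
    with 1 id basic_inequality[OF n \<omega>]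
    have "c * real n * t\<^sup>2 \<le> 4 * (\<tau> * (real n * r n) * t) + 5 * (\<tau> * real n * t\<^sup>2)"
      unfolding c_def t_def v_def by linarith
    then have "real n * (c * t\<^sup>2) \<le> real n * (4 * \<tau> * r n * t + 5 * \<tau> * t\<^sup>2)" by (simp add: algebra_simps)
    then have main: "c * t\<^sup>2 \<le> 4 * \<tau> * r n * t + 5 * \<tau> * t\<^sup>2" using n by simp
    have "10 * \<tau> * t\<^sup>2 \<le> c * t\<^sup>2" using \<tau>(2) by (rule mult_right_mono) simp
    with main have "c * t\<^sup>2 \<le> 8 * \<tau> * (r n * t)" by simp
    also have "\<dots> \<le> \<eta> * c * (r n * t)" using \<tau>(3) rs(2) t(1) by (intro mult_right_mono) auto
    finally have "c * (t * t) \<le> c * (\<eta> * r n * t)" by (simp add: power2_eq_square mult_ac)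
    then have tt: "t * t \<le> \<eta> * r n * t" using c by simp
    show "norm (\<theta>hat n \<omega> - \<theta>0) \<le> \<eta> * r n"
    proof (cases "t = 0")
      case True
      then show ?thesis using \<eta> rs(2) by (simp add: t_def v_def)
    next
      case False
      with t(1) have "t > 0" by simp
      with tt have "t \<le> \<eta> * r n" by simp
      then show ?thesis by (simp add: t_def v_def)
    qed
  qed
qed

end

section \<open>The test statistic\<close>

definition bilin :: "(nat \<Rightarrow> nat \<Rightarrow> real) \<Rightarrow> nat \<Rightarrow> (nat \<Rightarrow> real) \<Rightarrow> (nat \<Rightarrow> real) \<Rightarrow> real" where
  "bilin w n u v = (\<Sum>i<n. u i * (\<Sum>j<n. w i j * v j))"

lemma bilin_add: "bilin w n u (\<lambda>i. v i + v' i) = bilin w n u v + bilin w n u v'"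
  "bilin w n (\<lambda>i. u i + u' i) v = bilin w n u v + bilin w n u' v"
  by (simp_all add: bilin_def distrib_left distrib_right sum.distrib)

lemma bilin_scale: "bilin w n u (\<lambda>i. c * v i) = c * bilin w n u v"
  "bilin w n (\<lambda>i. c * u i) v = c * bilin w n u v"
  by (simp_all add: bilin_def sum_distrib_left mult_ac)

lemma bilin_sum:
  assumes "finite K" shows "bilin w n u (\<lambda>i. \<Sum>k\<in>K. f k i) = (\<Sum>k\<in>K. bilin w n u (f k))"
  using assms by (induction K) (simp_all add: bilin_add(1), simp add: bilin_def)

lemma bilin_commute:
  assumes "\<And>i j. i < n \<Longrightarrow> j < n \<Longrightarrow> w i j = w j i" shows "bilin w n u v = bilin w n v u"
proof -
  have "bilin w n u v = (\<Sum>i<n. \<Sum>j<n. u i * (w i j * v j))" by (simp add: bilin_def sum_distrib_left)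
  also have "\<dots> = (\<Sum>j<n. \<Sum>i<n. u i * (w i j * v j))" by (rule sum.swap)
  also have "\<dots> = (\<Sum>j<n. \<Sum>i<n. v j * (w j i * u i))"
    by (intro sum.cong refl) (use assms in \<open>simp add: mult_ac\<close>)
  finally show ?thesis by (simp add: bilin_def sum_distrib_left)
qed

lemma bilin_bound:
  assumes "\<And>u. (\<Sum>i<n. (\<Sum>j<n. w i j * u j)\<^sup>2) \<le> 4 * (\<Sum>i<n. (u i)\<^sup>2)"
  shows "\<bar>bilin w n u v\<bar> \<le> 2 * sqrt (\<Sum>i<n. (u i)\<^sup>2) * sqrt (\<Sum>i<n. (v i)\<^sup>2)"
  unfolding bilin_def using quadratic_form_bound[where n = n and w = w and C = 2 and u = u and v = v] assms by simp

text \<open>Applied to a unit vector, the norm bound controls a column and so each entry; this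
  supplies integrability of the squared weights.\<close>

lemma contraction_entry:
  fixes w :: "nat \<Rightarrow> nat \<Rightarrow> real"
  assumes w: "\<And>u. (\<Sum>i<n. (\<Sum>j<n. w i j * u j)\<^sup>2) \<le> 4 * (\<Sum>i<n. (u i)\<^sup>2)" and ij: "i < n" "j < n"
  shows "\<bar>w i j\<bar> \<le> 2"
proof -
  define u :: "nat \<Rightarrow> real" where "u l = of_bool (l = j)" for l
  have "(\<Sum>l<n. w i l * u l) = (\<Sum>l<n. if l = j then w i l else 0)" for i
    by (rule sum.cong) (auto simp: u_def)
  then have s: "(\<Sum>l<n. w i l * u l) = w i j" for i using ij by simp
  have "(\<Sum>l<n. (u l)\<^sup>2) = (\<Sum>l<n. if l = j then 1 else 0)" by (rule sum.cong) (auto simp: u_def)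
  then have s2: "(\<Sum>l<n. (u l)\<^sup>2) = 1" using ij by simp
  have "(w i j)\<^sup>2 \<le> (\<Sum>i<n. (w i j)\<^sup>2)" using ij by (intro member_le_sum) auto
  also have "\<dots> \<le> 2\<^sup>2" using w[of u] unfolding s s2 by simp
  finally show ?thesis by (simp only: abs_le_square_iff[symmetric])
qed

text \<open>The weights are abstract here. The quantity in \<open>noise_rate\<close> is the fourth
  power of the rate assumed for the alternatives; it compares n r^2 with the size h^(-p/2) of the
  quadratic noise.\<close>

locale weighted_alternatives =
  local_alternatives M X \<epsilon> \<sigma>2 d \<Theta> \<mu> G H \<theta>0 \<delta> m r R \<theta>hat C3
  for M :: "'a measure" and X :: "nat \<Rightarrow> 'a \<Rightarrow> real^'p" and \<epsilon> \<sigma>2 d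
    and \<Theta> :: "(real^'d) set" and \<mu> :: "real^'p \<Rightarrow> real^'d \<Rightarrow> real" and G H \<theta>0 \<delta> m r R \<theta>hat C3 +
  fixes h :: "nat \<Rightarrow> real" and w :: "nat \<Rightarrow> 'a \<Rightarrow> nat \<Rightarrow> nat \<Rightarrow> real" and Cw :: real
  assumes regular: "regular_weights M X h w Cw"
    and signal: "whp M (\<lambda>n \<omega>. real n / 2 \<le> (\<Sum>i<n. \<Sum>j<n. \<delta> n (X i \<omega>) * w n \<omega> i j * \<delta> n (X j \<omega>)))"
    and noise_rate: "filterlim (\<lambda>n. h n ^ CARD('p) * (real n * (r n)\<^sup>2)\<^sup>2) at_top sequentially"
begin

lemma noise_vanishes: "(\<lambda>n. (b / h n ^ CARD('p)) / (\<kappa> * (real n * (r n)\<^sup>2))\<^sup>2) \<longlonglongrightarrow> 0"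
proof -
  have "(\<lambda>n. b / \<kappa>\<^sup>2 * inverse (h n ^ CARD('p) * (real n * (r n)\<^sup>2)\<^sup>2)) \<longlonglongrightarrow> b / \<kappa>\<^sup>2 * 0"
    by (intro tendsto_mult tendsto_const tendsto_inverse_0_at_top noise_rate)
  moreover have "b / \<kappa>\<^sup>2 * inverse (h n ^ CARD('p) * (real n * (r n)\<^sup>2)\<^sup>2) = (b / h n ^ CARD('p)) / (\<kappa> * (real n * (r n)\<^sup>2))\<^sup>2" for n
    by (simp add: power_mult_distrib divide_inverse mult_ac)
  ultimately show ?thesis by simp
qed

lemma signal_scale_pos:
  assumes "\<kappa> > 0" shows "\<forall>\<^sub>F n in sequentially. 0 < \<kappa> * (real n * (r n)\<^sup>2)"
  using r_pos eventually_gt_at_top[of 0] by eventually_elim (use assms in simp)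

lemma sum_sq_weights_integrable:
  assumes wm: "\<forall>i<n. \<forall>j<n. (\<lambda>\<omega>. w n \<omega> i j) \<in> borel_measurable (sigma_design M X n)"
    and contr: "\<forall>\<omega>\<in>space M. \<forall>u. (\<Sum>i<n. (\<Sum>j<n. w n \<omega> i j * u j)\<^sup>2) \<le> 4 * (\<Sum>i<n. (u i)\<^sup>2)"
  shows "integrable M (\<lambda>\<omega>. \<Sum>i<n. \<Sum>j<n. (w n \<omega> i j)\<^sup>2)"
proof (intro Bochner_Integration.integrable_sum)
  fix i j assume "i \<in> {..<n}" "j \<in> {..<n}"
  then have ij: "i < n" "j < n" by auto
  have [measurable]: "(\<lambda>\<omega>. w n \<omega> i j) \<in> borel_measurable M"
    using wm ij by (intro measurable_from_subalg[OF subalgebra_design]) auto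
  have "(w n \<omega> i j)\<^sup>2 \<le> 2\<^sup>2" if "\<omega> \<in> space M" for \<omega>
  proof -
    have "\<bar>w n \<omega> i j\<bar> \<le> 2" by (rule contraction_entry[OF contr[rule_format, OF that] ij])
    from power_mono[OF this abs_ge_zero, of 2] show ?thesis by simp
  qed
  then show "integrable M (\<lambda>\<omega>. (w n \<omega> i j)\<^sup>2)"
    by (intro integrable_const_bound[where B = "2\<^sup>2"] AE_I2) auto
qed

text \<open>Markov's inequality for the squared Frobenius norm, intended for the critical value,
  which is bounded by a multiple of that norm.\<close>

lemma weights_small:
  assumes \<kappa>: "\<kappa> > 0"
  shows "whp M (\<lambda>n \<omega>. (\<Sum>i<n. \<Sum>j<n. (w n \<omega> i j)\<^sup>2) \<le> (\<kappa> * (real n * (r n)\<^sup>2))\<^sup>2)"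
proof (rule whp_Markov[where b = "\<lambda>n. Cw / h n ^ CARD('p)"])
  show "\<forall>\<^sub>F n in sequentially. integrable M (\<lambda>\<omega>. \<Sum>i<n. \<Sum>j<n. (w n \<omega> i j)\<^sup>2) \<and>
      (AE \<omega> in M. 0 \<le> (\<Sum>i<n. \<Sum>j<n. (w n \<omega> i j)\<^sup>2)) \<and>
      expectation (\<lambda>\<omega>. \<Sum>i<n. \<Sum>j<n. (w n \<omega> i j)\<^sup>2) \<le> Cw / h n ^ CARD('p)"
    using regular[unfolded regular_weights_def]
  proof eventually_elim
    case (elim n)
    then show ?case using sum_sq_weights_integrable[of n] by (auto intro!: sum_nonneg)
  qed
  show "\<forall>\<^sub>F n in sequentially. 0 < (\<kappa> * (real n * (r n)\<^sup>2))\<^sup>2"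
    using signal_scale_pos[OF \<kappa>] by eventually_elim (rule zero_less_power)
qed (rule noise_vanishes)

text \<open>The second moment is at most a multiple of the mean squared Frobenius norm, thus of
  h^-p, which is negligible against the square of n r^2.\<close>

lemma noise_quadratic_whp:
  assumes \<tau>: "\<tau> > 0"
  shows "whp M (\<lambda>n \<omega>. \<bar>bilin (w n \<omega>) n (\<lambda>i. \<epsilon> i \<omega>) (\<lambda>i. \<epsilon> i \<omega>)\<bar> \<le> \<tau> * (real n * (r n)\<^sup>2))"
proof (rule whp_Chebyshev[where b = "\<lambda>n. (2 * vmax\<^sup>2 * Cw) / h n ^ CARD('p)", OF _ signal_scale_pos[OF \<tau>] noise_vanishes])
  show "\<forall>\<^sub>F n in sequentially. integrable M (\<lambda>\<omega>. (bilin (w n \<omega>) n (\<lambda>i. \<epsilon> i \<omega>) (\<lambda>i. \<epsilon> i \<omega>))\<^sup>2) \<and>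
      expectation (\<lambda>\<omega>. (bilin (w n \<omega>) n (\<lambda>i. \<epsilon> i \<omega>) (\<lambda>i. \<epsilon> i \<omega>))\<^sup>2) \<le> (2 * vmax\<^sup>2 * Cw) / h n ^ CARD('p)"
    using regular[unfolded regular_weights_def]
  proof (eventually_elim, elim conjE)
    fix n assume wm: "\<forall>i<n. \<forall>j<n. (\<lambda>\<omega>. w n \<omega> i j) \<in> borel_measurable (sigma_design M X n)"
      and sym: "\<forall>\<omega>. \<forall>i<n. \<forall>j<n. w n \<omega> i j = w n \<omega> j i" and diag: "\<forall>\<omega>. \<forall>i<n. w n \<omega> i i = 0"
      and contr: "\<forall>\<omega>\<in>space M. \<forall>u. (\<Sum>i<n. (\<Sum>j<n. w n \<omega> i j * u j)\<^sup>2) \<le> 4 * (\<Sum>i<n. (u i)\<^sup>2)"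
      and E: "expectation (\<lambda>\<omega>. \<Sum>i<n. \<Sum>j<n. (w n \<omega> i j)\<^sup>2) \<le> Cw / h n ^ CARD('p)"
    have eq: "bilin (w n \<omega>) n (\<lambda>i. \<epsilon> i \<omega>) (\<lambda>i. \<epsilon> i \<omega>) = (\<Sum>i<n. \<Sum>j<n. w n \<omega> i j * \<epsilon> i \<omega> * \<epsilon> j \<omega>)" for \<omega>
      by (simp add: bilin_def sum_distrib_left mult_ac)
    have bd: "\<bar>w n \<omega> i j\<bar> \<le> 2" if "i < n" "j < n" "\<omega> \<in> space M" for i j \<omega>
      using contraction_entry[where n = n and w = "w n \<omega>" and i = i and j = j] contr that by blast
    have wm': "(\<lambda>\<omega>. w n \<omega> i j) \<in> borel_measurable (sigma_design M X n)" if "i < n" "j < n" for i j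
      using wm that by blast
    have sym': "w n \<omega> i j = w n \<omega> j i" if "i < n" "j < n" for i j \<omega> using sym that by blast
    have diag': "w n \<omega> i i = 0" if "i < n" for i \<omega> using diag that by blast
    note Q = quadratic_form_second_moment[where w = "\<lambda>i j \<omega>. w n \<omega> i j" and n = n and B = 2, OF wm' bd sym' diag']
    have "2 * vmax\<^sup>2 * expectation (\<lambda>\<omega>. \<Sum>i<n. \<Sum>j<n. (w n \<omega> i j)\<^sup>2) \<le> 2 * vmax\<^sup>2 * (Cw / h n ^ CARD('p))"
      by (rule mult_left_mono[OF E]) simp
    with Q show "integrable M (\<lambda>\<omega>. (bilin (w n \<omega>) n (\<lambda>i. \<epsilon> i \<omega>) (\<lambda>i. \<epsilon> i \<omega>))\<^sup>2) \<and>
      expectation (\<lambda>\<omega>. (bilin (w n \<omega>) n (\<lambda>i. \<epsilon> i \<omega>) (\<lambda>i. \<epsilon> i \<omega>))\<^sup>2) \<le> (2 * vmax\<^sup>2 * Cw) / h n ^ CARD('p)"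
      unfolding eq by (auto intro: order.trans)
  qed
qed

text \<open>The form is linear in the errors with coefficients that depend on the design alone; the
  norm bound keeps their sum of squares of order n.\<close>

lemma smoothed_noise_whp:
  assumes \<phi>: "\<forall>\<^sub>F n in sequentially. (\<forall>i<n. (\<lambda>\<omega>. \<phi> n (X i \<omega>)) \<in> borel_measurable (sigma_design M X n)) \<and> (\<forall>x\<in>ucube. \<bar>\<phi> n x\<bar> \<le> B)"
    and \<tau>: "\<tau> > 0"
  shows "whp M (\<lambda>n \<omega>. \<bar>bilin (w n \<omega>) n (\<lambda>i. \<epsilon> i \<omega>) (\<lambda>i. \<phi> n (X i \<omega>))\<bar> \<le> \<tau> * (real n * r n))"
proof -
  have ev: "\<forall>\<^sub>F n in sequentially. 0 < \<tau> * (real n * r n)"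
    using r_pos eventually_gt_at_top[of 0] by eventually_elim (use \<tau> in simp)
  have "whp M (\<lambda>n \<omega>. \<bar>\<Sum>i<n. (\<Sum>j<n. w n \<omega> i j * \<phi> n (X j \<omega>)) * \<epsilon> i \<omega>\<bar> \<le> \<tau> * (real n * r n))"
  proof (rule linear_form_whp[where B = "4 * B\<^sup>2", OF _ ev inverse_rate[OF \<tau>]])
    show "\<forall>\<^sub>F n in sequentially. (\<forall>i<n. (\<lambda>\<omega>. \<Sum>j<n. w n \<omega> i j * \<phi> n (X j \<omega>)) \<in> borel_measurable (sigma_design M X n)) \<and>
      (\<forall>\<omega>\<in>space M. (\<Sum>i<n. (\<Sum>j<n. w n \<omega> i j * \<phi> n (X j \<omega>))\<^sup>2) \<le> 4 * B\<^sup>2 * real n)"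
      using regular[unfolded regular_weights_def] \<phi>
    proof (eventually_elim, elim conjE, intro conjI allI impI ballI)
      fix n assume wm: "\<forall>i<n. \<forall>j<n. (\<lambda>\<omega>. w n \<omega> i j) \<in> borel_measurable (sigma_design M X n)"
        and contr: "\<forall>\<omega>\<in>space M. \<forall>u. (\<Sum>i<n. (\<Sum>j<n. w n \<omega> i j * u j)\<^sup>2) \<le> 4 * (\<Sum>i<n. (u i)\<^sup>2)"
        and \<phi>m: "\<forall>i<n. (\<lambda>\<omega>. \<phi> n (X i \<omega>)) \<in> borel_measurable (sigma_design M X n)" and \<phi>B: "\<forall>x\<in>ucube. \<bar>\<phi> n x\<bar> \<le> B"
      {
        fix i assume "i < n"
        with wm \<phi>m show "(\<lambda>\<omega>. \<Sum>j<n. w n \<omega> i j * \<phi> n (X j \<omega>)) \<in> borel_measurable (sigma_design M X n)"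
          by (intro borel_measurable_sum borel_measurable_times) auto
      next
        fix \<omega> assume \<omega>: "\<omega> \<in> space M"
        have "(\<Sum>i<n. (\<Sum>j<n. w n \<omega> i j * \<phi> n (X j \<omega>))\<^sup>2) \<le> 4 * (\<Sum>i<n. (\<phi> n (X i \<omega>))\<^sup>2)"
          by (rule contr[rule_format, OF \<omega>])
        also have "\<dots> \<le> 4 * (B\<^sup>2 * real n)"
          using \<phi>B X_cube[OF \<omega>] by (intro mult_left_mono sum_sq_le_const) auto
        finally show "(\<Sum>i<n. (\<Sum>j<n. w n \<omega> i j * \<phi> n (X j \<omega>))\<^sup>2) \<le> 4 * B\<^sup>2 * real n" by simp
      }
    qed
  qed
  then show ?thesis by (simp add: bilin_def mult.commute)
qed

text \<open>The quadratic form in \<open>r\<^sub>n \<delta>\<^sub>n\<close> has order \<open>n r\<^sub>n\<^sup>2\<close> and dominates every other term: the estimation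
  error of the parameter is \<open>o(r\<^sub>n)\<close>, the linear terms have order \<open>\<surd>n r\<^sub>n\<close>, and the quadratic form in
  the errors has order \<open>h\<^sup>-\<^sup>p\<^sup>/\<^sup>2\<close>.\<close>
lemma statistic_large:
  "whp M (\<lambda>n \<omega>. real n * (r n)\<^sup>2 / 4 \<le>
     bilin (w n \<omega>) n (\<lambda>i. response (m n) X \<epsilon> \<omega> i - \<mu> (X i \<omega>) (\<theta>hat n \<omega>)) (\<lambda>i. response (m n) X \<epsilon> \<omega> i - \<mu> (X i \<omega>) (\<theta>hat n \<omega>)))"
proof (rule whp_of_bounded_squares)
  fix K :: real assume K: "K > 0"
  obtain B where B: "B > 0" "\<And>x \<theta> \<theta>'. x \<in> ucube \<Longrightarrow> \<theta> \<in> \<Theta> \<Longrightarrow> \<theta>' \<in> \<Theta> \<Longrightarrow> \<bar>\<mu> x \<theta> - \<mu> x \<theta>'\<bar> \<le> B * norm (\<theta> - \<theta>')"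
    using mu_Lipschitz by blast
  obtain B' where B': "B' > 0" "\<forall>\<^sub>F n in sequentially. \<forall>x\<in>ucube. \<bar>\<delta> n x\<bar> \<le> B'" by (rule delta_bounded)
  obtain C where C: "C > 0" "\<And>x \<theta>. x \<in> ucube \<Longrightarrow> \<theta> \<in> \<Theta> \<Longrightarrow>
    \<bar>\<mu> x \<theta> - \<mu> x \<theta>0 - G x \<theta>0 \<bullet> (\<theta> - \<theta>0)\<bar> \<le> C * (norm (\<theta> - \<theta>0))\<^sup>2"
    using quadratic_remainder by blast
  obtain Bg where Bg: "Bg > 0" "\<And>x k. x \<in> ucube \<Longrightarrow> \<bar>G x \<theta>0 $ k\<bar> \<le> Bg" using gradient_bounded by blast
  define D where "D = real CARD('d)"
  have D: "D > 0" by (simp add: D_def)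
  \<comment> \<open>Noise contributes \<tau> N once from the form in the errors, twice from the
    cross term with \<delta> and 2 D times from the gradient directions, in total N/8.\<close>
  define \<tau> where "\<tau> = 1 / (8 * (3 + 2 * D))"
  have \<tau>: "\<tau> > 0" "(3 + 2 * D) * \<tau> = 1/8" using D by (simp_all add: \<tau>_def)
  \<comment> \<open>\<open>S\<close> collects the remaining terms with the fitted difference, each
    at most a multiple of \<eta> N; \<eta> is then chosen so that they sum to at most N/8.\<close>
  define S where "S = 4 * C * sqrt K + 4 * B' * B + 2 * B\<^sup>2"
  have S: "S > 0" using B(1) B'(1) C(1) K by (simp add: S_def add_pos_pos)
  define \<eta> where "\<eta> = min 1 (1 / (8 * S))"
  have \<eta>: "\<eta> > 0" "\<eta> \<le> 1" using S by (simp_all add: \<eta>_def)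
  have "\<eta> * S \<le> 1 / (8 * S) * S" using S by (intro mult_right_mono) (simp_all add: \<eta>_def)
  then have \<eta>S: "\<eta> * S \<le> 1/8" using S by simp
  have \<delta>_ev: "\<forall>\<^sub>F n in sequentially. (\<forall>i<n. (\<lambda>\<omega>. \<delta> n (X i \<omega>)) \<in> borel_measurable (sigma_design M X n)) \<and> (\<forall>x\<in>ucube. \<bar>\<delta> n x\<bar> \<le> B')"
    using B'(2) eventually_ge_at_top[of 1]
  proof eventually_elim
    case (elim n)
    then show ?case
      using continuous_design_measurable[OF equicontinuous_seq_continuous_on[OF equicontinuous]] by blast
  qed
  have G_ev: "\<forall>\<^sub>F n in sequentially. (\<forall>i<n. (\<lambda>\<omega>. G (X i \<omega>) \<theta>0 $ k) \<in> borel_measurable (sigma_design M X n)) \<and> (\<forall>x\<in>ucube. \<bar>G x \<theta>0 $ k\<bar> \<le> Bg)" for k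
    using gradient_design_measurable Bg(2) by (intro always_eventually) blast
  have gnoise: "whp M (\<lambda>n \<omega>. \<forall>k\<in>(UNIV::'d set). \<bar>bilin (w n \<omega>) n (\<lambda>i. \<epsilon> i \<omega>) (\<lambda>i. G (X i \<omega>) \<theta>0 $ k)\<bar> \<le> \<tau> * (real n * r n))"
    by (rule whp_finite_ball[OF finite]) (rule smoothed_noise_whp[where \<phi> = "\<lambda>n x. G x \<theta>0 $ _", OF G_ev \<tau>(1)])
  have ev: "\<forall>\<^sub>F n in sequentially. (\<forall>x\<in>ucube. \<bar>\<delta> n x\<bar> \<le> B') \<and> 0 < r n \<and> n \<ge> 1 \<and>
     (\<forall>\<omega>. \<forall>i<n. \<forall>j<n. w n \<omega> i j = w n \<omega> j i) \<and>
     (\<forall>\<omega>\<in>space M. \<forall>u. (\<Sum>i<n. (\<Sum>j<n. w n \<omega> i j * u j)\<^sup>2) \<le> 4 * (\<Sum>i<n. (u i)\<^sup>2))"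
    using B'(2) r_pos eventually_ge_at_top[of 1] regular[unfolded regular_weights_def]
    by eventually_elim blast
  note whps = whp_conj[OF signal whp_conj[OF parameter_rate[OF \<eta>(1)] whp_conj[OF noise_quadratic_whp[OF \<tau>(1)]
    whp_conj[OF smoothed_noise_whp[OF \<delta>_ev \<tau>(1)] gnoise]]]]
  from whps show "whp M (\<lambda>n \<omega>. (\<Sum>i<n. (\<epsilon> i \<omega>)\<^sup>2) \<le> K * real n \<longrightarrow> real n * (r n)\<^sup>2 / 4 \<le>
     bilin (w n \<omega>) n (\<lambda>i. response (m n) X \<epsilon> \<omega> i - \<mu> (X i \<omega>) (\<theta>hat n \<omega>)) (\<lambda>i. response (m n) X \<epsilon> \<omega> i - \<mu> (X i \<omega>) (\<theta>hat n \<omega>)))"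
  proof (rule whp_mono, use ev in eventually_elim, intro ballI impI, elim conjE)
    fix n \<omega> assume \<delta>: "\<forall>x\<in>ucube. \<bar>\<delta> n x\<bar> \<le> B'" and rp: "0 < r n" and n: "1 \<le> n"
      and sym: "\<forall>\<omega>. \<forall>i<n. \<forall>j<n. w n \<omega> i j = w n \<omega> j i"
      and contr: "\<forall>\<omega>\<in>space M. \<forall>u. (\<Sum>i<n. (\<Sum>j<n. w n \<omega> i j * u j)\<^sup>2) \<le> 4 * (\<Sum>i<n. (u i)\<^sup>2)"
      and \<omega>: "\<omega> \<in> space M" and eK: "(\<Sum>i<n. (\<epsilon> i \<omega>)\<^sup>2) \<le> K * real n"
      and sig: "real n / 2 \<le> (\<Sum>i<n. \<Sum>j<n. \<delta> n (X i \<omega>) * w n \<omega> i j * \<delta> n (X j \<omega>))"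
      and rate: "norm (\<theta>hat n \<omega> - \<theta>0) \<le> \<eta> * r n"
      and qn: "\<bar>bilin (w n \<omega>) n (\<lambda>i. \<epsilon> i \<omega>) (\<lambda>i. \<epsilon> i \<omega>)\<bar> \<le> \<tau> * (real n * (r n)\<^sup>2)"
      and dn: "\<bar>bilin (w n \<omega>) n (\<lambda>i. \<epsilon> i \<omega>) (\<lambda>i. \<delta> n (X i \<omega>))\<bar> \<le> \<tau> * (real n * r n)"
      and gn: "\<forall>k\<in>UNIV. \<bar>bilin (w n \<omega>) n (\<lambda>i. \<epsilon> i \<omega>) (\<lambda>i. G (X i \<omega>) \<theta>0 $ k)\<bar> \<le> \<tau> * (real n * r n)"
    note th = theta_hat_in[OF n \<omega>]
    define A where "A = bilin (w n \<omega>) n"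
    have A_sym: "A u v = A v u" for u v unfolding A_def by (rule bilin_commute) (use sym in blast)
    have A_le: "\<bar>A u v\<bar> \<le> 2 * sqrt (\<Sum>i<n. (u i)\<^sup>2) * sqrt (\<Sum>i<n. (v i)\<^sup>2)" for u v
      unfolding A_def by (rule bilin_bound) (use contr \<omega> in blast)
    note A_add = bilin_add[where w = "w n \<omega>" and n = n, folded A_def]
    note A_scale = bilin_scale[where w = "w n \<omega>" and n = n, folded A_def]
    note A_sum = bilin_sum[where w = "w n \<omega>" and n = n, folded A_def]
    define v where "v = \<theta>hat n \<omega> - \<theta>0"
    define N where "N = real n * (r n)\<^sup>2"
    have N: "N \<ge> 0" by (simp add: N_def)
    have v: "norm v \<le> \<eta> * r n" using rate by (simp add: v_def)
    define e where "e i = \<epsilon> i \<omega>" for i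
    define f where "f i = fit_diff n \<omega> i" for i
    define dl where "dl i = \<delta> n (X i \<omega>)" for i
    define q where "q i = f i - (\<Sum>k\<in>UNIV. v $ k * G (X i \<omega>) \<theta>0 $ k)" for i
    have Gv: "G x \<theta>0 \<bullet> v = (\<Sum>k\<in>UNIV. v $ k * G x \<theta>0 $ k)" for x by (simp add: inner_vec_def mult.commute)
    have f_split: "f = (\<lambda>i. (\<Sum>k\<in>UNIV. v $ k * G (X i \<omega>) \<theta>0 $ k) + q i)" by (simp add: q_def)
    have U: "(\<lambda>i. response (m n) X \<epsilon> \<omega> i - \<mu> (X i \<omega>) (\<theta>hat n \<omega>)) = (\<lambda>i. e i + (r n * dl i + (-1) * f i))"
      by (simp add: fun_eq_iff response_def alternative fit_diff_def e_def f_def dl_def)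
    have T: "A (\<lambda>i. e i + (r n * dl i + (-1) * f i)) (\<lambda>i. e i + (r n * dl i + (-1) * f i))
        = A e e + 2 * r n * A e dl - 2 * A e f + (r n)\<^sup>2 * A dl dl - 2 * r n * A dl f + A f f"
      unfolding A_add A_scale A_sym[of dl e] A_sym[of f e] A_sym[of f dl]
      by (simp add: power2_eq_square algebra_simps)
    have s_dl: "sqrt (\<Sum>i<n. (dl i)\<^sup>2) \<le> sqrt (real n) * B'"
      using \<delta> X_cube[OF \<omega>] B'(1) by (intro sum_sq_le_of_bound) (auto simp: dl_def)
    have s_f: "sqrt (\<Sum>i<n. (f i)\<^sup>2) \<le> sqrt (real n) * (B * (\<eta> * r n))"
    proof (rule sum_sq_le_of_bound)
      fix i
      have "\<bar>f i\<bar> \<le> B * norm v" unfolding f_def fit_diff_def v_def by (rule B(2)[OF X_cube[OF \<omega>] th theta0])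
      also have "\<dots> \<le> B * (\<eta> * r n)" using v B(1) by (intro mult_left_mono) auto
      finally show "\<bar>f i\<bar> \<le> B * (\<eta> * r n)" .
    qed (use B(1) \<eta>(1) rp in simp)
    have s_q: "sqrt (\<Sum>i<n. (q i)\<^sup>2) \<le> sqrt (real n) * (C * (\<eta> * r n)\<^sup>2)"
    proof (rule sum_sq_le_of_bound)
      fix i
      have "\<bar>q i\<bar> \<le> C * (norm v)\<^sup>2"
        using C(2)[OF X_cube[OF \<omega>, of i] th] unfolding q_def f_def fit_diff_def v_def[symmetric] Gv .
      also have "\<dots> \<le> C * (\<eta> * r n)\<^sup>2" using v C(1) by (intro mult_left_mono power_mono) auto
      finally show "\<bar>q i\<bar> \<le> C * (\<eta> * r n)\<^sup>2" .
    qed (use C(1) in simp)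
    have s_e: "sqrt (\<Sum>i<n. (e i)\<^sup>2) \<le> sqrt (real n) * sqrt K"
      using real_sqrt_le_mono[OF eK] by (simp add: e_def real_sqrt_mult mult.commute)
    have sn: "2 * (sqrt (real n) * a) * (sqrt (real n) * b) = 2 * a * b * real n" for a b
    proof -
      have "2 * (sqrt (real n) * a) * (sqrt (real n) * b) = 2 * a * b * (sqrt (real n) * sqrt (real n))" by (simp only: mult_ac)
      then show ?thesis by simp
    qed
    \<comment> \<open>With \<eta> at most 1, all error terms can be made linear in \<eta>.\<close>
    have \<eta>2: "\<eta>\<^sup>2 \<le> \<eta>" using \<eta> by (simp add: power2_eq_square mult_left_le_one_le)
    have "\<bar>A e q\<bar> \<le> 2 * (sqrt (real n) * sqrt K) * (sqrt (real n) * (C * (\<eta> * r n)\<^sup>2))"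
      using s_e s_q K by (intro order.trans[OF A_le] mult_mono mult_left_mono) (auto intro!: sum_nonneg mult_nonneg_nonneg)
    also have "\<dots> = \<eta>\<^sup>2 * (2 * C * sqrt K) * N" by (simp add: sn N_def power_mult_distrib mult_ac)
    also have "\<dots> \<le> \<eta> * (2 * C * sqrt K) * N" using \<eta>2 C(1) K N by (intro mult_right_mono) auto
    finally have t1: "\<bar>A e q\<bar> \<le> \<eta> * (2 * C * sqrt K) * N" .
    have "\<bar>A dl f\<bar> \<le> 2 * (sqrt (real n) * B') * (sqrt (real n) * (B * (\<eta> * r n)))"
      using s_dl s_f B'(1) by (intro order.trans[OF A_le] mult_mono mult_left_mono) (auto intro!: sum_nonneg mult_nonneg_nonneg)
    also have "\<dots> = \<eta> * (2 * B' * B) * (real n * r n)" by (simp add: sn mult_ac)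
    finally have "r n * \<bar>A dl f\<bar> \<le> r n * (\<eta> * (2 * B' * B) * (real n * r n))" using rp by (intro mult_left_mono) auto
    then have t2: "r n * \<bar>A dl f\<bar> \<le> \<eta> * (2 * B' * B) * N" by (simp add: N_def power2_eq_square mult_ac)
    have t2': "r n * A dl f \<le> r n * \<bar>A dl f\<bar>" using rp by (intro mult_left_mono) auto
    have "\<bar>A f f\<bar> \<le> 2 * (sqrt (real n) * (B * (\<eta> * r n))) * (sqrt (real n) * (B * (\<eta> * r n)))"
      using s_f B(1) \<eta>(1) rp by (intro order.trans[OF A_le] mult_mono mult_left_mono) (auto intro!: sum_nonneg mult_nonneg_nonneg)
    also have "\<dots> = \<eta>\<^sup>2 * (2 * B\<^sup>2) * N" by (simp add: sn N_def power2_eq_square mult_ac)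
    also have "\<dots> \<le> \<eta> * (2 * B\<^sup>2) * N" using \<eta>2 N by (intro mult_right_mono) auto
    finally have t3: "\<bar>A f f\<bar> \<le> \<eta> * (2 * B\<^sup>2) * N" .
    have "A e f = (\<Sum>k\<in>UNIV. v $ k * A e (\<lambda>i. G (X i \<omega>) \<theta>0 $ k)) + A e q"
      by (subst f_split) (simp only: A_add A_sum[OF finite] A_scale)
    moreover have "\<bar>\<Sum>k\<in>UNIV. v $ k * A e (\<lambda>i. G (X i \<omega>) \<theta>0 $ k)\<bar> \<le> D * \<tau> * N"
    proof -
      have "\<bar>\<Sum>k\<in>UNIV. v $ k * A e (\<lambda>i. G (X i \<omega>) \<theta>0 $ k)\<bar> \<le> (\<Sum>k\<in>UNIV. \<bar>v $ k\<bar> * \<bar>A e (\<lambda>i. G (X i \<omega>) \<theta>0 $ k)\<bar>)"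
        unfolding abs_mult[symmetric] by (rule sum_abs)
      also have "\<dots> \<le> (\<Sum>k\<in>(UNIV::'d set). r n * (\<tau> * (real n * r n)))"
      proof (intro sum_mono mult_mono)
        fix k
        have "\<bar>v $ k\<bar> \<le> \<eta> * r n" using component_le_norm_cart[of v k] v by linarith
        also have "\<dots> \<le> 1 * r n" using \<eta>(2) rp by (intro mult_right_mono) auto
        finally show "\<bar>v $ k\<bar> \<le> r n" by simp
        show "\<bar>A e (\<lambda>i. G (X i \<omega>) \<theta>0 $ k)\<bar> \<le> \<tau> * (real n * r n)" using gn unfolding A_def e_def by blast
      qed (use rp in auto)
      also have "\<dots> = D * \<tau> * N" by (simp add: D_def N_def power2_eq_square mult_ac)
      finally show ?thesis .
    qed
    ultimately have t4: "A e f \<le> D * \<tau> * N + \<eta> * (2 * C * sqrt K) * N" using t1 by linarith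
    have "r n * (- A e dl) \<le> r n * (\<tau> * (real n * r n))"
      using dn rp unfolding A_def e_def dl_def by (intro mult_left_mono) auto
    then have t5: "- (r n * A e dl) \<le> \<tau> * N" by (simp add: N_def power2_eq_square mult_ac)
    have t6: "- A e e \<le> \<tau> * N" using qn unfolding A_def e_def N_def by linarith
    have "A dl dl = (\<Sum>i<n. \<Sum>j<n. \<delta> n (X i \<omega>) * w n \<omega> i j * \<delta> n (X j \<omega>))"
      by (simp add: A_def bilin_def dl_def sum_distrib_left mult.assoc)
    with sig have "(r n)\<^sup>2 * (real n / 2) \<le> (r n)\<^sup>2 * A dl dl" by (intro mult_left_mono) auto
    then have t7: "N / 2 \<le> (r n)\<^sup>2 * A dl dl" by (simp add: N_def mult.commute)
    \<comment> \<open>The signal N/2 loses N/8 to the fit and N/8 to the noise.\<close>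
    have "\<eta> * S * N \<le> 1/8 * N" by (rule mult_right_mono[OF \<eta>S N])
    moreover have "(3 + 2 * D) * \<tau> * N \<le> 1/8 * N" unfolding \<tau>(2) by simp
    moreover have "\<eta> * S * N = 2 * (\<eta> * (2 * C * sqrt K) * N) + 2 * (\<eta> * (2 * B' * B) * N) + \<eta> * (2 * B\<^sup>2) * N"
      "(3 + 2 * D) * \<tau> * N = 3 * (\<tau> * N) + 2 * (D * \<tau> * N)"
      by (simp_all add: S_def algebra_simps)
    ultimately have "N / 4 \<le> A e e + 2 * (r n * A e dl) - 2 * A e f + (r n)\<^sup>2 * A dl dl - 2 * (r n * A dl f) + A f f"
      using t2 t2' t3 t4 t5 t6 t7 by linarith
    then show "real n * (r n)\<^sup>2 / 4 \<le>
       bilin (w n \<omega>) n (\<lambda>i. response (m n) X \<epsilon> \<omega> i - \<mu> (X i \<omega>) (\<theta>hat n \<omega>)) (\<lambda>i. response (m n) X \<epsilon> \<omega> i - \<mu> (X i \<omega>) (\<theta>hat n \<omega>))"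
      unfolding U A_def[symmetric] T by (simp only: N_def mult.assoc)
  qed
qed

end

section \<open>The variance estimator and measurability of the test\<close>

context local_alternatives
begin

text \<open>Consistency of the variance estimator is assumed for equicontinuous regression
  functions. Here \<mu> at \<theta>0 is uniformly continuous on the cube, and the convergent
  sequence r is bounded, so the perturbations r \<delta> share one modulus.\<close>

lemma equicontinuous_alternative: "equicontinuous_seq m"
  unfolding equicontinuous_seq_def
proof (intro allI impI)
  fix e :: real assume e: "e > 0"
  obtain b where b: "b > 0" "\<And>n. \<bar>r n\<bar> \<le> b"
    using convergent_imp_Bseq[OF convergentI[OF r_tendsto]] by (auto elim!: BseqE)
  have "uniformly_continuous_on ucube (\<lambda>x. \<mu> x \<theta>0)"
    by (rule compact_uniformly_continuous[OF mu_continuous[OF theta0] compact_cbox])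
  moreover have "e / 2 > 0" using e by simp
  ultimately obtain \<eta>1 where \<eta>1: "\<eta>1 > 0" "\<And>x x'. x \<in> ucube \<Longrightarrow> x' \<in> ucube \<Longrightarrow> dist x' x < \<eta>1 \<Longrightarrow> dist (\<mu> x' \<theta>0) (\<mu> x \<theta>0) < e / 2"
    unfolding uniformly_continuous_on_def by meson
  have "e / (2 * b) > 0" using e b by simp
  then obtain \<eta>2 where \<eta>2: "\<eta>2 > 0" "\<And>n x x'. n \<ge> 1 \<Longrightarrow> x \<in> ucube \<Longrightarrow> x' \<in> ucube \<Longrightarrow> infnorm (x - x') \<le> \<eta>2 \<Longrightarrow> \<bar>\<delta> n x - \<delta> n x'\<bar> \<le> e / (2 * b)"
    using equicontinuous unfolding equicontinuous_seq_def by meson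
  let ?s = "sqrt (real CARD('p))"
  have s: "?s > 0" by simp
  define \<eta> where "\<eta> = min \<eta>2 (\<eta>1 / (2 * ?s))"
  show "\<exists>\<eta>>0. \<forall>n\<ge>1. \<forall>x\<in>ucube. \<forall>x'\<in>ucube. infnorm (x - x') \<le> \<eta> \<longrightarrow> \<bar>m n x - m n x'\<bar> \<le> e"
  proof (intro exI[of _ \<eta>] conjI allI impI ballI)
    show "\<eta> > 0" using \<eta>1(1) \<eta>2(1) s by (simp add: \<eta>_def)
    fix n :: nat and x x' :: "real^'p" assume n: "1 \<le> n" and x: "x \<in> ucube" "x' \<in> ucube" and le: "infnorm (x - x') \<le> \<eta>"
    have "norm (x - x') \<le> ?s * infnorm (x - x')" using norm_le_infnorm[of "x - x'"] by simp
    also have "\<dots> \<le> ?s * (\<eta>1 / (2 * ?s))" using le s by (intro mult_left_mono) (auto simp: \<eta>_def)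
    also have "\<dots> = \<eta>1 / 2" using s by simp
    finally have "dist x x' < \<eta>1" using \<eta>1(1) by (simp add: dist_norm)
    from \<eta>1(2)[OF x(2,1) this] have 1: "\<bar>\<mu> x \<theta>0 - \<mu> x' \<theta>0\<bar> < e / 2" by (simp add: dist_real_def)
    have "\<bar>r n\<bar> * \<bar>\<delta> n x - \<delta> n x'\<bar> \<le> b * (e / (2 * b))"
      using \<eta>2(2)[OF n x] le b(2)[of n] b(1) by (intro mult_mono) (auto simp: \<eta>_def)
    then have 2: "\<bar>r n * (\<delta> n x - \<delta> n x')\<bar> \<le> e / 2" using b(1) by (simp add: abs_mult)
    have "m n x - m n x' = (\<mu> x \<theta>0 - \<mu> x' \<theta>0) + r n * (\<delta> n x - \<delta> n x')" by (simp add: alternative algebra_simps)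
    then show "\<bar>m n x - m n x'\<bar> \<le> e" using 1 2 by linarith
  qed
qed

text \<open>A relative error of at most 1 already bounds the estimate by twice the true
  variance.\<close>

lemma variance_estimate_bounded:
  assumes "variance_estimator_consistent M X \<epsilon> \<sigma>2 V"
  shows "whp M (\<lambda>n \<omega>. \<forall>i<n. V n (sample (m n) X \<epsilon> n \<omega>) (X i \<omega>) \<le> 2 * vmax)"
proof -
  have "conv_in_prob M (\<lambda>n \<omega>. MAX i\<in>{..<n}. \<bar>V n (sample (m n) X \<epsilon> n \<omega>) (X i \<omega>) / \<sigma>2 (X i \<omega>) - 1\<bar>) 0"
    using assms equicontinuous_alternative by (simp add: variance_estimator_consistent_def)
  from whp_conv_in_prob[OF this zero_less_one] show ?thesis
  proof (rule whp_mono, intro always_eventually allI ballI impI)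
    fix n \<omega> i assume \<omega>: "\<omega> \<in> space M" and i: "i < n"
      and d: "dist (MAX i\<in>{..<n}. \<bar>V n (sample (m n) X \<epsilon> n \<omega>) (X i \<omega>) / \<sigma>2 (X i \<omega>) - 1\<bar>) 0 \<le> 1"
    let ?V = "V n (sample (m n) X \<epsilon> n \<omega>) (X i \<omega>)"
    have "\<bar>?V / \<sigma>2 (X i \<omega>) - 1\<bar> \<le> (MAX i\<in>{..<n}. \<bar>V n (sample (m n) X \<epsilon> n \<omega>) (X i \<omega>) / \<sigma>2 (X i \<omega>) - 1\<bar>)"
      using i by (intro Max_ge) auto
    also have "\<dots> \<le> 1" using d by (simp add: dist_real_def)
    finally have "?V / \<sigma>2 (X i \<omega>) \<le> 2" by linarith
    then have "?V \<le> 2 * \<sigma>2 (X i \<omega>)" using variance_bounds(2)[OF X_cube[OF \<omega>]] by (simp add: pos_divide_le_eq)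
    then show "?V \<le> 2 * vmax" using variance_bounds(1)[OF X_cube[OF \<omega>], of i] by linarith
  qed
qed

lemma regression_measurable:
  assumes "n \<ge> 1" shows "(\<lambda>\<omega>. m n (X i \<omega>)) \<in> borel_measurable M"
  by (rule measurable_from_subalg[OF subalgebra_design[of "Suc i"]])
     (rule continuous_design_measurable[OF equicontinuous_seq_continuous_on[OF equicontinuous_alternative assms]], simp)

text \<open>\<mu> is continuous on the closed set \<open>ucube \<times> \<Theta>\<close>; extended
  by zero it is measurable, and design and estimator stay inside this set.\<close>

lemma fitted_measurable:
  assumes "n \<ge> 1" and [measurable]: "\<theta>hat n \<in> borel_measurable M"
  shows "(\<lambda>\<omega>. \<mu> (X i \<omega>) (\<theta>hat n \<omega>)) \<in> borel_measurable M"
proof -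
  have c: "continuous_on (ucube \<times> \<Theta>) (\<lambda>(x, \<theta>). \<mu> x \<theta>)" "compact \<Theta>" using model by (simp_all add: assumption_M_def)
  have cl: "ucube \<times> \<Theta> \<in> sets borel" using c(2) by (intro borel_closed closed_Times compact_imp_closed compact_cbox)
  have "(\<lambda>\<omega>. (X i \<omega>, \<theta>hat n \<omega>)) \<in> borel_measurable M" by (intro borel_measurable_Pair) measurable
  from measurable_compose[OF this borel_measurable_continuous_on_indicator[OF cl c(1)]]
  have "(\<lambda>\<omega>. indicator (ucube \<times> \<Theta>) (X i \<omega>, \<theta>hat n \<omega>) *\<^sub>R (case (X i \<omega>, \<theta>hat n \<omega>) of (x, \<theta>) \<Rightarrow> \<mu> x \<theta>)) \<in> borel_measurable M" .
  then show ?thesis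
    by (rule measurable_cong[THEN iffD1, rotated]) (use X_cube theta_hat_in[OF assms(1)] in simp)
qed

lemma T_stat_measurable:
  assumes S: "admissible_smoother S" and n: "n \<ge> 1" and \<theta>: "\<theta>hat n \<in> borel_measurable M"
  shows "(\<lambda>\<omega>. T_stat \<mu> S n (\<lambda>i. X i \<omega>) (response (m n) X \<epsilon> \<omega>) (\<theta>hat n \<omega>) b) \<in> borel_measurable M"
proof -
  have [measurable]: "(\<lambda>\<omega>. response (m n) X \<epsilon> \<omega> i - \<mu> (X i \<omega>) (\<theta>hat n \<omega>)) \<in> borel_measurable M" for i
    unfolding response_def
    by (intro borel_measurable_diff borel_measurable_add regression_measurable[OF n] fitted_measurable[OF n \<theta>] err_measurable)
  show ?thesis
    unfolding T_stat_def
    by (intro borel_measurable_sum borel_measurable_times weight_measurable[OF S X_measurable]) auto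
qed

lemma v_base_measurable:
  assumes S: "admissible_smoother S" and n: "n \<ge> 1" and V: "variance_estimator V"
  shows "(\<lambda>\<omega>. v_base S n (\<lambda>i. X i \<omega>) (V n (sample (m n) X \<epsilon> n \<omega>)) b) \<in> borel_measurable M"
proof -
  have sm: "(\<lambda>\<omega>. sample (m n) X \<epsilon> n \<omega>) \<in> measurable M (PiM {..<n} (\<lambda>_. borel))"
    unfolding sample_def response_def
    by (intro measurable_restrict borel_measurable_Pair borel_measurable_add regression_measurable[OF n] err_measurable X_measurable)
  have "(\<lambda>\<omega>. V n (sample (m n) X \<epsilon> n \<omega>) (X i \<omega>)) \<in> borel_measurable M" if "i < n" for i
  proof -
    have "(\<lambda>z. V n z (snd (z i))) \<in> borel_measurable (PiM {..<n} (\<lambda>_. borel))"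
      using V that by (simp add: variance_estimator_def)
    from measurable_compose[OF sm this] show ?thesis using that by (simp add: sample_def)
  qed
  then have "(\<lambda>\<omega>. 2 * (\<Sum>i<n. \<Sum>j<n. (weight S n b (\<lambda>i. X i \<omega>) i j)\<^sup>2 *
      V n (sample (m n) X \<epsilon> n \<omega>) (X i \<omega>) * V n (sample (m n) X \<epsilon> n \<omega>) (X j \<omega>))) \<in> borel_measurable M"
    by (intro borel_measurable_sum borel_measurable_times borel_measurable_power borel_measurable_const
          weight_measurable[OF S X_measurable]) auto
  then show ?thesis unfolding v_base_def by (rule measurable_compose) measurable
qed

end

section \<open>Bandwidth selection and the critical value\<close>

lemma finite_bandwidths: "finite (bandwidths b a J)"
proof -
  have "bandwidths b a J = (\<lambda>j. b / a ^ j) ` {..J}" by (auto simp: bandwidths_def)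
  then show ?thesis by simp
qed

lemma base_in_bandwidths: "b \<in> bandwidths b a J"
  by (auto simp: bandwidths_def intro!: exI[of _ 0])

lemma v_diff_nonneg:
  assumes "variance_estimator V" shows "0 \<le> v_diff S n x (V n z) b b'"
  unfolding v_diff_def using assms
  by (intro real_sqrt_ge_zero mult_nonneg_nonneg sum_nonneg) (auto simp: variance_estimator_def)

text \<open>The penalty vanishes at the base bandwidth, so the maximiser has a statistic at least as large.\<close>
lemma selected_statistic_ge:
  assumes "is_arg_max (\<lambda>b. T b - c * v_diff S n x (V n z) b h0) (\<lambda>b. b \<in> bandwidths h0 a J) ht"
    and "c > 0" "variance_estimator V"
  shows "T h0 \<le> T ht"
proof -
  have "T h0 - c * v_diff S n x (V n z) h0 h0 \<le> T ht - c * v_diff S n x (V n z) ht h0"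
    using assms(1) base_in_bandwidths by (auto simp: is_arg_max_def not_less)
  moreover have "v_diff S n x (V n z) h0 h0 = 0" by (simp add: v_diff_def)
  moreover have "0 \<le> c * v_diff S n x (V n z) ht h0" using assms(2) v_diff_nonneg[OF assms(3)] by simp
  ultimately show ?thesis by simp
qed

text \<open>With high probability the variance estimates are at most \<open>2 * vmax\<close>, so the
  critical value is at most a constant times the Frobenius norm of the weights, and this norm is o(n
  r^2).\<close>

lemma (in weighted_alternatives) critical_value_small:
  assumes w: "\<And>n \<omega>. w n \<omega> = weight S n (h n) (\<lambda>i. X i \<omega>)"
    and V: "variance_estimator V" "variance_estimator_consistent M X \<epsilon> \<sigma>2 V"
  shows "whp M (\<lambda>n \<omega>. v_base S n (\<lambda>i. X i \<omega>) (V n (sample (m n) X \<epsilon> n \<omega>)) (h n) * z \<le> real n * (r n)\<^sup>2 / 4)"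
proof -
  note vm = variance_bounds(3)
  \<comment> \<open>The normaliser is at most \<open>3 * (vmax * (\<kappa> * N))\<close>, and its
    product with \<bar>z\<bar> + 1 is N/4; the summand 1 covers a vanishing quantile.\<close>
  define \<kappa> where "\<kappa> = 1 / (12 * vmax * (\<bar>z\<bar> + 1))"
  have \<kappa>: "\<kappa> > 0" using vm by (simp add: \<kappa>_def)
  from whp_conj[OF weights_small[OF \<kappa>] variance_estimate_bounded[OF V(2)]] show ?thesis
  proof (rule whp_mono, intro always_eventually allI ballI impI, elim conjE)
    fix n \<omega> assume ws: "(\<Sum>i<n. \<Sum>j<n. (w n \<omega> i j)\<^sup>2) \<le> (\<kappa> * (real n * (r n)\<^sup>2))\<^sup>2"
      and Vb: "\<forall>i<n. V n (sample (m n) X \<epsilon> n \<omega>) (X i \<omega>) \<le> 2 * vmax"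
    define s where "s i = V n (sample (m n) X \<epsilon> n \<omega>) (X i \<omega>)" for i
    define N where "N = real n * (r n)\<^sup>2"
    have N: "N \<ge> 0" by (simp add: N_def)
    have s: "0 \<le> s i" "i < n \<Longrightarrow> s i \<le> 2 * vmax" for i using V(1) Vb by (auto simp: s_def variance_estimator_def)
    let ?v = "v_base S n (\<lambda>i. X i \<omega>) (V n (sample (m n) X \<epsilon> n \<omega>)) (h n)"
    have "(\<Sum>i<n. \<Sum>j<n. (w n \<omega> i j)\<^sup>2 * s i * s j) \<le> (\<Sum>i<n. \<Sum>j<n. (w n \<omega> i j)\<^sup>2 * (2 * vmax) * (2 * vmax))"
      using s vm by (intro sum_mono mult_mono mult_left_mono mult_nonneg_nonneg) auto
    also have "\<dots> = 4 * vmax\<^sup>2 * (\<Sum>i<n. \<Sum>j<n. (w n \<omega> i j)\<^sup>2)"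
      by (simp add: sum_distrib_left power2_eq_square mult_ac)
    also have "\<dots> \<le> 4 * vmax\<^sup>2 * (\<kappa> * N)\<^sup>2" using ws unfolding N_def by (rule mult_left_mono) simp
    finally have le: "2 * (\<Sum>i<n. \<Sum>j<n. (w n \<omega> i j)\<^sup>2 * s i * s j) \<le> 8 * (vmax * (\<kappa> * N))\<^sup>2"
      by (simp add: power_mult_distrib mult_ac)
    also have "\<dots> \<le> (3 * (vmax * (\<kappa> * N)))\<^sup>2" by (simp add: power_mult_distrib)
    finally have v: "?v \<le> 3 * (vmax * (\<kappa> * N))" "0 \<le> ?v"
      unfolding v_base_def w[symmetric] s_def[symmetric] using vm \<kappa> N s(1)
      by (auto intro!: real_le_lsqrt sum_nonneg mult_nonneg_nonneg)
    have "?v * z \<le> ?v * (\<bar>z\<bar> + 1)" using v(2) by (intro mult_left_mono) auto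
    also have "\<dots> \<le> 3 * (vmax * (\<kappa> * N)) * (\<bar>z\<bar> + 1)" using v(1) by (intro mult_right_mono) auto
    also have "\<dots> = 3 * N * (vmax * (\<bar>z\<bar> + 1) * \<kappa>)" by (simp only: mult_ac)
    also have "vmax * (\<bar>z\<bar> + 1) * \<kappa> = 1 / 12"
    proof -
      have "vmax * (\<bar>z\<bar> + 1) > 0" using vm by (intro mult_pos_pos) auto
      then have "y * (1 / (12 * y)) = 1 / 12" if "y = vmax * (\<bar>z\<bar> + 1)" for y
      proof -
        have "y \<noteq> 0" using that \<open>vmax * (\<bar>z\<bar> + 1) > 0\<close> by linarith
        then show ?thesis by simp
      qed
      from this[OF refl] show ?thesis by (simp only: \<kappa>_def mult.assoc)
    qed
    finally show "?v * z \<le> real n * (r n)\<^sup>2 / 4" by (simp add: N_def)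
  qed
qed

text \<open>With f the assumed rate, f > 0 forces r > 0, the fourth power of f is the second
  quantity, and f^2 is at most n r^2 once h is below 1.\<close>

lemma signal_rates:
  assumes lim: "filterlim (\<lambda>n. sqrt (real n * h n powr (real p / 2)) * r n) at_top sequentially"
    and h: "\<And>n. n \<ge> 1 \<Longrightarrow> 0 < h n" "h \<longlonglongrightarrow> 0"
  shows "\<forall>\<^sub>F n in sequentially. 0 < r n"
    and "filterlim (\<lambda>n. h n ^ p * (real n * (r n)\<^sup>2)\<^sup>2) at_top sequentially"
    and "filterlim (\<lambda>n. real n * (r n)\<^sup>2) at_top sequentially"
proof -
  define f where "f n = sqrt (real n * h n powr (real p / 2)) * r n" for n
  have f: "filterlim f at_top sequentially" using lim by (simp add: f_def[abs_def])
  have fp: "\<forall>\<^sub>F n in sequentially. 0 < f n" using f by (simp add: filterlim_at_top_dense)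
  then show "\<forall>\<^sub>F n in sequentially. 0 < r n"
  proof eventually_elim
    case (elim n)
    have "0 \<le> sqrt (real n * h n powr (real p / 2))" by simp
    from mult_nonneg_nonpos[OF this, of "r n"] elim show ?case unfolding f_def by linarith
  qed
  have f2: "(f n)\<^sup>2 = real n * h n powr (real p / 2) * (r n)\<^sup>2" for n
    by (simp add: f_def power_mult_distrib)
  have "filterlim (\<lambda>n. ((f n)\<^sup>2)\<^sup>2) at_top sequentially"
    by (intro filterlim_pow_at_top f) auto
  moreover have "\<forall>\<^sub>F n in sequentially. ((f n)\<^sup>2)\<^sup>2 = h n ^ p * (real n * (r n)\<^sup>2)\<^sup>2"
    using eventually_ge_at_top[of 1]
  proof eventually_elim
    case (elim n)
    have "(h n powr (real p / 2))\<^sup>2 = h n powr (real p / 2 + real p / 2)" by (simp only: powr_add power2_eq_square)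
    also have "\<dots> = h n ^ p" using h(1)[OF elim] by (simp add: powr_realpow)
    finally show ?case unfolding f2 by (simp add: power_mult_distrib mult_ac)
  qed
  ultimately show "filterlim (\<lambda>n. h n ^ p * (real n * (r n)\<^sup>2)\<^sup>2) at_top sequentially"
    by (rule filterlim_cong[OF refl refl, THEN iffD1, rotated])
  have "\<forall>\<^sub>F n in sequentially. h n < 1" using h(2) by (intro order_tendstoD(2)) auto
  then have "\<forall>\<^sub>F n in sequentially. (f n)\<^sup>2 \<le> real n * (r n)\<^sup>2"
    using eventually_ge_at_top[of 1]
  proof eventually_elim
    case (elim n)
    have "h n powr (real p / 2) \<le> 1" using h(1)[of n] elim by (intro powr_le1) auto
    then have "real n * (r n)\<^sup>2 * h n powr (real p / 2) \<le> real n * (r n)\<^sup>2 * 1" by (intro mult_left_mono) auto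
    then show ?case unfolding f2 by (simp add: mult_ac)
  qed
  then show "filterlim (\<lambda>n. real n * (r n)\<^sup>2) at_top sequentially"
    by (rule filterlim_at_top_mono[rotated]) (intro filterlim_pow_at_top f, simp)
qed

theorem theorem3:
  fixes M :: "'a measure"
    and X :: "nat \<Rightarrow> 'a \<Rightarrow> real^'p"
    and \<epsilon> :: "nat \<Rightarrow> 'a \<Rightarrow> real"
    and \<sigma>2 :: "real^'p \<Rightarrow> real"
    and \<Theta> :: "(real^'d) set"
    and \<mu> :: "real^'p \<Rightarrow> real^'d \<Rightarrow> real"
    and G :: "real^'p \<Rightarrow> real^'d \<Rightarrow> real^'d"
    and H :: "real^'p \<Rightarrow> real^'d \<Rightarrow> real^'d^'d"
    and \<theta>0 :: "real^'d"
    and \<delta> m :: "nat \<Rightarrow> real^'p \<Rightarrow> real"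
    and r \<gamma> h0 :: "nat \<Rightarrow> real"
    and J :: "nat \<Rightarrow> nat"
    and S :: "'p smoother"
    and V :: "nat \<Rightarrow> (nat \<Rightarrow> real \<times> (real^'p)) \<Rightarrow> real^'p \<Rightarrow> real"
    and R :: "nat \<Rightarrow> 'a \<Rightarrow> real"
    and \<theta>hat :: "nat \<Rightarrow> 'a \<Rightarrow> real^'d"
    and htilde :: "nat \<Rightarrow> 'a \<Rightarrow> real"
    and a s L C3 \<alpha> :: real
  assumes "prob_space M"
    and "assumption_D M X"
    and "assumption_M \<Theta> \<mu>"
    and "assumption_E M X \<epsilon> \<sigma>2 CARD('d)"
    and "assumption_W S a h0 J"
    and "\<theta>0 \<in> interior \<Theta>"
    and "\<And>n x. m n x = \<mu> x \<theta>0 + r n * \<delta> n x"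
    and "equicontinuous_seq \<delta>"
    and "s > s_lower S" and "L > 0"
    and "\<And>n. n \<ge> 1 \<Longrightarrow> \<delta> n \<in> holder_class L s"
    and "conv_in_prob M (\<lambda>n \<omega>. (1 / real n) * (\<Sum>i<n. (\<delta> n (X i \<omega>))\<^sup>2)) 1"
    and "conv_in_prob M (\<lambda>n \<omega>. (1 / real n) *\<^sub>R (\<Sum>i<n. \<delta> n (X i \<omega>) *\<^sub>R G (X i \<omega>) \<theta>0)) 0"
    and "twice_diff_param \<Theta> \<mu> G H"
    and "C3 > 0"
    and "conv_in_prob M R 0"
    and "\<And>n. n \<ge> 1 \<Longrightarrow> AE \<omega> in M. \<forall>\<theta>\<in>\<Theta>. \<forall>\<theta>'\<in>\<Theta>.
           (C3 + R n \<omega>) * (infnorm (\<theta> - \<theta>'))\<^sup>2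
             \<le> (1 / real n) * (\<Sum>i<n. (\<mu> (X i \<omega>) \<theta> - \<mu> (X i \<omega>) \<theta>')\<^sup>2)"
    and "variance_estimator V"
    and "variance_estimator_consistent M X \<epsilon> \<sigma>2 V"
    and "\<And>n. n \<ge> 1 \<Longrightarrow> \<gamma> n > 0"
    and "\<And>n. \<theta>hat n \<in> borel_measurable M"
    and "\<And>n \<omega>. n \<ge> 1 \<Longrightarrow> \<omega> \<in> space M \<Longrightarrow>
           is_arg_min (sum_sq_resid \<mu> n (\<lambda>i. X i \<omega>) (response (m n) X \<epsilon> \<omega>)) (\<lambda>\<theta>. \<theta> \<in> \<Theta>) (\<theta>hat n \<omega>)"
    and "\<And>n. htilde n \<in> borel_measurable M"
    and "\<And>n \<omega>. n \<ge> 1 \<Longrightarrow> \<omega> \<in> space M \<Longrightarrow>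
           is_arg_max
             (\<lambda>h. T_stat \<mu> S n (\<lambda>i. X i \<omega>) (response (m n) X \<epsilon> \<omega>) (\<theta>hat n \<omega>) h
                  - \<gamma> n * v_diff S n (\<lambda>i. X i \<omega>) (V n (sample (m n) X \<epsilon> n \<omega>)) h (h0 n))
             (\<lambda>h. h \<in> bandwidths (h0 n) a (J n)) (htilde n \<omega>)"
    and "0 < \<alpha>" and "\<alpha> < 1"
    and "h0 \<longlonglongrightarrow> 0" and "r \<longlonglongrightarrow> 0"
    and "filterlim (\<lambda>n. sqrt (real n * h0 n powr (real CARD('p) / 2)) * r n) at_top sequentially"
  shows "conv_in_prob M
           (\<lambda>n. cond_prob_given M (sigma_design M X n)
              (\<lambda>\<omega>. T_stat \<mu> S n (\<lambda>i. X i \<omega>) (response (m n) X \<epsilon> \<omega>) (\<theta>hat n \<omega>) (htilde n \<omega>)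
                    \<ge> v_base S n (\<lambda>i. X i \<omega>) (V n (sample (m n) X \<epsilon> n \<omega>)) (h0 n) * z_quantile \<alpha>)) 1"
proof -
  note D = assms(2) and Mdl = assms(3) and E = assms(4) and W = assms(5) and V = assms(18) and Vc = assms(19)
    and \<gamma> = assms(20) and \<theta>m = assms(21) and hm = assms(23) and sel = assms(24)
  interpret prob_space M by (rule assms(1))
  have Xm: "X i \<in> borel_measurable M" for i
  proof -
    obtain f where "\<And>i. distributed M lborel (X i) f" using D unfolding assumption_D_def by blast
    from distributed_measurable[OF this, of i] show ?thesis by simp
  qed
  have hpos: "\<And>n. n \<ge> 1 \<Longrightarrow> 0 < h0 n" using W unfolding assumption_W_def by blast
  note rates = signal_rates[OF assms(29) hpos assms(27)]
  obtain C where C: "C > 0" "regular_weights M X h0 (\<lambda>n \<omega>. weight S n (h0 n) (\<lambda>i. X i \<omega>)) C"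
    "whp M (\<lambda>n \<omega>. real n / 2 \<le> (\<Sum>i<n. \<Sum>j<n. \<delta> n (X i \<omega>) * weight S n (h0 n) (\<lambda>i. X i \<omega>) i j * \<delta> n (X j \<omega>)))"
    using smoother_weights[OF assms(1) D W assms(27) assms(8) assms(12)] by blast
  interpret weighted_alternatives M X \<epsilon> \<sigma>2 "CARD('d)" \<Theta> \<mu> G H \<theta>0 \<delta> m r R \<theta>hat C3 h0
    "\<lambda>n \<omega>. weight S n (h0 n) (\<lambda>i. X i \<omega>)" C
  proof unfold_locales
    show "X i \<omega> \<in> ucube" if "\<omega> \<in> space M" for i \<omega> using D that by (simp add: assumption_D_def)
    show "\<forall>\<^sub>F n in sequentially. 0 < r n" by (rule rates(1))
    show "filterlim (\<lambda>n. real n * (r n)\<^sup>2) at_top sequentially" by (rule rates(3))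
    show "filterlim (\<lambda>n. h0 n ^ CARD('p) * (real n * (r n)\<^sup>2)\<^sup>2) at_top sequentially" by (rule rates(2))
    show "regular_weights M X h0 (\<lambda>n \<omega>. weight S n (h0 n) (\<lambda>i. X i \<omega>)) C" by (rule C(2))
    show "whp M (\<lambda>n \<omega>. real n / 2 \<le> (\<Sum>i<n. \<Sum>j<n. \<delta> n (X i \<omega>) * weight S n (h0 n) (\<lambda>i. X i \<omega>) i j * \<delta> n (X j \<omega>)))"
      by (rule C(3))
  qed (fact Xm E Mdl assms(14) assms(6) assms(7) assms(8) assms(12) assms(13) assms(15) assms(16) assms(17) assms(22) assms(28))+
  have S: "admissible_smoother S"
    using W by (cases S) (auto simp: assumption_W_def admissible_smoother_def)
  define T where "T n \<omega> b = T_stat \<mu> S n (\<lambda>i. X i \<omega>) (response (m n) X \<epsilon> \<omega>) (\<theta>hat n \<omega>) b" for n \<omega> b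
  define v where "v n \<omega> = v_base S n (\<lambda>i. X i \<omega>) (V n (sample (m n) X \<epsilon> n \<omega>)) (h0 n) * z_quantile \<alpha>" for n \<omega>
  have ht: "htilde n \<omega> \<in> bandwidths (h0 n) a (J n)" "T n \<omega> (h0 n) \<le> T n \<omega> (htilde n \<omega>)" if "n \<ge> 1" "\<omega> \<in> space M" for n \<omega>
  proof -
    show "htilde n \<omega> \<in> bandwidths (h0 n) a (J n)" using sel[OF that] by (simp add: is_arg_max_def)
    show "T n \<omega> (h0 n) \<le> T n \<omega> (htilde n \<omega>)"
      unfolding T_def by (rule selected_statistic_ge[OF sel[OF that] \<gamma>[OF that(1)] V])
  qed
  have T_eq: "T n \<omega> (h0 n) = bilin (weight S n (h0 n) (\<lambda>i. X i \<omega>)) n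
      (\<lambda>i. response (m n) X \<epsilon> \<omega> i - \<mu> (X i \<omega>) (\<theta>hat n \<omega>)) (\<lambda>i. response (m n) X \<epsilon> \<omega> i - \<mu> (X i \<omega>) (\<theta>hat n \<omega>))" for n \<omega>
    by (simp add: T_def T_stat_def bilin_def sum_distrib_left mult.assoc)
  have large: "whp M (\<lambda>n \<omega>. v n \<omega> \<le> T n \<omega> (htilde n \<omega>))"
  proof -
    \<comment> \<open>The threshold n r^2 / 4 separates the two: the statistic at the base bandwidth
      lies above it and the critical value below.\<close>
    from whp_conj[OF statistic_large critical_value_small[OF refl V Vc, of "z_quantile \<alpha>"]]
    show ?thesis
    proof (rule whp_mono, use eventually_ge_at_top[of 1] in eventually_elim, intro ballI impI, elim conjE)
      fix n \<omega> assume n: "1 \<le> n" and \<omega>: "\<omega> \<in> space M"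
        and "real n * (r n)\<^sup>2 / 4 \<le> bilin (weight S n (h0 n) (\<lambda>i. X i \<omega>)) n
      (\<lambda>i. response (m n) X \<epsilon> \<omega> i - \<mu> (X i \<omega>) (\<theta>hat n \<omega>)) (\<lambda>i. response (m n) X \<epsilon> \<omega> i - \<mu> (X i \<omega>) (\<theta>hat n \<omega>))"
        and "v_base S n (\<lambda>i. X i \<omega>) (V n (sample (m n) X \<epsilon> n \<omega>)) (h0 n) * z_quantile \<alpha> \<le> real n * (r n)\<^sup>2 / 4"
      then show "v n \<omega> \<le> T n \<omega> (htilde n \<omega>)" using ht(2)[OF n \<omega>] unfolding v_def T_eq by linarith
    qed
  qed
  have meas: "{\<omega>\<in>space M. v n \<omega> \<le> T n \<omega> (htilde n \<omega>)} \<in> sets M" for n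
  proof (cases "n = 0")
    \<comment> \<open>For n = 0 all sums are empty, both sides are 0, and the event is the whole
      space.\<close>
    case True
    then show ?thesis by (simp add: v_def T_def v_base_def T_stat_def)
  next
    case False
    then have n: "n \<ge> 1" by simp
    have [measurable]: "htilde n \<in> borel_measurable M" by (rule hm)
    have [measurable]: "(\<lambda>\<omega>. T n \<omega> b) \<in> borel_measurable M" for b
      unfolding T_def by (rule T_stat_measurable[OF S n \<theta>m])
    have [measurable]: "(\<lambda>\<omega>. v n \<omega>) \<in> borel_measurable M"
      unfolding v_def by (intro borel_measurable_times v_base_measurable[OF S n V] borel_measurable_const)
    \<comment> \<open>The selected bandwidth takes finitely many values, so measurability of the
      statistic at each fixed bandwidth suffices.\<close>
    have "{\<omega>\<in>space M. v n \<omega> \<le> T n \<omega> (htilde n \<omega>)}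
        = {\<omega>\<in>space M. \<exists>b\<in>bandwidths (h0 n) a (J n). htilde n \<omega> = b \<and> v n \<omega> \<le> T n \<omega> b}"
      using ht(1)[OF n] by auto
    also have "\<dots> \<in> sets M"
      by (rule sets.sets_Collect_finite_Ex[OF _ finite_bandwidths]) measurable
    finally show ?thesis .
  qed
  show ?thesis
    using conv_in_prob_cond_prob[OF subalgebra_design meas large] unfolding v_def T_def .
qed

end
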